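(* Let $(H,\mu,u,\Delta,\epsilon,S)$ be a proper Hopf $(\Gamma,\omega)$-algebra over $\mathbb{K}$ with bijective antipode, let $(H^0,\mu_0,u_0,\Delta_0,\epsilon_0,S_0)$ be the opposite of its finite dual, and let $D(H)=H\otimes_{\mathbb{K}}H^0$ be the associative $(\Gamma,\omega)$-algebra with unit $1\otimes\epsilon$ and multiplication $\bar\mu=(\mu\otimes\mu_0)(\mathrm{id}_H\otimes\psi\otimes\mathrm{id}_{H^0})$, where $\psi:H^0\otimes H\to H\otimes H^0$ is $\psi(f\otimes x)=\sum\omega(d f_{(2)},d x_{(1)})\,(f_{(1)}\blacktriangleright x_{(1)})\otimes(f_{(2)}\lhd x_{(2)})$. Then $D(H)$ can be endowed with a Hopf $(\Gamma,\omega)$-algebra structure with co-multiplication $$\bar\Delta(x\otimes f)=\sum\omega(d x_{(2)},d f_{(1)})\,(x_{(1)}\otimes f_{(1)})\otimes(x_{(2)}\otimes f_{(2)}),$$ co-unit $\bar\epsilon(x\otimes f)=\epsilon(x)f(1)$, and antipode $$\bar S:\ D(H)=H\otimes H^0\xrightarrow{\ (S_0\otimes S)\tau\ }H^0\otimes H\xrightarrow{\ \psi\ }D(H),$$ where $\tau(x\otimes f)=\omega(d x,d f)f\otimes x$.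
   Context: $\Gamma$ is an additive abelian group with commutative factor $\omega$ ($\omega(\alpha,\beta)=\omega(\beta,\alpha)^{-1}$, multiplicative in each argument; no other condition), $\mathbb{K}$ a commutative ring with identity (over which the values of $\omega$ act as units). $d x$ is the degree of a homogeneous $x$; formulas with $\omega$ are for homogeneous elements and extended linearly. Tensor products of $(\Gamma,\omega)$-algebras (i.e. $\Gamma$-graded associative algebras) have multiplication $(a\otimes b)(c\otimes e)=\omega(d b,d c)ac\otimes be$. A Hopf $(\Gamma,\omega)$-algebra $(H,\mu,u,\Delta,\epsilon,S)$ is a $(\Gamma,\omega)$-algebra with coassociative co-multiplication $\Delta:H\to H\otimes H$ and co-unit $\epsilon$, both degree $0$ algebra homomorphisms, and degree $0$ antipode $S$ with $S(xy)=\omega(d x,d y)S(y)S(x)$ and $\sum S(x_{(1)})x_{(2)}=\sum x_{(1)}S(x_{(2)})=\epsilon(x)1$. Sweedler notation $\Delta(x)=\sum x_{(1)}\otimes x_{(2)}$ is used. $H^*$ is the $\Gamma$-graded dual; pairings on tensor squares are $\langle f\otimes g,x\otimes y\rangle=\omega(d g,d x)\langle f,x\rangle\langle g,y\rangle$. The finite dual $H^0$ is the set of $f\in H^*$ such that $\ker f$ contains a homogeneous two-sided ideal $\mathcal{J}$ with $H/\mathcal{J}$ a finitely generated $\mathbb{K}$-module. $H$ is proper if for every non-zero $x\in H$ there is $f\in H^0$ with $\langle f,x\rangle\neq0$. When $S$ is bijective, $H^0$ is given the (opposite) Hopf structure: $\langle\mu_0(f\otimes g),x\rangle=\langle f\otimes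 g,\Delta(x)\rangle$, unit $\epsilon$, $\langle\Delta_0(f),x\otimes y\rangle=\omega(d x,d y)\langle f,yx\rangle$, $\epsilon_0(f)=f(1)$, $\langle S_0(f),x\rangle=\langle f,S^{-1}(x)\rangle$; write $\Delta_0(f)=\sum f_{(1)}\otimes f_{(2)}$. For $f\in H^0$, $x\in H$: $f\blacktriangleright x=\sum\langle S_0(f),x_{(1)}\rangle x_{(2)}$ and $f\lhd x=\sum f_{(1)}\langle f_{(2)},x\rangle$. *)

theory Defs
  imports "HOL-Algebra.Module" "HOL-Algebra.Ideal"
begin

section \<open>Graded modules, quotients and tensor products\<close>

text \<open>
  Graded modules extend the module records, so their ring fields \<open>mult\<close> and \<open>one\<close> carry
  meaning only for algebras and are \<open>undefined\<close> for plain modules.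
\<close>

record ('k, 'a, 'g) graded_module = "('k, 'a) module" +
  grade :: "'g \<Rightarrow> 'a set"

definition mspan :: "('k, 's) ring_scheme \<Rightarrow> ('k, 'a, 'm) module_scheme \<Rightarrow> 'a set \<Rightarrow> 'a set"
  where "mspan K M S = \<Inter>{N. submodule N K M \<and> S \<subseteq> N}"

definition fin_gen :: "('k, 's) ring_scheme \<Rightarrow> ('k, 'a, 'm) module_scheme \<Rightarrow> bool"
  where "fin_gen K M \<longleftrightarrow> (\<exists>S. finite S \<and> S \<subseteq> carrier M \<and> mspan K M S = carrier M)"

definition linear_map ::
  "('k, 's) ring_scheme \<Rightarrow> ('k, 'a, 'm) module_scheme \<Rightarrow> ('k, 'b, 'n) module_scheme
    \<Rightarrow> ('a \<Rightarrow> 'b) \<Rightarrow> bool"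
  where "linear_map K M N f \<longleftrightarrow>
    f \<in> carrier M \<rightarrow> carrier N \<and>
    (\<forall>x\<in>carrier M. \<forall>y\<in>carrier M. f (x \<oplus>\<^bsub>M\<^esub> y) = f x \<oplus>\<^bsub>N\<^esub> f y) \<and>
    (\<forall>a\<in>carrier K. \<forall>x\<in>carrier M. f (a \<odot>\<^bsub>M\<^esub> x) = a \<odot>\<^bsub>N\<^esub> f x)"

definition homogeneous_decomposition ::
  "('k, 'a, 'g, 'm) graded_module_scheme \<Rightarrow> 'a \<Rightarrow> ('g \<Rightarrow> 'a) \<Rightarrow> bool"
  where "homogeneous_decomposition M x c \<longleftrightarrow>
    (\<forall>\<gamma>. c \<gamma> \<in> grade M \<gamma>) \<and> finite {\<gamma>. c \<gamma> \<noteq> \<zero>\<^bsub>M\<^esub>} \<and>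
    x = (\<Oplus>\<^bsub>M\<^esub>\<gamma>\<in>{\<gamma>. c \<gamma> \<noteq> \<zero>\<^bsub>M\<^esub>}. c \<gamma>)"

locale graded_module = module K M
  for K (structure) and M :: "('k, 'a, 'g, 'm) graded_module_scheme" (structure) +
  assumes grade_submodule: "submodule (grade M \<gamma>) K M"
    and ex1_decomposition: "x \<in> carrier M \<Longrightarrow> \<exists>!c. homogeneous_decomposition M x c"

definition hcomp :: "('k, 'a, 'g, 'm) graded_module_scheme \<Rightarrow> 'a \<Rightarrow> 'g \<Rightarrow> 'a"
  where "hcomp M x = (THE c. homogeneous_decomposition M x c)"

definition hsupp :: "('k, 'a, 'g, 'm) graded_module_scheme \<Rightarrow> 'a \<Rightarrow> 'g set"
  where "hsupp M x = {\<gamma>. hcomp M x \<gamma> \<noteq> \<zero>\<^bsub>M\<^esub>}"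

definition scalars :: "('k, 's) ring_scheme \<Rightarrow> ('k, 'k, 'g::zero) graded_module"
  where "scalars K = \<lparr>carrier = carrier K, mult = mult K, one = one K, zero = zero K,
    add = add K, smult = mult K,
    grade = (\<lambda>\<gamma>. if \<gamma> = 0 then carrier K else {\<zero>\<^bsub>K\<^esub>})\<rparr>"

definition quotient_module :: "('k, 'a, 'm) module_scheme \<Rightarrow> 'a set \<Rightarrow> ('k, 'a set) module"
  where "quotient_module M N = \<lparr>carrier = a_rcosets\<^bsub>M\<^esub> N, mult = undefined, one = undefined,
    zero = N, add = (\<lambda>X Y. X <+>\<^bsub>M\<^esub> Y), smult = (\<lambda>a X. \<Union>x\<in>X. N +>\<^bsub>M\<^esub> (a \<odot>\<^bsub>M\<^esub> x))\<rparr>"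

definition free_module :: "('k, 's) ring_scheme \<Rightarrow> 'b set \<Rightarrow> ('k, 'b \<Rightarrow> 'k) module"
  where "free_module K B = \<lparr>
    carrier = {u. range u \<subseteq> carrier K \<and> finite {b. u b \<noteq> \<zero>\<^bsub>K\<^esub>} \<and> {b. u b \<noteq> \<zero>\<^bsub>K\<^esub>} \<subseteq> B},
    mult = undefined, one = undefined, zero = (\<lambda>b. \<zero>\<^bsub>K\<^esub>),
    add = (\<lambda>u v b. u b \<oplus>\<^bsub>K\<^esub> v b), smult = (\<lambda>a u b. a \<otimes>\<^bsub>K\<^esub> u b)\<rparr>"

definition free_gen :: "('k, 's) ring_scheme \<Rightarrow> 'b \<Rightarrow> 'b \<Rightarrow> 'k"
  where "free_gen K b = (\<lambda>c. if c = b then \<one>\<^bsub>K\<^esub> else \<zero>\<^bsub>K\<^esub>)"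

definition tensor_relations ::
  "('k, 's) ring_scheme \<Rightarrow> ('k, 'a, 'm) module_scheme \<Rightarrow> ('k, 'b, 'n) module_scheme
    \<Rightarrow> ('a \<times> 'b \<Rightarrow> 'k) set"
  where "tensor_relations K M N =
    (let F = free_module K (carrier M \<times> carrier N); e = (\<lambda>x y. free_gen K (x, y)) in
      mspan K F
       ({e (x \<oplus>\<^bsub>M\<^esub> x') y \<ominus>\<^bsub>F\<^esub> (e x y \<oplus>\<^bsub>F\<^esub> e x' y) | x x' y.
           x \<in> carrier M \<and> x' \<in> carrier M \<and> y \<in> carrier N} \<union>
        {e x (y \<oplus>\<^bsub>N\<^esub> y') \<ominus>\<^bsub>F\<^esub> (e x y \<oplus>\<^bsub>F\<^esub> e x y') | x y y'.
           x \<in> carrier M \<and> y \<in> carrier N \<and> y' \<in> carrier N} \<union>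
        {e (a \<odot>\<^bsub>M\<^esub> x) y \<ominus>\<^bsub>F\<^esub> (a \<odot>\<^bsub>F\<^esub> e x y) | a x y.
           a \<in> carrier K \<and> x \<in> carrier M \<and> y \<in> carrier N} \<union>
        {e x (a \<odot>\<^bsub>N\<^esub> y) \<ominus>\<^bsub>F\<^esub> (a \<odot>\<^bsub>F\<^esub> e x y) | a x y.
           a \<in> carrier K \<and> x \<in> carrier M \<and> y \<in> carrier N}))"

definition tensor_module ::
  "('k, 's) ring_scheme \<Rightarrow> ('k, 'a, 'm) module_scheme \<Rightarrow> ('k, 'b, 'n) module_scheme
    \<Rightarrow> ('k, ('a \<times> 'b \<Rightarrow> 'k) set) module"
  where "tensor_module K M N =
    quotient_module (free_module K (carrier M \<times> carrier N)) (tensor_relations K M N)"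

definition pure_tensor ::
  "('k, 's) ring_scheme \<Rightarrow> ('k, 'a, 'm) module_scheme \<Rightarrow> ('k, 'b, 'n) module_scheme
    \<Rightarrow> 'a \<Rightarrow> 'b \<Rightarrow> ('a \<times> 'b \<Rightarrow> 'k) set"
  where "pure_tensor K M N x y =
    tensor_relations K M N +>\<^bsub>free_module K (carrier M \<times> carrier N)\<^esub> free_gen K (x, y)"

text \<open>
  \<open>tsum K P t b\<close> is the image of the tensor \<open>t\<close> under the linear map \<open>x \<otimes> y \<mapsto> b x y\<close> into \<open>P\<close>;
  for bilinear \<open>b\<close> the chosen representative is irrelevant. In Sweedler notation,
  \<open>tsum K P (\<Delta> x) (\<lambda>x\<^sub>1 x\<^sub>2. b x\<^sub>1 x\<^sub>2)\<close> is \<open>\<Sum> b(x\<^sub>(\<^sub>1\<^sub>), x\<^sub>(\<^sub>2\<^sub>))\<close>.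
\<close>

definition tsum ::
  "('k, 's) ring_scheme \<Rightarrow> ('k, 'c, 'm) module_scheme \<Rightarrow> ('a \<times> 'b \<Rightarrow> 'k) set
    \<Rightarrow> ('a \<Rightarrow> 'b \<Rightarrow> 'c) \<Rightarrow> 'c"
  where "tsum K P t b =
    (let u = (SOME u. u \<in> t) in
      \<Oplus>\<^bsub>P\<^esub>p\<in>{p. u p \<noteq> \<zero>\<^bsub>K\<^esub>}. u p \<odot>\<^bsub>P\<^esub> b (fst p) (snd p))"

section \<open>Colour signs and graded algebras\<close>

locale commutative_factor = cring K for K (structure) +
  fixes \<omega> :: "'g::ab_group_add \<Rightarrow> 'g \<Rightarrow> 'a"
  assumes factor_closed: "\<omega> \<alpha> \<beta> \<in> carrier K"
    and factor_inverse: "\<omega> \<alpha> \<beta> \<otimes> \<omega> \<beta> \<alpha> = \<one>"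
    and factor_add_left: "\<omega> (\<alpha> + \<beta>) \<gamma> = \<omega> \<alpha> \<gamma> \<otimes> \<omega> \<beta> \<gamma>"
    and factor_add_right: "\<omega> \<alpha> (\<beta> + \<gamma>) = \<omega> \<alpha> \<beta> \<otimes> \<omega> \<alpha> \<gamma>"

text \<open>
  \<open>colour_ext K \<omega> M N P F\<close> is the bi-additive extension to \<open>M \<times> N\<close> of the \<open>P\<close>-valued map
  \<open>(x, y) \<mapsto> \<omega>(d x, d y) F(x, y)\<close> on homogeneous elements.
\<close>

definition colour_ext ::
  "('k, 's) ring_scheme \<Rightarrow> ('g \<Rightarrow> 'g \<Rightarrow> 'k) \<Rightarrow> ('k, 'a, 'g, 'm) graded_module_scheme
    \<Rightarrow> ('k, 'b, 'g, 'n) graded_module_scheme \<Rightarrow> ('k, 'c, 'p) module_scheme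
    \<Rightarrow> ('a \<Rightarrow> 'b \<Rightarrow> 'c) \<Rightarrow> 'a \<Rightarrow> 'b \<Rightarrow> 'c"
  where "colour_ext K \<omega> M N P F x y =
    (\<Oplus>\<^bsub>P\<^esub>\<alpha>\<in>hsupp M x. \<Oplus>\<^bsub>P\<^esub>\<beta>\<in>hsupp N y. \<omega> \<alpha> \<beta> \<odot>\<^bsub>P\<^esub> F (hcomp M x \<alpha>) (hcomp N y \<beta>))"

text \<open>
  The tensor product as a graded module; \<open>mult\<close> and \<open>one\<close> give the tensor product algebra,
  \<open>(a \<otimes> b)(c \<otimes> e) = \<omega>(d b, d c) ac \<otimes> be\<close>, when \<open>A\<close> and \<open>B\<close> are graded algebras.
\<close>

definition tensor ::
  "('k, 's) ring_scheme \<Rightarrow> ('g::ab_group_add \<Rightarrow> 'g \<Rightarrow> 'k)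
    \<Rightarrow> ('k, 'a, 'g, 'm) graded_module_scheme \<Rightarrow> ('k, 'b, 'g, 'n) graded_module_scheme
    \<Rightarrow> ('k, ('a \<times> 'b \<Rightarrow> 'k) set, 'g) graded_module"
  where "tensor K \<omega> A B =
    (let T = tensor_module K A B in
     \<lparr>carrier = carrier T,
      mult = (\<lambda>s t. tsum K T s (\<lambda>a b. tsum K T t (\<lambda>c e.
        colour_ext K \<omega> B A T (\<lambda>b' c'. pure_tensor K A B (a \<otimes>\<^bsub>A\<^esub> c') (b' \<otimes>\<^bsub>B\<^esub> e)) b c))),
      one = pure_tensor K A B \<one>\<^bsub>A\<^esub> \<one>\<^bsub>B\<^esub>,
      zero = zero T,
      add = add T,
      smult = smult T,
      grade = (\<lambda>\<gamma>. mspan K T {pure_tensor K A B x y | x y.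
        \<exists>\<alpha> \<beta>. \<alpha> + \<beta> = \<gamma> \<and> x \<in> grade A \<alpha> \<and> y \<in> grade B \<beta>})\<rparr>)"

definition tensor_swap ::
  "('k, 's) ring_scheme \<Rightarrow> ('g::ab_group_add \<Rightarrow> 'g \<Rightarrow> 'k)
    \<Rightarrow> ('k, 'a, 'g, 'm) graded_module_scheme \<Rightarrow> ('k, 'b, 'g, 'n) graded_module_scheme
    \<Rightarrow> ('a \<times> 'b \<Rightarrow> 'k) set \<Rightarrow> ('b \<times> 'a \<Rightarrow> 'k) set"
  where "tensor_swap K \<omega> M N t =
    (let T = tensor_module K N M in
      tsum K T t (colour_ext K \<omega> M N T (\<lambda>x y. pure_tensor K N M y x)))"

definition tensor_map ::
  "('k, 's) ring_scheme \<Rightarrow> ('k, 'c, 'm) module_scheme \<Rightarrow> ('k, 'e, 'n) module_scheme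
    \<Rightarrow> ('a \<Rightarrow> 'c) \<Rightarrow> ('b \<Rightarrow> 'e) \<Rightarrow> ('a \<times> 'b \<Rightarrow> 'k) set \<Rightarrow> ('c \<times> 'e \<Rightarrow> 'k) set"
  where "tensor_map K P Q f g t =
    tsum K (tensor_module K P Q) t (\<lambda>x y. pure_tensor K P Q (f x) (g y))"

locale graded_algebra = graded_module K A + A?: ring A
  for K (structure) and A :: "('k, 'a, 'g::ab_group_add, 'm) graded_module_scheme" (structure) +
  assumes smult_mult_left:
      "\<lbrakk>a \<in> carrier K; x \<in> carrier A; y \<in> carrier A\<rbrakk> \<Longrightarrow>
        (a \<odot>\<^bsub>A\<^esub> x) \<otimes>\<^bsub>A\<^esub> y = a \<odot>\<^bsub>A\<^esub> (x \<otimes>\<^bsub>A\<^esub> y)"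
    and smult_mult_right:
      "\<lbrakk>a \<in> carrier K; x \<in> carrier A; y \<in> carrier A\<rbrakk> \<Longrightarrow>
        x \<otimes>\<^bsub>A\<^esub> (a \<odot>\<^bsub>A\<^esub> y) = a \<odot>\<^bsub>A\<^esub> (x \<otimes>\<^bsub>A\<^esub> y)"
    and grade_mult: "\<lbrakk>x \<in> grade A \<alpha>; y \<in> grade A \<beta>\<rbrakk> \<Longrightarrow> x \<otimes>\<^bsub>A\<^esub> y \<in> grade A (\<alpha> + \<beta>)"
    and grade_one: "\<one>\<^bsub>A\<^esub> \<in> grade A 0"

definition graded_algebra_hom ::
  "('k, 's) ring_scheme \<Rightarrow> ('k, 'a, 'g, 'm) graded_module_scheme
    \<Rightarrow> ('k, 'b, 'g, 'n) graded_module_scheme \<Rightarrow> ('a \<Rightarrow> 'b) \<Rightarrow> bool"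
  where "graded_algebra_hom K A B f \<longleftrightarrow>
    linear_map K A B f \<and> (\<forall>\<gamma>. f ` grade A \<gamma> \<subseteq> grade B \<gamma>) \<and>
    (\<forall>x\<in>carrier A. \<forall>y\<in>carrier A. f (x \<otimes>\<^bsub>A\<^esub> y) = f x \<otimes>\<^bsub>B\<^esub> f y) \<and> f \<one>\<^bsub>A\<^esub> = \<one>\<^bsub>B\<^esub>"

section \<open>Hopf algebras\<close>

record ('k, 'a, 'g) hopf = "('k, 'a, 'g) graded_module" +
  comult :: "'a \<Rightarrow> ('a \<times> 'a \<Rightarrow> 'k) set"
  counit :: "'a \<Rightarrow> 'k"
  antipode :: "'a \<Rightarrow> 'a"

locale hopf_algebra = commutative_factor K \<omega> + graded_algebra K H
  for K :: "('k, 's) ring_scheme" (structure)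
    and \<omega> :: "'g::ab_group_add \<Rightarrow> 'g \<Rightarrow> 'k"
    and H :: "('k, 'a, 'g, 'm) hopf_scheme" (structure) +
  assumes comult_hom: "graded_algebra_hom K H (tensor K \<omega> H H) (comult H)"
    and coassociative: "x \<in> carrier H \<Longrightarrow>
      (let HH = tensor_module K H H; T = tensor_module K H HH;
           triple = (\<lambda>x y z. pure_tensor K H HH x (pure_tensor K H H y z)) in
        tsum K T (comult H x) (\<lambda>x1 x2. tsum K T (comult H x1) (\<lambda>x11 x12. triple x11 x12 x2)) =
        tsum K T (comult H x) (\<lambda>x1 x2. tsum K T (comult H x2) (\<lambda>x21 x22. triple x1 x21 x22)))"
    and counit_hom: "graded_algebra_hom K H (scalars K) (counit H)"
    and counit_left: "x \<in> carrier H \<Longrightarrow>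
      tsum K H (comult H x) (\<lambda>x1 x2. counit H x1 \<odot>\<^bsub>H\<^esub> x2) = x"
    and counit_right: "x \<in> carrier H \<Longrightarrow>
      tsum K H (comult H x) (\<lambda>x1 x2. counit H x2 \<odot>\<^bsub>H\<^esub> x1) = x"
    and antipode_linear: "linear_map K H H (antipode H)"
    and antipode_grade: "antipode H ` grade H \<gamma> \<subseteq> grade H \<gamma>"
    and antipode_mult: "\<lbrakk>x \<in> grade H \<alpha>; y \<in> grade H \<beta>\<rbrakk> \<Longrightarrow>
      antipode H (x \<otimes>\<^bsub>H\<^esub> y) = \<omega> \<alpha> \<beta> \<odot>\<^bsub>H\<^esub> (antipode H y \<otimes>\<^bsub>H\<^esub> antipode H x)"
    and antipode_left: "x \<in> carrier H \<Longrightarrow>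
      tsum K H (comult H x) (\<lambda>x1 x2. antipode H x1 \<otimes>\<^bsub>H\<^esub> x2) = counit H x \<odot>\<^bsub>H\<^esub> \<one>\<^bsub>H\<^esub>"
    and antipode_right: "x \<in> carrier H \<Longrightarrow>
      tsum K H (comult H x) (\<lambda>x1 x2. x1 \<otimes>\<^bsub>H\<^esub> antipode H x2) = counit H x \<odot>\<^bsub>H\<^esub> \<one>\<^bsub>H\<^esub>"

section \<open>The finite dual\<close>

definition linear_forms ::
  "('k, 's) ring_scheme \<Rightarrow> ('k, 'a, 'g::zero, 'm) graded_module_scheme \<Rightarrow> ('k, 'a \<Rightarrow> 'k) module"
  where "linear_forms K M =
    \<lparr>carrier = {f \<in> extensional (carrier M).
        linear_map K M (scalars K :: ('k, 'k, 'g) graded_module) f},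
     mult = undefined, one = undefined,
     zero = (\<lambda>x\<in>carrier M. \<zero>\<^bsub>K\<^esub>),
     add = (\<lambda>f g. \<lambda>x\<in>carrier M. f x \<oplus>\<^bsub>K\<^esub> g x),
     smult = (\<lambda>a f. \<lambda>x\<in>carrier M. a \<otimes>\<^bsub>K\<^esub> f x)\<rparr>"

text \<open>A form of degree \<open>\<gamma>\<close> shifts degrees by \<open>\<gamma>\<close>, hence lives on the component of degree \<open>-\<gamma>\<close>.\<close>

definition dual_grade ::
  "('k, 's) ring_scheme \<Rightarrow> ('k, 'a, 'g::ab_group_add, 'm) graded_module_scheme
    \<Rightarrow> 'g \<Rightarrow> ('a \<Rightarrow> 'k) set"
  where "dual_grade K M \<gamma> = {f \<in> carrier (linear_forms K M).
    \<forall>\<beta>. \<forall>x\<in>grade M \<beta>. \<beta> \<noteq> - \<gamma> \<longrightarrow> f x = \<zero>\<^bsub>K\<^esub>}"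

definition graded_dual ::
  "('k, 's) ring_scheme \<Rightarrow> ('k, 'a, 'g::ab_group_add, 'm) graded_module_scheme
    \<Rightarrow> ('k, 'a \<Rightarrow> 'k, 'g) graded_module"
  where "graded_dual K M =
    (let L = linear_forms K M in
     \<lparr>carrier = mspan K L (\<Union>\<gamma>. dual_grade K M \<gamma>), mult = undefined, one = undefined,
      zero = zero L, add = add L, smult = smult L, grade = dual_grade K M\<rparr>)"

definition homogeneous_ideal :: "('k, 'a, 'g, 'm) graded_module_scheme \<Rightarrow> 'a set \<Rightarrow> bool"
  where "homogeneous_ideal A J \<longleftrightarrow> ideal J A \<and> (\<forall>x\<in>J. \<forall>\<gamma>. hcomp A x \<gamma> \<in> J)"

definition finite_dual ::
  "('k, 's) ring_scheme \<Rightarrow> ('k, 'a, 'g::ab_group_add, 'm) graded_module_scheme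
    \<Rightarrow> ('k, 'a \<Rightarrow> 'k, 'g) graded_module"
  where "finite_dual K A =
    (let F = {f \<in> carrier (graded_dual K A).
        \<exists>J. homogeneous_ideal A J \<and> fin_gen K (quotient_module A J) \<and> (\<forall>x\<in>J. f x = \<zero>\<^bsub>K\<^esub>)} in
     (graded_dual K A)\<lparr>carrier := F, grade := (\<lambda>\<gamma>. dual_grade K A \<gamma> \<inter> F)\<rparr>)"

definition proper ::
  "('k, 's) ring_scheme \<Rightarrow> ('k, 'a, 'g::ab_group_add, 'm) graded_module_scheme \<Rightarrow> bool"
  where "proper K A \<longleftrightarrow>
    (\<forall>x\<in>carrier A. x \<noteq> \<zero>\<^bsub>A\<^esub> \<longrightarrow> (\<exists>f\<in>carrier (finite_dual K A). f x \<noteq> \<zero>\<^bsub>K\<^esub>))"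

text \<open>The pairing \<open>\<langle>f \<otimes> g, x \<otimes> y\<rangle> = \<omega>(d g, d x) \<langle>f, x\<rangle> \<langle>g, y\<rangle>\<close> of tensor squares.\<close>

definition pairing2 ::
  "('k, 's) ring_scheme \<Rightarrow> ('g::ab_group_add \<Rightarrow> 'g \<Rightarrow> 'k)
    \<Rightarrow> ('k, 'a, 'g, 'm) graded_module_scheme
    \<Rightarrow> (('a \<Rightarrow> 'k) \<times> ('a \<Rightarrow> 'k) \<Rightarrow> 'k) set \<Rightarrow> ('a \<times> 'a \<Rightarrow> 'k) set \<Rightarrow> 'k"
  where "pairing2 K \<omega> H s t =
    (let S = (scalars K :: ('k, 'k, 'g) graded_module) in
      tsum K S s (\<lambda>f g. tsum K S t (\<lambda>x y.
        colour_ext K \<omega> (finite_dual K H) H S (\<lambda>g' x'. f x' \<otimes>\<^bsub>K\<^esub> g' y) g x)))"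

text \<open>
  Over an arbitrary base ring the pairing of \<open>H\<^sup>0 \<otimes> H\<^sup>0\<close> with \<open>H \<otimes> H\<close> may be degenerate, so that
  a co-multiplication of \<open>H\<^sup>0\<close> is not determined by its pairing formula. It is therefore a
  parameter \<open>\<Delta>0\<close> here, whereas all other structure maps are given explicitly.
\<close>

definition opposite_finite_dual ::
  "('k, 's) ring_scheme \<Rightarrow> ('g::ab_group_add \<Rightarrow> 'g \<Rightarrow> 'k) \<Rightarrow> ('k, 'a, 'g, 'm) hopf_scheme
    \<Rightarrow> (('a \<Rightarrow> 'k) \<Rightarrow> (('a \<Rightarrow> 'k) \<times> ('a \<Rightarrow> 'k) \<Rightarrow> 'k) set) \<Rightarrow> ('k, 'a \<Rightarrow> 'k, 'g) hopf"
  where "opposite_finite_dual K \<omega> H \<Delta>0 =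
    (let V = finite_dual K H in
     \<lparr>carrier = carrier V,
      mult = (\<lambda>f g. \<lambda>x\<in>carrier H. pairing2 K \<omega> H (pure_tensor K V V f g) (comult H x)),
      one = (\<lambda>x\<in>carrier H. counit H x),
      zero = zero V,
      add = add V,
      smult = smult V,
      grade = grade V,
      comult = \<Delta>0,
      counit = (\<lambda>f. f \<one>\<^bsub>H\<^esub>),
      antipode = (\<lambda>f. \<lambda>x\<in>carrier H. f (inv_into (carrier H) (antipode H) x))\<rparr>)"

definition opposite_comult_formula ::
  "('k, 's) ring_scheme \<Rightarrow> ('g::ab_group_add \<Rightarrow> 'g \<Rightarrow> 'k) \<Rightarrow> ('k, 'a, 'g, 'm) hopf_scheme
    \<Rightarrow> (('a \<Rightarrow> 'k) \<Rightarrow> (('a \<Rightarrow> 'k) \<times> ('a \<Rightarrow> 'k) \<Rightarrow> 'k) set) \<Rightarrow> bool"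
  where "opposite_comult_formula K \<omega> H \<Delta>0 \<longleftrightarrow>
    (\<forall>f\<in>carrier (finite_dual K H). \<forall>\<alpha> \<beta>. \<forall>x\<in>grade H \<alpha>. \<forall>y\<in>grade H \<beta>.
      pairing2 K \<omega> H (\<Delta>0 f) (pure_tensor K H H x y) = \<omega> \<alpha> \<beta> \<otimes>\<^bsub>K\<^esub> f (y \<otimes>\<^bsub>H\<^esub> x))"

section \<open>The Drinfeld double\<close>

text \<open>In this section \<open>V\<close> stands for the opposite finite dual of \<open>H\<close>.\<close>

definition left_action ::
  "('k, 's) ring_scheme \<Rightarrow> ('k, 'a, 'g, 'm) hopf_scheme \<Rightarrow> ('k, 'a \<Rightarrow> 'k, 'g, 'n) hopf_scheme
    \<Rightarrow> ('a \<Rightarrow> 'k) \<Rightarrow> 'a \<Rightarrow> 'a"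
  where "left_action K H V f x = tsum K H (comult H x) (\<lambda>x1 x2. antipode V f x1 \<odot>\<^bsub>H\<^esub> x2)"

definition right_action ::
  "('k, 's) ring_scheme \<Rightarrow> ('k, 'a \<Rightarrow> 'k, 'g, 'n) hopf_scheme \<Rightarrow> ('a \<Rightarrow> 'k) \<Rightarrow> 'a \<Rightarrow> ('a \<Rightarrow> 'k)"
  where "right_action K V f x = tsum K V (comult V f) (\<lambda>f1 f2. f2 x \<odot>\<^bsub>V\<^esub> f1)"

definition double_psi ::
  "('k, 's) ring_scheme \<Rightarrow> ('g::ab_group_add \<Rightarrow> 'g \<Rightarrow> 'k) \<Rightarrow> ('k, 'a, 'g, 'm) hopf_scheme
    \<Rightarrow> ('k, 'a \<Rightarrow> 'k, 'g, 'n) hopf_scheme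
    \<Rightarrow> (('a \<Rightarrow> 'k) \<times> 'a \<Rightarrow> 'k) set \<Rightarrow> ('a \<times> ('a \<Rightarrow> 'k) \<Rightarrow> 'k) set"
  where "double_psi K \<omega> H V t =
    (let T = tensor_module K H V in
      tsum K T t (\<lambda>f x. tsum K T (comult V f) (\<lambda>f1 f2. tsum K T (comult H x) (\<lambda>x1 x2.
        colour_ext K \<omega> V H T (\<lambda>f2' x1'.
          pure_tensor K H V (left_action K H V f1 x1') (right_action K V f2' x2)) f2 x1))))"

text \<open>\<open>(\<mu> \<otimes> \<mu>\<^sub>0)(id \<otimes> \<psi> \<otimes> id)\<close>, written out on \<open>(x \<otimes> f) \<otimes> (y \<otimes> g)\<close>.\<close>

definition double_mult ::
  "('k, 's) ring_scheme \<Rightarrow> ('g::ab_group_add \<Rightarrow> 'g \<Rightarrow> 'k) \<Rightarrow> ('k, 'a, 'g, 'm) hopf_scheme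
    \<Rightarrow> ('k, 'a \<Rightarrow> 'k, 'g, 'n) hopf_scheme
    \<Rightarrow> ('a \<times> ('a \<Rightarrow> 'k) \<Rightarrow> 'k) set \<Rightarrow> ('a \<times> ('a \<Rightarrow> 'k) \<Rightarrow> 'k) set
    \<Rightarrow> ('a \<times> ('a \<Rightarrow> 'k) \<Rightarrow> 'k) set"
  where "double_mult K \<omega> H V s t =
    (let T = tensor_module K H V in
      tsum K T s (\<lambda>x f. tsum K T t (\<lambda>y g.
        tsum K T (double_psi K \<omega> H V (pure_tensor K V H f y)) (\<lambda>y' f'.
          pure_tensor K H V (x \<otimes>\<^bsub>H\<^esub> y') (f' \<otimes>\<^bsub>V\<^esub> g)))))"

definition double_comult ::
  "('k, 's) ring_scheme \<Rightarrow> ('g::ab_group_add \<Rightarrow> 'g \<Rightarrow> 'k) \<Rightarrow> ('k, 'a, 'g, 'm) hopf_scheme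
    \<Rightarrow> ('k, 'a \<Rightarrow> 'k, 'g, 'n) hopf_scheme \<Rightarrow> ('a \<times> ('a \<Rightarrow> 'k) \<Rightarrow> 'k) set
    \<Rightarrow> (('a \<times> ('a \<Rightarrow> 'k) \<Rightarrow> 'k) set \<times> ('a \<times> ('a \<Rightarrow> 'k) \<Rightarrow> 'k) set \<Rightarrow> 'k) set"
  where "double_comult K \<omega> H V t =
    (let D = tensor_module K H V; DD = tensor_module K D D in
      tsum K DD t (\<lambda>x f. tsum K DD (comult H x) (\<lambda>x1 x2. tsum K DD (comult V f) (\<lambda>f1 f2.
        colour_ext K \<omega> H V DD (\<lambda>x2' f1'.
          pure_tensor K D D (pure_tensor K H V x1 f1') (pure_tensor K H V x2' f2)) x2 f1))))"

definition double_counit ::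
  "('k, 's) ring_scheme \<Rightarrow> ('k, 'a, 'g::zero, 'm) hopf_scheme
    \<Rightarrow> ('a \<times> ('a \<Rightarrow> 'k) \<Rightarrow> 'k) set \<Rightarrow> 'k"
  where "double_counit K H t =
    tsum K (scalars K :: ('k, 'k, 'g) graded_module) t
      (\<lambda>x f. counit H x \<otimes>\<^bsub>K\<^esub> f \<one>\<^bsub>H\<^esub>)"

definition double_antipode ::
  "('k, 's) ring_scheme \<Rightarrow> ('g::ab_group_add \<Rightarrow> 'g \<Rightarrow> 'k) \<Rightarrow> ('k, 'a, 'g, 'm) hopf_scheme
    \<Rightarrow> ('k, 'a \<Rightarrow> 'k, 'g, 'n) hopf_scheme
    \<Rightarrow> ('a \<times> ('a \<Rightarrow> 'k) \<Rightarrow> 'k) set \<Rightarrow> ('a \<times> ('a \<Rightarrow> 'k) \<Rightarrow> 'k) set"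
  where "double_antipode K \<omega> H V t =
    double_psi K \<omega> H V (tensor_map K V H (antipode V) (antipode H) (tensor_swap K \<omega> H V t))"

definition drinfeld_double ::
  "('k, 's) ring_scheme \<Rightarrow> ('g::ab_group_add \<Rightarrow> 'g \<Rightarrow> 'k) \<Rightarrow> ('k, 'a, 'g, 'm) hopf_scheme
    \<Rightarrow> ('k, 'a \<Rightarrow> 'k, 'g, 'n) hopf_scheme \<Rightarrow> ('k, ('a \<times> ('a \<Rightarrow> 'k) \<Rightarrow> 'k) set, 'g) hopf"
  where "drinfeld_double K \<omega> H V =
    (let T = tensor K \<omega> H V in
     \<lparr>carrier = carrier T,
      mult = double_mult K \<omega> H V,
      one = pure_tensor K H V \<one>\<^bsub>H\<^esub> \<one>\<^bsub>V\<^esub>,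
      zero = zero T,
      add = add T,
      smult = smult T,
      grade = grade T,
      comult = double_comult K \<omega> H V,
      counit = double_counit K H,
      antipode = double_antipode K \<omega> H V\<rparr>)"

end

theory Submission
  imports Defs
begin

text \<open>
  Write \<open>V\<close> for the opposite finite dual. Only its evaluation pairing with \<open>H\<close> matters: \<open>V\<close> and \<open>H\<close> are
  Hopf algebras in colour-signed duality. The map \<open>\<psi>\<close> is compatible with both multiplications,
  \<open>\<psi>(fg \<otimes> x)\<close> and \<open>\<psi>(f \<otimes> xy)\<close> being computed by moving one factor at a time past the other algebra,
  which gives associativity of the double. The double is generated by the copies of \<open>H\<close> and \<open>V\<close>, and
  \<open>\<psi>(f \<otimes> x) = (1 \<otimes> f)(x \<otimes> 1)\<close>; so multiplicativity of the co-multiplication, of the co-unit and of the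
  antipode reduces to the behaviour of these maps on \<open>\<psi>(f \<otimes> x)\<close>. For the co-multiplication this is a
  Sweedler computation in which an antipode convolution cancels; for the antipode it follows from
  uniqueness of convolution inverses.
\<close>

section \<open>Linear maps and finite sums\<close>

text \<open>The signs depend on the degrees of Sweedler legs, while a tensor is a coset without a
  preferred representative. Every Sweedler sum therefore runs over homogeneous legs and hands their
  degrees to the summand. Signs are exchanged by one principle: a factor \<open>ev f x\<close> or
  \<open>q f x\<close> vanishes unless the degrees of \<open>f\<close> and \<open>x\<close> are
  opposite, so the degree of a form may be replaced by minus the degree of its argument, and
  \<open>\<omega> (- \<alpha>) \<beta> = \<omega> \<beta> \<alpha>\<close>. Pairing tensors with
  forms may fail to separate them over a general base ring, so identities of tensors are derived
  inside the tensor products from the Hopf axioms of both algebras. The inverse antipode in the dual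
  is forced by the opposite co-multiplication: when evaluation turns products around, its signed
  convolution inverse is evaluation at \<open>S\<^sup>-\<^sup>1 x\<close>. This is the coefficient
  in the left action, which is why a right action followed by a left action on adjacent legs
  cancels.\<close>

lemma linear_mapI:
  assumes "\<And>x. x \<in> carrier M \<Longrightarrow> f x \<in> carrier N"
    and "\<And>x y. \<lbrakk>x \<in> carrier M; y \<in> carrier M\<rbrakk> \<Longrightarrow> f (x \<oplus>\<^bsub>M\<^esub> y) = f x \<oplus>\<^bsub>N\<^esub> f y"
    and "\<And>a x. \<lbrakk>a \<in> carrier K; x \<in> carrier M\<rbrakk> \<Longrightarrow> f (a \<odot>\<^bsub>M\<^esub> x) = a \<odot>\<^bsub>N\<^esub> f x"
  shows "linear_map K M N f"
  using assms by (auto simp: linear_map_def)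

lemma linear_map_closed: "\<lbrakk>linear_map K M N f; x \<in> carrier M\<rbrakk> \<Longrightarrow> f x \<in> carrier N"
  by (auto simp: linear_map_def)

lemma linear_map_add:
  "\<lbrakk>linear_map K M N f; x \<in> carrier M; y \<in> carrier M\<rbrakk> \<Longrightarrow> f (x \<oplus>\<^bsub>M\<^esub> y) = f x \<oplus>\<^bsub>N\<^esub> f y"
  by (auto simp: linear_map_def)

lemma linear_map_smult:
  "\<lbrakk>linear_map K M N f; a \<in> carrier K; x \<in> carrier M\<rbrakk> \<Longrightarrow> f (a \<odot>\<^bsub>M\<^esub> x) = a \<odot>\<^bsub>N\<^esub> f x"
  by (auto simp: linear_map_def)

lemma linear_map_zero:
  assumes "module K M" "module K N" "linear_map K M N f"
  shows "f \<zero>\<^bsub>M\<^esub> = \<zero>\<^bsub>N\<^esub>"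
proof -
  interpret M: module K M by fact
  interpret N: module K N by fact
  have "f (\<zero>\<^bsub>K\<^esub> \<odot>\<^bsub>M\<^esub> \<zero>\<^bsub>M\<^esub>) = \<zero>\<^bsub>K\<^esub> \<odot>\<^bsub>N\<^esub> f \<zero>\<^bsub>M\<^esub>"
    by (rule linear_map_smult[OF assms(3)]) simp_all
  then show ?thesis using linear_map_closed[OF assms(3), of "\<zero>\<^bsub>M\<^esub>"] by simp
qed

lemma linear_map_compose:
  "\<lbrakk>linear_map K M N f; linear_map K N P g\<rbrakk> \<Longrightarrow> linear_map K M P (\<lambda>x. g (f x))"
  by (rule linear_mapI) (simp_all add: linear_map_closed linear_map_add[of K M N f]
    linear_map_add[of K N P g] linear_map_smult[of K M N f] linear_map_smult[of K N P g])

lemma linear_map_cong: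
  assumes "linear_map K M N f" "\<And>x. x \<in> carrier M \<Longrightarrow> f x = g x" "module K M"
  shows "linear_map K M N g"
proof -
  interpret M: module K M by fact
  show ?thesis
    by (rule linear_mapI)
      (use assms(1) in \<open>auto simp: assms(2)[symmetric] linear_map_closed linear_map_add linear_map_smult\<close>)
qed

definition bilinear_map ::
  "('k, 's) ring_scheme \<Rightarrow> ('k, 'a, 'm) module_scheme \<Rightarrow> ('k, 'b, 'n) module_scheme
    \<Rightarrow> ('k, 'c, 'p) module_scheme \<Rightarrow> ('a \<Rightarrow> 'b \<Rightarrow> 'c) \<Rightarrow> bool"
  where "bilinear_map K M N P b \<longleftrightarrow>
    (\<forall>x\<in>carrier M. linear_map K N P (b x)) \<and> (\<forall>y\<in>carrier N. linear_map K M P (\<lambda>x. b x y))"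

lemma bilinear_mapI:
  "\<lbrakk>\<And>x. x \<in> carrier M \<Longrightarrow> linear_map K N P (b x);
    \<And>y. y \<in> carrier N \<Longrightarrow> linear_map K M P (\<lambda>x. b x y)\<rbrakk> \<Longrightarrow> bilinear_map K M N P b"
  by (auto simp: bilinear_map_def)

lemma bilinear_map_right: "\<lbrakk>bilinear_map K M N P b; x \<in> carrier M\<rbrakk> \<Longrightarrow> linear_map K N P (b x)"
  by (auto simp: bilinear_map_def)

lemma bilinear_map_left:
  "\<lbrakk>bilinear_map K M N P b; y \<in> carrier N\<rbrakk> \<Longrightarrow> linear_map K M P (\<lambda>x. b x y)"
  by (auto simp: bilinear_map_def)

lemma bilinear_map_closed:
  "\<lbrakk>bilinear_map K M N P b; x \<in> carrier M; y \<in> carrier N\<rbrakk> \<Longrightarrow> b x y \<in> carrier P"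
  using bilinear_map_right linear_map_closed by metis

text \<open>In a list sum a summand may repeat, and congruence and reindexing need neither
  membership in the carrier nor injectivity, unlike for \<open>finsum\<close>.\<close>

definition lsum :: "('c, 'm) ring_scheme \<Rightarrow> 'i list \<Rightarrow> ('i \<Rightarrow> 'c) \<Rightarrow> 'c"
  where "lsum P xs F = foldr (\<lambda>i s. F i \<oplus>\<^bsub>P\<^esub> s) xs \<zero>\<^bsub>P\<^esub>"

lemma lsum_Nil [simp]: "lsum P [] F = \<zero>\<^bsub>P\<^esub>"
  and lsum_Cons [simp]: "lsum P (x # xs) F = F x \<oplus>\<^bsub>P\<^esub> lsum P xs F"
  by (simp_all add: lsum_def)

lemma lsum_cong: "(\<And>i. i \<in> set xs \<Longrightarrow> F i = G i) \<Longrightarrow> lsum P xs F = lsum P xs G"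
  by (induction xs) auto

lemma lsum_map: "lsum P (map h xs) F = lsum P xs (\<lambda>i. F (h i))"
  by (induction xs) auto

context abelian_group
begin

lemma lsum_closed: "(\<And>i. i \<in> set xs \<Longrightarrow> F i \<in> carrier G) \<Longrightarrow> lsum G xs F \<in> carrier G"
  by (induction xs) auto

lemma lsum_append:
  "\<lbrakk>\<And>i. i \<in> set xs \<Longrightarrow> F i \<in> carrier G; \<And>i. i \<in> set ys \<Longrightarrow> F i \<in> carrier G\<rbrakk> \<Longrightarrow>
    lsum G (xs @ ys) F = lsum G xs F \<oplus> lsum G ys F"
  by (induction xs) (auto simp: lsum_closed a_assoc)

lemma lsum_add:
  "\<lbrakk>\<And>i. i \<in> set xs \<Longrightarrow> F i \<in> carrier G; \<And>i. i \<in> set xs \<Longrightarrow> F' i \<in> carrier G\<rbrakk> \<Longrightarrow>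
    lsum G xs (\<lambda>i. F i \<oplus> F' i) = lsum G xs F \<oplus> lsum G xs F'"
  by (induction xs) (auto simp: lsum_closed a_ac)

lemma lsum_zero: "(\<And>i. i \<in> set xs \<Longrightarrow> F i = \<zero>) \<Longrightarrow> lsum G xs F = \<zero>"
  by (induction xs) auto

lemma lsum_swap:
  "(\<And>i j. \<lbrakk>i \<in> set xs; j \<in> set ys\<rbrakk> \<Longrightarrow> F i j \<in> carrier G) \<Longrightarrow>
    lsum G xs (\<lambda>i. lsum G ys (F i)) = lsum G ys (\<lambda>j. lsum G xs (\<lambda>i. F i j))"
proof (induction xs)
  case Nil
  then show ?case by (simp add: lsum_zero)
next
  case (Cons x xs)
  then show ?case by (simp add: lsum_add lsum_closed)
qed

lemma lsum_concat:
  "(\<And>i j. \<lbrakk>i \<in> set xs; j \<in> set (h i)\<rbrakk> \<Longrightarrow> F j \<in> carrier G) \<Longrightarrow>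
    lsum G (concat (map h xs)) F = lsum G xs (\<lambda>i. lsum G (h i) F)"
proof (induction xs)
  case (Cons x xs)
  then have *: "lsum G (concat (map h xs)) F = lsum G xs (\<lambda>i. lsum G (h i) F)" by auto
  have "lsum G (h x @ concat (map h xs)) F = lsum G (h x) F \<oplus> lsum G (concat (map h xs)) F"
    using Cons.prems by (intro lsum_append) auto
  with * show ?case by simp
qed simp

lemma finsum_mono_neutral:
  assumes "finite B" "A \<subseteq> B" "\<And>i. i \<in> B - A \<Longrightarrow> f i = \<zero>" "f \<in> A \<rightarrow> carrier G"
  shows "finsum G f A = finsum G f B"
  by (rule add.finprod_mono_neutral_cong_left) (use assms in auto)

text \<open>The bridge from \<open>finsum\<close>, in which gradings and tensors are defined, to
  list sums.\<close>

lemma finsum_lsum: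
  assumes "finite A" "f \<in> A \<rightarrow> carrier G"
  shows "\<exists>xs. distinct xs \<and> set xs = A \<and> finsum G f A = lsum G xs f"
  using assms
proof (induction rule: finite_induct)
  case empty
  then show ?case by (intro exI[of _ "[]"]) auto
next
  case (insert x A)
  then obtain xs where "distinct xs" "set xs = A" "finsum G f A = lsum G xs f" by auto
  with insert show ?case by (intro exI[of _ "x # xs"]) auto
qed

end

lemma linear_map_lsum:
  assumes "module K M" "module K N" "linear_map K M N f" "\<And>i. i \<in> set xs \<Longrightarrow> F i \<in> carrier M"
  shows "f (lsum M xs F) = lsum N xs (\<lambda>i. f (F i))"
proof -
  interpret M: module K M by fact
  show ?thesis using assms(4)
    by (induction xs)
      (auto simp: linear_map_zero[OF assms(1-3)] linear_map_add[OF assms(3)] M.lsum_closed)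
qed

context module
begin

lemma linear_map_lsum_pointwise:
  assumes "module R N" "\<And>i. i \<in> set xs \<Longrightarrow> linear_map R N M (F i)"
  shows "linear_map R N M (\<lambda>x. lsum M xs (\<lambda>i. F i x))"
proof -
  interpret N: module R N by fact
  have *: "F i x \<in> carrier M" if "i \<in> set xs" "x \<in> carrier N" for i x
    using assms(2)[OF that(1)] that(2) by (rule linear_map_closed)
  show ?thesis using assms(2) *
  proof (induction xs)
    case Nil
    then show ?case by (auto intro!: linear_mapI)
  next
    case (Cons i xs)
    have IH: "linear_map R N M (\<lambda>x. lsum M xs (\<lambda>i. F i x))" by (rule Cons.IH) (use Cons.prems in auto)
    have i: "linear_map R N M (F i)" using Cons.prems by auto
    show ?case
      by (rule linear_mapI)
        (simp_all add: linear_map_closed[OF IH] linear_map_closed[OF i] linear_map_add[OF IH]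
          linear_map_add[OF i] linear_map_smult[OF IH] linear_map_smult[OF i] M.a_ac smult_r_distr)
  qed
qed

lemma linear_map_finsum:
  assumes "module R N" "linear_map R M N f" "finite A" "g \<in> A \<rightarrow> carrier M"
  shows "f (finsum M g A) = finsum N (\<lambda>i. f (g i)) A"
proof -
  interpret N: module R N by fact
  show ?thesis using assms(3,4)
  proof (induction rule: finite_induct)
    case empty
    then show ?case using linear_map_zero[OF module_axioms assms(1,2)] by simp
  next
    case (insert x F)
    then have "(\<lambda>i. f (g i)) \<in> F \<rightarrow> carrier N" "f (g x) \<in> carrier N"
      using linear_map_closed[OF assms(2)] by auto
    then show ?case using insert by (simp add: linear_map_add[OF assms(2)])
  qed
qed

end

section \<open>Tensor products of modules\<close>

lemma submodule_mspan:
  assumes "module K M" "S \<subseteq> carrier M"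
  shows "submodule (mspan K M S) K M"
proof -
  interpret M: module K M by fact
  show ?thesis
  proof (rule M.submoduleI)
    show "mspan K M S \<subseteq> carrier M"
      using M.carrier_is_submodule assms(2) by (auto simp: mspan_def)
    show "\<zero>\<^bsub>M\<^esub> \<in> mspan K M S"
      by (auto simp: mspan_def dest!: submodule.axioms(1) subgroup.one_closed)
  qed (auto simp: mspan_def M.submoduleE)
qed

lemma mspan_superset: "S \<subseteq> mspan K M S"
  by (auto simp: mspan_def)

lemma mspan_least: "\<lbrakk>submodule N K M; S \<subseteq> N\<rbrakk> \<Longrightarrow> mspan K M S \<subseteq> N"
  by (auto simp: mspan_def)

text \<open>Together with \<open>mspan_least\<close> this reduces the equality of two linear maps on
  a span to equality on its generators.\<close>

lemma submodule_equalizer: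
  assumes "module K M" "module K N" "linear_map K M N f" "linear_map K M N g"
  shows "submodule {x \<in> carrier M. f x = g x} K M"
proof -
  interpret M: module K M by fact
  interpret N: module K N by fact
  show ?thesis
  proof (rule M.submoduleI, goal_cases)
    \<comment> \<open>The case of additive inverses. Linearity speaks only of sums and scalar
      multiples, so the inverse of \<open>a\<close> is read as its multiple by minus one.\<close>
    case (3 a)
    then have "f (\<ominus>\<^bsub>M\<^esub> a) = f ((\<ominus>\<^bsub>K\<^esub> \<one>\<^bsub>K\<^esub>) \<odot>\<^bsub>M\<^esub> a)" "g (\<ominus>\<^bsub>M\<^esub> a) = g ((\<ominus>\<^bsub>K\<^esub> \<one>\<^bsub>K\<^esub>) \<odot>\<^bsub>M\<^esub> a)"
      by (simp_all add: M.smult_l_minus)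
    then show ?case using 3 by (simp add: linear_map_smult[OF assms(3)] linear_map_smult[OF assms(4)])
  qed (use linear_map_zero[OF assms(1-3)] linear_map_zero[OF assms(1,2,4)] in
      \<open>auto simp: linear_map_add[OF assms(3)] linear_map_smult[OF assms(3)]
        linear_map_add[OF assms(4)] linear_map_smult[OF assms(4)]\<close>)
qed

lemma submodule_kernel:
  assumes "module K M" "module K N" "linear_map K M N f"
  shows "submodule {x \<in> carrier M. f x = \<zero>\<^bsub>N\<^esub>} K M"
proof -
  interpret N: module K N by fact
  have "linear_map K M N (\<lambda>x. \<zero>\<^bsub>N\<^esub>)" by (rule linear_mapI) auto
  with assms show ?thesis by (rule submodule_equalizer)
qed

lemma abelian_subgroup_submodule:
  assumes "module K M" "submodule N K M"
  shows "abelian_subgroup N M"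
proof -
  interpret M: module K M by fact
  show ?thesis
    by (rule abelian_subgroupI3)
      (use assms(2) in \<open>auto intro: additive_subgroup.intro submodule.axioms(1) M.abelian_group_axioms\<close>)
qed

context
  fixes K :: "('k, 's) ring_scheme" and M :: "('k, 'a, 'm) module_scheme" and N
  assumes M: "module K M" and N: "submodule N K M"
begin

interpretation M: module K M by (rule M)
interpretation N: abelian_subgroup N M by (rule abelian_subgroup_submodule[OF M N])

text \<open>By definition this is a union of cosets over all representatives. Since \<open>N\<close>
  is closed under scalar multiplication, those cosets coincide and the union is a single
  one.\<close>

lemma quotient_smult:
  assumes "a \<in> carrier K" "x \<in> carrier M"
  shows "a \<odot>\<^bsub>quotient_module M N\<^esub> (N +>\<^bsub>M\<^esub> x) = N +>\<^bsub>M\<^esub> (a \<odot>\<^bsub>M\<^esub> x)"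
proof -
  have const: "N +>\<^bsub>M\<^esub> (a \<odot>\<^bsub>M\<^esub> y) = N +>\<^bsub>M\<^esub> (a \<odot>\<^bsub>M\<^esub> x)" if y: "y \<in> N +>\<^bsub>M\<^esub> x" for y
  proof -
    obtain n where n: "n \<in> N" "y = n \<oplus>\<^bsub>M\<^esub> x" using y by (auto simp: a_r_coset_def')
    then have "a \<odot>\<^bsub>M\<^esub> y = a \<odot>\<^bsub>M\<^esub> n \<oplus>\<^bsub>M\<^esub> a \<odot>\<^bsub>M\<^esub> x" "a \<odot>\<^bsub>M\<^esub> n \<in> N"
      using assms M.submoduleE(4)[OF N] M.submoduleE(1)[OF N] by (auto simp: M.smult_r_distr)
    then have "a \<odot>\<^bsub>M\<^esub> y \<in> N +>\<^bsub>M\<^esub> (a \<odot>\<^bsub>M\<^esub> x)" by (auto simp: a_r_coset_def')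
    then show ?thesis using assms by (simp add: N.a_repr_independence')
  qed
  have x: "x \<in> N +>\<^bsub>M\<^esub> x" using assms by (simp add: N.a_rcos_self)
  have "(\<Union>y\<in>N +>\<^bsub>M\<^esub> x. N +>\<^bsub>M\<^esub> (a \<odot>\<^bsub>M\<^esub> y)) = N +>\<^bsub>M\<^esub> (a \<odot>\<^bsub>M\<^esub> x)"
    by (subst SUP_cong[OF refl const]) (use x in auto)
  then show ?thesis by (simp add: quotient_module_def)
qed

lemma quotient_add:
  "\<lbrakk>x \<in> carrier M; y \<in> carrier M\<rbrakk> \<Longrightarrow>
    (N +>\<^bsub>M\<^esub> x) \<oplus>\<^bsub>quotient_module M N\<^esub> (N +>\<^bsub>M\<^esub> y) = N +>\<^bsub>M\<^esub> (x \<oplus>\<^bsub>M\<^esub> y)"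
  by (simp add: quotient_module_def N.a_rcos_sum)

lemma quotient_carrier: "carrier (quotient_module M N) = (\<lambda>x. N +>\<^bsub>M\<^esub> x) ` carrier M"
  by (auto simp: quotient_module_def A_RCOSETS_def')

lemma quotient_zero: "\<zero>\<^bsub>quotient_module M N\<^esub> = N +>\<^bsub>M\<^esub> \<zero>\<^bsub>M\<^esub>"
  using M.a_coset_add_zero M.submoduleE(1)[OF N] by (simp add: quotient_module_def)

lemma module_quotient: "module K (quotient_module M N)"
proof (rule moduleI)
  show "cring K" by (rule M.R.is_cring)
  show "abelian_group (quotient_module M N)"
  proof (rule abelian_groupI, goal_cases)
    case (6 x)
    then obtain m where "m \<in> carrier M" "x = N +>\<^bsub>M\<^esub> m" by (auto simp: quotient_carrier)
    then show ?case
      by (intro bexI[of _ "N +>\<^bsub>M\<^esub> (\<ominus>\<^bsub>M\<^esub> m)"])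
        (auto simp: quotient_add quotient_carrier quotient_zero M.M.l_neg)
  qed (auto simp: quotient_carrier quotient_add quotient_zero M.M.a_ac)
qed (auto simp: quotient_carrier quotient_add quotient_smult M.smult_l_distr M.smult_r_distr
    M.smult_assoc1)

lemma linear_map_coset: "linear_map K M (quotient_module M N) (\<lambda>x. N +>\<^bsub>M\<^esub> x)"
  by (rule linear_mapI) (auto simp: quotient_carrier quotient_add quotient_smult)

end

text \<open>The linear extension of \<open>b\<close> from the basis to the free module. It is the
  sum inside \<open>tsum\<close> once a representative \<open>u\<close> has been chosen.\<close>

definition free_lift :: "('k, 's) ring_scheme \<Rightarrow> ('k, 'c, 'm) module_scheme \<Rightarrow> ('b \<Rightarrow> 'c) \<Rightarrow> ('b \<Rightarrow> 'k) \<Rightarrow> 'c"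
  where "free_lift K P b u = (\<Oplus>\<^bsub>P\<^esub>p\<in>{p. u p \<noteq> \<zero>\<^bsub>K\<^esub>}. u p \<odot>\<^bsub>P\<^esub> b p)"

context cring
begin

lemma free_module_simps:
  "\<zero>\<^bsub>free_module R B\<^esub> = (\<lambda>b. \<zero>)"
  "u \<oplus>\<^bsub>free_module R B\<^esub> v = (\<lambda>b. u b \<oplus> v b)"
  "a \<odot>\<^bsub>free_module R B\<^esub> u = (\<lambda>b. a \<otimes> u b)"
  by (simp_all add: free_module_def)

lemma free_module_carrier:
  "u \<in> carrier (free_module R B) \<longleftrightarrow>
    (\<forall>b. u b \<in> carrier R) \<and> finite {b. u b \<noteq> \<zero>} \<and> (\<forall>b. u b \<noteq> \<zero> \<longrightarrow> b \<in> B)"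
  by (auto simp: free_module_def)

lemma free_module_add_closed:
  assumes "u \<in> carrier (free_module R B)" "v \<in> carrier (free_module R B)"
  shows "(\<lambda>b. u b \<oplus> v b) \<in> carrier (free_module R B)"
proof -
  have "{b. u b \<oplus> v b \<noteq> \<zero>} \<subseteq> {b. u b \<noteq> \<zero>} \<union> {b. v b \<noteq> \<zero>}" by auto
  then have "finite {b. u b \<oplus> v b \<noteq> \<zero>}"
    by (rule finite_subset) (use assms in \<open>auto simp: free_module_carrier\<close>)
  moreover have "b \<in> B" if "u b \<oplus> v b \<noteq> \<zero>" for b
    using assms that by (cases "u b = \<zero>") (auto simp: free_module_carrier)
  ultimately show ?thesis using assms by (auto simp: free_module_carrier)
qed

lemma free_module_smult_closed:
  assumes "u \<in> carrier (free_module R B)" "a \<in> carrier R"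
  shows "(\<lambda>b. a \<otimes> u b) \<in> carrier (free_module R B)"
proof -
  have "{b. a \<otimes> u b \<noteq> \<zero>} \<subseteq> {b. u b \<noteq> \<zero>}" using assms by auto
  then have "finite {b. a \<otimes> u b \<noteq> \<zero>}"
    by (rule finite_subset) (use assms in \<open>auto simp: free_module_carrier\<close>)
  moreover have "b \<in> B" if "a \<otimes> u b \<noteq> \<zero>" for b
    using assms that by (cases "u b = \<zero>") (auto simp: free_module_carrier)
  ultimately show ?thesis using assms by (auto simp: free_module_carrier)
qed

lemma free_module_value: "u \<in> carrier (free_module R B) \<Longrightarrow> u b \<in> carrier R"
  by (simp add: free_module_carrier)

lemma free_module_zero_closed: "(\<lambda>b. \<zero>) \<in> carrier (free_module R B)"
  by (simp add: free_module_carrier)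

lemma module_free: "module R (free_module R B)"
proof (rule moduleI)
  show "cring R" by (rule is_cring)
  show "abelian_group (free_module R B)"
  proof (rule abelian_groupI, goal_cases)
    case (6 u)
    then have "(\<lambda>b. (\<ominus> \<one>) \<otimes> u b) \<in> carrier (free_module R B)"
      by (rule free_module_smult_closed) simp
    with 6 show ?case
      by (intro bexI[of _ "\<lambda>b. (\<ominus> \<one>) \<otimes> u b"])
        (simp_all add: free_module_simps free_module_value l_minus l_neg)
  qed (simp_all add: free_module_simps free_module_value free_module_add_closed
      free_module_zero_closed a_ac)
qed (simp_all add: free_module_simps free_module_smult_closed free_module_value
    l_distr r_distr m_assoc)

lemma free_gen_closed: "p \<in> B \<Longrightarrow> free_gen R p \<in> carrier (free_module R B)"
  by (auto simp: free_module_carrier free_gen_def)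

text \<open>Supports can shrink by cancellation. Additivity is therefore proved over a common finite
  index set, where the extra terms are zero.\<close>

lemma free_lift_superset:
  assumes "module R P" "b \<in> B \<rightarrow> carrier P" "u \<in> carrier (free_module R B)"
    and "finite S" "{p. u p \<noteq> \<zero>} \<subseteq> S" "S \<subseteq> B"
  shows "free_lift R P b u = (\<Oplus>\<^bsub>P\<^esub>p\<in>S. u p \<odot>\<^bsub>P\<^esub> b p)"
proof -
  interpret P: module R P by fact
  show ?thesis unfolding free_lift_def
    by (rule P.finsum_mono_neutral)
      (use assms in \<open>auto simp: free_module_carrier Pi_def subset_iff\<close>)
qed

lemma linear_map_free_lift:
  assumes P: "module R P" and b: "b \<in> B \<rightarrow> carrier P"
  shows "linear_map R (free_module R B) P (free_lift R P b)"
proof -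
  interpret P: module R P by fact
  note sup = free_lift_superset[OF P b]
  show ?thesis
  proof (rule linear_mapI, goal_cases)
    case (1 u)
    then show ?case unfolding free_lift_def
      using b by (intro P.finsum_closed) (auto simp: free_module_carrier)
  next
    case (2 u v)
    let ?S = "{p. u p \<noteq> \<zero>} \<union> {p. v p \<noteq> \<zero>}"
    have S: "finite ?S" "?S \<subseteq> B" using 2 by (auto simp: free_module_carrier)
    have uv: "(\<lambda>b. u b \<oplus> v b) \<in> carrier (free_module R B)" using 2 by (rule free_module_add_closed)
    have "free_lift R P b (\<lambda>b. u b \<oplus> v b) = (\<Oplus>\<^bsub>P\<^esub>p\<in>?S. (u p \<oplus> v p) \<odot>\<^bsub>P\<^esub> b p)"
      using S by (intro sup[OF uv]) auto
    also have "\<dots> = (\<Oplus>\<^bsub>P\<^esub>p\<in>?S. u p \<odot>\<^bsub>P\<^esub> b p \<oplus>\<^bsub>P\<^esub> v p \<odot>\<^bsub>P\<^esub> b p)"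
      using 2 b S(2) by (intro P.finsum_cong') (auto simp: P.smult_l_distr free_module_carrier Pi_def)
    also have "\<dots> = (\<Oplus>\<^bsub>P\<^esub>p\<in>?S. u p \<odot>\<^bsub>P\<^esub> b p) \<oplus>\<^bsub>P\<^esub> (\<Oplus>\<^bsub>P\<^esub>p\<in>?S. v p \<odot>\<^bsub>P\<^esub> b p)"
      using 2 b S(2) by (intro P.finsum_addf) (auto simp: free_module_carrier Pi_def)
    also have "\<dots> = free_lift R P b u \<oplus>\<^bsub>P\<^esub> free_lift R P b v"
      using sup[OF 2(1) S(1) _ S(2)] sup[OF 2(2) S(1) _ S(2)] by simp
    finally show ?case by (simp add: free_module_simps)
  next
    case (3 a u)
    let ?S = "{p. u p \<noteq> \<zero>}"
    have S: "finite ?S" "?S \<subseteq> B" using 3 by (auto simp: free_module_carrier)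
    have au: "(\<lambda>b. a \<otimes> u b) \<in> carrier (free_module R B)" using 3 by (intro free_module_smult_closed)
    have "free_lift R P b (\<lambda>b. a \<otimes> u b) = (\<Oplus>\<^bsub>P\<^esub>p\<in>?S. (a \<otimes> u p) \<odot>\<^bsub>P\<^esub> b p)"
      using S 3 by (intro sup[OF au]) auto
    also have "\<dots> = (\<Oplus>\<^bsub>P\<^esub>p\<in>?S. a \<odot>\<^bsub>P\<^esub> (u p \<odot>\<^bsub>P\<^esub> b p))"
      using 3 b S(2) by (intro P.finsum_cong') (auto simp: P.smult_assoc1 free_module_carrier Pi_def)
    also have "\<dots> = a \<odot>\<^bsub>P\<^esub> free_lift R P b u" unfolding free_lift_def
      using 3 b S by (subst P.finsum_smult_ldistr) (auto simp: free_module_carrier Pi_def)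
    finally show ?case by (simp add: free_module_simps)
  qed
qed

lemma free_lift_gen:
  assumes "module R P" "b \<in> B \<rightarrow> carrier P" "p \<in> B"
  shows "free_lift R P b (free_gen R p) = b p"
proof -
  interpret P: module R P by fact
  have bp: "b p \<in> carrier P" using assms by auto
  have "free_lift R P b (free_gen R p) = (\<Oplus>\<^bsub>P\<^esub>q\<in>{p}. free_gen R p q \<odot>\<^bsub>P\<^esub> b q)"
    by (rule free_lift_superset[OF assms(1,2) free_gen_closed]) (use assms in \<open>auto simp: free_gen_def\<close>)
  then show ?thesis using bp by (simp add: free_gen_def)
qed

lemma free_module_list:
  assumes "u \<in> carrier (free_module R B)"
  shows "\<exists>xs. set xs \<subseteq> carrier R \<times> B \<and>
    u = lsum (free_module R B) xs (\<lambda>(a, p). a \<odot>\<^bsub>free_module R B\<^esub> free_gen R p)"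
proof -
  interpret F: module R "free_module R B" by (rule module_free)
  \<comment> \<open>Stated for every finite set containing the support, so that the induction can
    remove one point from it and set \<open>u\<close> to zero there.\<close>
  have "\<exists>xs. set xs \<subseteq> carrier R \<times> B \<and>
      u = lsum (free_module R B) xs (\<lambda>(a, p). a \<odot>\<^bsub>free_module R B\<^esub> free_gen R p)"
    if "finite S" "u \<in> carrier (free_module R B)" "{p. u p \<noteq> \<zero>} \<subseteq> S" for S u
    using that
  proof (induction S arbitrary: u rule: finite_induct)
    case empty
    then have "u = (\<lambda>b. \<zero>)" by auto
    then show ?case by (intro exI[of _ "[]"]) (simp add: free_module_simps)
  next
    case (insert p S)
    show ?case
    proof (cases "u p = \<zero>")
      case True
      then have "{p. u p \<noteq> \<zero>} \<subseteq> S" using insert by auto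
      then show ?thesis using insert by blast
    next
      case False
      let ?u = "u(p := \<zero>)"
      have sub: "{b. ?u b \<noteq> \<zero>} \<subseteq> {b. u b \<noteq> \<zero>}" by auto
      have cl: "?u \<in> carrier (free_module R B)"
        using insert.prems(1) finite_subset[OF sub] unfolding free_module_carrier by auto
      have "{b. ?u b \<noteq> \<zero>} \<subseteq> S" using insert.prems by auto
      with insert.IH[OF cl] obtain xs where xs: "set xs \<subseteq> carrier R \<times> B"
        "?u = lsum (free_module R B) xs (\<lambda>(a, p). a \<odot>\<^bsub>free_module R B\<^esub> free_gen R p)" by blast
      have p: "p \<in> B" "u p \<in> carrier R" using False insert.prems by (auto simp: free_module_carrier)
      have "u = u p \<odot>\<^bsub>free_module R B\<^esub> free_gen R p \<oplus>\<^bsub>free_module R B\<^esub> ?u"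
        using insert.prems by (auto simp: free_module_simps free_gen_def free_module_carrier fun_eq_iff)
      then show ?thesis using xs p by (intro exI[of _ "(u p, p) # xs"]) auto
    qed
  qed
  from this[of "{p. u p \<noteq> \<zero>}" u] assms show ?thesis by (simp add: free_module_carrier)
qed

end

section \<open>The tensor product of two modules and its universal property\<close>

locale module_pair = M: module K M + N: module K N
  for K :: "('k, 's) ring_scheme" (structure)
    and M :: "('k, 'a, 'm) module_scheme" and N :: "('k, 'b, 'n) module_scheme"
begin

abbreviation "T \<equiv> tensor_module K M N"
abbreviation "F \<equiv> free_module K (carrier M \<times> carrier N)"
abbreviation "Rel \<equiv> tensor_relations K M N"
abbreviation "e x y \<equiv> free_gen K (x, y)"
abbreviation "pure \<equiv> pure_tensor K M N"

sublocale F: module K F by (rule M.R.module_free)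

lemma e_closed: "\<lbrakk>x \<in> carrier M; y \<in> carrier N\<rbrakk> \<Longrightarrow> e x y \<in> carrier F"
  by (simp add: M.R.free_gen_closed)

text \<open>The generators of the relations, separated from their span so that linear maps can be
  tested on them.\<close>

definition "rel_gens =
  {e (x \<oplus>\<^bsub>M\<^esub> x') y \<ominus>\<^bsub>F\<^esub> (e x y \<oplus>\<^bsub>F\<^esub> e x' y) | x x' y.
     x \<in> carrier M \<and> x' \<in> carrier M \<and> y \<in> carrier N} \<union>
  {e x (y \<oplus>\<^bsub>N\<^esub> y') \<ominus>\<^bsub>F\<^esub> (e x y \<oplus>\<^bsub>F\<^esub> e x y') | x y y'.
     x \<in> carrier M \<and> y \<in> carrier N \<and> y' \<in> carrier N} \<union>
  {e (a \<odot>\<^bsub>M\<^esub> x) y \<ominus>\<^bsub>F\<^esub> (a \<odot>\<^bsub>F\<^esub> e x y) | a x y.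
     a \<in> carrier K \<and> x \<in> carrier M \<and> y \<in> carrier N} \<union>
  {e x (a \<odot>\<^bsub>N\<^esub> y) \<ominus>\<^bsub>F\<^esub> (a \<odot>\<^bsub>F\<^esub> e x y) | a x y.
     a \<in> carrier K \<and> x \<in> carrier M \<and> y \<in> carrier N}"

lemma Rel_eq: "Rel = mspan K F rel_gens"
  by (simp add: tensor_relations_def rel_gens_def Let_def)

lemma rel_gens_closed: "rel_gens \<subseteq> carrier F"
  unfolding rel_gens_def by (auto simp: e_closed F.M.minus_closed)

lemma submodule_Rel: "submodule Rel K F"
  unfolding Rel_eq by (rule submodule_mspan[OF F.module_axioms rel_gens_closed])

sublocale Rel: abelian_subgroup Rel F
  by (rule abelian_subgroup_submodule[OF F.module_axioms submodule_Rel])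

lemma module_tensor: "module K T"
  unfolding tensor_module_def by (rule module_quotient[OF F.module_axioms submodule_Rel])

sublocale T: module K T by (rule module_tensor)

lemma linear_map_proj: "linear_map K F T (\<lambda>u. Rel +>\<^bsub>F\<^esub> u)"
  unfolding tensor_module_def by (rule linear_map_coset[OF F.module_axioms submodule_Rel])

lemma tensor_carrier: "carrier T = (\<lambda>u. Rel +>\<^bsub>F\<^esub> u) ` carrier F"
  unfolding tensor_module_def by (rule quotient_carrier[OF F.module_axioms submodule_Rel])

lemma pure_def': "pure x y = Rel +>\<^bsub>F\<^esub> e x y"
  by (simp add: pure_tensor_def)

lemma coset_eqI: 
  assumes "u \<in> carrier F" "v \<in> carrier F" "u \<ominus>\<^bsub>F\<^esub> v \<in> Rel"
  shows "Rel +>\<^bsub>F\<^esub> u = Rel +>\<^bsub>F\<^esub> v"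
proof -
  have "u \<in> Rel +>\<^bsub>F\<^esub> v" using assms by (simp add: Rel.a_rcos_module a_minus_def)
  then show ?thesis using assms by (metis Rel.a_repr_independence')
qed

end

context module_pair
begin

lemma pure_closed: "\<lbrakk>x \<in> carrier M; y \<in> carrier N\<rbrakk> \<Longrightarrow> pure x y \<in> carrier T"
  by (auto simp: pure_def' tensor_carrier e_closed)

lemma rel_gens_in_Rel: "u \<in> rel_gens \<Longrightarrow> u \<in> Rel"
  unfolding Rel_eq by (rule subsetD[OF mspan_superset])

lemma pure_relations:
  assumes "x \<in> carrier M" "y \<in> carrier N"
  shows pure_add_left: "x' \<in> carrier M \<Longrightarrow> pure (x \<oplus>\<^bsub>M\<^esub> x') y = pure x y \<oplus>\<^bsub>T\<^esub> pure x' y"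
    and pure_add_right: "y' \<in> carrier N \<Longrightarrow> pure x (y \<oplus>\<^bsub>N\<^esub> y') = pure x y \<oplus>\<^bsub>T\<^esub> pure x y'"
    and pure_smult_left: "a \<in> carrier K \<Longrightarrow> pure (a \<odot>\<^bsub>M\<^esub> x) y = a \<odot>\<^bsub>T\<^esub> pure x y"
    and pure_smult_right: "a \<in> carrier K \<Longrightarrow> pure x (a \<odot>\<^bsub>N\<^esub> y) = a \<odot>\<^bsub>T\<^esub> pure x y"
proof -
  note [simp] = linear_map_add[OF linear_map_proj, symmetric]
    linear_map_smult[OF linear_map_proj, symmetric]
  show "pure (x \<oplus>\<^bsub>M\<^esub> x') y = pure x y \<oplus>\<^bsub>T\<^esub> pure x' y" if that: "x' \<in> carrier M"
  proof -
    have "e (x \<oplus>\<^bsub>M\<^esub> x') y \<ominus>\<^bsub>F\<^esub> (e x y \<oplus>\<^bsub>F\<^esub> e x' y) \<in> Rel"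
      by (rule rel_gens_in_Rel, unfold rel_gens_def, rule UnI1, rule UnI1, rule UnI1)
        (rule CollectI, (rule exI)+, rule conjI, rule refl, simp add: assms that)
    then show ?thesis unfolding pure_def' using assms that
      by (simp add: e_closed) (intro coset_eqI, simp_all add: e_closed)
  qed
  show "pure x (y \<oplus>\<^bsub>N\<^esub> y') = pure x y \<oplus>\<^bsub>T\<^esub> pure x y'" if that: "y' \<in> carrier N"
  proof -
    have "e x (y \<oplus>\<^bsub>N\<^esub> y') \<ominus>\<^bsub>F\<^esub> (e x y \<oplus>\<^bsub>F\<^esub> e x y') \<in> Rel"
      by (rule rel_gens_in_Rel, unfold rel_gens_def, rule UnI1, rule UnI1, rule UnI2)
        (rule CollectI, (rule exI)+, rule conjI, rule refl, simp add: assms that)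
    then show ?thesis unfolding pure_def' using assms that
      by (simp add: e_closed) (intro coset_eqI, simp_all add: e_closed)
  qed
  show "pure (a \<odot>\<^bsub>M\<^esub> x) y = a \<odot>\<^bsub>T\<^esub> pure x y" if that: "a \<in> carrier K"
  proof -
    have "e (a \<odot>\<^bsub>M\<^esub> x) y \<ominus>\<^bsub>F\<^esub> (a \<odot>\<^bsub>F\<^esub> e x y) \<in> Rel"
      by (rule rel_gens_in_Rel, unfold rel_gens_def, rule UnI1, rule UnI2)
        (rule CollectI, (rule exI)+, rule conjI, rule refl, simp add: assms that)
    then show ?thesis unfolding pure_def' using assms that
      by (simp add: e_closed) (intro coset_eqI, simp_all add: e_closed)
  qed
  show "pure x (a \<odot>\<^bsub>N\<^esub> y) = a \<odot>\<^bsub>T\<^esub> pure x y" if that: "a \<in> carrier K"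
  proof -
    have "e x (a \<odot>\<^bsub>N\<^esub> y) \<ominus>\<^bsub>F\<^esub> (a \<odot>\<^bsub>F\<^esub> e x y) \<in> Rel"
      by (rule rel_gens_in_Rel, unfold rel_gens_def, rule UnI2)
        (rule CollectI, (rule exI)+, rule conjI, rule refl, simp add: assms that)
    then show ?thesis unfolding pure_def' using assms that
      by (simp add: e_closed) (intro coset_eqI, simp_all add: e_closed)
  qed
qed

lemma bilinear_map_pure: "bilinear_map K M N T pure"
  by (intro bilinear_mapI linear_mapI)
    (simp_all add: pure_closed pure_add_left pure_add_right pure_smult_left pure_smult_right)

context
  fixes P :: "('k, 'c, 'p) module_scheme" and b
  assumes P: "module K P" and b: "bilinear_map K M N P b"
begin

abbreviation (input) "lift \<equiv> free_lift K P (\<lambda>p. b (fst p) (snd p))"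

lemma lift_funcset: "(\<lambda>p. b (fst p) (snd p)) \<in> carrier M \<times> carrier N \<rightarrow> carrier P"
  by (auto intro: bilinear_map_closed[OF b])

lemma linear_map_lift: "linear_map K F P lift"
  by (rule M.R.linear_map_free_lift[OF P lift_funcset])

lemma lift_e: "\<lbrakk>x \<in> carrier M; y \<in> carrier N\<rbrakk> \<Longrightarrow> lift (e x y) = b x y"
  by (subst M.R.free_lift_gen[OF P lift_funcset]) auto

lemma lift_minus:
  assumes "u \<in> carrier F" "v \<in> carrier F" "lift u = lift v"
  shows "lift (u \<ominus>\<^bsub>F\<^esub> v) = \<zero>\<^bsub>P\<^esub>"
proof -
  interpret P: module K P by (rule P)
  have "u \<ominus>\<^bsub>F\<^esub> v = u \<oplus>\<^bsub>F\<^esub> (\<ominus>\<^bsub>K\<^esub> \<one>\<^bsub>K\<^esub>) \<odot>\<^bsub>F\<^esub> v"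
    using assms by (simp add: a_minus_def F.smult_l_minus)
  then show ?thesis using assms linear_map_closed[OF linear_map_lift]
    by (simp add: linear_map_add[OF linear_map_lift] linear_map_smult[OF linear_map_lift]
        P.smult_l_minus P.M.r_neg)
qed

text \<open>Bilinearity makes the lift vanish on each of the four kinds of generators, and its
  kernel is a submodule, hence contains their span.\<close>

lemma lift_Rel: "u \<in> Rel \<Longrightarrow> lift u = \<zero>\<^bsub>P\<^esub>"
proof -
  interpret P: module K P by (rule P)
  note [simp] = linear_map_add[OF linear_map_lift] linear_map_smult[OF linear_map_lift] lift_e e_closed
    bilinear_map_closed[OF b]
    linear_map_add[OF bilinear_map_left[OF b]] linear_map_add[OF bilinear_map_right[OF b]]
    linear_map_smult[OF bilinear_map_left[OF b]] linear_map_smult[OF bilinear_map_right[OF b]]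
  have "rel_gens \<subseteq> {u \<in> carrier F. lift u = \<zero>\<^bsub>P\<^esub>}"
    unfolding rel_gens_def by (auto simp: F.M.minus_closed intro!: lift_minus)
  then have "Rel \<subseteq> {u \<in> carrier F. lift u = \<zero>\<^bsub>P\<^esub>}"
    unfolding Rel_eq by (intro mspan_least submodule_kernel[OF F.module_axioms P linear_map_lift])
  then show "u \<in> Rel \<Longrightarrow> lift u = \<zero>\<^bsub>P\<^esub>" by auto
qed

text \<open>The representative picked by \<open>SOME\<close> differs from \<open>u\<close> by a
  relation, which the lift kills. From here on the choice inside \<open>tsum\<close> is harmless for
  bilinear maps.\<close>

lemma tsum_coset:
  assumes "u \<in> carrier F"
  shows "tsum K P (Rel +>\<^bsub>F\<^esub> u) b = lift u"
proof -
  interpret P: module K P by (rule P)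
  let ?v = "SOME v. v \<in> Rel +>\<^bsub>F\<^esub> u"
  have "u \<in> Rel +>\<^bsub>F\<^esub> u" using assms by (rule Rel.a_rcos_self)
  then have "?v \<in> Rel +>\<^bsub>F\<^esub> u" by (rule someI[of "\<lambda>v. v \<in> Rel +>\<^bsub>F\<^esub> u"])
  then obtain r where r: "r \<in> Rel" "?v = r \<oplus>\<^bsub>F\<^esub> u" by (auto simp: a_r_coset_def')
  then have "lift ?v = lift u"
    using assms lift_Rel[OF r(1)] linear_map_closed[OF linear_map_lift assms] Rel.a_subset
    by (auto simp: linear_map_add[OF linear_map_lift])
  then show ?thesis by (simp add: tsum_def Let_def free_lift_def)
qed

lemma tsum_pure: "\<lbrakk>x \<in> carrier M; y \<in> carrier N\<rbrakk> \<Longrightarrow> tsum K P (pure x y) b = b x y"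
  unfolding pure_def' by (simp add: tsum_coset e_closed lift_e)

lemma linear_map_tsum: "linear_map K T P (\<lambda>t. tsum K P t b)"
proof (rule linear_mapI, goal_cases)
  case (1 s)
  then show ?case using linear_map_closed[OF linear_map_lift] by (auto simp: tensor_carrier tsum_coset)
next
  case (2 s t)
  then obtain u v where "u \<in> carrier F" "v \<in> carrier F" "s = Rel +>\<^bsub>F\<^esub> u" "t = Rel +>\<^bsub>F\<^esub> v"
    by (auto simp: tensor_carrier)
  then show ?case
    by (simp add: linear_map_add[OF linear_map_proj, symmetric] tsum_coset linear_map_add[OF linear_map_lift])
next
  case (3 a s)
  then obtain u where "u \<in> carrier F" "s = Rel +>\<^bsub>F\<^esub> u"
    by (auto simp: tensor_carrier)
  then show ?case using 3
    by (simp add: linear_map_smult[OF linear_map_proj, symmetric] tsum_coset linear_map_smult[OF linear_map_lift])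
qed

end

text \<open>The coefficients of a representative are absorbed into the first factors, so lists of
  pure tensors without scalars suffice.\<close>

lemma tensor_list:
  assumes "t \<in> carrier T"
  shows "\<exists>xs. set xs \<subseteq> carrier M \<times> carrier N \<and> t = lsum T xs (\<lambda>(x, y). pure x y)"
proof -
  obtain u where u: "u \<in> carrier F" "t = Rel +>\<^bsub>F\<^esub> u" using assms by (auto simp: tensor_carrier)
  obtain xs where xs: "set xs \<subseteq> carrier K \<times> (carrier M \<times> carrier N)"
    "u = lsum F xs (\<lambda>(a, p). a \<odot>\<^bsub>F\<^esub> free_gen K p)"
    using M.R.free_module_list[OF u(1)] by auto
  have "t = lsum T xs (\<lambda>i. Rel +>\<^bsub>F\<^esub> (case i of (a, p) \<Rightarrow> a \<odot>\<^bsub>F\<^esub> free_gen K p))"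
    unfolding u(2) xs(2)
    by (rule linear_map_lsum[OF F.module_axioms T.module_axioms linear_map_proj])
      (use xs(1) in \<open>auto simp: e_closed\<close>)
  also have "\<dots> = lsum T xs (\<lambda>(a, x, y). pure (a \<odot>\<^bsub>M\<^esub> x) y)"
    by (rule lsum_cong)
      (use xs(1) in \<open>auto simp: linear_map_smult[OF linear_map_proj] e_closed pure_def'[symmetric]
        pure_smult_left\<close>)
  also have "\<dots> = lsum T (map (\<lambda>(a, x, y). (a \<odot>\<^bsub>M\<^esub> x, y)) xs) (\<lambda>(x, y). pure x y)"
    by (auto simp: lsum_map intro!: lsum_cong)
  finally show ?thesis
    by (intro exI[of _ "map (\<lambda>(a, x, y). (a \<odot>\<^bsub>M\<^esub> x, y)) xs"]) (use xs(1) in auto)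
qed

lemma tensor_eqI:
  assumes "module K P" "linear_map K T P f" "linear_map K T P g"
    and "\<And>x y. \<lbrakk>x \<in> carrier M; y \<in> carrier N\<rbrakk> \<Longrightarrow> f (pure x y) = g (pure x y)" "t \<in> carrier T"
  shows "f t = g t"
proof -
  obtain xs where xs: "set xs \<subseteq> carrier M \<times> carrier N" "t = lsum T xs (\<lambda>(x, y). pure x y)"
    using tensor_list[OF assms(5)] by auto
  have "f t = lsum P xs (\<lambda>i. f (case i of (x, y) \<Rightarrow> pure x y))"
    unfolding xs(2) by (rule linear_map_lsum[OF T.module_axioms assms(1,2)])
      (use xs(1) in \<open>auto simp: pure_closed\<close>)
  also have "\<dots> = lsum P xs (\<lambda>i. g (case i of (x, y) \<Rightarrow> pure x y))"
    by (rule lsum_cong) (use xs(1) assms(4) in auto)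
  also have "\<dots> = g t"
    unfolding xs(2) by (rule linear_map_lsum[OF T.module_axioms assms(1,3), symmetric])
      (use xs(1) in \<open>auto simp: pure_closed\<close>)
  finally show ?thesis .
qed

end

text \<open>\<open>tensor\<close> and \<open>tensor_module\<close>, the double and its underlying
  tensor product, the finite dual and its opposite are different records with the same module
  fields. These congruences move facts between such records.\<close>

lemma tensor_cong:
  assumes "carrier M = carrier M'" "add M = add M'" "smult M = smult M'"
    and "carrier N = carrier N'" "add N = add N'" "smult N = smult N'"
  shows tensor_relations_cong: "tensor_relations K M N = tensor_relations K M' N'"
    and tensor_module_cong: "tensor_module K M N = tensor_module K M' N'"
    and pure_tensor_cong: "pure_tensor K M N = pure_tensor K M' N'"
proof -
  show *: "tensor_relations K M N = tensor_relations K M' N'"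
    by (simp add: tensor_relations_def assms)
  show "tensor_module K M N = tensor_module K M' N'"
    by (simp add: tensor_module_def * assms)
  show "pure_tensor K M N = pure_tensor K M' N'"
    by (simp add: pure_tensor_def * assms fun_eq_iff)
qed

lemma finsum_record_cong:
  assumes "carrier M = carrier M'" "add M = add M'" "zero M = zero M'"
  shows "finsum M = finsum M'"
  by (simp add: finsum_def finprod_def assms fun_eq_iff)

lemma tsum_cong:
  assumes "carrier M = carrier M'" "add M = add M'" "zero M = zero M'" "smult M = smult M'"
  shows "tsum K M = tsum K M'"
  by (simp add: tsum_def finsum_record_cong[OF assms(1-3)] assms fun_eq_iff)

lemma linear_map_record_cong:
  assumes "carrier M = carrier M'" "add M = add M'" "smult M = smult M'"
    and "carrier N = carrier N'" "add N = add N'" "smult N = smult N'"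
  shows "linear_map K M N = linear_map K M' N'"
  by (simp add: linear_map_def assms fun_eq_iff)

lemma lsum_record_cong:
  assumes "add M = add M'" "zero M = zero M'"
  shows "lsum M = lsum M'"
  by (simp add: lsum_def assms fun_eq_iff)

lemma module_record_cong:
  assumes "carrier M = carrier M'" "add M = add M'" "zero M = zero M'" "smult M = smult M'"
  shows "module K M = module K M'"
  by (simp add: module_def abelian_group_def abelian_monoid_def abelian_group_axioms_def
      comm_group_def group_def group_axioms_def comm_monoid_def comm_monoid_axioms_def monoid_def
      Units_def module_axioms_def assms)

section \<open>Graded modules\<close>

text \<open>Extends a degree-dependent family of maps from homogeneous elements to all of
  \<open>M\<close>. Iterated in two arguments it becomes \<open>colour_ext\<close>, the sign being
  part of the family.\<close>

definition graded_ext ::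
  "('k, 'a, 'g, 'm) graded_module_scheme \<Rightarrow> ('k, 'c, 'p) module_scheme \<Rightarrow> ('g \<Rightarrow> 'a \<Rightarrow> 'c) \<Rightarrow> 'a \<Rightarrow> 'c"
  where "graded_ext M P F x = (\<Oplus>\<^bsub>P\<^esub>\<alpha>\<in>hsupp M x. F \<alpha> (hcomp M x \<alpha>))"

context graded_module
begin

lemma grade_closed: "x \<in> grade M \<gamma> \<Longrightarrow> x \<in> carrier M"
  using submoduleE(1)[OF grade_submodule] by blast

lemma grade_zero: "\<zero>\<^bsub>M\<^esub> \<in> grade M \<gamma>"
  using subgroup.one_closed[OF submodule.axioms(1)[OF grade_submodule]] by simp

lemma grade_add: "\<lbrakk>x \<in> grade M \<gamma>; y \<in> grade M \<gamma>\<rbrakk> \<Longrightarrow> x \<oplus>\<^bsub>M\<^esub> y \<in> grade M \<gamma>"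
  using submoduleE(5)[OF grade_submodule] by blast

lemma grade_smult: "\<lbrakk>a \<in> carrier K; x \<in> grade M \<gamma>\<rbrakk> \<Longrightarrow> a \<odot>\<^bsub>M\<^esub> x \<in> grade M \<gamma>"
  using submoduleE(4)[OF grade_submodule] by blast

lemma hcomp_decomposition: "x \<in> carrier M \<Longrightarrow> homogeneous_decomposition M x (hcomp M x)"
  unfolding hcomp_def by (rule theI'[OF ex1_decomposition])

lemma hcomp_unique: "\<lbrakk>x \<in> carrier M; homogeneous_decomposition M x c\<rbrakk> \<Longrightarrow> hcomp M x = c"
  using ex1_decomposition hcomp_decomposition by blast

lemma hcomp_grade: "x \<in> carrier M \<Longrightarrow> hcomp M x \<gamma> \<in> grade M \<gamma>"
  using hcomp_decomposition by (auto simp: homogeneous_decomposition_def)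

lemma hcomp_closed: "x \<in> carrier M \<Longrightarrow> hcomp M x \<gamma> \<in> carrier M"
  using hcomp_grade grade_closed by blast

lemma finite_hsupp: "x \<in> carrier M \<Longrightarrow> finite (hsupp M x)"
  using hcomp_decomposition by (auto simp: homogeneous_decomposition_def hsupp_def)

lemma finsum_hcomp: "x \<in> carrier M \<Longrightarrow> x = (\<Oplus>\<^bsub>M\<^esub>\<gamma>\<in>hsupp M x. hcomp M x \<gamma>)"
  using hcomp_decomposition by (auto simp: homogeneous_decomposition_def hsupp_def)

lemma homogeneous_decompositionI:
  assumes "\<And>\<gamma>. c \<gamma> \<in> grade M \<gamma>" "finite S" "{\<gamma>. c \<gamma> \<noteq> \<zero>\<^bsub>M\<^esub>} \<subseteq> S" "x = (\<Oplus>\<^bsub>M\<^esub>\<gamma>\<in>S. c \<gamma>)"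
  shows "homogeneous_decomposition M x c"
proof -
  have "finsum M c {\<gamma>. c \<gamma> \<noteq> \<zero>\<^bsub>M\<^esub>} = finsum M c S"
    by (rule M.finsum_mono_neutral) (use assms grade_closed in auto)
  then show ?thesis using assms finite_subset[OF assms(3,2)] by (simp add: homogeneous_decomposition_def)
qed

lemma hcomp_homogeneous:
  assumes "x \<in> grade M \<alpha>"
  shows "hcomp M x = (\<lambda>\<gamma>. if \<gamma> = \<alpha> then x else \<zero>\<^bsub>M\<^esub>)"
  by (rule hcomp_unique[OF grade_closed[OF assms]],
      rule homogeneous_decompositionI[of _ "{\<alpha>}"])
    (use assms grade_closed grade_zero in auto)

lemma finsum_hcomp_superset:
  assumes "x \<in> carrier M" "finite S" "hsupp M x \<subseteq> S"
  shows "x = (\<Oplus>\<^bsub>M\<^esub>\<gamma>\<in>S. hcomp M x \<gamma>)"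
proof -
  have "finsum M (hcomp M x) (hsupp M x) = finsum M (hcomp M x) S"
    by (rule M.finsum_mono_neutral) (use assms hcomp_closed in \<open>auto simp: hsupp_def\<close>)
  then show ?thesis using finsum_hcomp[OF assms(1)] by simp
qed

lemma hcomp_add:
  assumes "x \<in> carrier M" "y \<in> carrier M"
  shows "hcomp M (x \<oplus>\<^bsub>M\<^esub> y) = (\<lambda>\<gamma>. hcomp M x \<gamma> \<oplus>\<^bsub>M\<^esub> hcomp M y \<gamma>)"
proof (rule hcomp_unique)
  let ?S = "hsupp M x \<union> hsupp M y"
  show "homogeneous_decomposition M (x \<oplus>\<^bsub>M\<^esub> y) (\<lambda>\<gamma>. hcomp M x \<gamma> \<oplus>\<^bsub>M\<^esub> hcomp M y \<gamma>)"
  proof (rule homogeneous_decompositionI[of _ ?S])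
    show "x \<oplus>\<^bsub>M\<^esub> y = (\<Oplus>\<^bsub>M\<^esub>\<gamma>\<in>?S. hcomp M x \<gamma> \<oplus>\<^bsub>M\<^esub> hcomp M y \<gamma>)"
      using assms finsum_hcomp_superset[of x ?S] finsum_hcomp_superset[of y ?S]
      by (subst M.finsum_addf) (auto simp: hcomp_closed finite_hsupp)
  qed (use assms hcomp_grade grade_add finite_hsupp in \<open>auto simp: hsupp_def\<close>)
qed (use assms in auto)

lemma hcomp_smult:
  assumes "a \<in> carrier K" "x \<in> carrier M"
  shows "hcomp M (a \<odot>\<^bsub>M\<^esub> x) = (\<lambda>\<gamma>. a \<odot>\<^bsub>M\<^esub> hcomp M x \<gamma>)"
proof (rule hcomp_unique)
  show "homogeneous_decomposition M (a \<odot>\<^bsub>M\<^esub> x) (\<lambda>\<gamma>. a \<odot>\<^bsub>M\<^esub> hcomp M x \<gamma>)"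
  proof (rule homogeneous_decompositionI[of _ "hsupp M x"])
    show "a \<odot>\<^bsub>M\<^esub> x = (\<Oplus>\<^bsub>M\<^esub>\<gamma>\<in>hsupp M x. a \<odot>\<^bsub>M\<^esub> hcomp M x \<gamma>)"
      using assms finsum_hcomp[of x] finsum_smult_ldistr[of "hsupp M x" a "hcomp M x"]
      by (auto simp: hcomp_closed finite_hsupp)
  qed (use assms hcomp_grade grade_smult finite_hsupp in \<open>auto simp: hsupp_def\<close>)
qed (use assms in auto)

lemma linear_map_hcomp: "linear_map K M M (\<lambda>x. hcomp M x \<gamma>)"
  by (rule linear_mapI) (simp_all add: hcomp_closed hcomp_add hcomp_smult)

lemma graded_ext_homogeneous:
  assumes "module K P" "linear_map K M P (F \<alpha>)" "x \<in> grade M \<alpha>"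
  shows "graded_ext M P F x = F \<alpha> x"
proof -
  interpret P: module K P by fact
  have x: "x \<in> carrier M" by (rule grade_closed[OF assms(3)])
  have "F \<alpha> x \<in> carrier P" using assms(2) x by (rule linear_map_closed)
  then show ?thesis
    using linear_map_zero[OF module_axioms assms(1,2)]
    unfolding graded_ext_def hsupp_def hcomp_homogeneous[OF assms(3)]
    by (cases "x = \<zero>\<^bsub>M\<^esub>") simp_all
qed

lemma graded_ext_superset:
  assumes P: "module K P" and lin: "\<And>\<alpha>. linear_map K M P (F \<alpha>)"
    and "x \<in> carrier M" "finite S" "hsupp M x \<subseteq> S"
  shows "graded_ext M P F x = (\<Oplus>\<^bsub>P\<^esub>\<alpha>\<in>S. F \<alpha> (hcomp M x \<alpha>))"
proof -
  interpret P: module K P by (rule P)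
  show ?thesis unfolding graded_ext_def
    by (rule P.finsum_mono_neutral)
      (use assms(3-) in \<open>auto simp: hsupp_def linear_map_zero[OF module_axioms P lin] hcomp_closed
        linear_map_closed[OF lin]\<close>)
qed

lemma linear_map_graded_ext:
  assumes P: "module K P" and lin: "\<And>\<alpha>. linear_map K M P (F \<alpha>)"
  shows "linear_map K M P (graded_ext M P F)"
proof (rule linear_mapI, goal_cases)
  case (1 x)
  interpret P: module K P by (rule P)
  from 1 show ?case unfolding graded_ext_def
    by (intro P.finsum_closed) (auto simp: hcomp_closed linear_map_closed[OF lin])
next
  case (2 x y)
  interpret P: module K P by (rule P)
  let ?S = "hsupp M x \<union> hsupp M y"
  have *: "finite ?S" "hsupp M (x \<oplus>\<^bsub>M\<^esub> y) \<subseteq> ?S"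
    using 2 by (auto simp: finite_hsupp[unfolded hsupp_def] hsupp_def hcomp_add)
  have "graded_ext M P F (x \<oplus>\<^bsub>M\<^esub> y) =
      (\<Oplus>\<^bsub>P\<^esub>\<alpha>\<in>?S. F \<alpha> (hcomp M x \<alpha>) \<oplus>\<^bsub>P\<^esub> F \<alpha> (hcomp M y \<alpha>))"
    using 2 by (subst graded_ext_superset[OF P lin _ *])
      (auto simp: hcomp_add hcomp_closed linear_map_add[OF lin])
  also have "\<dots> = (\<Oplus>\<^bsub>P\<^esub>\<alpha>\<in>?S. F \<alpha> (hcomp M x \<alpha>)) \<oplus>\<^bsub>P\<^esub> (\<Oplus>\<^bsub>P\<^esub>\<alpha>\<in>?S. F \<alpha> (hcomp M y \<alpha>))"
    using 2 by (intro P.finsum_addf) (auto simp: hcomp_closed linear_map_closed[OF lin])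
  finally show ?case using 2 *(1) by (simp add: graded_ext_superset[OF P lin, of _ ?S])
next
  case (3 a x)
  interpret P: module K P by (rule P)
  have *: "finite (hsupp M x)" "hsupp M (a \<odot>\<^bsub>M\<^esub> x) \<subseteq> hsupp M x"
    using 3 by (auto simp: finite_hsupp[unfolded hsupp_def] hsupp_def hcomp_smult)
  have "graded_ext M P F (a \<odot>\<^bsub>M\<^esub> x) = (\<Oplus>\<^bsub>P\<^esub>\<alpha>\<in>hsupp M x. a \<odot>\<^bsub>P\<^esub> F \<alpha> (hcomp M x \<alpha>))"
    using 3 by (subst graded_ext_superset[OF P lin _ *])
      (auto simp: hcomp_smult hcomp_closed linear_map_smult[OF lin])
  also have "\<dots> = a \<odot>\<^bsub>P\<^esub> graded_ext M P F x" unfolding graded_ext_def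
    using 3 by (intro P.finsum_smult_ldistr[symmetric])
      (auto simp: hcomp_closed finite_hsupp linear_map_closed[OF lin])
  finally show ?case .
qed

lemma homogeneous_list:
  assumes "x \<in> carrier M"
  shows "\<exists>xs. (\<forall>(\<alpha>, a)\<in>set xs. a \<in> grade M \<alpha>) \<and> x = lsum M xs snd"
proof -
  obtain xs where "set xs = hsupp M x" "x = lsum M xs (hcomp M x)"
    using M.finsum_lsum[OF finite_hsupp[OF assms], of "hcomp M x"] finsum_hcomp[OF assms]
      hcomp_closed[OF assms] by auto
  then show ?thesis
    by (intro exI[of _ "map (\<lambda>\<alpha>. (\<alpha>, hcomp M x \<alpha>)) xs"])
      (auto simp: lsum_map hcomp_grade[OF assms])
qed

end

text \<open>A criterion by projections, meant for tensor products: there the components are spans,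
  and it is not visible from the definition that their sum is direct. The map
  \<open>p \<gamma>\<close> has to pick out the component of degree \<open>\<gamma>\<close>.\<close>

lemma graded_moduleI:
  assumes M: "module K M" and sub: "\<And>\<gamma>. submodule (grade M \<gamma>) K M"
    and lin: "\<And>\<gamma>. linear_map K M M (p \<gamma>)"
    and ran: "\<And>\<gamma> x. x \<in> carrier M \<Longrightarrow> p \<gamma> x \<in> grade M \<gamma>"
    and p: "\<And>\<gamma> \<delta> x. x \<in> grade M \<delta> \<Longrightarrow> p \<gamma> x = (if \<gamma> = \<delta> then x else \<zero>\<^bsub>M\<^esub>)"
    and gen: "\<And>x. x \<in> carrier M \<Longrightarrow> \<exists>xs. (\<forall>(\<alpha>, a)\<in>set xs. a \<in> grade M \<alpha>) \<and> x = lsum M xs snd"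
  shows "graded_module K M"
proof -
  interpret M: module K M by (rule M)
  have gc: "x \<in> grade M \<gamma> \<Longrightarrow> x \<in> carrier M" for x \<gamma> using M.submoduleE(1)[OF sub] by blast
  have pc: "x \<in> carrier M \<Longrightarrow> p \<gamma> x \<in> carrier M" for x \<gamma> using ran gc by blast
  \<comment> \<open>By induction on a list of homogeneous summands: a summand of degree
    \<open>\<alpha>\<close> affects only the projection of degree \<open>\<alpha>\<close>, so the
    finite index set grows by at most one element.\<close>
  have ex: "\<exists>S. finite S \<and> {\<gamma>. p \<gamma> x \<noteq> \<zero>\<^bsub>M\<^esub>} \<subseteq> S \<and> x = (\<Oplus>\<^bsub>M\<^esub>\<gamma>\<in>S. p \<gamma> x)" if x: "x \<in> carrier M" for x
  proof -
    obtain xs where xs: "\<forall>(\<alpha>, a)\<in>set xs. a \<in> grade M \<alpha>" "x = lsum M xs snd" using gen[OF x] by auto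
    show ?thesis unfolding xs(2) using xs(1)
    proof (induction xs)
      case Nil
      then show ?case using linear_map_zero[OF M M lin] by (intro exI[of _ "{}"]) auto
    next
      case (Cons i xs)
      obtain \<alpha> a where i: "i = (\<alpha>, a)" by (cases i)
      have a: "a \<in> grade M \<alpha>" "a \<in> carrier M" using Cons.prems i gc by auto
      let ?y = "lsum M xs snd"
      have y: "?y \<in> carrier M" by (rule M.lsum_closed) (use Cons.prems gc in auto)
      from Cons obtain S where S: "finite S" "{\<gamma>. p \<gamma> ?y \<noteq> \<zero>\<^bsub>M\<^esub>} \<subseteq> S" "?y = (\<Oplus>\<^bsub>M\<^esub>\<gamma>\<in>S. p \<gamma> ?y)"
        by auto
      have 1: "?y = (\<Oplus>\<^bsub>M\<^esub>\<gamma>\<in>insert \<alpha> S. p \<gamma> ?y)"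
        by (subst S(3), rule M.finsum_mono_neutral) (use S(1,2) pc[OF y] in auto)
      have "(\<Oplus>\<^bsub>M\<^esub>\<gamma>\<in>{\<alpha>}. p \<gamma> a) = (\<Oplus>\<^bsub>M\<^esub>\<gamma>\<in>insert \<alpha> S. p \<gamma> a)"
        by (rule M.finsum_mono_neutral) (use S(1) p[OF a(1)] a in auto)
      then have 2: "a = (\<Oplus>\<^bsub>M\<^esub>\<gamma>\<in>insert \<alpha> S. p \<gamma> a)" using p[OF a(1)] a by simp
      have "a \<oplus>\<^bsub>M\<^esub> ?y = (\<Oplus>\<^bsub>M\<^esub>\<gamma>\<in>insert \<alpha> S. p \<gamma> a \<oplus>\<^bsub>M\<^esub> p \<gamma> ?y)"
        by (subst 2, subst 1, rule M.finsum_addf[symmetric]) (use pc y a in auto)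
      also have "\<dots> = (\<Oplus>\<^bsub>M\<^esub>\<gamma>\<in>insert \<alpha> S. p \<gamma> (a \<oplus>\<^bsub>M\<^esub> ?y))"
        using y a by (simp add: linear_map_add[OF lin])
      finally have "a \<oplus>\<^bsub>M\<^esub> ?y = (\<Oplus>\<^bsub>M\<^esub>\<gamma>\<in>insert \<alpha> S. p \<gamma> (a \<oplus>\<^bsub>M\<^esub> ?y))" .
      moreover have "p \<gamma> (a \<oplus>\<^bsub>M\<^esub> ?y) = \<zero>\<^bsub>M\<^esub>" if "\<gamma> \<notin> insert \<alpha> S" for \<gamma>
      proof -
        have "p \<gamma> ?y = \<zero>\<^bsub>M\<^esub>" using that S(2) by blast
        then show ?thesis using that y a p[OF a(1), of \<gamma>] by (simp add: linear_map_add[OF lin])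
      qed
      then have "{\<gamma>. p \<gamma> (a \<oplus>\<^bsub>M\<^esub> ?y) \<noteq> \<zero>\<^bsub>M\<^esub>} \<subseteq> insert \<alpha> S" by blast
      ultimately show ?case using S(1) i by (intro exI[of _ "insert \<alpha> S"]) auto
    qed
  qed
  have "homogeneous_decomposition M x (\<lambda>\<gamma>. p \<gamma> x)" if x: "x \<in> carrier M" for x
  proof -
    obtain S where S: "finite S" "{\<gamma>. p \<gamma> x \<noteq> \<zero>\<^bsub>M\<^esub>} \<subseteq> S" "x = (\<Oplus>\<^bsub>M\<^esub>\<gamma>\<in>S. p \<gamma> x)" using ex[OF x] by auto
    have "(\<Oplus>\<^bsub>M\<^esub>\<gamma>\<in>{\<gamma>. p \<gamma> x \<noteq> \<zero>\<^bsub>M\<^esub>}. p \<gamma> x) = (\<Oplus>\<^bsub>M\<^esub>\<gamma>\<in>S. p \<gamma> x)"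
      by (rule M.finsum_mono_neutral) (use S(1,2) pc[OF x] in auto)
    then show ?thesis using S ran[OF x] finite_subset[OF S(2,1)]
      by (simp add: homogeneous_decomposition_def)
  qed
  \<comment> \<open>Uniqueness: \<open>p \<gamma>\<close> applied to any homogeneous decomposition
    kills all components except the one of degree \<open>\<gamma>\<close>.\<close>
  moreover have "c = (\<lambda>\<gamma>. p \<gamma> x)" if x: "x \<in> carrier M" and c: "homogeneous_decomposition M x c" for x c
  proof
    fix \<gamma>
    let ?S = "{\<gamma>. c \<gamma> \<noteq> \<zero>\<^bsub>M\<^esub>}"
    have cg: "c \<delta> \<in> grade M \<delta>" "c \<delta> \<in> carrier M" for \<delta>
      using c gc by (auto simp: homogeneous_decomposition_def)
    have fin: "finite ?S" and xs: "x = (\<Oplus>\<^bsub>M\<^esub>\<delta>\<in>?S. c \<delta>)"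
      using c by (auto simp: homogeneous_decomposition_def)
    have "p \<gamma> x = (\<Oplus>\<^bsub>M\<^esub>\<delta>\<in>?S. p \<gamma> (c \<delta>))"
      by (subst xs, rule M.linear_map_finsum[OF M lin fin]) (use cg in auto)
    also have "\<dots> = (\<Oplus>\<^bsub>M\<^esub>\<delta>\<in>insert \<gamma> ?S. p \<gamma> (c \<delta>))"
      by (rule M.finsum_mono_neutral) (use fin pc[OF cg(2)] linear_map_zero[OF M M lin] in auto)
    also have "\<dots> = (\<Oplus>\<^bsub>M\<^esub>\<delta>\<in>{\<gamma>}. p \<gamma> (c \<delta>))"
      by (rule M.finsum_mono_neutral[symmetric]) (use fin p[OF cg(1)] cg in auto)
    also have "\<dots> = c \<gamma>" using p[OF cg(1)] cg by simp
    finally show "c \<gamma> = p \<gamma> x" by simp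
  qed
  ultimately show ?thesis
    by (intro graded_module.intro M graded_module_axioms.intro sub) blast
qed

lemma (in module) linear_map_finsum_pointwise:
  assumes "module R N" "finite A" "\<And>i. i \<in> A \<Longrightarrow> linear_map R N M (F i)"
  shows "linear_map R N M (\<lambda>x. finsum M (\<lambda>i. F i x) A)"
proof -
  interpret N: module R N by fact
  show ?thesis using assms(2,3)
  proof (induction rule: finite_induct)
    case empty
    then show ?case by (auto intro!: linear_mapI)
  next
    case (insert i A)
    have IH: "linear_map R N M (\<lambda>x. finsum M (\<lambda>i. F i x) A)" by (rule insert.IH) (use insert.prems in auto)
    have i: "linear_map R N M (F i)" using insert.prems by auto
    have cl: "F j x \<in> carrier M" if "j \<in> insert i A" "x \<in> carrier N" for j x
      using insert.prems[OF that(1)] that(2) by (rule linear_map_closed)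
    have eq: "finsum M (\<lambda>i. F i x) (insert i A) = F i x \<oplus>\<^bsub>M\<^esub> finsum M (\<lambda>i. F i x) A"
      if "x \<in> carrier N" for x
      using insert cl[OF _ that] by (intro M.finsum_insert) auto
    have "linear_map R N M (\<lambda>x. F i x \<oplus>\<^bsub>M\<^esub> finsum M (\<lambda>i. F i x) A)"
      by (rule linear_mapI)
        (simp_all add: linear_map_closed[OF IH] linear_map_closed[OF i] linear_map_add[OF IH]
          linear_map_add[OF i] linear_map_smult[OF IH] linear_map_smult[OF i] M.a_ac smult_r_distr)
    then show ?case by (rule linear_map_cong) (simp_all add: eq assms(1))
  qed
qed

lemma (in graded_module) linear_map_graded_ext_param:
  assumes "module K P" "module K N" "x \<in> carrier M"
    and "\<And>\<alpha> a. a \<in> carrier M \<Longrightarrow> linear_map K N P (\<lambda>y. F y \<alpha> a)"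
  shows "linear_map K N P (\<lambda>y. graded_ext M P (F y) x)"
proof -
  interpret P: module K P by fact
  show ?thesis unfolding graded_ext_def
    by (rule P.linear_map_finsum_pointwise) (use assms in \<open>auto simp: finite_hsupp hcomp_closed\<close>)
qed

section \<open>The grading of a tensor product\<close>

definition tensor_grade ::
  "('k, 's) ring_scheme \<Rightarrow> ('k, 'a, 'g::ab_group_add, 'm) graded_module_scheme
    \<Rightarrow> ('k, 'b, 'g, 'n) graded_module_scheme \<Rightarrow> 'g \<Rightarrow> ('a \<times> 'b \<Rightarrow> 'k) set set"
  where "tensor_grade K M N \<gamma> = mspan K (tensor_module K M N)
    {pure_tensor K M N x y | x y. \<exists>\<alpha> \<beta>. \<alpha> + \<beta> = \<gamma> \<and> x \<in> grade M \<alpha> \<and> y \<in> grade N \<beta>}"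

lemma tensor_simps [simp]:
  "carrier (tensor K \<omega> M N) = carrier (tensor_module K M N)"
  "add (tensor K \<omega> M N) = add (tensor_module K M N)"
  "zero (tensor K \<omega> M N) = zero (tensor_module K M N)"
  "smult (tensor K \<omega> M N) = smult (tensor_module K M N)"
  "grade (tensor K \<omega> M N) = tensor_grade K M N"
  "one (tensor K \<omega> M N) = pure_tensor K M N \<one>\<^bsub>M\<^esub> \<one>\<^bsub>N\<^esub>"
  by (simp_all add: tensor_def Let_def tensor_grade_def fun_eq_iff)

lemma submodule_record_cong:
  assumes "carrier M = carrier M'" "add M = add M'" "zero M = zero M'" "smult M = smult M'"
  shows "submodule S K M = submodule S K M'"
  by (simp add: submodule_def subgroup_def submodule_axioms_def m_inv_def assms)

locale graded_pair = M: graded_module K M + N: graded_module K N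
  for K :: "('k, 's) ring_scheme" (structure)
    and M :: "('k, 'a, 'g::ab_group_add, 'm) graded_module_scheme"
    and N :: "('k, 'b, 'g, 'n) graded_module_scheme"
begin

sublocale module_pair K M N ..

lemma pure_zero: "x \<in> carrier M \<Longrightarrow> pure x \<zero>\<^bsub>N\<^esub> = \<zero>\<^bsub>T\<^esub>" "y \<in> carrier N \<Longrightarrow> pure \<zero>\<^bsub>M\<^esub> y = \<zero>\<^bsub>T\<^esub>"
  using linear_map_zero[OF N.module_axioms T.module_axioms bilinear_map_right[OF bilinear_map_pure]]
    linear_map_zero[OF M.module_axioms T.module_axioms bilinear_map_left[OF bilinear_map_pure]]
  by blast+

text \<open>In each pure tensor both factors are written as sums of homogeneous elements, and the
  product is expanded.\<close>

lemma tensor_homogeneous_list: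
  assumes "t \<in> carrier T"
  shows "\<exists>xs. (\<forall>(\<alpha>, x, \<beta>, y)\<in>set xs. x \<in> grade M \<alpha> \<and> y \<in> grade N \<beta>) \<and>
    t = lsum T xs (\<lambda>(\<alpha>, x, \<beta>, y). pure x y)"
proof -
  have pure: "\<exists>zs. (\<forall>(\<alpha>, x, \<beta>, y)\<in>set zs. x \<in> grade M \<alpha> \<and> y \<in> grade N \<beta>) \<and>
    pure x y = lsum T zs (\<lambda>(\<alpha>, x, \<beta>, y). pure x y)"
    if x: "x \<in> carrier M" and y: "y \<in> carrier N" for x y
  proof -
    obtain xs where xs: "\<And>\<alpha> a. (\<alpha>, a) \<in> set xs \<Longrightarrow> a \<in> grade M \<alpha>" "x = lsum M xs snd"
      using M.homogeneous_list[OF x] by blast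
    obtain ys where ys: "\<And>\<alpha> a. (\<alpha>, a) \<in> set ys \<Longrightarrow> a \<in> grade N \<alpha>" "y = lsum N ys snd"
      using N.homogeneous_list[OF y] by blast
    have xc: "\<And>i. i \<in> set xs \<Longrightarrow> snd i \<in> carrier M" using xs(1) M.grade_closed by force
    have yc: "\<And>i. i \<in> set ys \<Longrightarrow> snd i \<in> carrier N" using ys(1) N.grade_closed by force
    let ?h = "\<lambda>i. map (\<lambda>j. (fst i, snd i, fst j, snd j)) ys"
    have "pure x y = lsum T xs (\<lambda>i. pure (snd i) y)"
      unfolding xs(2)
      by (rule linear_map_lsum[OF M.module_axioms T.module_axioms
            bilinear_map_left[OF bilinear_map_pure y] xc])
    also have "\<dots> = lsum T xs (\<lambda>i. lsum T ys (\<lambda>j. pure (snd i) (snd j)))"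
      unfolding ys(2)
      by (rule lsum_cong, rule linear_map_lsum[OF N.module_axioms T.module_axioms
            bilinear_map_right[OF bilinear_map_pure] yc]) (auto intro: xc)
    also have "\<dots> = lsum T xs (\<lambda>i. lsum T (?h i) (\<lambda>(\<alpha>, x, \<beta>, y). pure x y))"
      by (simp add: lsum_map case_prod_beta)
    also have "\<dots> = lsum T (concat (map ?h xs)) (\<lambda>(\<alpha>, x, \<beta>, y). pure x y)"
      by (rule T.lsum_concat[symmetric]) (use xc yc pure_closed in auto)
    finally show ?thesis
      by (intro exI[of _ "concat (map ?h xs)"] conjI) (use xs(1) ys(1) in force)
  qed
  obtain ts where ts: "set ts \<subseteq> carrier M \<times> carrier N" "t = lsum T ts (\<lambda>(x, y). pure x y)"
    using tensor_list[OF assms] by auto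
  show ?thesis unfolding ts(2) using ts(1)
  proof (induction ts)
    case Nil
    then show ?case by (intro exI[of _ "[]"]) auto
  next
    case (Cons p ts)
    obtain x y where p: "p = (x, y)" by (cases p)
    then have xy: "x \<in> carrier M" "y \<in> carrier N" using Cons.prems by auto
    obtain xs where xs: "\<forall>(\<alpha>, x, \<beta>, y)\<in>set xs. x \<in> grade M \<alpha> \<and> y \<in> grade N \<beta>"
      "pure x y = lsum T xs (\<lambda>(\<alpha>, x, \<beta>, y). pure x y)" using pure[OF xy] by blast
    obtain ys where ys: "\<forall>(\<alpha>, x, \<beta>, y)\<in>set ys. x \<in> grade M \<alpha> \<and> y \<in> grade N \<beta>"
      "lsum T ts (\<lambda>(x, y). pure x y) = lsum T ys (\<lambda>(\<alpha>, x, \<beta>, y). pure x y)"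
      using Cons by auto
    have "lsum T (xs @ ys) (\<lambda>(\<alpha>, x, \<beta>, y). pure x y) =
      lsum T xs (\<lambda>(\<alpha>, x, \<beta>, y). pure x y) \<oplus>\<^bsub>T\<^esub> lsum T ys (\<lambda>(\<alpha>, x, \<beta>, y). pure x y)"
      by (rule T.lsum_append)
        (use xs(1) ys(1) M.grade_closed N.grade_closed in \<open>force intro!: pure_closed\<close>)+
    then show ?case using xs ys p by (intro exI[of _ "xs @ ys"]) auto
  qed
qed

text \<open>The projection to degree \<open>\<gamma>\<close>: on \<open>x \<otimes> y\<close> it is
  the sum over \<open>\<alpha>\<close> of the component of \<open>x\<close> of degree
  \<open>\<alpha>\<close> tensored with the component of \<open>y\<close> of degree
  \<open>\<gamma> - \<alpha>\<close>. This is bilinear, so \<open>tsum\<close> makes it a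
  well-defined linear map.\<close>

definition "tensor_proj \<gamma> t =
  tsum K T t (\<lambda>x y. graded_ext M T (\<lambda>\<alpha> a. pure a (hcomp N y (\<gamma> - \<alpha>))) x)"

lemma bilinear_map_tensor_proj:
  "bilinear_map K M N T (\<lambda>x y. graded_ext M T (\<lambda>\<alpha> a. pure a (hcomp N y (\<gamma> - \<alpha>))) x)"
proof (rule bilinear_mapI)
  show "linear_map K N T (\<lambda>y. graded_ext M T (\<lambda>\<alpha> a. pure a (hcomp N y (\<gamma> - \<alpha>))) x)"
    if "x \<in> carrier M" for x
    by (rule M.linear_map_graded_ext_param[OF T.module_axioms N.module_axioms that],
        rule linear_map_compose[OF N.linear_map_hcomp bilinear_map_right[OF bilinear_map_pure]])
  show "linear_map K M T (\<lambda>x. graded_ext M T (\<lambda>\<alpha> a. pure a (hcomp N y (\<gamma> - \<alpha>))) x)"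
    if "y \<in> carrier N" for y
    by (rule M.linear_map_graded_ext[OF T.module_axioms],
        rule bilinear_map_left[OF bilinear_map_pure N.hcomp_closed[OF that]])
qed

lemma linear_map_tensor_proj: "linear_map K T T (tensor_proj \<gamma>)"
  unfolding tensor_proj_def by (rule linear_map_tsum[OF T.module_axioms bilinear_map_tensor_proj])

lemma tensor_proj_pure:
  assumes "x \<in> grade M \<alpha>" "y \<in> grade N \<beta>"
  shows "tensor_proj \<gamma> (pure x y) = (if \<alpha> + \<beta> = \<gamma> then pure x y else \<zero>\<^bsub>T\<^esub>)"
proof -
  have xy: "x \<in> carrier M" "y \<in> carrier N" using assms M.grade_closed N.grade_closed by auto
  have "tensor_proj \<gamma> (pure x y) = pure x (hcomp N y (\<gamma> - \<alpha>))"
    unfolding tensor_proj_def tsum_pure[OF T.module_axioms bilinear_map_tensor_proj xy]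
    by (rule M.graded_ext_homogeneous[OF T.module_axioms _ assms(1)],
        rule bilinear_map_left[OF bilinear_map_pure N.hcomp_closed[OF xy(2)]])
  moreover have "\<gamma> - \<alpha> = \<beta> \<longleftrightarrow> \<alpha> + \<beta> = \<gamma>" by (auto simp: algebra_simps)
  ultimately show ?thesis using xy by (simp add: N.hcomp_homogeneous[OF assms(2)] pure_zero)
qed

lemma tensor_grade_gens_closed:
  "{pure x y | x y. \<exists>\<alpha> \<beta>. \<alpha> + \<beta> = \<gamma> \<and> x \<in> grade M \<alpha> \<and> y \<in> grade N \<beta>} \<subseteq> carrier T"
  using M.grade_closed N.grade_closed pure_closed by blast

lemma submodule_tensor_grade: "submodule (tensor_grade K M N \<gamma>) K T"
  unfolding tensor_grade_def by (rule submodule_mspan[OF T.module_axioms tensor_grade_gens_closed])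

lemma pure_grade: "\<lbrakk>x \<in> grade M \<alpha>; y \<in> grade N \<beta>; \<alpha> + \<beta> = \<gamma>\<rbrakk> \<Longrightarrow> pure x y \<in> tensor_grade K M N \<gamma>"
  unfolding tensor_grade_def by (rule subsetD[OF mspan_superset]) blast

text \<open>A component is known only as a span. On its generators the projection is the identity or
  zero, and equalizers and kernels of linear maps are submodules.\<close>

lemma tensor_proj_homogeneous:
  assumes "t \<in> tensor_grade K M N \<delta>"
  shows "tensor_proj \<gamma> t = (if \<gamma> = \<delta> then t else \<zero>\<^bsub>T\<^esub>)"
proof (cases "\<gamma> = \<delta>")
  case True
  have "tensor_grade K M N \<delta> \<subseteq> {t \<in> carrier T. tensor_proj \<gamma> t = t}"
    unfolding tensor_grade_def
    by (rule mspan_least[OF submodule_equalizer[OF T.module_axioms T.module_axioms linear_map_tensor_proj]])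
      (use M.grade_closed N.grade_closed True in \<open>auto simp: tensor_proj_pure pure_closed intro!: linear_mapI\<close>)
  then show ?thesis using True assms by auto
next
  case False
  have "tensor_grade K M N \<delta> \<subseteq> {t \<in> carrier T. tensor_proj \<gamma> t = \<zero>\<^bsub>T\<^esub>}"
    unfolding tensor_grade_def
    by (rule mspan_least[OF submodule_kernel[OF T.module_axioms T.module_axioms linear_map_tensor_proj]])
      (use M.grade_closed N.grade_closed False in \<open>auto simp: tensor_proj_pure pure_closed\<close>)
  then show ?thesis using False assms by auto
qed

lemma tensor_proj_grade:
  assumes "t \<in> carrier T"
  shows "tensor_proj \<gamma> t \<in> tensor_grade K M N \<gamma>"
proof -
  note S = T.submoduleE[OF submodule_tensor_grade]
  obtain xs where xs: "\<forall>(\<alpha>, x, \<beta>, y)\<in>set xs. x \<in> grade M \<alpha> \<and> y \<in> grade N \<beta>"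
    "t = lsum T xs (\<lambda>(\<alpha>, x, \<beta>, y). pure x y)"
    using tensor_homogeneous_list[OF assms] by blast
  have cl: "i \<in> set xs \<Longrightarrow> (case i of (\<alpha>, x, \<beta>, y) \<Rightarrow> pure x y) \<in> carrier T" for i
    using xs(1) M.grade_closed N.grade_closed pure_closed by fastforce
  have z: "\<zero>\<^bsub>T\<^esub> \<in> tensor_grade K M N \<gamma>"
    using subgroup.one_closed[OF submodule.axioms(1)[OF submodule_tensor_grade]] by simp
  have "tensor_proj \<gamma> t = lsum T xs (\<lambda>i. tensor_proj \<gamma> (case i of (\<alpha>, x, \<beta>, y) \<Rightarrow> pure x y))"
    unfolding xs(2) by (rule linear_map_lsum[OF T.module_axioms T.module_axioms linear_map_tensor_proj cl])
  also have "\<dots> \<in> tensor_grade K M N \<gamma>" using xs(1)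
    by (induction xs) (auto simp: tensor_proj_pure z intro!: S(5) pure_grade)
  finally show ?thesis .
qed

lemma module_tensor_graded: "module K (tensor K \<omega> M N)"
  using T.module_axioms by (simp add: module_record_cong[of "tensor K \<omega> M N" T])

lemma lsum_tensor: "lsum (tensor K \<omega> M N) = lsum T"
  by (rule lsum_record_cong) simp_all

lemma graded_module_tensor: "graded_module K (tensor K \<omega> M N)"
proof (rule graded_moduleI[where p = tensor_proj])
  show "module K (tensor K \<omega> M N)" by (rule module_tensor_graded)
  show "submodule (grade (tensor K \<omega> M N) \<gamma>) K (tensor K \<omega> M N)" for \<gamma>
    using submodule_tensor_grade by (simp add: submodule_record_cong[of "tensor K \<omega> M N" T])
  show "linear_map K (tensor K \<omega> M N) (tensor K \<omega> M N) (tensor_proj \<gamma>)" for \<gamma>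
    using linear_map_tensor_proj by (simp add: linear_map_def)
  show "\<exists>xs. (\<forall>(\<alpha>, a)\<in>set xs. a \<in> grade (tensor K \<omega> M N) \<alpha>) \<and> t = lsum (tensor K \<omega> M N) xs snd"
    if t: "t \<in> carrier (tensor K \<omega> M N)" for t
  proof -
    obtain xs where xs: "\<forall>(\<alpha>, x, \<beta>, y)\<in>set xs. x \<in> grade M \<alpha> \<and> y \<in> grade N \<beta>"
      "t = lsum T xs (\<lambda>(\<alpha>, x, \<beta>, y). pure x y)"
      using tensor_homogeneous_list t by (metis tensor_simps(1))
    then show ?thesis
      by (intro exI[of _ "map (\<lambda>(\<alpha>, x, \<beta>, y). (\<alpha> + \<beta>, pure x y)) xs"])
        (auto simp: lsum_tensor lsum_map case_prod_beta intro!: pure_grade lsum_cong)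
  qed
qed (simp_all add: tensor_proj_grade tensor_proj_homogeneous)

end

text \<open>The extra clause requires the summands of a homogeneous tensor to have its total degree;
  this is what allows signs in a Sweedler sum to be rewritten with a relation between the degrees of
  the two legs. The zero tensor lies in every component, and the empty list represents it.\<close>

definition homogeneous_rep where
  "homogeneous_rep K M N t xs \<longleftrightarrow>
    (\<forall>(\<alpha>, x, \<beta>, y)\<in>set xs. x \<in> grade M \<alpha> \<and> y \<in> grade N \<beta> \<and>
      (\<forall>\<gamma>. t \<in> tensor_grade K M N \<gamma> \<longrightarrow> \<alpha> + \<beta> = \<gamma>)) \<and>
    t = lsum (tensor_module K M N) xs (\<lambda>(\<alpha>, x, \<beta>, y). pure_tensor K M N x y)"

text \<open>
  \<open>gsum K M N P t b\<close> is \<open>tsum\<close> for maps \<open>b \<alpha> x \<beta> y\<close> that also depend on the degrees of the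
  homogeneous arguments \<open>x\<close> and \<open>y\<close>. It is a sum over a chosen list of homogeneous pure tensors
  adding up to \<open>t\<close>, so that congruence and interchange of sums need no linearity.
\<close>

definition gsum ::
  "('k, 's) ring_scheme \<Rightarrow> ('k, 'a, 'g::ab_group_add, 'm) graded_module_scheme
    \<Rightarrow> ('k, 'b, 'g, 'n) graded_module_scheme \<Rightarrow> ('c, 'p) ring_scheme \<Rightarrow> ('a \<times> 'b \<Rightarrow> 'k) set
    \<Rightarrow> ('g \<Rightarrow> 'a \<Rightarrow> 'g \<Rightarrow> 'b \<Rightarrow> 'c) \<Rightarrow> 'c"
  where "gsum K M N P t b =
    lsum P (SOME xs. homogeneous_rep K M N t xs) (\<lambda>(\<alpha>, x, \<beta>, y). b \<alpha> x \<beta> y)"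

definition graded_bilinear ::
  "('k, 's) ring_scheme \<Rightarrow> ('k, 'a, 'm) module_scheme
    \<Rightarrow> ('k, 'b, 'n) module_scheme \<Rightarrow> ('k, 'c, 'p) module_scheme
    \<Rightarrow> ('g \<Rightarrow> 'a \<Rightarrow> 'g \<Rightarrow> 'b \<Rightarrow> 'c) \<Rightarrow> bool"
  where "graded_bilinear K M N P b \<longleftrightarrow> (\<forall>\<alpha> \<beta>. bilinear_map K M N P (\<lambda>x y. b \<alpha> x \<beta> y))"

lemma graded_bilinearI:
  "\<lbrakk>\<And>\<alpha> \<beta> x. x \<in> carrier M \<Longrightarrow> linear_map K N P (\<lambda>y. b \<alpha> x \<beta> y);
    \<And>\<alpha> \<beta> y. y \<in> carrier N \<Longrightarrow> linear_map K M P (\<lambda>x. b \<alpha> x \<beta> y)\<rbrakk> \<Longrightarrow> graded_bilinear K M N P b"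
  by (simp add: graded_bilinear_def bilinear_map_def)

definition graded_ext2 where
  "graded_ext2 M N P b x y = graded_ext M P (\<lambda>\<alpha> a. graded_ext N P (\<lambda>\<beta> c. b \<alpha> a \<beta> c) y) x"

lemma colour_ext_eq:
  "colour_ext K \<omega> M N P F = graded_ext2 M N P (\<lambda>\<alpha> x \<beta> y. \<omega> \<alpha> \<beta> \<odot>\<^bsub>P\<^esub> F x y)"
  by (simp add: fun_eq_iff colour_ext_def graded_ext2_def graded_ext_def)

context graded_pair
begin

lemma bilinear_graded_ext2:
  assumes P: "module K P" and b: "graded_bilinear K M N P b"
  shows "bilinear_map K M N P (graded_ext2 M N P b)"
proof (rule bilinear_mapI)
  have bl: "linear_map K M P (\<lambda>x. b \<alpha> x \<beta> y)" if "y \<in> carrier N" for \<alpha> \<beta> y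
    using b that by (auto simp: graded_bilinear_def bilinear_map_def)
  have br: "linear_map K N P (\<lambda>y. b \<alpha> x \<beta> y)" if "x \<in> carrier M" for \<alpha> \<beta> x
    using b that by (auto simp: graded_bilinear_def bilinear_map_def)
  show "linear_map K N P (graded_ext2 M N P b x)" if "x \<in> carrier M" for x
    unfolding graded_ext2_def[abs_def]
    by (rule M.linear_map_graded_ext_param[OF P N.module_axioms that],
        rule N.linear_map_graded_ext[OF P], rule br)
  show "linear_map K M P (\<lambda>x. graded_ext2 M N P b x y)" if "y \<in> carrier N" for y
    unfolding graded_ext2_def
    by (rule M.linear_map_graded_ext[OF P],
        rule N.linear_map_graded_ext_param[OF P M.module_axioms that], rule bl)
qed

lemma graded_ext2_homogeneous:
  assumes P: "module K P" and b: "graded_bilinear K M N P b"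
    and x: "x \<in> grade M \<alpha>" and y: "y \<in> grade N \<beta>"
  shows "graded_ext2 M N P b x y = b \<alpha> x \<beta> y"
proof -
  have bl: "linear_map K M P (\<lambda>x. b \<alpha> x \<beta> y)" if "y \<in> carrier N" for \<alpha> \<beta> y
    using b that by (auto simp: graded_bilinear_def bilinear_map_def)
  have br: "linear_map K N P (\<lambda>y. b \<alpha> x \<beta> y)" if "x \<in> carrier M" for \<alpha> \<beta> x
    using b that by (auto simp: graded_bilinear_def bilinear_map_def)
  have "graded_ext2 M N P b x y = graded_ext N P (\<lambda>\<beta> c. b \<alpha> x \<beta> c) y"
    unfolding graded_ext2_def
    by (rule M.graded_ext_homogeneous[OF P _ x],
        rule N.linear_map_graded_ext_param[OF P M.module_axioms N.grade_closed[OF y]], rule bl)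
  also have "\<dots> = b \<alpha> x \<beta> y"
    by (rule N.graded_ext_homogeneous[OF P _ y], rule br[OF M.grade_closed[OF x]])
  finally show ?thesis .
qed

text \<open>Zero has the empty list, and for a tensor in no component the degree clause is void.
  Otherwise the degree is unique, and applying the projection to that degree discards all summands
  of other degrees without changing the tensor.\<close>

lemma homogeneous_rep_ex:
  assumes "t \<in> carrier T"
  shows "\<exists>xs. homogeneous_rep K M N t xs"
proof (cases "t = \<zero>\<^bsub>T\<^esub> \<or> (\<forall>\<gamma>. t \<notin> tensor_grade K M N \<gamma>)")
  case True
  then show ?thesis
  proof
    assume "t = \<zero>\<^bsub>T\<^esub>"
    then show ?thesis by (intro exI[of _ "[]"]) (simp add: homogeneous_rep_def)
  next
    assume "\<forall>\<gamma>. t \<notin> tensor_grade K M N \<gamma>"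
    then show ?thesis
      using tensor_homogeneous_list[OF assms] by (fastforce simp: homogeneous_rep_def)
  qed
next
  case False
  then obtain \<delta> where \<delta>: "t \<in> tensor_grade K M N \<delta>" and nz: "t \<noteq> \<zero>\<^bsub>T\<^esub>" by auto
  have uniq: "\<gamma> = \<delta>" if "t \<in> tensor_grade K M N \<gamma>" for \<gamma>
    using tensor_proj_homogeneous[OF \<delta>, of \<gamma>] tensor_proj_homogeneous[OF that, of \<gamma>] nz
    by (auto split: if_splits)
  obtain xs where xs: "\<forall>(\<alpha>, x, \<beta>, y)\<in>set xs. x \<in> grade M \<alpha> \<and> y \<in> grade N \<beta>"
    "t = lsum T xs (\<lambda>(\<alpha>, x, \<beta>, y). pure x y)"
    using tensor_homogeneous_list[OF assms] by blast
  have cl: "i \<in> set xs \<Longrightarrow> (case i of (\<alpha>, x, \<beta>, y) \<Rightarrow> pure x y) \<in> carrier T" for i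
    using xs(1) M.grade_closed N.grade_closed pure_closed by fastforce
  let ?ys = "filter (\<lambda>(\<alpha>, x, \<beta>, y). \<alpha> + \<beta> = \<delta>) xs"
  have "t = tensor_proj \<delta> t" using tensor_proj_homogeneous[OF \<delta>, of \<delta>] by simp
  also have "\<dots> = lsum T xs (\<lambda>i. tensor_proj \<delta> (case i of (\<alpha>, x, \<beta>, y) \<Rightarrow> pure x y))"
    by (subst xs(2), rule linear_map_lsum[OF T.module_axioms T.module_axioms linear_map_tensor_proj cl])
  also have "\<dots> = lsum T ?ys (\<lambda>(\<alpha>, x, \<beta>, y). pure x y)" using xs(1)
  proof (induction xs)
    case (Cons i xs)
    have "lsum T (filter (\<lambda>(\<alpha>, x, \<beta>, y). \<alpha> + \<beta> = \<delta>) xs) (\<lambda>(\<alpha>, x, \<beta>, y). pure x y) \<in> carrier T"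
      by (rule T.lsum_closed)
        (use Cons.prems M.grade_closed N.grade_closed in \<open>force intro!: pure_closed\<close>)
    then show ?case using Cons by (cases i) (auto simp: tensor_proj_pure)
  qed simp
  finally have t: "t = lsum T ?ys (\<lambda>(\<alpha>, x, \<beta>, y). pure x y)" .
  have "homogeneous_rep K M N t ?ys"
    unfolding homogeneous_rep_def by (rule conjI[OF _ t]) (use xs(1) uniq in fastforce)
  then show ?thesis by blast
qed

abbreviation "hrep t \<equiv> SOME xs. homogeneous_rep K M N t xs"

lemma hrep: "t \<in> carrier T \<Longrightarrow> homogeneous_rep K M N t (hrep t)"
  by (rule someI_ex[OF homogeneous_rep_ex])

text \<open>The right-hand side does not refer to the chosen list, so for graded bilinear maps the
  choice is irrelevant and \<open>gsum\<close> becomes linear in the tensor.\<close>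

lemma gsum_eq_tsum:
  assumes P: "module K P" and b: "graded_bilinear K M N P b" and t: "t \<in> carrier T"
  shows "gsum K M N P t b = tsum K P t (graded_ext2 M N P b)"
proof -
  note B = bilinear_graded_ext2[OF P b]
  have rep: "\<forall>(\<alpha>, x, \<beta>, y)\<in>set (hrep t). x \<in> grade M \<alpha> \<and> y \<in> grade N \<beta>"
    "t = lsum T (hrep t) (\<lambda>(\<alpha>, x, \<beta>, y). pure x y)"
    using hrep[OF t] unfolding homogeneous_rep_def by blast+
  have cl: "i \<in> set (hrep t) \<Longrightarrow> (case i of (\<alpha>, x, \<beta>, y) \<Rightarrow> pure x y) \<in> carrier T" for i
    using rep(1) M.grade_closed N.grade_closed pure_closed by fastforce
  have "tsum K P t (graded_ext2 M N P b) =
      lsum P (hrep t) (\<lambda>i. tsum K P (case i of (\<alpha>, x, \<beta>, y) \<Rightarrow> pure x y) (graded_ext2 M N P b))"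
    by (subst rep(2), rule linear_map_lsum[OF T.module_axioms P linear_map_tsum[OF P B] cl])
  also have "\<dots> = gsum K M N P t b" unfolding gsum_def
    by (rule lsum_cong)
      (use rep(1) M.grade_closed N.grade_closed in
        \<open>force simp: tsum_pure[OF P B] graded_ext2_homogeneous[OF P b]\<close>)
  finally show ?thesis by simp
qed

lemma tsum_eq_gsum:
  assumes P: "module K P" and b: "bilinear_map K M N P b" and t: "t \<in> carrier T"
  shows "tsum K P t b = gsum K M N P t (\<lambda>\<alpha> x \<beta> y. b x y)"
proof -
  have rep: "\<forall>(\<alpha>, x, \<beta>, y)\<in>set (hrep t). x \<in> grade M \<alpha> \<and> y \<in> grade N \<beta>"
    "t = lsum T (hrep t) (\<lambda>(\<alpha>, x, \<beta>, y). pure x y)"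
    using hrep[OF t] unfolding homogeneous_rep_def by blast+
  have cl: "i \<in> set (hrep t) \<Longrightarrow> (case i of (\<alpha>, x, \<beta>, y) \<Rightarrow> pure x y) \<in> carrier T" for i
    using rep(1) M.grade_closed N.grade_closed pure_closed by fastforce
  have "tsum K P t b = lsum P (hrep t) (\<lambda>i. tsum K P (case i of (\<alpha>, x, \<beta>, y) \<Rightarrow> pure x y) b)"
    by (subst rep(2), rule linear_map_lsum[OF T.module_axioms P linear_map_tsum[OF P b] cl])
  also have "\<dots> = gsum K M N P t (\<lambda>\<alpha> x \<beta> y. b x y)" unfolding gsum_def
    by (rule lsum_cong) (use rep(1) M.grade_closed N.grade_closed in \<open>force simp: tsum_pure[OF P b]\<close>)
  finally show ?thesis .
qed

lemma linear_map_gsum: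
  assumes P: "module K P" and b: "graded_bilinear K M N P b"
  shows "linear_map K T P (\<lambda>t. gsum K M N P t b)"
  by (rule linear_map_cong[OF linear_map_tsum[OF P bilinear_graded_ext2[OF P b]] _ T.module_axioms])
    (simp add: gsum_eq_tsum[OF P b])

lemma gsum_pure:
  assumes P: "module K P" and b: "graded_bilinear K M N P b"
    and x: "x \<in> grade M \<alpha>" and y: "y \<in> grade N \<beta>"
  shows "gsum K M N P (pure x y) b = b \<alpha> x \<beta> y"
  using M.grade_closed[OF x] N.grade_closed[OF y]
  by (simp add: gsum_eq_tsum[OF P b] pure_closed tsum_pure[OF P bilinear_graded_ext2[OF P b]]
      graded_ext2_homogeneous[OF P b x y])

lemma gsum_cong:
  assumes "t \<in> carrier T"
    and "\<And>\<alpha> x \<beta> y. \<lbrakk>x \<in> grade M \<alpha>; y \<in> grade N \<beta>; x \<in> carrier M; y \<in> carrier N\<rbrakk> \<Longrightarrow> b \<alpha> x \<beta> y = c \<alpha> x \<beta> y"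
  shows "gsum K M N P t b = gsum K M N P t c"
  unfolding gsum_def
  by (rule lsum_cong) (use hrep[OF assms(1)] assms(2) M.grade_closed N.grade_closed in
    \<open>fastforce simp: homogeneous_rep_def\<close>)

text \<open>The relation \<open>\<alpha> + \<beta> = \<gamma>\<close> comes from the degree clause
  of the chosen list. Most sign computations below rest on it.\<close>

lemma gsum_homogeneous_cong:
  assumes "t \<in> tensor_grade K M N \<gamma>"
    and "\<And>\<alpha> x \<beta> y. \<lbrakk>x \<in> grade M \<alpha>; y \<in> grade N \<beta>; x \<in> carrier M; y \<in> carrier N; \<alpha> + \<beta> = \<gamma>\<rbrakk>
      \<Longrightarrow> b \<alpha> x \<beta> y = c \<alpha> x \<beta> y"
  shows "gsum K M N P t b = gsum K M N P t c"
proof -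
  have t: "t \<in> carrier T" using assms(1) T.submoduleE(1)[OF submodule_tensor_grade] by blast
  show ?thesis unfolding gsum_def
    by (rule lsum_cong) (use hrep[OF t] assms M.grade_closed N.grade_closed in
      \<open>fastforce simp: homogeneous_rep_def\<close>)
qed

lemma gsum_closed:
  assumes "abelian_group P" "t \<in> carrier T"
    and "\<And>\<alpha> x \<beta> y. \<lbrakk>x \<in> grade M \<alpha>; y \<in> grade N \<beta>; x \<in> carrier M; y \<in> carrier N\<rbrakk> \<Longrightarrow> b \<alpha> x \<beta> y \<in> carrier P"
  shows "gsum K M N P t b \<in> carrier P"
  unfolding gsum_def
  by (rule abelian_group.lsum_closed[OF assms(1)])
    (use hrep[OF assms(2)] assms(3) M.grade_closed N.grade_closed in
      \<open>fastforce simp: homogeneous_rep_def\<close>)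

lemma linear_map_gsum_commute:
  assumes "module K P" "module K Q" "linear_map K P Q f" "t \<in> carrier T"
    and "\<And>\<alpha> x \<beta> y. \<lbrakk>x \<in> grade M \<alpha>; y \<in> grade N \<beta>; x \<in> carrier M; y \<in> carrier N\<rbrakk> \<Longrightarrow> b \<alpha> x \<beta> y \<in> carrier P"
  shows "f (gsum K M N P t b) = gsum K M N Q t (\<lambda>\<alpha> x \<beta> y. f (b \<alpha> x \<beta> y))"
proof -
  have "f (gsum K M N P t b) = lsum Q (hrep t) (\<lambda>i. f (case i of (\<alpha>, x, \<beta>, y) \<Rightarrow> b \<alpha> x \<beta> y))"
    unfolding gsum_def
    by (rule linear_map_lsum[OF assms(1-3)])
      (use hrep[OF assms(4)] assms(5) M.grade_closed N.grade_closed in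
        \<open>fastforce simp: homogeneous_rep_def\<close>)
  also have "\<dots> = gsum K M N Q t (\<lambda>\<alpha> x \<beta> y. f (b \<alpha> x \<beta> y))"
    unfolding gsum_def by (rule lsum_cong) auto
  finally show ?thesis .
qed

lemma linear_map_gsum_pointwise:
  assumes "module K P" "module K Q" "t \<in> carrier T"
    and "\<And>\<alpha> x \<beta> y. \<lbrakk>x \<in> grade M \<alpha>; y \<in> grade N \<beta>; x \<in> carrier M; y \<in> carrier N\<rbrakk>
      \<Longrightarrow> linear_map K Q P (\<lambda>z. b z \<alpha> x \<beta> y)"
  shows "linear_map K Q P (\<lambda>z. gsum K M N P t (b z))"
proof -
  interpret P: module K P by fact
  have "linear_map K Q P (\<lambda>z. lsum P (hrep t) (\<lambda>i. (\<lambda>(\<alpha>, x, \<beta>, y) z. b z \<alpha> x \<beta> y) i z))"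
    by (rule P.linear_map_lsum_pointwise[OF assms(2)])
      (use hrep[OF assms(3)] assms(4) M.grade_closed N.grade_closed in
        \<open>fastforce simp: homogeneous_rep_def\<close>)
  moreover have "(\<lambda>i. (\<lambda>(\<alpha>, x, \<beta>, y) z. b z \<alpha> x \<beta> y) i z) = (\<lambda>(\<alpha>, x, \<beta>, y). b z \<alpha> x \<beta> y)" for z
    by (auto simp: fun_eq_iff)
  ultimately show ?thesis unfolding gsum_def by simp
qed

end

lemma gsum_swap:
  assumes "graded_pair K M N" "graded_pair K M' N'" "abelian_group P"
    and t: "t \<in> carrier (tensor_module K M N)" and t': "t' \<in> carrier (tensor_module K M' N')"
    and cl: "\<And>\<alpha> x \<beta> y \<alpha>' x' \<beta>' y'. \<lbrakk>x \<in> grade M \<alpha>; y \<in> grade N \<beta>; x' \<in> grade M' \<alpha>'; y' \<in> grade N' \<beta>'\<rbrakk> \<Longrightarrow>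
      b \<alpha> x \<beta> y \<alpha>' x' \<beta>' y' \<in> carrier P"
  shows "gsum K M N P t (\<lambda>\<alpha> x \<beta> y. gsum K M' N' P t' (b \<alpha> x \<beta> y)) =
    gsum K M' N' P t' (\<lambda>\<alpha>' x' \<beta>' y'. gsum K M N P t (\<lambda>\<alpha> x \<beta> y. b \<alpha> x \<beta> y \<alpha>' x' \<beta>' y'))"
proof -
  interpret X: graded_pair K M N by fact
  interpret Y: graded_pair K M' N' by fact
  interpret P: abelian_group P by fact
  let ?b = "\<lambda>i j. case i of (\<alpha>, x, \<beta>, y) \<Rightarrow> case j of (\<alpha>', x', \<beta>', y') \<Rightarrow> b \<alpha> x \<beta> y \<alpha>' x' \<beta>' y'"
  have "lsum P (X.hrep t) (\<lambda>i. lsum P (Y.hrep t') (?b i)) =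
    lsum P (Y.hrep t') (\<lambda>j. lsum P (X.hrep t) (\<lambda>i. ?b i j))"
    by (rule P.lsum_swap)
      (use X.hrep[OF t] Y.hrep[OF t'] cl in \<open>fastforce simp: homogeneous_rep_def\<close>)
  moreover have "(\<lambda>(\<alpha>, x, \<beta>, y). lsum P (Y.hrep t') (\<lambda>(\<alpha>', x', \<beta>', y'). b \<alpha> x \<beta> y \<alpha>' x' \<beta>' y')) =
      (\<lambda>i. lsum P (Y.hrep t') (?b i))"
    "(\<lambda>(\<alpha>', x', \<beta>', y'). lsum P (X.hrep t) (\<lambda>(\<alpha>, x, \<beta>, y). b \<alpha> x \<beta> y \<alpha>' x' \<beta>' y')) =
      (\<lambda>j. lsum P (X.hrep t) (\<lambda>i. ?b i j))"
    by (auto simp: fun_eq_iff)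
  ultimately show ?thesis unfolding gsum_def by simp
qed

section \<open>Colour signs\<close>

lemma scalars_simps [simp]:
  "carrier (scalars K) = carrier K" "add (scalars K) = add K" "zero (scalars K) = zero K"
  "smult (scalars K) = mult K" "mult (scalars K) = mult K" "one (scalars K) = one K"
  by (simp_all add: scalars_def)

lemma (in cring) module_scalars: "module R (scalars R)"
proof (rule moduleI)
  show "cring R" by (rule is_cring)
  show "abelian_group (scalars R)"
    by (rule abelian_groupI) (auto simp: a_ac intro: l_neg)
qed (auto simp: l_distr r_distr m_assoc)

context commutative_factor
begin

declare factor_closed [simp, intro]

text \<open>By additivity \<open>\<omega> 0 \<beta>\<close> is idempotent, and it is a unit, hence
  equal to one.\<close>

lemma factor_zero_left [simp]: "\<omega> 0 \<beta> = \<one>"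
proof -
  have "\<omega> 0 \<beta> \<otimes> \<omega> 0 \<beta> = \<omega> 0 \<beta>" using factor_add_left[of 0 0 \<beta>] by simp
  then have "\<omega> \<beta> 0 \<otimes> (\<omega> 0 \<beta> \<otimes> \<omega> 0 \<beta>) = \<omega> \<beta> 0 \<otimes> \<omega> 0 \<beta>" by simp
  then show ?thesis by (simp add: m_assoc[symmetric] factor_inverse)
qed

lemma factor_zero_right [simp]: "\<omega> \<beta> 0 = \<one>"
  using factor_inverse[of \<beta> 0] by simp

lemma factor_cancel [simp]:
  "\<omega> \<alpha> \<beta> \<otimes> \<omega> \<beta> \<alpha> = \<one>"
  "c \<in> carrier K \<Longrightarrow> \<omega> \<alpha> \<beta> \<otimes> (\<omega> \<beta> \<alpha> \<otimes> c) = c"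
  by (simp_all add: factor_inverse m_assoc[symmetric])

lemma factor_uminus_left [simp]: "\<omega> (- \<alpha>) \<beta> = \<omega> \<beta> \<alpha>"
proof -
  have "\<omega> \<alpha> \<beta> \<otimes> \<omega> (- \<alpha>) \<beta> = \<one>" using factor_add_left[of \<alpha> "- \<alpha>" \<beta>] by simp
  then have "\<omega> \<beta> \<alpha> \<otimes> (\<omega> \<alpha> \<beta> \<otimes> \<omega> (- \<alpha>) \<beta>) = \<omega> \<beta> \<alpha>" by simp
  then show ?thesis by simp
qed

lemma factor_uminus_right [simp]: "\<omega> \<alpha> (- \<beta>) = \<omega> \<beta> \<alpha>"
proof -
  have "\<omega> \<alpha> \<beta> \<otimes> \<omega> \<alpha> (- \<beta>) = \<one>" using factor_add_right[of \<alpha> \<beta> "- \<beta>"] by simp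
  then have "\<omega> \<beta> \<alpha> \<otimes> (\<omega> \<alpha> \<beta> \<otimes> \<omega> \<alpha> (- \<beta>)) = \<omega> \<beta> \<alpha>" by simp
  then show ?thesis by simp
qed

lemmas factor_add = factor_add_left factor_add_right

end

section \<open>Linear maps built from the structure maps\<close>

text \<open>Linearity of a composite expression in one argument with the others fixed. The variants
  named \<open>_eta\<close> cover the case in which the argument itself stands in the last place, so
  that the map is a partial application.\<close>

named_theorems lin

lemma lin_id [lin]: "linear_map K M M (\<lambda>x. x)"
  by (auto intro: linear_mapI)

lemma (in module) lin_smult [lin]:
  "\<lbrakk>linear_map R N M f; c \<in> carrier R\<rbrakk> \<Longrightarrow> linear_map R N M (\<lambda>x. c \<odot>\<^bsub>M\<^esub> f x)"
  by (rule linear_mapI)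
    (simp_all add: linear_map_closed[of R N M f] linear_map_add[of R N M f] linear_map_smult[of R N M f]
      smult_r_distr smult_assoc1[symmetric] R.m_comm)

lemmas (in module) lin_smult_eta [lin] = lin_smult[OF lin_id]

lemma (in module) lin_scalar [lin]:
  assumes "linear_map R N (scalars R) g" "y \<in> carrier M"
  shows "linear_map R N M (\<lambda>x. g x \<odot>\<^bsub>M\<^esub> y)"
  using linear_map_closed[OF assms(1)] assms(2)
  by (auto intro!: linear_mapI simp: linear_map_add[OF assms(1)] linear_map_smult[OF assms(1)]
      smult_l_distr smult_assoc1)

lemma (in cring) lin_scalars_mult [lin]:
  assumes "linear_map R N (scalars R) g" "c \<in> carrier R"
  shows "linear_map R N (scalars R) (\<lambda>x. g x \<otimes> c)" "linear_map R N (scalars R) (\<lambda>x. c \<otimes> g x)"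
  using linear_map_closed[OF assms(1)] assms(2)
  by (auto intro!: linear_mapI simp: linear_map_add[OF assms(1)] linear_map_smult[OF assms(1)]
      l_distr r_distr m_ac)

context graded_algebra
begin

lemma lin_mult [lin]:
  assumes "linear_map K N A f" "y \<in> carrier A"
  shows "linear_map K N A (\<lambda>x. f x \<otimes>\<^bsub>A\<^esub> y)" "linear_map K N A (\<lambda>x. y \<otimes>\<^bsub>A\<^esub> f x)"
  using linear_map_closed[OF assms(1)] assms(2)
  by (auto intro!: linear_mapI simp: linear_map_add[OF assms(1)] linear_map_smult[OF assms(1)]
      A.l_distr A.r_distr smult_mult_left smult_mult_right)

end

lemmas (in graded_algebra) lin_mult_eta [lin] = lin_mult(2)[OF lin_id]

context graded_pair
begin

lemmas lin_pure_eta [lin] = bilinear_map_right[OF bilinear_map_pure]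

lemma lin_pure [lin]:
  "\<lbrakk>linear_map K Q M f; y \<in> carrier N\<rbrakk> \<Longrightarrow> linear_map K Q T (\<lambda>z. pure (f z) y)"
  "\<lbrakk>linear_map K Q N g; x \<in> carrier M\<rbrakk> \<Longrightarrow> linear_map K Q T (\<lambda>z. pure x (g z))"
  by (rule linear_map_compose[OF _ bilinear_map_left[OF bilinear_map_pure]], assumption+)
    (rule linear_map_compose[OF _ bilinear_map_right[OF bilinear_map_pure]], assumption+)

lemma lin_gsum [lin]:
  "\<lbrakk>module K P; linear_map K Q T f; graded_bilinear K M N P b\<rbrakk> \<Longrightarrow>
    linear_map K Q P (\<lambda>z. gsum K M N P (f z) b)"
  by (rule linear_map_compose[OF _ linear_map_gsum])

lemma lin_tsum [lin]:
  "\<lbrakk>module K P; linear_map K Q T f; bilinear_map K M N P b\<rbrakk> \<Longrightarrow>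
    linear_map K Q P (\<lambda>z. tsum K P (f z) b)"
  by (rule linear_map_compose[OF _ linear_map_tsum])

lemmas [lin] = linear_map_gsum_pointwise

lemma tsum_pointwise_lin:
  assumes "module K P" "module K Q" "t \<in> carrier T" "\<And>z. z \<in> carrier Q \<Longrightarrow> bilinear_map K M N P (b z)"
    and "\<And>x y. \<lbrakk>x \<in> carrier M; y \<in> carrier N\<rbrakk> \<Longrightarrow> linear_map K Q P (\<lambda>z. b z x y)"
  shows "linear_map K Q P (\<lambda>z. tsum K P t (b z))"
  by (rule linear_map_cong[OF linear_map_gsum_pointwise[OF assms(1,2,3), of "\<lambda>z \<alpha> x \<beta> y. b z x y"]])
    (simp_all add: assms tsum_eq_gsum)

lemma gsum_smult:
  assumes "module K P" "c \<in> carrier K" "t \<in> carrier T"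
    and "\<And>\<alpha> x \<beta> y. \<lbrakk>x \<in> grade M \<alpha>; y \<in> grade N \<beta>; x \<in> carrier M; y \<in> carrier N\<rbrakk> \<Longrightarrow> b \<alpha> x \<beta> y \<in> carrier P"
  shows "c \<odot>\<^bsub>P\<^esub> gsum K M N P t b = gsum K M N P t (\<lambda>\<alpha> x \<beta> y. c \<odot>\<^bsub>P\<^esub> b \<alpha> x \<beta> y)"
proof -
  interpret P: module K P by fact
  show ?thesis
    by (rule linear_map_gsum_commute[OF assms(1,1) P.lin_smult[OF lin_id assms(2)] assms(3,4)])
qed

lemma gsum_scalar:
  assumes "module K P" "p \<in> carrier P" "t \<in> carrier T"
    and "\<And>\<alpha> x \<beta> y. \<lbrakk>x \<in> grade M \<alpha>; y \<in> grade N \<beta>; x \<in> carrier M; y \<in> carrier N\<rbrakk> \<Longrightarrow> b \<alpha> x \<beta> y \<in> carrier K"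
  shows "gsum K M N (scalars K) t b \<odot>\<^bsub>P\<^esub> p = gsum K M N P t (\<lambda>\<alpha> x \<beta> y. b \<alpha> x \<beta> y \<odot>\<^bsub>P\<^esub> p)"
proof -
  interpret P: module K P by fact
  show ?thesis
    by (rule linear_map_gsum_commute[OF M.R.module_scalars assms(1) P.lin_scalar[OF lin_id assms(2)] assms(3)])
      (simp add: assms(4))
qed

end

section \<open>Graded tensor products of algebras\<close>

locale algebra_pair = commutative_factor K \<omega> + A: graded_algebra K A + B: graded_algebra K B
  for K :: "('k, 's) ring_scheme" (structure) and \<omega> :: "'g::ab_group_add \<Rightarrow> 'g \<Rightarrow> 'k"
    and A :: "('k, 'a, 'g, 'm) graded_module_scheme" and B :: "('k, 'b, 'g, 'n) graded_module_scheme"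
begin

sublocale AB: graded_pair K A B ..
sublocale BA: graded_pair K B A ..

lemma tensor_mult_eq:
  "s \<otimes>\<^bsub>tensor K \<omega> A B\<^esub> t = tsum K AB.T s (\<lambda>a b. tsum K AB.T t (\<lambda>c e.
        graded_ext2 B A AB.T (\<lambda>\<beta> b' \<gamma> c'. \<omega> \<beta> \<gamma> \<odot>\<^bsub>AB.T\<^esub> AB.pure (a \<otimes>\<^bsub>A\<^esub> c') (b' \<otimes>\<^bsub>B\<^esub> e)) b c))"
  by (simp add: tensor_def Let_def colour_ext_eq)

lemma graded_bilinear_swap:
  assumes "a \<in> carrier A" "e \<in> carrier B"
  shows "graded_bilinear K B A AB.T (\<lambda>\<beta> b' \<gamma> c'. \<omega> \<beta> \<gamma> \<odot>\<^bsub>AB.T\<^esub> AB.pure (a \<otimes>\<^bsub>A\<^esub> c') (b' \<otimes>\<^bsub>B\<^esub> e))"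
  using assms by (intro graded_bilinearI lin) auto

lemma lin_graded_ext2_param:
  assumes "module K P" "module K Q" "b \<in> carrier B" "c \<in> carrier A"
    and "\<And>\<beta> \<gamma> b' c'. \<lbrakk>b' \<in> carrier B; c' \<in> carrier A\<rbrakk> \<Longrightarrow> linear_map K Q P (\<lambda>z. F z \<beta> b' \<gamma> c')"
  shows "linear_map K Q P (\<lambda>z. graded_ext2 B A P (F z) b c)"
  unfolding graded_ext2_def
  by (rule B.linear_map_graded_ext_param[OF assms(1,2,3)],
      rule A.linear_map_graded_ext_param[OF assms(1,2,4)], rule assms(5))

text \<open>The product of \<open>a \<otimes> b\<close> and \<open>c \<otimes> e\<close> without any
  homogeneity assumption. Its linearity in each of the four arguments makes the representatives
  chosen in the product of tensors irrelevant.\<close>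

abbreviation (input) "quad a b c e \<equiv>
  graded_ext2 B A AB.T (\<lambda>\<beta> b' \<gamma> c'. \<omega> \<beta> \<gamma> \<odot>\<^bsub>AB.T\<^esub> AB.pure (a \<otimes>\<^bsub>A\<^esub> c') (b' \<otimes>\<^bsub>B\<^esub> e)) b c"

lemma quad_lin:
  assumes "b \<in> carrier B" "c \<in> carrier A"
  shows "a \<in> carrier A \<Longrightarrow> linear_map K B AB.T (\<lambda>e. quad a b c e)"
    and "e \<in> carrier B \<Longrightarrow> linear_map K A AB.T (\<lambda>a. quad a b c e)"
  by (rule lin_graded_ext2_param[OF AB.T.module_axioms _ assms]; (intro lin B.module_axioms A.module_axioms)?; simp)+

lemma bilinear_quad_right:
  assumes "a \<in> carrier A" "b \<in> carrier B"
  shows "bilinear_map K A B AB.T (\<lambda>c e. quad a b c e)"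
  using assms BA.bilinear_graded_ext2[OF AB.T.module_axioms graded_bilinear_swap[OF assms(1)]]
  by (intro bilinear_mapI) (auto intro: quad_lin bilinear_map_right)

lemma bilinear_quad_left:
  assumes "c \<in> carrier A" "e \<in> carrier B"
  shows "bilinear_map K A B AB.T (\<lambda>a b. quad a b c e)"
  using assms BA.bilinear_graded_ext2[OF AB.T.module_axioms graded_bilinear_swap[OF _ assms(2)]]
  by (intro bilinear_mapI) (auto intro: quad_lin bilinear_map_left)

lemma bilinear_tsum_quad:
  assumes "t \<in> carrier AB.T"
  shows "bilinear_map K A B AB.T (\<lambda>a b. tsum K AB.T t (\<lambda>c e. quad a b c e))"
  by (intro bilinear_mapI AB.tsum_pointwise_lin AB.T.module_axioms A.module_axioms B.module_axioms assms
      bilinear_quad_right; (rule bilinear_map_left[OF bilinear_quad_left] bilinear_map_right[OF bilinear_quad_left])?)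

abbreviation "TA \<equiv> tensor K \<omega> A B"

lemma lin_tensor_mult:
  assumes "t \<in> carrier AB.T"
  shows "linear_map K AB.T AB.T (\<lambda>s. s \<otimes>\<^bsub>TA\<^esub> t)" "linear_map K AB.T AB.T (\<lambda>s. t \<otimes>\<^bsub>TA\<^esub> s)"
  unfolding tensor_mult_eq
  by (intro lin AB.T.module_axioms bilinear_tsum_quad assms)
    (intro AB.tsum_pointwise_lin AB.T.module_axioms bilinear_tsum_quad assms lin bilinear_quad_right)

lemma tensor_mult_closed: "\<lbrakk>s \<in> carrier AB.T; t \<in> carrier AB.T\<rbrakk> \<Longrightarrow> s \<otimes>\<^bsub>TA\<^esub> t \<in> carrier AB.T"
  using lin_tensor_mult(1) linear_map_closed by metis

text \<open>Only the inner factors \<open>b\<close> and \<open>c\<close> pass each other, so only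
  they have to be homogeneous.\<close>

lemma tensor_mult_pure:
  assumes "a \<in> carrier A" "b \<in> grade B \<beta>" "c \<in> grade A \<gamma>" "e \<in> carrier B"
  shows "AB.pure a b \<otimes>\<^bsub>TA\<^esub> AB.pure c e = \<omega> \<beta> \<gamma> \<odot>\<^bsub>AB.T\<^esub> AB.pure (a \<otimes>\<^bsub>A\<^esub> c) (b \<otimes>\<^bsub>B\<^esub> e)"
proof -
  have bc: "b \<in> carrier B" "c \<in> carrier A" using assms A.grade_closed B.grade_closed by auto
  show ?thesis unfolding tensor_mult_eq
    using assms bc
    by (subst AB.tsum_pure[OF AB.T.module_axioms bilinear_tsum_quad])
      (simp_all add: AB.pure_closed AB.tsum_pure[OF AB.T.module_axioms bilinear_quad_right]
        BA.graded_ext2_homogeneous[OF AB.T.module_axioms graded_bilinear_swap])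
qed

end

lemma (in graded_pair) tensor_eqI_homogeneous:
  assumes "module K P" "linear_map K T P f" "linear_map K T P g"
    and "\<And>\<alpha> x \<beta> y. \<lbrakk>x \<in> grade M \<alpha>; y \<in> grade N \<beta>; x \<in> carrier M; y \<in> carrier N\<rbrakk> \<Longrightarrow> f (pure x y) = g (pure x y)"
    and "t \<in> carrier T"
  shows "f t = g t"
proof -
  obtain xs where xs: "\<forall>(\<alpha>, x, \<beta>, y)\<in>set xs. x \<in> grade M \<alpha> \<and> y \<in> grade N \<beta>"
    "t = lsum T xs (\<lambda>(\<alpha>, x, \<beta>, y). pure x y)"
    using tensor_homogeneous_list[OF assms(5)] by blast
  have cl: "i \<in> set xs \<Longrightarrow> (case i of (\<alpha>, x, \<beta>, y) \<Rightarrow> pure x y) \<in> carrier T" for i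
    using xs(1) M.grade_closed N.grade_closed pure_closed by fastforce
  have "f t = lsum P xs (\<lambda>i. f (case i of (\<alpha>, x, \<beta>, y) \<Rightarrow> pure x y))"
    unfolding xs(2) by (rule linear_map_lsum[OF T.module_axioms assms(1,2) cl])
  also have "\<dots> = lsum P xs (\<lambda>i. g (case i of (\<alpha>, x, \<beta>, y) \<Rightarrow> pure x y))"
    by (rule lsum_cong) (use xs(1) M.grade_closed N.grade_closed in \<open>fastforce simp: assms(4)\<close>)
  also have "\<dots> = g t"
    unfolding xs(2) by (rule linear_map_lsum[OF T.module_axioms assms(1,3) cl, symmetric])
  finally show ?thesis .
qed

lemma submodule_preimage:
  assumes "module K M" "module K N" "linear_map K M N f" "submodule S K N"
  shows "submodule {x \<in> carrier M. f x \<in> S} K M"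
proof -
  interpret M: module K M by fact
  interpret N: module K N by fact
  note S = N.submoduleE[OF assms(4)]
  have z: "\<zero>\<^bsub>N\<^esub> \<in> S" using subgroup.one_closed[OF submodule.axioms(1)[OF assms(4)]] by simp
  show ?thesis
  proof (rule M.submoduleI, goal_cases)
    case (3 a)
    then have "f (\<ominus>\<^bsub>M\<^esub> a) = f ((\<ominus>\<^bsub>K\<^esub> \<one>\<^bsub>K\<^esub>) \<odot>\<^bsub>M\<^esub> a)" by (simp add: M.smult_l_minus)
    also have "\<dots> = (\<ominus>\<^bsub>K\<^esub> \<one>\<^bsub>K\<^esub>) \<odot>\<^bsub>N\<^esub> f a" using 3 by (simp add: linear_map_smult[OF assms(3)])
    finally show ?case using 3 S(4) by simp
  qed (use linear_map_zero[OF assms(1-3)] z S in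
      \<open>auto simp: linear_map_add[OF assms(3)] linear_map_smult[OF assms(3)]\<close>)
qed

lemma (in graded_pair) tensor_grade_closed: "t \<in> tensor_grade K M N \<gamma> \<Longrightarrow> t \<in> carrier T"
  using T.submoduleE(1)[OF submodule_tensor_grade] by blast

text \<open>Degree statements for linear maps on tensors are checked on homogeneous pure tensors,
  because the preimage of a submodule is a submodule.\<close>

lemma (in graded_pair) linear_map_tensor_grade:
  assumes "module K P" "linear_map K T P f" "submodule S K P" "t \<in> tensor_grade K M N \<gamma>"
    and "\<And>\<alpha> x \<beta> y. \<lbrakk>x \<in> grade M \<alpha>; y \<in> grade N \<beta>; \<alpha> + \<beta> = \<gamma>\<rbrakk> \<Longrightarrow> f (pure x y) \<in> S"
  shows "f t \<in> S"
proof -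
  have "tensor_grade K M N \<gamma> \<subseteq> {t \<in> carrier T. f t \<in> S}" unfolding tensor_grade_def
    by (rule mspan_least[OF submodule_preimage[OF T.module_axioms assms(1,2,3)]])
      (use assms(5) M.grade_closed N.grade_closed pure_closed in blast)
  then show ?thesis using assms(4) by blast
qed

context algebra_pair
begin

text \<open>By linearity the three factors are replaced by homogeneous pure tensors one at a time.
  For these both bracketings carry the sign \<open>\<omega> \<beta> \<gamma> \<otimes> \<omega>
  \<beta> \<xi> \<otimes> \<omega> \<delta> \<xi>\<close>, since \<open>\<omega>\<close> is
  multiplicative in each argument.\<close>

lemma tensor_mult_assoc:
  assumes r: "r \<in> carrier AB.T" and s: "s \<in> carrier AB.T" and t: "t \<in> carrier AB.T"
  shows "(r \<otimes>\<^bsub>TA\<^esub> s) \<otimes>\<^bsub>TA\<^esub> t = r \<otimes>\<^bsub>TA\<^esub> (s \<otimes>\<^bsub>TA\<^esub> t)"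
proof -
  note c = AB.tensor_eqI_homogeneous[OF AB.T.module_axioms]
  note l = linear_map_compose[OF lin_tensor_mult(1)] linear_map_compose[OF lin_tensor_mult(2)]
  note cl = tensor_mult_closed AB.pure_closed
  have 1: "(AB.pure a b \<otimes>\<^bsub>TA\<^esub> AB.pure c e) \<otimes>\<^bsub>TA\<^esub> AB.pure x y =
      AB.pure a b \<otimes>\<^bsub>TA\<^esub> (AB.pure c e \<otimes>\<^bsub>TA\<^esub> AB.pure x y)"
    if h: "a \<in> grade A \<alpha>" "b \<in> grade B \<beta>" "c \<in> grade A \<gamma>" "e \<in> grade B \<delta>" "x \<in> grade A \<xi>" "y \<in> grade B \<eta>"
    for a b c e x y \<alpha> \<beta> \<gamma> \<delta> \<xi> \<eta>
  proof -
    have "a \<in> carrier A" "b \<in> carrier B" "c \<in> carrier A" "e \<in> carrier B" "x \<in> carrier A" "y \<in> carrier B"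
      using h A.grade_closed B.grade_closed by auto
    with h A.grade_mult[OF h(3,5)] B.grade_mult[OF h(2,4)] show ?thesis
      by (simp add: tensor_mult_pure linear_map_smult[OF lin_tensor_mult(1)]
          linear_map_smult[OF lin_tensor_mult(2)] cl factor_add AB.T.smult_assoc1[symmetric]
          A.m_assoc B.m_assoc m_ac)
  qed
  have 2: "(AB.pure a b \<otimes>\<^bsub>TA\<^esub> AB.pure c e) \<otimes>\<^bsub>TA\<^esub> t = AB.pure a b \<otimes>\<^bsub>TA\<^esub> (AB.pure c e \<otimes>\<^bsub>TA\<^esub> t)"
    if h: "a \<in> grade A \<alpha>" "b \<in> grade B \<beta>" "c \<in> grade A \<gamma>" "e \<in> grade B \<delta>"
    for a b c e \<alpha> \<beta> \<gamma> \<delta>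
    by (rule c[OF _ _ _ t])
      (use h A.grade_closed B.grade_closed 1 in \<open>auto intro!: lin_tensor_mult l cl\<close>)
  have 3: "(AB.pure a b \<otimes>\<^bsub>TA\<^esub> s) \<otimes>\<^bsub>TA\<^esub> t = AB.pure a b \<otimes>\<^bsub>TA\<^esub> (s \<otimes>\<^bsub>TA\<^esub> t)"
    if h: "a \<in> grade A \<alpha>" "b \<in> grade B \<beta>"
    for a b \<alpha> \<beta>
    by (rule c[OF _ _ _ s])
      (use h t A.grade_closed B.grade_closed 2 in \<open>auto intro!: lin_tensor_mult l cl\<close>)
  show ?thesis
    by (rule c[OF _ _ _ r])
      (use s t A.grade_closed B.grade_closed 3 in \<open>auto intro!: lin_tensor_mult l cl\<close>)
qed

end

section \<open>Sweedler calculus\<close>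

definition graded_trilinear where
  "graded_trilinear K M P b \<longleftrightarrow> (\<forall>\<alpha> \<beta> \<gamma>.
    (\<forall>y\<in>carrier M. \<forall>z\<in>carrier M. linear_map K M P (\<lambda>x. b \<alpha> x \<beta> y \<gamma> z)) \<and>
    (\<forall>x\<in>carrier M. \<forall>z\<in>carrier M. linear_map K M P (\<lambda>y. b \<alpha> x \<beta> y \<gamma> z)) \<and>
    (\<forall>x\<in>carrier M. \<forall>y\<in>carrier M. linear_map K M P (\<lambda>z. b \<alpha> x \<beta> y \<gamma> z)))"

lemma graded_trilinearI:
  assumes "\<And>\<alpha> \<beta> \<gamma> y z. \<lbrakk>y \<in> carrier M; z \<in> carrier M\<rbrakk> \<Longrightarrow> linear_map K M P (\<lambda>x. b \<alpha> x \<beta> y \<gamma> z)"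
    and "\<And>\<alpha> \<beta> \<gamma> x z. \<lbrakk>x \<in> carrier M; z \<in> carrier M\<rbrakk> \<Longrightarrow> linear_map K M P (\<lambda>y. b \<alpha> x \<beta> y \<gamma> z)"
    and "\<And>\<alpha> \<beta> \<gamma> x y. \<lbrakk>x \<in> carrier M; y \<in> carrier M\<rbrakk> \<Longrightarrow> linear_map K M P (\<lambda>z. b \<alpha> x \<beta> y \<gamma> z)"
  shows "graded_trilinear K M P b"
  using assms by (simp add: graded_trilinear_def)

lemma bilinear_map_cong:
  assumes "bilinear_map K M N P b" "\<And>x y. \<lbrakk>x \<in> carrier M; y \<in> carrier N\<rbrakk> \<Longrightarrow> b x y = c x y"
    "module K M" "module K N"
  shows "bilinear_map K M N P c"
proof (rule bilinear_mapI)
  show "linear_map K N P (c x)" if "x \<in> carrier M" for x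
    by (rule linear_map_cong[OF bilinear_map_right[OF assms(1) that] assms(2)[OF that] assms(4)])
  show "linear_map K M P (\<lambda>x. c x y)" if "y \<in> carrier N" for y
    by (rule linear_map_cong[OF bilinear_map_left[OF assms(1) that] assms(2)[OF _ that] assms(3)])
qed

lemma (in graded_pair) gsum_id:
  assumes "t \<in> carrier T"
  shows "gsum K M N T t (\<lambda>\<alpha> x \<beta> y. pure x y) = t"
  using hrep[OF assms] unfolding homogeneous_rep_def gsum_def by simp

context hopf_algebra
begin

interpretation HH: algebra_pair K \<omega> H H ..
interpretation HT: graded_pair K H "tensor K \<omega> H H"
  by (intro graded_pair.intro graded_module_axioms HH.AB.graded_module_tensor)

text \<open>A Sweedler sum with values in \<open>P\<close>: in \<open>swe P x (\<lambda>\<alpha> u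
  \<beta> v. b \<alpha> u \<beta> v)\<close> the legs \<open>u\<close> and \<open>v\<close> of the
  coproduct of \<open>x\<close> are homogeneous of degrees \<open>\<alpha>\<close> and
  \<open>\<beta>\<close>.\<close>

abbreviation "swe P x b \<equiv> gsum K H H P (comult H x) b"

lemma linear_map_comult [lin]: "linear_map K H HH.AB.T (comult H)"
  using comult_hom by (simp add: graded_algebra_hom_def linear_map_def)

lemma comult_closed [simp, intro]: "x \<in> carrier H \<Longrightarrow> comult H x \<in> carrier HH.AB.T"
  using linear_map_comult by (rule linear_map_closed)

lemma comult_grade: "x \<in> grade H \<xi> \<Longrightarrow> comult H x \<in> tensor_grade K H H \<xi>"
  using comult_hom by (auto simp: graded_algebra_hom_def)

lemma lin_comult [lin]: "linear_map K Q H f \<Longrightarrow> linear_map K Q HH.AB.T (\<lambda>z. comult H (f z))"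
  by (rule linear_map_compose[OF _ linear_map_comult])

lemma linear_map_counit [lin]: "linear_map K H (scalars K) (counit H)"
  using counit_hom by (simp add: graded_algebra_hom_def linear_map_def)

lemma counit_closed [simp, intro]: "x \<in> carrier H \<Longrightarrow> counit H x \<in> carrier K"
  using linear_map_closed[OF linear_map_counit] by simp

lemma counit_zero: "\<lbrakk>x \<in> grade H \<xi>; \<xi> \<noteq> 0\<rbrakk> \<Longrightarrow> counit H x = \<zero>"
  using counit_hom by (force simp: graded_algebra_hom_def scalars_def)

lemmas [lin] = antipode_linear

lemma antipode_closed [simp, intro]: "x \<in> carrier H \<Longrightarrow> antipode H x \<in> carrier H"
  using antipode_linear by (rule linear_map_closed)

lemma lin_antipode [lin]: "linear_map K Q H f \<Longrightarrow> linear_map K Q H (\<lambda>z. antipode H (f z))"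
  by (rule linear_map_compose[OF _ antipode_linear])

text \<open>The coassociativity axiom is an equality in a triple tensor product. It is transported
  to an arbitrary degree-dependent trilinear \<open>b\<close> by a linear map that sends
  \<open>x \<otimes> (y \<otimes> z)\<close> to \<open>b \<alpha> x \<beta> y \<gamma> z\<close> on
  homogeneous elements.\<close>

lemma swe_coassoc:
  assumes x: "x \<in> carrier H" and P: "module K P" and b: "graded_trilinear K H P b"
  shows "swe P x (\<lambda>\<alpha> u \<gamma> z. swe P u (\<lambda>\<alpha> x \<beta> y. b \<alpha> x \<beta> y \<gamma> z)) =
    swe P x (\<lambda>\<alpha> x \<beta> v. swe P v (\<lambda>\<beta> y \<gamma> z. b \<alpha> x \<beta> y \<gamma> z))"
proof -
  have bl: "linear_map K H P (\<lambda>x. b \<alpha> x \<beta> y \<gamma> z)" "linear_map K H P (\<lambda>x. b \<alpha> y \<beta> x \<gamma> z)"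
    "linear_map K H P (\<lambda>x. b \<alpha> y \<beta> z \<gamma> x)" if "y \<in> carrier H" "z \<in> carrier H" for \<alpha> \<beta> \<gamma> y z
    using b that by (auto simp: graded_trilinear_def)
  \<comment> \<open>The transporting map. It ignores the degree \<open>\<sigma>\<close> of the inner
    tensor \<open>s\<close>; the degrees of \<open>y\<close> and \<open>z\<close> are obtained by
    decomposing \<open>s\<close> itself.\<close>
  let ?L = "\<lambda>s. gsum K H (tensor K \<omega> H H) P s (\<lambda>\<alpha> x \<sigma> s. gsum K H H P s (\<lambda>\<beta> y \<gamma> z. b \<alpha> x \<beta> y \<gamma> z))"
  let ?tr = "\<lambda>x y z. HT.pure x (HH.AB.pure y z)"
  \<comment> \<open>The axiom is stated over the bare module of tensors, whereas the graded calculus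
    needs the graded record \<open>tensor\<close>; the triple tensor products agree.\<close>
  have T3: "tensor_module K H HH.AB.T = HT.T" "pure_tensor K H HH.AB.T = HT.pure"
    by (rule tensor_module_cong pure_tensor_cong; simp)+
  have gb: "graded_bilinear K H (tensor K \<omega> H H) P (\<lambda>\<alpha> x \<sigma> s. gsum K H H P s (\<lambda>\<beta> y \<gamma> z. b \<alpha> x \<beta> y \<gamma> z))"
  proof (rule graded_bilinearI)
    fix \<alpha> x assume "x \<in> carrier H"
    then have "linear_map K HH.AB.T P (\<lambda>s. gsum K H H P s (\<lambda>\<beta> y \<gamma> z. b \<alpha> x \<beta> y \<gamma> z))"
      by (intro lin P graded_bilinearI bl)
    then show "linear_map K (tensor K \<omega> H H) P (\<lambda>s. gsum K H H P s (\<lambda>\<beta> y \<gamma> z. b \<alpha> x \<beta> y \<gamma> z))"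
      by (simp add: linear_map_def)
  next
    fix \<alpha> s assume "s \<in> carrier (tensor K \<omega> H H)"
    then show "linear_map K H P (\<lambda>x. gsum K H H P s (\<lambda>\<beta> y \<gamma> z. b \<alpha> x \<beta> y \<gamma> z))"
      by (intro lin P module_axioms bl) auto
  qed
  have L: "linear_map K HT.T P ?L" by (rule HT.linear_map_gsum[OF P gb])
  have Ltr: "?L (?tr x y z) = b \<alpha> x \<beta> y \<gamma> z" if "x \<in> grade H \<alpha>" "y \<in> grade H \<beta>" "z \<in> grade H \<gamma>" for \<alpha> \<beta> \<gamma> x y z
    using that
    by (subst HT.gsum_pure[OF P gb that(1), of _ "\<beta> + \<gamma>"])
      (auto intro!: HH.AB.pure_grade HH.AB.gsum_pure P graded_bilinearI bl grade_closed)
  have trcl: "?tr x y z \<in> carrier HT.T" if "x \<in> carrier H" "y \<in> carrier H" "z \<in> carrier H" for x y z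
    using that by (auto intro!: HT.pure_closed HH.AB.pure_closed)
  have conv: "linear_map K H (tensor K \<omega> H H) f" if "linear_map K H HH.AB.T f" for f
    using that by (simp add: linear_map_def)
  have trl: "linear_map K H HT.T (\<lambda>x. ?tr x y z)" "linear_map K H HT.T (\<lambda>x. ?tr y x z)"
    "linear_map K H HT.T (\<lambda>x. ?tr y z x)" if "y \<in> carrier H" "z \<in> carrier H" for y z
    using that by (auto intro!: lin conv HH.AB.pure_closed)
  note gs = HH.AB.tsum_eq_gsum[OF HT.module_tensor]
  have inner: "tsum K HT.T (comult H u) (\<lambda>x y. ?tr x y z) = gsum K H H HT.T (comult H u) (\<lambda>\<alpha> x \<beta> y. ?tr x y z)"
    "tsum K HT.T (comult H u) (\<lambda>x y. ?tr z x y) = gsum K H H HT.T (comult H u) (\<lambda>\<alpha> x \<beta> y. ?tr z x y)"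
    if "u \<in> carrier H" "z \<in> carrier H" for u z
    by (rule gs; (intro bilinear_mapI trl comult_closed that)?; assumption?)+
  have bil: "bilinear_map K H H HT.T (\<lambda>u z. gsum K H H HT.T (comult H u) (\<lambda>\<alpha> x \<beta> y. ?tr x y z))"
    "bilinear_map K H H HT.T (\<lambda>z u. gsum K H H HT.T (comult H u) (\<lambda>\<alpha> x \<beta> y. ?tr z x y))"
    by (intro bilinear_mapI lin HT.module_tensor module_axioms graded_bilinearI trl comult_closed; assumption)+
  have bil': "bilinear_map K H H HT.T (\<lambda>u z. tsum K HT.T (comult H u) (\<lambda>x y. ?tr x y z))"
    "bilinear_map K H H HT.T (\<lambda>z u. tsum K HT.T (comult H u) (\<lambda>x y. ?tr z x y))"
    by (rule bilinear_map_cong[OF bil(1)] bilinear_map_cong[OF bil(2)];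
        (intro inner[symmetric] module_axioms)?; assumption?)+
  have "tsum K HT.T (comult H x) (\<lambda>u z. tsum K HT.T (comult H u) (\<lambda>x y. ?tr x y z)) =
      tsum K HT.T (comult H x) (\<lambda>x v. tsum K HT.T (comult H v) (\<lambda>y z. ?tr x y z))"
    using coassociative[OF x] by (simp add: Let_def T3)
  moreover have "tsum K HT.T (comult H x) (\<lambda>u z. tsum K HT.T (comult H u) (\<lambda>x y. ?tr x y z)) =
      gsum K H H HT.T (comult H x) (\<lambda>\<alpha> u \<gamma> z. gsum K H H HT.T (comult H u) (\<lambda>\<alpha> x \<beta> y. ?tr x y z))"
    unfolding gs[OF bil'(1) comult_closed[OF x]]
    by (rule HH.AB.gsum_cong[OF comult_closed[OF x]], rule inner(1))
  moreover have "tsum K HT.T (comult H x) (\<lambda>x v. tsum K HT.T (comult H v) (\<lambda>y z. ?tr x y z)) =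
      gsum K H H HT.T (comult H x) (\<lambda>\<alpha> x \<beta> v. gsum K H H HT.T (comult H v) (\<lambda>\<beta> y \<gamma> z. ?tr x y z))"
    unfolding gs[OF bil'(2) comult_closed[OF x]]
    by (rule HH.AB.gsum_cong[OF comult_closed[OF x]], rule inner(2))
  ultimately have eq: "gsum K H H HT.T (comult H x) (\<lambda>\<alpha> u \<gamma> z. gsum K H H HT.T (comult H u) (\<lambda>\<alpha> x \<beta> y. ?tr x y z)) =
      gsum K H H HT.T (comult H x) (\<lambda>\<alpha> x \<beta> v. gsum K H H HT.T (comult H v) (\<lambda>\<beta> y \<gamma> z. ?tr x y z))"
    by simp
  have cl: "u \<in> carrier H \<Longrightarrow> z \<in> carrier H \<Longrightarrow> gsum K H H HT.T (comult H u) (\<lambda>\<alpha> x \<beta> y. ?tr x y z) \<in> carrier HT.T"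
    "u \<in> carrier H \<Longrightarrow> z \<in> carrier H \<Longrightarrow> gsum K H H HT.T (comult H u) (\<lambda>\<alpha> x \<beta> y. ?tr z x y) \<in> carrier HT.T" for u z
    by (auto intro!: HH.AB.gsum_closed trcl HT.T.abelian_group_axioms)
  note com = HH.AB.linear_map_gsum_commute[OF HT.module_tensor P L]
  have "?L (gsum K H H HT.T (comult H x) (\<lambda>\<alpha> u \<gamma> z. gsum K H H HT.T (comult H u) (\<lambda>\<alpha> x \<beta> y. ?tr x y z))) =
      swe P x (\<lambda>\<alpha> u \<gamma> z. ?L (gsum K H H HT.T (comult H u) (\<lambda>\<alpha> x \<beta> y. ?tr x y z)))"
    by (rule com[OF comult_closed[OF x] cl(1)])
  also have "\<dots> = swe P x (\<lambda>\<alpha> u \<gamma> z. swe P u (\<lambda>\<alpha> x \<beta> y. ?L (?tr x y z)))"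
    by (rule HH.AB.gsum_cong[OF comult_closed[OF x]], rule com[OF comult_closed trcl])
  also have "\<dots> = swe P x (\<lambda>\<alpha> u \<gamma> z. swe P u (\<lambda>\<alpha> x \<beta> y. b \<alpha> x \<beta> y \<gamma> z))"
    by (rule HH.AB.gsum_cong[OF comult_closed[OF x]], rule HH.AB.gsum_cong[OF comult_closed], assumption,
        rule Ltr)
  finally have 1: "?L (gsum K H H HT.T (comult H x) (\<lambda>\<alpha> u \<gamma> z. gsum K H H HT.T (comult H u) (\<lambda>\<alpha> x \<beta> y. ?tr x y z))) =
      swe P x (\<lambda>\<alpha> u \<gamma> z. swe P u (\<lambda>\<alpha> x \<beta> y. b \<alpha> x \<beta> y \<gamma> z))" .
  have "?L (gsum K H H HT.T (comult H x) (\<lambda>\<alpha> x \<beta> v. gsum K H H HT.T (comult H v) (\<lambda>\<beta> y \<gamma> z. ?tr x y z))) =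
      swe P x (\<lambda>\<alpha> x \<beta> v. ?L (gsum K H H HT.T (comult H v) (\<lambda>\<beta> y \<gamma> z. ?tr x y z)))"
    by (rule com[OF comult_closed[OF x] cl(2)])
  also have "\<dots> = swe P x (\<lambda>\<alpha> x \<beta> v. swe P v (\<lambda>\<beta> y \<gamma> z. ?L (?tr x y z)))"
    by (rule HH.AB.gsum_cong[OF comult_closed[OF x]], rule com[OF comult_closed trcl])
  also have "\<dots> = swe P x (\<lambda>\<alpha> x \<beta> v. swe P v (\<lambda>\<beta> y \<gamma> z. b \<alpha> x \<beta> y \<gamma> z))"
    by (rule HH.AB.gsum_cong[OF comult_closed[OF x]], rule HH.AB.gsum_cong[OF comult_closed], assumption,
        rule Ltr)
  finally show ?thesis using 1 eq by simp
qed

lemma swe_cong: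
  assumes "x \<in> carrier H"
    and "\<And>\<alpha> u \<beta> v. \<lbrakk>u \<in> grade H \<alpha>; v \<in> grade H \<beta>; u \<in> carrier H; v \<in> carrier H\<rbrakk> \<Longrightarrow> b \<alpha> u \<beta> v = c \<alpha> u \<beta> v"
  shows "swe P x b = swe P x c"
  by (rule HH.AB.gsum_cong[OF comult_closed[OF assms(1)] assms(2)])

lemma swe_homogeneous_cong:
  assumes "x \<in> grade H \<xi>"
    and "\<And>\<alpha> u \<beta> v. \<lbrakk>u \<in> grade H \<alpha>; v \<in> grade H \<beta>; u \<in> carrier H; v \<in> carrier H; \<alpha> + \<beta> = \<xi>\<rbrakk>
      \<Longrightarrow> b \<alpha> u \<beta> v = c \<alpha> u \<beta> v"
  shows "swe P x b = swe P x c"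
  by (rule HH.AB.gsum_homogeneous_cong[OF comult_grade[OF assms(1)] assms(2)])

lemma swe_closed:
  assumes "module K P" "x \<in> carrier H"
    and "\<And>\<alpha> u \<beta> v. \<lbrakk>u \<in> grade H \<alpha>; v \<in> grade H \<beta>; u \<in> carrier H; v \<in> carrier H\<rbrakk> \<Longrightarrow> b \<alpha> u \<beta> v \<in> carrier P"
  shows "swe P x b \<in> carrier P"
  by (rule HH.AB.gsum_closed[OF module.axioms(2)[OF assms(1)] comult_closed[OF assms(2)] assms(3)])

lemma swe_linear_map:
  assumes "module K P" "module K Q" "linear_map K P Q f" "x \<in> carrier H"
    and "\<And>\<alpha> u \<beta> v. \<lbrakk>u \<in> grade H \<alpha>; v \<in> grade H \<beta>; u \<in> carrier H; v \<in> carrier H\<rbrakk> \<Longrightarrow> b \<alpha> u \<beta> v \<in> carrier P"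
  shows "f (swe P x b) = swe Q x (\<lambda>\<alpha> u \<beta> v. f (b \<alpha> u \<beta> v))"
  by (rule HH.AB.linear_map_gsum_commute[OF assms(1,2,3) comult_closed[OF assms(4)] assms(5)])

lemma swe_smult:
  assumes "module K P" "c \<in> carrier K" "x \<in> carrier H"
    and "\<And>\<alpha> u \<beta> v. \<lbrakk>u \<in> grade H \<alpha>; v \<in> grade H \<beta>; u \<in> carrier H; v \<in> carrier H\<rbrakk> \<Longrightarrow> b \<alpha> u \<beta> v \<in> carrier P"
  shows "c \<odot>\<^bsub>P\<^esub> swe P x b = swe P x (\<lambda>\<alpha> u \<beta> v. c \<odot>\<^bsub>P\<^esub> b \<alpha> u \<beta> v)"
  by (rule HH.AB.gsum_smult[OF assms(1,2) comult_closed[OF assms(3)] assms(4)])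

lemma swe_scalar:
  assumes "module K P" "p \<in> carrier P" "x \<in> carrier H"
    and "\<And>\<alpha> u \<beta> v. \<lbrakk>u \<in> grade H \<alpha>; v \<in> grade H \<beta>; u \<in> carrier H; v \<in> carrier H\<rbrakk> \<Longrightarrow> b \<alpha> u \<beta> v \<in> carrier K"
  shows "swe (scalars K) x b \<odot>\<^bsub>P\<^esub> p = swe P x (\<lambda>\<alpha> u \<beta> v. b \<alpha> u \<beta> v \<odot>\<^bsub>P\<^esub> p)"
  by (rule HH.AB.gsum_scalar[OF assms(1,2) comult_closed[OF assms(3)] assms(4)])

lemma tsum_comult:
  assumes "module K P" "bilinear_map K H H P b" "x \<in> carrier H"
  shows "tsum K P (comult H x) b = swe P x (\<lambda>\<alpha> u \<beta> v. b u v)"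
  by (rule HH.AB.tsum_eq_gsum[OF assms(1,2) comult_closed[OF assms(3)]])

lemma lin_swe [lin]:
  "\<lbrakk>module K P; linear_map K Q H f; graded_bilinear K H H P b\<rbrakk> \<Longrightarrow> linear_map K Q P (\<lambda>z. swe P (f z) b)"
  by (intro lin)

lemma lin_swe_pointwise [lin]:
  assumes "module K P" "module K Q" "x \<in> carrier H"
    and "\<And>\<alpha> u \<beta> v. \<lbrakk>u \<in> grade H \<alpha>; v \<in> grade H \<beta>; u \<in> carrier H; v \<in> carrier H\<rbrakk>
      \<Longrightarrow> linear_map K Q P (\<lambda>z. b z \<alpha> u \<beta> v)"
  shows "linear_map K Q P (\<lambda>z. swe P x (b z))"
  by (rule HH.AB.linear_map_gsum_pointwise[OF assms(1,2) comult_closed[OF assms(3)] assms(4)])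

text \<open>The coproduct is multiplicative into the signed tensor square. The second leg of
  \<open>x\<close> has to pass the first leg of \<open>y\<close>, and this is the only sign.\<close>

lemma swe_mult:
  assumes x: "x \<in> carrier H" and y: "y \<in> carrier H" and P: "module K P"
    and b: "graded_bilinear K H H P b"
  shows "swe P (x \<otimes>\<^bsub>H\<^esub> y) b = swe P x (\<lambda>\<alpha> u \<beta> v. swe P y (\<lambda>\<gamma> w \<delta> z.
    \<omega> \<beta> \<gamma> \<odot>\<^bsub>P\<^esub> b (\<alpha> + \<gamma>) (u \<otimes>\<^bsub>H\<^esub> w) (\<beta> + \<delta>) (v \<otimes>\<^bsub>H\<^esub> z)))"
proof -
  let ?T = "HH.AB.T" and ?L = "\<lambda>t. gsum K H H P t b"
  have L: "linear_map K ?T P ?L" by (rule HH.AB.linear_map_gsum[OF P b])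
  note com = swe_linear_map[OF HH.AB.module_tensor]
  have "comult H (x \<otimes>\<^bsub>H\<^esub> y) = comult H x \<otimes>\<^bsub>HH.TA\<^esub> comult H y"
    using comult_hom x y by (simp add: graded_algebra_hom_def)
  also have "\<dots> = swe ?T x (\<lambda>\<alpha> u \<beta> v. HH.AB.pure u v) \<otimes>\<^bsub>HH.TA\<^esub> comult H y"
    using x by (simp add: HH.AB.gsum_id)
  also have "\<dots> = swe ?T x (\<lambda>\<alpha> u \<beta> v. HH.AB.pure u v \<otimes>\<^bsub>HH.TA\<^esub> comult H y)"
    by (rule com[OF HH.AB.module_tensor HH.lin_tensor_mult(1)]) (use x y in \<open>simp_all add: HH.AB.pure_closed\<close>)
  also have "\<dots> = swe ?T x (\<lambda>\<alpha> u \<beta> v. HH.AB.pure u v \<otimes>\<^bsub>HH.TA\<^esub> swe ?T y (\<lambda>\<gamma> w \<delta> z. HH.AB.pure w z))"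
    using y by (simp add: HH.AB.gsum_id)
  also have "\<dots> = swe ?T x (\<lambda>\<alpha> u \<beta> v. swe ?T y (\<lambda>\<gamma> w \<delta> z. HH.AB.pure u v \<otimes>\<^bsub>HH.TA\<^esub> HH.AB.pure w z))"
    by (rule swe_cong[OF x], rule com[OF HH.AB.module_tensor HH.lin_tensor_mult(2)])
      (use x y in \<open>simp_all add: HH.AB.pure_closed\<close>)
  also have "\<dots> = swe ?T x (\<lambda>\<alpha> u \<beta> v. swe ?T y (\<lambda>\<gamma> w \<delta> z.
      \<omega> \<beta> \<gamma> \<odot>\<^bsub>?T\<^esub> HH.AB.pure (u \<otimes>\<^bsub>H\<^esub> w) (v \<otimes>\<^bsub>H\<^esub> z)))"
    by (rule swe_cong[OF x], rule swe_cong[OF y], rule HH.tensor_mult_pure)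
  finally have "swe P (x \<otimes>\<^bsub>H\<^esub> y) b = ?L (swe ?T x (\<lambda>\<alpha> u \<beta> v. swe ?T y (\<lambda>\<gamma> w \<delta> z.
      \<omega> \<beta> \<gamma> \<odot>\<^bsub>?T\<^esub> HH.AB.pure (u \<otimes>\<^bsub>H\<^esub> w) (v \<otimes>\<^bsub>H\<^esub> z))))" by simp
  also have "\<dots> = swe P x (\<lambda>\<alpha> u \<beta> v. ?L (swe ?T y (\<lambda>\<gamma> w \<delta> z.
      \<omega> \<beta> \<gamma> \<odot>\<^bsub>?T\<^esub> HH.AB.pure (u \<otimes>\<^bsub>H\<^esub> w) (v \<otimes>\<^bsub>H\<^esub> z))))"
    by (rule com[OF P L x]) (intro swe_closed HH.AB.module_tensor y; simp add: HH.AB.pure_closed)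
  also have "\<dots> = swe P x (\<lambda>\<alpha> u \<beta> v. swe P y (\<lambda>\<gamma> w \<delta> z.
      ?L (\<omega> \<beta> \<gamma> \<odot>\<^bsub>?T\<^esub> HH.AB.pure (u \<otimes>\<^bsub>H\<^esub> w) (v \<otimes>\<^bsub>H\<^esub> z))))"
    by (rule swe_cong[OF x], rule com[OF P L y]) (simp add: HH.AB.pure_closed)
  also have "\<dots> = swe P x (\<lambda>\<alpha> u \<beta> v. swe P y (\<lambda>\<gamma> w \<delta> z.
      \<omega> \<beta> \<gamma> \<odot>\<^bsub>P\<^esub> b (\<alpha> + \<gamma>) (u \<otimes>\<^bsub>H\<^esub> w) (\<beta> + \<delta>) (v \<otimes>\<^bsub>H\<^esub> z)))"
    by (rule swe_cong[OF x], rule swe_cong[OF y])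
      (simp add: linear_map_smult[OF L] HH.AB.pure_closed HH.AB.gsum_pure[OF P b grade_mult grade_mult])
  finally show ?thesis .
qed

lemma swe_one:
  assumes "module K P" "graded_bilinear K H H P b"
  shows "swe P \<one>\<^bsub>H\<^esub> b = b 0 \<one>\<^bsub>H\<^esub> 0 \<one>\<^bsub>H\<^esub>"
proof -
  have "comult H \<one>\<^bsub>H\<^esub> = HH.AB.pure \<one>\<^bsub>H\<^esub> \<one>\<^bsub>H\<^esub>"
    using comult_hom by (simp add: graded_algebra_hom_def)
  then show ?thesis by (simp add: HH.AB.gsum_pure[OF assms grade_one grade_one])
qed

lemma swe_counit_id:
  assumes x: "x \<in> carrier H"
  shows "swe H x (\<lambda>\<alpha> u \<beta> v. counit H u \<odot>\<^bsub>H\<^esub> v) = x" "swe H x (\<lambda>\<alpha> u \<beta> v. counit H v \<odot>\<^bsub>H\<^esub> u) = x"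
  by (subst tsum_comult[OF module_axioms _ x, symmetric];
      auto intro!: bilinear_mapI lin simp: counit_left[OF x] counit_right[OF x])+

text \<open>The co-unit vanishes off degree zero, so a summand survives only if its legs have
  degrees \<open>0\<close> and \<open>\<xi>\<close>. These values can be inserted into
  \<open>F\<close> first, after which the co-unit axiom applies to a single linear map.\<close>

lemma swe_counit_left:
  assumes x: "x \<in> grade H \<xi>" and P: "module K P" and F: "\<And>\<alpha> \<beta>. linear_map K H P (F \<alpha> \<beta>)"
  shows "swe P x (\<lambda>\<alpha> u \<beta> v. counit H u \<odot>\<^bsub>P\<^esub> F \<alpha> \<beta> v) = F 0 \<xi> x"
proof -
  interpret P: module K P by (rule P)
  have xc: "x \<in> carrier H" by (rule grade_closed[OF x])
  have "swe P x (\<lambda>\<alpha> u \<beta> v. counit H u \<odot>\<^bsub>P\<^esub> F \<alpha> \<beta> v) = swe P x (\<lambda>\<alpha> u \<beta> v. F 0 \<xi> (counit H u \<odot>\<^bsub>H\<^esub> v))"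
  proof (rule swe_homogeneous_cong[OF x])
    fix \<alpha> u \<beta> v assume h: "u \<in> grade H \<alpha>" "v \<in> grade H \<beta>" "u \<in> carrier H" "v \<in> carrier H" "\<alpha> + \<beta> = \<xi>"
    then show "counit H u \<odot>\<^bsub>P\<^esub> F \<alpha> \<beta> v = F 0 \<xi> (counit H u \<odot>\<^bsub>H\<^esub> v)"
      using counit_zero[OF h(1)] linear_map_closed[OF F h(4)]
      by (cases "\<alpha> = 0") (simp_all add: linear_map_smult[OF F] linear_map_zero[OF module_axioms P F])
  qed
  also have "\<dots> = F 0 \<xi> (swe H x (\<lambda>\<alpha> u \<beta> v. counit H u \<odot>\<^bsub>H\<^esub> v))"
    by (rule swe_linear_map[OF module_axioms P F xc, symmetric]) simp
  also have "swe H x (\<lambda>\<alpha> u \<beta> v. counit H u \<odot>\<^bsub>H\<^esub> v) = x" by (rule swe_counit_id(1)[OF xc])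
  finally show ?thesis .
qed

lemma swe_counit_right:
  assumes x: "x \<in> grade H \<xi>" and P: "module K P" and F: "\<And>\<alpha> \<beta>. linear_map K H P (F \<alpha> \<beta>)"
  shows "swe P x (\<lambda>\<alpha> u \<beta> v. counit H v \<odot>\<^bsub>P\<^esub> F \<alpha> \<beta> u) = F \<xi> 0 x"
proof -
  interpret P: module K P by (rule P)
  have xc: "x \<in> carrier H" by (rule grade_closed[OF x])
  have "swe P x (\<lambda>\<alpha> u \<beta> v. counit H v \<odot>\<^bsub>P\<^esub> F \<alpha> \<beta> u) = swe P x (\<lambda>\<alpha> u \<beta> v. F \<xi> 0 (counit H v \<odot>\<^bsub>H\<^esub> u))"
  proof (rule swe_homogeneous_cong[OF x])
    fix \<alpha> u \<beta> v assume h: "u \<in> grade H \<alpha>" "v \<in> grade H \<beta>" "u \<in> carrier H" "v \<in> carrier H" "\<alpha> + \<beta> = \<xi>"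
    then show "counit H v \<odot>\<^bsub>P\<^esub> F \<alpha> \<beta> u = F \<xi> 0 (counit H v \<odot>\<^bsub>H\<^esub> u)"
      using counit_zero[OF h(2)] linear_map_closed[OF F h(3)]
      by (cases "\<beta> = 0") (simp_all add: linear_map_smult[OF F] linear_map_zero[OF module_axioms P F])
  qed
  also have "\<dots> = F \<xi> 0 (swe H x (\<lambda>\<alpha> u \<beta> v. counit H v \<odot>\<^bsub>H\<^esub> u))"
    by (rule swe_linear_map[OF module_axioms P F xc, symmetric]) simp
  also have "swe H x (\<lambda>\<alpha> u \<beta> v. counit H v \<odot>\<^bsub>H\<^esub> u) = x" by (rule swe_counit_id(2)[OF xc])
  finally show ?thesis .
qed

lemma swe_antipode:
  assumes x: "x \<in> carrier H" and P: "module K P" and F: "linear_map K H P F"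
  shows "swe P x (\<lambda>\<alpha> u \<beta> v. F (antipode H u \<otimes>\<^bsub>H\<^esub> v)) = counit H x \<odot>\<^bsub>P\<^esub> F \<one>\<^bsub>H\<^esub>"
    and "swe P x (\<lambda>\<alpha> u \<beta> v. F (u \<otimes>\<^bsub>H\<^esub> antipode H v)) = counit H x \<odot>\<^bsub>P\<^esub> F \<one>\<^bsub>H\<^esub>"
proof -
  have "swe H x (\<lambda>\<alpha> u \<beta> v. antipode H u \<otimes>\<^bsub>H\<^esub> v) = counit H x \<odot>\<^bsub>H\<^esub> \<one>\<^bsub>H\<^esub>"
    by (subst tsum_comult[OF module_axioms _ x, symmetric])
      (auto intro!: bilinear_mapI lin simp: antipode_left[OF x])
  then have "F (swe H x (\<lambda>\<alpha> u \<beta> v. antipode H u \<otimes>\<^bsub>H\<^esub> v)) = counit H x \<odot>\<^bsub>P\<^esub> F \<one>\<^bsub>H\<^esub>"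
    using x by (simp add: linear_map_smult[OF F])
  then show "swe P x (\<lambda>\<alpha> u \<beta> v. F (antipode H u \<otimes>\<^bsub>H\<^esub> v)) = counit H x \<odot>\<^bsub>P\<^esub> F \<one>\<^bsub>H\<^esub>"
    by (subst (asm) swe_linear_map[OF module_axioms P F x]) simp_all
  have "swe H x (\<lambda>\<alpha> u \<beta> v. u \<otimes>\<^bsub>H\<^esub> antipode H v) = counit H x \<odot>\<^bsub>H\<^esub> \<one>\<^bsub>H\<^esub>"
    by (subst tsum_comult[OF module_axioms _ x, symmetric])
      (auto intro!: bilinear_mapI lin simp: antipode_right[OF x])
  then have "F (swe H x (\<lambda>\<alpha> u \<beta> v. u \<otimes>\<^bsub>H\<^esub> antipode H v)) = counit H x \<odot>\<^bsub>P\<^esub> F \<one>\<^bsub>H\<^esub>"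
    using x by (simp add: linear_map_smult[OF F])
  then show "swe P x (\<lambda>\<alpha> u \<beta> v. F (u \<otimes>\<^bsub>H\<^esub> antipode H v)) = counit H x \<odot>\<^bsub>P\<^esub> F \<one>\<^bsub>H\<^esub>"
    by (subst (asm) swe_linear_map[OF module_axioms P F x]) simp_all
qed

end

lemma (in hopf_algebra) antipode_one: "antipode H \<one>\<^bsub>H\<^esub> = \<one>\<^bsub>H\<^esub>"
proof -
  have "swe H \<one>\<^bsub>H\<^esub> (\<lambda>\<alpha> u \<beta> v. antipode H u \<otimes>\<^bsub>H\<^esub> v) = counit H \<one>\<^bsub>H\<^esub> \<odot>\<^bsub>H\<^esub> \<one>\<^bsub>H\<^esub>"
    by (rule swe_antipode(1)[where F = "\<lambda>x. x"]) (auto intro: lin module_axioms)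
  moreover have "counit H \<one>\<^bsub>H\<^esub> = \<one>" using counit_hom by (simp add: graded_algebra_hom_def)
  moreover have "swe H \<one>\<^bsub>H\<^esub> (\<lambda>\<alpha> u \<beta> v. antipode H u \<otimes>\<^bsub>H\<^esub> v) = antipode H \<one>\<^bsub>H\<^esub> \<otimes>\<^bsub>H\<^esub> \<one>\<^bsub>H\<^esub>"
    by (rule swe_one) (auto intro!: graded_bilinearI lin module_axioms)
  ultimately show ?thesis by simp
qed

lemma (in hopf_algebra) counit_one: "counit H \<one>\<^bsub>H\<^esub> = \<one>"
  using counit_hom by (simp add: graded_algebra_hom_def)

text \<open>Gives the degrees of Sweedler sums: the relation between the degrees of the legs is
  available because \<open>t\<close> is homogeneous.\<close>

lemma (in graded_pair) gsum_submodule: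
  assumes "module K P" "submodule S K P" "t \<in> tensor_grade K M N \<gamma>"
    and "\<And>\<alpha> x \<beta> y. \<lbrakk>x \<in> grade M \<alpha>; y \<in> grade N \<beta>; x \<in> carrier M; y \<in> carrier N; \<alpha> + \<beta> = \<gamma>\<rbrakk> \<Longrightarrow> b \<alpha> x \<beta> y \<in> S"
  shows "gsum K M N P t b \<in> S"
proof -
  interpret P: module K P by fact
  have z: "\<zero>\<^bsub>P\<^esub> \<in> S" using subgroup.one_closed[OF submodule.axioms(1)[OF assms(2)]] by simp
  have "(\<And>i. i \<in> set xs \<Longrightarrow> F i \<in> S) \<Longrightarrow> lsum P xs F \<in> S" for xs :: "'i list" and F
    using P.submoduleE(5)[OF assms(2)] z by (induction xs) auto
  then show ?thesis unfolding gsum_def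
    by this (use hrep[OF tensor_grade_closed[OF assms(3)]] assms(3,4) M.grade_closed N.grade_closed in
      \<open>fastforce simp: homogeneous_rep_def\<close>)
qed

section \<open>Hopf pairings\<close>

text \<open>Naming application keeps pairings first-order, so that rules about them unify.\<close>

definition ev :: "('a \<Rightarrow> 'b) \<Rightarrow> 'a \<Rightarrow> 'b"
  where "ev f x = f x"

text \<open>What the construction uses about evaluation, detached from the encoding of the finite
  dual. \<open>ev_comult\<close> reverses the product because the dual is the opposite one; it
  carries no sign because on non-zero summands the sign in the defining formula equals the sign of
  the pairing of tensor squares. \<open>antipode_eq_ev\<close> expresses
  \<open>S\<^sub>0 f = f \<circ> S\<^sup>-\<^sup>1\<close> without an inverse map.\<close>

locale hopf_pairing = commutative_factor K \<omega> + H: hopf_algebra K \<omega> H + V: hopf_algebra K \<omega> V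
  for K :: "('k, 's) ring_scheme" (structure) and \<omega> :: "'g::ab_group_add \<Rightarrow> 'g \<Rightarrow> 'k"
    and H :: "('k, 'a, 'g, 'm) hopf_scheme" and V :: "('k, 'a \<Rightarrow> 'k, 'g, 'n) hopf_scheme" +
  assumes ev_right: "f \<in> carrier V \<Longrightarrow> linear_map K H (scalars K :: ('k, 'k, 'g) graded_module) (ev f)"
    and ev_left: "x \<in> carrier H \<Longrightarrow> linear_map K V (scalars K :: ('k, 'k, 'g) graded_module) (\<lambda>f. ev f x)"
    and ev_degree: "\<lbrakk>f \<in> grade V \<phi>; x \<in> grade H \<xi>\<rbrakk> \<Longrightarrow> ev f x = \<zero> \<or> \<phi> = - \<xi>"
    and ev_mult: "\<lbrakk>f \<in> carrier V; g \<in> grade V \<gamma>; x \<in> carrier H\<rbrakk> \<Longrightarrow>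
      ev (f \<otimes>\<^bsub>V\<^esub> g) x = H.swe (scalars K :: ('k, 'k, 'g) graded_module) x (\<lambda>\<alpha> u \<beta> v. \<omega> \<gamma> \<alpha> \<otimes> (ev f u \<otimes> ev g v))"
    and ev_comult: "\<lbrakk>f \<in> carrier V; x \<in> carrier H; y \<in> carrier H\<rbrakk> \<Longrightarrow>
      ev f (y \<otimes>\<^bsub>H\<^esub> x) = V.swe (scalars K :: ('k, 'k, 'g) graded_module) f (\<lambda>\<alpha> f1 \<beta> f2. ev f1 x \<otimes> ev f2 y)"
    and ev_one: "x \<in> carrier H \<Longrightarrow> ev \<one>\<^bsub>V\<^esub> x = counit H x"
    and counit_eq_ev: "f \<in> carrier V \<Longrightarrow> counit V f = ev f \<one>\<^bsub>H\<^esub>"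
    and antipode_eq_ev: "\<lbrakk>f \<in> carrier V; x \<in> carrier H\<rbrakk> \<Longrightarrow>
      ev (antipode V f) (antipode H x) = ev f x"
    and antipode_bij: "bij_betw (antipode H) (carrier H) (carrier H)"
begin

abbreviation Ks :: "('k, 'k, 'g) graded_module" where "Ks \<equiv> scalars K"

lemmas modules [simp] = H.module_axioms V.module_axioms module_scalars

lemma lin_ev_left [lin]:
  "\<lbrakk>linear_map K Q V f; x \<in> carrier H\<rbrakk> \<Longrightarrow> linear_map K Q Ks (\<lambda>z. ev (f z) x)"
  by (rule linear_map_compose[OF _ ev_left])

lemma lin_ev_right [lin]:
  "\<lbrakk>linear_map K Q H g; f \<in> carrier V\<rbrakk> \<Longrightarrow> linear_map K Q Ks (\<lambda>z. ev f (g z))"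
  by (rule linear_map_compose[OF _ ev_right])

lemmas [lin] = ev_right

lemma ev_closed [simp, intro]: "\<lbrakk>f \<in> carrier V; x \<in> carrier H\<rbrakk> \<Longrightarrow> ev f x \<in> carrier K"
  using linear_map_closed[OF ev_right] by simp

text \<open>The coefficient of the left action; it is the value of \<open>f\<close> at
  \<open>Sinv x\<close>, by \<open>q_eq_ev_Sinv\<close>.\<close>

abbreviation "q f x \<equiv> ev (antipode V f) x"

lemma q_degree: "\<lbrakk>f \<in> grade V \<phi>; x \<in> grade H \<xi>\<rbrakk> \<Longrightarrow> q f x = \<zero> \<or> \<phi> = - \<xi>"
  using V.antipode_grade ev_degree by blast

definition "Sinv = inv_into (carrier H) (antipode H)"

lemma Sinv:
  assumes "x \<in> carrier H"
  shows Sinv_closed [simp, intro]: "Sinv x \<in> carrier H" and antipode_Sinv [simp]: "antipode H (Sinv x) = x"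
  using antipode_bij assms unfolding Sinv_def
  by (metis bij_betw_imp_surj_on inv_into_into, metis bij_betw_imp_surj_on f_inv_into_f)

lemma antipode_inj: "\<lbrakk>antipode H x = antipode H y; x \<in> carrier H; y \<in> carrier H\<rbrakk> \<Longrightarrow> x = y"
  using antipode_bij by (auto simp: bij_betw_def inj_on_def)

text \<open>The antipode preserves degrees, so it maps the components of \<open>Sinv x\<close> to
  those of \<open>x\<close>. The latter vanish outside degree \<open>\<xi>\<close>, and injectivity
  gives the same for the former.\<close>

lemma Sinv_grade: "x \<in> grade H \<xi> \<Longrightarrow> Sinv x \<in> grade H \<xi>"
proof -
  assume x: "x \<in> grade H \<xi>"
  then have xc: "x \<in> carrier H" by (rule H.grade_closed)
  let ?y = "Sinv x"
  have y: "?y \<in> carrier H" using xc by simp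
  have "hcomp H (antipode H ?y) = (\<lambda>\<gamma>. antipode H (hcomp H ?y \<gamma>))"
  proof (rule H.hcomp_unique)
    show "homogeneous_decomposition H (antipode H ?y) (\<lambda>\<gamma>. antipode H (hcomp H ?y \<gamma>))"
    proof (rule H.homogeneous_decompositionI[OF _ H.finite_hsupp[OF y]])
      show "antipode H ?y = (\<Oplus>\<^bsub>H\<^esub>\<gamma>\<in>hsupp H ?y. antipode H (hcomp H ?y \<gamma>))"
        by (subst (1) H.finsum_hcomp[OF y], rule H.linear_map_finsum[OF H.module_axioms H.antipode_linear])
          (auto simp: y H.finite_hsupp H.hcomp_closed)
    qed (use H.antipode_grade H.hcomp_grade[OF y] linear_map_zero[OF H.module_axioms H.module_axioms H.antipode_linear] in \<open>auto simp: hsupp_def\<close>)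
  qed (use y in simp)
  note e = this
  have "antipode H (hcomp H ?y \<gamma>) = antipode H \<zero>\<^bsub>H\<^esub>" if "\<gamma> \<noteq> \<xi>" for \<gamma>
    using that xc fun_cong[OF e[symmetric], of \<gamma>] by (simp add: H.hcomp_homogeneous[OF x]
        linear_map_zero[OF H.module_axioms H.module_axioms H.antipode_linear])
  then have "hcomp H ?y \<gamma> = \<zero>\<^bsub>H\<^esub>" if "\<gamma> \<noteq> \<xi>" for \<gamma>
    using that antipode_inj H.hcomp_closed[OF y] by blast
  then have "?y = (\<Oplus>\<^bsub>H\<^esub>\<gamma>\<in>{\<xi>}. hcomp H ?y \<gamma>)"
    by (intro H.finsum_hcomp_superset[OF y]) (auto simp: hsupp_def)
  then have "?y = hcomp H ?y \<xi>" using H.hcomp_closed[OF y] by simp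
  then show ?thesis using H.hcomp_grade[OF y, of \<xi>] by metis
qed

lemma q_eq_ev_Sinv: "\<lbrakk>f \<in> carrier V; x \<in> carrier H\<rbrakk> \<Longrightarrow> q f x = ev f (Sinv x)"
  using antipode_eq_ev[of f "Sinv x"] by simp

lemma Sinv_mult:
  assumes "x \<in> grade H \<xi>" "y \<in> grade H \<eta>"
  shows "Sinv (x \<otimes>\<^bsub>H\<^esub> y) = \<omega> \<xi> \<eta> \<odot>\<^bsub>H\<^esub> (Sinv y \<otimes>\<^bsub>H\<^esub> Sinv x)"
proof -
  have c: "x \<in> carrier H" "y \<in> carrier H" using assms H.grade_closed by auto
  show ?thesis
    by (rule antipode_inj)
      (use c H.antipode_mult[OF Sinv_grade[OF assms(2)] Sinv_grade[OF assms(1)]] in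
        \<open>simp_all add: linear_map_smult[OF H.antipode_linear] H.smult_assoc1[symmetric]\<close>)
qed

text \<open>The inverse of the antipode satisfies the antipode axiom with the legs interchanged,
  \<open>\<omega> \<alpha> \<beta>\<close> being the sign of the interchange. Applying the injective
  antipode reverses the product, cancels this sign and leaves the antipode axiom.\<close>

lemma Sinv_convolution_left:
  assumes "x \<in> carrier H"
  shows "H.swe H x (\<lambda>\<alpha> u \<beta> v. \<omega> \<alpha> \<beta> \<odot>\<^bsub>H\<^esub> (Sinv v \<otimes>\<^bsub>H\<^esub> u)) = counit H x \<odot>\<^bsub>H\<^esub> \<one>\<^bsub>H\<^esub>"
proof (rule antipode_inj)
  have "antipode H (H.swe H x (\<lambda>\<alpha> u \<beta> v. \<omega> \<alpha> \<beta> \<odot>\<^bsub>H\<^esub> (Sinv v \<otimes>\<^bsub>H\<^esub> u))) =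
      H.swe H x (\<lambda>\<alpha> u \<beta> v. antipode H (\<omega> \<alpha> \<beta> \<odot>\<^bsub>H\<^esub> (Sinv v \<otimes>\<^bsub>H\<^esub> u)))"
    by (rule H.swe_linear_map[OF _ _ H.antipode_linear assms]) simp_all
  also have "\<dots> = H.swe H x (\<lambda>\<alpha> u \<beta> v. antipode H u \<otimes>\<^bsub>H\<^esub> v)"
    by (rule H.swe_cong[OF assms])
      (simp add: linear_map_smult[OF H.antipode_linear] H.antipode_mult[OF Sinv_grade]
        H.smult_assoc1[symmetric])
  also have "\<dots> = counit H x \<odot>\<^bsub>H\<^esub> \<one>\<^bsub>H\<^esub>"
    by (rule H.swe_antipode(1)[where F = "\<lambda>x. x"]) (auto intro: lin assms)
  finally show "antipode H (H.swe H x (\<lambda>\<alpha> u \<beta> v. \<omega> \<alpha> \<beta> \<odot>\<^bsub>H\<^esub> (Sinv v \<otimes>\<^bsub>H\<^esub> u))) =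
      antipode H (counit H x \<odot>\<^bsub>H\<^esub> \<one>\<^bsub>H\<^esub>)"
    using assms by (simp add: linear_map_smult[OF H.antipode_linear] H.antipode_one)
qed (use assms in \<open>auto intro!: H.swe_closed\<close>)

text \<open>The antipode of the dual produces the sign \<open>\<omega> \<phi> \<gamma>\<close> and
  the product formula the sign \<open>\<omega> \<phi> \<alpha>\<close>. They cancel, because
  \<open>q g u\<close> vanishes unless \<open>\<alpha> = - \<gamma>\<close>.\<close>

lemma q_mult:
  assumes "f \<in> grade V \<phi>" "g \<in> grade V \<gamma>" "x \<in> carrier H"
  shows "q (f \<otimes>\<^bsub>V\<^esub> g) x = H.swe Ks x (\<lambda>\<alpha> u \<beta> v. q g u \<otimes> q f v)"
proof -
  have c: "f \<in> carrier V" "g \<in> carrier V" using assms V.grade_closed by auto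
  have Sf: "antipode V f \<in> grade V \<phi>" "antipode V g \<in> grade V \<gamma>" using assms V.antipode_grade by blast+
  have "q (f \<otimes>\<^bsub>V\<^esub> g) x = \<omega> \<phi> \<gamma> \<otimes> ev (antipode V g \<otimes>\<^bsub>V\<^esub> antipode V f) x"
    using c assms(3) linear_map_smult[OF ev_left[OF assms(3)]] by (simp add: V.antipode_mult[OF assms(1,2)])
  also have "\<dots> = \<omega> \<phi> \<gamma> \<odot>\<^bsub>Ks\<^esub> H.swe Ks x (\<lambda>\<alpha> u \<beta> v. \<omega> \<phi> \<alpha> \<otimes> (q g u \<otimes> q f v))"
    using c by (simp add: ev_mult[OF _ Sf(1) assms(3)])
  also have "\<dots> = H.swe Ks x (\<lambda>\<alpha> u \<beta> v. \<omega> \<phi> \<gamma> \<odot>\<^bsub>Ks\<^esub> (\<omega> \<phi> \<alpha> \<otimes> (q g u \<otimes> q f v)))"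
    by (rule H.swe_smult) (use c assms in auto)
  also have "\<dots> = H.swe Ks x (\<lambda>\<alpha> u \<beta> v. q g u \<otimes> q f v)"
  proof (rule H.swe_cong[OF assms(3)])
    fix \<alpha> u \<beta> v assume h: "u \<in> grade H \<alpha>" "v \<in> grade H \<beta>" "u \<in> carrier H" "v \<in> carrier H"
    show "\<omega> \<phi> \<gamma> \<odot>\<^bsub>Ks\<^esub> (\<omega> \<phi> \<alpha> \<otimes> (q g u \<otimes> q f v)) = q g u \<otimes> q f v"
      using q_degree[OF assms(2) h(1)] c h by auto
  qed
  finally show ?thesis .
qed

text \<open>Two reversals cancel: \<open>Sinv\<close> reverses the product, with sign
  \<open>\<omega> \<xi> \<eta>\<close>, and the opposite co-multiplication reverses it
  again.\<close>

lemma q_comult: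
  assumes "f \<in> carrier V" "x \<in> grade H \<xi>" "y \<in> grade H \<eta>"
  shows "q f (x \<otimes>\<^bsub>H\<^esub> y) = \<omega> \<xi> \<eta> \<otimes> V.swe Ks f (\<lambda>\<alpha> f1 \<beta> f2. q f1 x \<otimes> q f2 y)"
proof -
  have c: "x \<in> carrier H" "y \<in> carrier H" using assms H.grade_closed by auto
  have "q f (x \<otimes>\<^bsub>H\<^esub> y) = \<omega> \<xi> \<eta> \<otimes> ev f (Sinv y \<otimes>\<^bsub>H\<^esub> Sinv x)"
    using c assms linear_map_smult[OF ev_right[OF assms(1)]] by (simp add: q_eq_ev_Sinv Sinv_mult[OF assms(2,3)])
  also have "ev f (Sinv y \<otimes>\<^bsub>H\<^esub> Sinv x) = V.swe Ks f (\<lambda>\<alpha> f1 \<beta> f2. q f1 x \<otimes> q f2 y)"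
    using c assms by (subst ev_comult) (auto intro!: V.swe_cong simp: q_eq_ev_Sinv)
  finally show ?thesis .
qed

text \<open>\<open>q\<close> is a right convolution inverse of evaluation. The sign
  \<open>\<omega> \<phi>2 \<xi>1\<close> becomes \<open>\<omega> \<xi>1 \<xi>2\<close>, since
  \<open>q f2 x2\<close> forces \<open>\<phi>2 = - \<xi>2\<close>; then the sum over the legs of
  \<open>f\<close> is \<open>f\<close> at the product of \<open>Sinv x2\<close> and
  \<open>x1\<close>, and \<open>Sinv_convolution_left\<close> applies.\<close>

lemma ev_q_convolution:
  assumes "f \<in> carrier V" "x \<in> carrier H"
  shows "V.swe Ks f (\<lambda>\<phi>1 f1 \<phi>2 f2. H.swe Ks x (\<lambda>\<xi>1 x1 \<xi>2 x2. \<omega> \<phi>2 \<xi>1 \<otimes> (ev f1 x1 \<otimes> q f2 x2))) =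
    counit V f \<otimes> counit H x"
proof -
  have "V.swe Ks f (\<lambda>\<phi>1 f1 \<phi>2 f2. H.swe Ks x (\<lambda>\<xi>1 x1 \<xi>2 x2. \<omega> \<phi>2 \<xi>1 \<otimes> (ev f1 x1 \<otimes> q f2 x2))) =
      V.swe Ks f (\<lambda>\<phi>1 f1 \<phi>2 f2. H.swe Ks x (\<lambda>\<xi>1 x1 \<xi>2 x2. \<omega> \<xi>1 \<xi>2 \<odot>\<^bsub>Ks\<^esub> (ev f1 x1 \<otimes> ev f2 (Sinv x2))))"
  proof (rule V.swe_cong[OF assms(1)], rule H.swe_cong[OF assms(2)])
    fix \<phi>1 f1 \<phi>2 f2 \<xi>1 x1 \<xi>2 x2
    assume h: "f1 \<in> carrier V" "f2 \<in> grade V \<phi>2" "f2 \<in> carrier V" "x1 \<in> carrier H" "x2 \<in> grade H \<xi>2" "x2 \<in> carrier H"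
    show "\<omega> \<phi>2 \<xi>1 \<otimes> (ev f1 x1 \<otimes> q f2 x2) = \<omega> \<xi>1 \<xi>2 \<odot>\<^bsub>Ks\<^esub> (ev f1 x1 \<otimes> ev f2 (Sinv x2))"
      using q_degree[OF h(2,5)] h by (auto simp: q_eq_ev_Sinv)
  qed
  also have "\<dots> = H.swe Ks x (\<lambda>\<xi>1 x1 \<xi>2 x2. V.swe Ks f (\<lambda>\<phi>1 f1 \<phi>2 f2. \<omega> \<xi>1 \<xi>2 \<odot>\<^bsub>Ks\<^esub> (ev f1 x1 \<otimes> ev f2 (Sinv x2))))"
    by (rule gsum_swap) (use assms H.grade_closed V.grade_closed in
      \<open>auto intro!: graded_pair.intro H.graded_module_axioms V.graded_module_axioms module.axioms(2)[OF module_scalars]\<close>)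
  also have "\<dots> = H.swe Ks x (\<lambda>\<xi>1 x1 \<xi>2 x2. ev f (\<omega> \<xi>1 \<xi>2 \<odot>\<^bsub>H\<^esub> (Sinv x2 \<otimes>\<^bsub>H\<^esub> x1)))"
    by (rule H.swe_cong[OF assms(2)], subst V.swe_smult[symmetric])
      (use assms in \<open>auto simp: linear_map_smult[OF ev_right] ev_comult\<close>)
  also have "\<dots> = ev f (H.swe H x (\<lambda>\<xi>1 x1 \<xi>2 x2. \<omega> \<xi>1 \<xi>2 \<odot>\<^bsub>H\<^esub> (Sinv x2 \<otimes>\<^bsub>H\<^esub> x1)))"
    by (rule H.swe_linear_map[symmetric]) (use assms in \<open>auto intro: lin\<close>)
  also have "\<dots> = counit V f \<otimes> counit H x"
    using assms by (simp add: Sinv_convolution_left linear_map_smult[OF ev_right] counit_eq_ev m_comm)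
  finally show ?thesis .
qed

end

lemma (in hopf_algebra) swe_submodule:
  assumes "module K P" "submodule S K P" "x \<in> grade H \<xi>"
    and "\<And>\<alpha> u \<beta> v. \<lbrakk>u \<in> grade H \<alpha>; v \<in> grade H \<beta>; u \<in> carrier H; v \<in> carrier H; \<alpha> + \<beta> = \<xi>\<rbrakk> \<Longrightarrow> b \<alpha> u \<beta> v \<in> S"
  shows "swe P x b \<in> S"
proof -
  interpret HH: graded_pair K H H ..
  show ?thesis by (rule HH.gsum_submodule[OF assms(1,2) comult_grade[OF assms(3)] assms(4)])
qed

lemma (in hopf_algebra) swe_scalars_closed:
  assumes "x \<in> carrier H"
    and "\<And>\<alpha> u \<beta> v. \<lbrakk>u \<in> grade H \<alpha>; v \<in> grade H \<beta>; u \<in> carrier H; v \<in> carrier H\<rbrakk> \<Longrightarrow> b \<alpha> u \<beta> v \<in> carrier K"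
  shows "swe (scalars K) x b \<in> carrier K"
  using swe_closed[OF module_scalars assms(1), of b] assms(2) by simp

lemma swe_swap:
  assumes "hopf_algebra K \<omega> H" "hopf_algebra K \<omega> H'" "module K P" "x \<in> carrier H" "y \<in> carrier H'"
    and cl: "\<And>\<alpha> u \<beta> v \<gamma> w \<delta> z. \<lbrakk>u \<in> grade H \<alpha>; v \<in> grade H \<beta>; w \<in> grade H' \<gamma>; z \<in> grade H' \<delta>;
        u \<in> carrier H; v \<in> carrier H; w \<in> carrier H'; z \<in> carrier H'\<rbrakk> \<Longrightarrow> b \<alpha> u \<beta> v \<gamma> w \<delta> z \<in> carrier P"
  shows "gsum K H H P (comult H x) (\<lambda>\<alpha> u \<beta> v. gsum K H' H' P (comult H' y) (b \<alpha> u \<beta> v)) =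
    gsum K H' H' P (comult H' y) (\<lambda>\<gamma> w \<delta> z. gsum K H H P (comult H x) (\<lambda>\<alpha> u \<beta> v. b \<alpha> u \<beta> v \<gamma> w \<delta> z))"
proof -
  interpret H: hopf_algebra K \<omega> H by fact
  interpret H': hopf_algebra K \<omega> H' by fact
  show ?thesis
    by (rule gsum_swap)
      (use assms(3-5) H.grade_closed H'.grade_closed in
        \<open>auto intro!: graded_pair.intro H.graded_module_axioms H'.graded_module_axioms
          module.axioms(2)[OF assms(3)] cl\<close>)
qed

lemma graded_bilinearD:
  assumes "graded_bilinear K M N P b"
  shows "y \<in> carrier N \<Longrightarrow> linear_map K M P (\<lambda>x. b \<alpha> x \<beta> y)"
    and "x \<in> carrier M \<Longrightarrow> linear_map K N P (b \<alpha> x \<beta>)"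
    and "\<lbrakk>x \<in> carrier M; y \<in> carrier N\<rbrakk> \<Longrightarrow> b \<alpha> x \<beta> y \<in> carrier P"
  using assms linear_map_closed[of K N P "b \<alpha> x \<beta>" y]
  by (auto simp: graded_bilinear_def bilinear_map_def)

section \<open>The two actions\<close>

context hopf_pairing
begin

lemmas swap_VH = swe_swap[OF V.hopf_algebra_axioms H.hopf_algebra_axioms]
  and swap_VV = swe_swap[OF V.hopf_algebra_axioms V.hopf_algebra_axioms]

text \<open>
  From here on short names stand for the structure maps of the paper: \<open>la\<close> and \<open>ra\<close> for the two
  actions, \<open>psi\<close> for \<open>\<psi>\<close>, and \<open>dm\<close>, \<open>cm\<close>, \<open>ce\<close>, \<open>an\<close> for multiplication, co-multiplication,
  co-unit and antipode of the double.
\<close>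

definition "la f x = H.swe H x (\<lambda>\<alpha> u \<beta> v. q f u \<odot>\<^bsub>H\<^esub> v)"
definition "ra f x = V.swe V f (\<lambda>\<alpha> f1 \<beta> f2. ev f2 x \<odot>\<^bsub>V\<^esub> f1)"

lemma la_closed [simp, intro]: "\<lbrakk>f \<in> carrier V; x \<in> carrier H\<rbrakk> \<Longrightarrow> la f x \<in> carrier H"
  unfolding la_def by (auto intro!: H.swe_closed)

lemma ra_closed [simp, intro]: "\<lbrakk>f \<in> carrier V; x \<in> carrier H\<rbrakk> \<Longrightarrow> ra f x \<in> carrier V"
  unfolding ra_def by (auto intro!: V.swe_closed)

lemma lin_la [lin]:
  "\<lbrakk>linear_map K Q H g; f \<in> carrier V\<rbrakk> \<Longrightarrow> linear_map K Q H (\<lambda>z. la f (g z))"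
  "\<lbrakk>linear_map K Q V h; x \<in> carrier H; module K Q\<rbrakk> \<Longrightarrow> linear_map K Q H (\<lambda>z. la (h z) x)"
  unfolding la_def by (auto intro!: lin graded_bilinearI)

lemma lin_ra [lin]:
  "\<lbrakk>linear_map K Q V h; x \<in> carrier H\<rbrakk> \<Longrightarrow> linear_map K Q V (\<lambda>z. ra (h z) x)"
  "\<lbrakk>linear_map K Q H g; f \<in> carrier V; module K Q\<rbrakk> \<Longrightarrow> linear_map K Q V (\<lambda>z. ra f (g z))"
  unfolding ra_def by (auto intro!: lin graded_bilinearI)

lemmas lin_la_eta [lin] = lin_la(1)[OF lin_id]
lemmas lin_ra_eta [lin] = lin_ra(2)[OF lin_id]

lemma la_grade: "\<lbrakk>f \<in> grade V \<phi>; x \<in> grade H \<xi>\<rbrakk> \<Longrightarrow> la f x \<in> grade H (\<phi> + \<xi>)"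
  unfolding la_def
proof (rule H.swe_submodule[OF _ H.grade_submodule], simp, assumption)
  fix \<alpha> u \<beta> v
  assume h: "f \<in> grade V \<phi>" "x \<in> grade H \<xi>" "u \<in> grade H \<alpha>" "v \<in> grade H \<beta>" "u \<in> carrier H" "v \<in> carrier H" "\<alpha> + \<beta> = \<xi>"
  \<comment> \<open>A non-zero coefficient forces \<open>\<alpha> = - \<phi>\<close>, so the
    remaining leg \<open>v\<close> has degree \<open>\<phi> + \<xi>\<close>.\<close>
  show "q f u \<odot>\<^bsub>H\<^esub> v \<in> grade H (\<phi> + \<xi>)"
    using q_degree[OF h(1,3)] h V.grade_closed[OF h(1)]
    by (auto simp: H.grade_smult H.grade_zero)
qed

lemma ra_grade: "\<lbrakk>f \<in> grade V \<phi>; x \<in> grade H \<xi>\<rbrakk> \<Longrightarrow> ra f x \<in> grade V (\<phi> + \<xi>)"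
  unfolding ra_def
proof (rule V.swe_submodule[OF _ V.grade_submodule], simp, assumption)
  fix \<alpha> u \<beta> v
  assume h: "f \<in> grade V \<phi>" "x \<in> grade H \<xi>" "u \<in> grade V \<alpha>" "v \<in> grade V \<beta>" "u \<in> carrier V" "v \<in> carrier V" "\<alpha> + \<beta> = \<phi>"
  show "ev v x \<odot>\<^bsub>V\<^esub> u \<in> grade V (\<phi> + \<xi>)"
    using ev_degree[OF h(4,2)] h H.grade_closed[OF h(2)]
    by (auto simp: V.grade_smult V.grade_zero)
qed

text \<open>\<open>q\<close> is anti-multiplicative, so \<open>g\<close> is paired with the first
  leg of \<open>x\<close> and \<open>f\<close> with the second. By coassociativity this is acting
  with \<open>g\<close> and then with \<open>f\<close>.\<close>

lemma la_mult:
  assumes "f \<in> grade V \<phi>" "g \<in> grade V \<gamma>" "x \<in> carrier H"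
  shows "la (f \<otimes>\<^bsub>V\<^esub> g) x = la f (la g x)"
proof -
  have c [simp]: "f \<in> carrier V" "g \<in> carrier V" using assms V.grade_closed by auto
  note [simp] = assms(3)
  have "la (f \<otimes>\<^bsub>V\<^esub> g) x = H.swe H x (\<lambda>\<alpha> u \<beta> w. H.swe H u (\<lambda>\<alpha> u \<beta> v. (q g u \<otimes> q f v) \<odot>\<^bsub>H\<^esub> w))"
    unfolding la_def
    by (rule H.swe_cong) (simp_all add: q_mult[OF assms(1,2)] H.swe_scalar)
  also have "\<dots> = H.swe H x (\<lambda>\<alpha> u \<beta> v. H.swe H v (\<lambda>\<beta> v \<gamma> w. (q g u \<otimes> q f v) \<odot>\<^bsub>H\<^esub> w))"
    by (rule H.swe_coassoc) (auto intro!: lin graded_trilinearI)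
  also have "\<dots> = H.swe H x (\<lambda>\<alpha> u \<beta> v. q g u \<odot>\<^bsub>H\<^esub> la f v)"
    unfolding la_def
    by (rule H.swe_cong) (auto simp: H.swe_smult H.smult_assoc1 intro!: H.swe_cong)
  also have "\<dots> = la f (la g x)"
    unfolding la_def[of g]
    by (subst H.swe_linear_map[of H H "la f"]) (auto intro!: lin H.swe_cong simp: linear_map_smult[OF lin_la_eta])
  finally show ?thesis .
qed

text \<open>The left action uses up a first leg of \<open>x\<close>. By coassociativity the last leg
  of \<open>la f x\<close> is a last leg of \<open>x\<close>, and only the first one has been acted
  upon; \<open>\<phi> + \<alpha>\<close> is its degree.\<close>

lemma la_comult:
  assumes P: "module K P" and b: "graded_bilinear K H H P b" and f: "f \<in> grade V \<phi>" and x: "x \<in> carrier H"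
  shows "H.swe P (la f x) b = H.swe P x (\<lambda>\<alpha> u \<beta> v. b (\<phi> + \<alpha>) (la f u) \<beta> v)"
proof -
  interpret P: module K P by (rule P)
  have fc [simp]: "f \<in> carrier V" by (rule V.grade_closed[OF f])
  note [simp] = x P
  have bl: "linear_map K H P (\<lambda>x. b \<alpha> x \<beta> y)" "linear_map K H P (b \<alpha> y \<beta>)" if "y \<in> carrier H" for \<alpha> \<beta> y
    using b that by (auto simp: graded_bilinear_def bilinear_map_def)
  have bc: "b \<alpha> x \<beta> y \<in> carrier P" if "x \<in> carrier H" "y \<in> carrier H" for \<alpha> \<beta> x y
    using bl(2)[OF that(1)] that(2) by (rule linear_map_closed)
  have L: "linear_map K H P (\<lambda>z. H.swe P z b)" by (intro lin P b)
  have "H.swe P (la f x) b = H.swe P x (\<lambda>\<alpha> u \<beta> v. q f u \<odot>\<^bsub>P\<^esub> H.swe P v b)"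
    unfolding la_def
    by (subst H.swe_linear_map[OF _ P L]) (auto intro!: H.swe_cong simp: linear_map_smult[OF L])
  also have "\<dots> = H.swe P x (\<lambda>\<alpha> u \<beta> v. H.swe P v (\<lambda>\<beta> v \<gamma> w. q f u \<odot>\<^bsub>P\<^esub> b \<beta> v \<gamma> w))"
    by (rule H.swe_cong) (simp_all add: H.swe_smult bc)
  also have "\<dots> = H.swe P x (\<lambda>\<alpha> u \<gamma> w. H.swe P u (\<lambda>\<alpha> u \<beta> v. q f u \<odot>\<^bsub>P\<^esub> b \<beta> v \<gamma> w))"
    by (rule H.swe_coassoc[symmetric]) (auto intro!: lin graded_trilinearI bl bc)
  also have "\<dots> = H.swe P x (\<lambda>\<alpha> u \<gamma> w. b (\<phi> + \<alpha>) (la f u) \<gamma> w)"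
  proof (rule H.swe_cong[OF x])
    fix \<alpha> u \<gamma> w assume h: "u \<in> grade H \<alpha>" "u \<in> carrier H" "w \<in> carrier H"
    have "H.swe P u (\<lambda>\<alpha> u \<beta> v. q f u \<odot>\<^bsub>P\<^esub> b \<beta> v \<gamma> w) = H.swe P u (\<lambda>\<alpha>' u \<beta> v. b (\<phi> + \<alpha>) (q f u \<odot>\<^bsub>H\<^esub> v) \<gamma> w)"
    proof (rule H.swe_homogeneous_cong[OF h(1)])
      \<comment> \<open>Unless \<open>q f u\<close> vanishes, \<open>u\<close> has degree
        \<open>- \<phi>\<close>, so the degree \<open>\<beta>\<close> of \<open>v\<close> equals
        \<open>\<phi> + \<alpha>\<close>. With the label thus fixed, the sum can be moved inside
        \<open>b\<close>.\<close>
      fix \<alpha>' u \<beta> v assume k: "u \<in> grade H \<alpha>'" "u \<in> carrier H" "v \<in> carrier H" "\<alpha>' + \<beta> = \<alpha>"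
      show "q f u \<odot>\<^bsub>P\<^esub> b \<beta> v \<gamma> w = b (\<phi> + \<alpha>) (q f u \<odot>\<^bsub>H\<^esub> v) \<gamma> w"
        using q_degree[OF f k(1)]
      proof
        assume "q f u = \<zero>"
        then show ?thesis using k h linear_map_zero[OF H.module_axioms P bl(1)] by (simp add: bc)
      next
        assume "\<phi> = - \<alpha>'"
        then have "\<phi> + \<alpha> = \<beta>" using k(4) by auto
        then show ?thesis using k h by (simp add: linear_map_smult[OF bl(1)])
      qed
    qed
    also have "\<dots> = b (\<phi> + \<alpha>) (la f u) \<gamma> w"
      unfolding la_def using h
      by (intro H.swe_linear_map[symmetric, OF _ P bl(1)]) auto
    finally show "H.swe P u (\<lambda>\<alpha> u \<beta> v. q f u \<odot>\<^bsub>P\<^esub> b \<beta> v \<gamma> w) = b (\<phi> + \<alpha>) (la f u) \<gamma> w" .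
  qed
  finally show ?thesis .
qed

text \<open>\<open>H\<close> is a module algebra under the left action. The sign
  \<open>\<omega> \<beta> \<gamma>\<close> of the coproduct of a product and the sign
  \<open>\<omega> \<alpha> \<gamma>\<close> of \<open>q_comult\<close> combine to
  \<open>\<omega> \<xi> \<gamma>\<close>, which is \<open>\<omega> \<phi>2 \<xi>\<close> because
  \<open>q f2 w\<close> forces \<open>\<phi>2 = - \<gamma>\<close>.\<close>

lemma la_tensor:
  assumes f: "f \<in> carrier V" and x: "x \<in> grade H \<xi>" and y: "y \<in> carrier H"
  shows "la f (x \<otimes>\<^bsub>H\<^esub> y) = V.swe H f (\<lambda>\<phi>1 f1 \<phi>2 f2. \<omega> \<phi>2 \<xi> \<odot>\<^bsub>H\<^esub> (la f1 x \<otimes>\<^bsub>H\<^esub> la f2 y))"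
proof -
  have xc: "x \<in> carrier H" by (rule H.grade_closed[OF x])
  note [simp] = f xc y
  have "la f (x \<otimes>\<^bsub>H\<^esub> y) = H.swe H x (\<lambda>\<alpha> u \<beta> v. H.swe H y (\<lambda>\<gamma> w \<delta> z.
      \<omega> \<beta> \<gamma> \<odot>\<^bsub>H\<^esub> (q f (u \<otimes>\<^bsub>H\<^esub> w) \<odot>\<^bsub>H\<^esub> (v \<otimes>\<^bsub>H\<^esub> z))))"
    unfolding la_def by (rule H.swe_mult) (auto intro!: lin graded_bilinearI)
  also have "\<dots> = H.swe H x (\<lambda>\<alpha> u \<beta> v. H.swe H y (\<lambda>\<gamma> w \<delta> z. V.swe H f (\<lambda>\<phi>1 f1 \<phi>2 f2.
      (\<omega> \<xi> \<gamma> \<otimes> (q f1 u \<otimes> q f2 w)) \<odot>\<^bsub>H\<^esub> (v \<otimes>\<^bsub>H\<^esub> z))))"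
  proof (rule H.swe_homogeneous_cong[OF x], rule H.swe_cong[OF y])
    fix \<alpha> u \<beta> v \<gamma> w \<delta> z
    assume h: "u \<in> grade H \<alpha>" "u \<in> carrier H" "v \<in> carrier H" "\<alpha> + \<beta> = \<xi>" "w \<in> grade H \<gamma>" "w \<in> carrier H" "z \<in> carrier H"
    have "\<omega> \<beta> \<gamma> \<odot>\<^bsub>H\<^esub> (q f (u \<otimes>\<^bsub>H\<^esub> w) \<odot>\<^bsub>H\<^esub> (v \<otimes>\<^bsub>H\<^esub> z)) =
        \<omega> \<xi> \<gamma> \<odot>\<^bsub>H\<^esub> (V.swe Ks f (\<lambda>\<phi>1 f1 \<phi>2 f2. q f1 u \<otimes> q f2 w) \<odot>\<^bsub>H\<^esub> (v \<otimes>\<^bsub>H\<^esub> z))"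
      using h V.swe_closed[of Ks f "\<lambda>\<phi>1 f1 \<phi>2 f2. q f1 u \<otimes> q f2 w"]
      by (simp add: q_comult H.smult_assoc1[symmetric] factor_add m_ac flip: h(4))
    also have "\<dots> = V.swe H f (\<lambda>\<phi>1 f1 \<phi>2 f2. (\<omega> \<xi> \<gamma> \<otimes> (q f1 u \<otimes> q f2 w)) \<odot>\<^bsub>H\<^esub> (v \<otimes>\<^bsub>H\<^esub> z))"
      using h by (auto simp: V.swe_scalar V.swe_smult H.smult_assoc1 intro!: V.swe_cong)
    finally show "\<omega> \<beta> \<gamma> \<odot>\<^bsub>H\<^esub> (q f (u \<otimes>\<^bsub>H\<^esub> w) \<odot>\<^bsub>H\<^esub> (v \<otimes>\<^bsub>H\<^esub> z)) =
        V.swe H f (\<lambda>\<phi>1 f1 \<phi>2 f2. (\<omega> \<xi> \<gamma> \<otimes> (q f1 u \<otimes> q f2 w)) \<odot>\<^bsub>H\<^esub> (v \<otimes>\<^bsub>H\<^esub> z))" .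
  qed
  also have "\<dots> = H.swe H x (\<lambda>\<alpha> u \<beta> v. V.swe H f (\<lambda>\<phi>1 f1 \<phi>2 f2. H.swe H y (\<lambda>\<gamma> w \<delta> z.
      (\<omega> \<xi> \<gamma> \<otimes> (q f1 u \<otimes> q f2 w)) \<odot>\<^bsub>H\<^esub> (v \<otimes>\<^bsub>H\<^esub> z))))"
    by (rule H.swe_cong, simp, rule swap_VH[symmetric]) auto
  also have "\<dots> = V.swe H f (\<lambda>\<phi>1 f1 \<phi>2 f2. H.swe H x (\<lambda>\<alpha> u \<beta> v. H.swe H y (\<lambda>\<gamma> w \<delta> z.
      (\<omega> \<xi> \<gamma> \<otimes> (q f1 u \<otimes> q f2 w)) \<odot>\<^bsub>H\<^esub> (v \<otimes>\<^bsub>H\<^esub> z))))"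
    by (rule swap_VH[symmetric]) (auto intro!: H.swe_closed)
  also have "\<dots> = V.swe H f (\<lambda>\<phi>1 f1 \<phi>2 f2. H.swe H x (\<lambda>\<alpha> u \<beta> v. H.swe H y (\<lambda>\<gamma> w \<delta> z.
      \<omega> \<phi>2 \<xi> \<odot>\<^bsub>H\<^esub> ((q f1 u \<odot>\<^bsub>H\<^esub> v) \<otimes>\<^bsub>H\<^esub> (q f2 w \<odot>\<^bsub>H\<^esub> z)))))"
  proof (rule V.swe_cong[OF f], rule H.swe_cong[OF xc], rule H.swe_cong[OF y])
    fix \<phi>1 f1 \<phi>2 f2 \<alpha> u \<beta> v \<gamma> w \<delta> z
    assume h: "f1 \<in> carrier V" "f2 \<in> grade V \<phi>2" "f2 \<in> carrier V" "u \<in> carrier H" "v \<in> carrier H"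
      "w \<in> grade H \<gamma>" "w \<in> carrier H" "z \<in> carrier H"
    show "(\<omega> \<xi> \<gamma> \<otimes> (q f1 u \<otimes> q f2 w)) \<odot>\<^bsub>H\<^esub> (v \<otimes>\<^bsub>H\<^esub> z) =
        \<omega> \<phi>2 \<xi> \<odot>\<^bsub>H\<^esub> ((q f1 u \<odot>\<^bsub>H\<^esub> v) \<otimes>\<^bsub>H\<^esub> (q f2 w \<odot>\<^bsub>H\<^esub> z))"
      using q_degree[OF h(2,6)] h
      by (auto simp: H.smult_assoc1[symmetric] H.smult_mult_left H.smult_mult_right m_ac)
  qed
  also have "\<dots> = V.swe H f (\<lambda>\<phi>1 f1 \<phi>2 f2. \<omega> \<phi>2 \<xi> \<odot>\<^bsub>H\<^esub> (la f1 x \<otimes>\<^bsub>H\<^esub> la f2 y))"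
  proof (rule V.swe_cong[OF f])
    fix \<phi>1 f1 \<phi>2 f2 assume [simp]: "f1 \<in> carrier V" "f2 \<in> carrier V"
    have "\<omega> \<phi>2 \<xi> \<odot>\<^bsub>H\<^esub> (la f1 x \<otimes>\<^bsub>H\<^esub> la f2 y) =
        H.swe H x (\<lambda>\<alpha> u \<beta> v. \<omega> \<phi>2 \<xi> \<odot>\<^bsub>H\<^esub> ((q f1 u \<odot>\<^bsub>H\<^esub> v) \<otimes>\<^bsub>H\<^esub> la f2 y))"
      unfolding la_def[of f1] by (rule H.swe_linear_map) (auto intro!: lin)
    also have "\<dots> = H.swe H x (\<lambda>\<alpha> u \<beta> v. H.swe H y (\<lambda>\<gamma> w \<delta> z.
        \<omega> \<phi>2 \<xi> \<odot>\<^bsub>H\<^esub> ((q f1 u \<odot>\<^bsub>H\<^esub> v) \<otimes>\<^bsub>H\<^esub> (q f2 w \<odot>\<^bsub>H\<^esub> z))))"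
      unfolding la_def[of f2] by (rule H.swe_cong, simp, rule H.swe_linear_map) (auto intro!: lin)
    finally show "H.swe H x (\<lambda>\<alpha> u \<beta> v. H.swe H y (\<lambda>\<gamma> w \<delta> z.
        \<omega> \<phi>2 \<xi> \<odot>\<^bsub>H\<^esub> ((q f1 u \<odot>\<^bsub>H\<^esub> v) \<otimes>\<^bsub>H\<^esub> (q f2 w \<odot>\<^bsub>H\<^esub> z)))) =
      \<omega> \<phi>2 \<xi> \<odot>\<^bsub>H\<^esub> (la f1 x \<otimes>\<^bsub>H\<^esub> la f2 y)" ..
  qed
  finally show ?thesis .
qed

text \<open>The reversal in \<open>ev_comult\<close> pairs \<open>x\<close> with the last leg of
  \<open>f\<close> and \<open>y\<close> with the one before it. By coassociativity \<open>x\<close>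
  acts first.\<close>

lemma ra_tensor:
  assumes f: "f \<in> carrier V" and x: "x \<in> carrier H" and y: "y \<in> carrier H"
  shows "ra f (x \<otimes>\<^bsub>H\<^esub> y) = ra (ra f x) y"
proof -
  note [simp] = f x y
  have "ra f (x \<otimes>\<^bsub>H\<^esub> y) = V.swe V f (\<lambda>\<alpha> u \<beta> v. V.swe V v (\<lambda>\<beta> v \<gamma> w. (ev v y \<otimes> ev w x) \<odot>\<^bsub>V\<^esub> u))"
    unfolding ra_def
    by (rule V.swe_cong) (simp_all add: ev_comult V.swe_scalar)
  also have "\<dots> = V.swe V f (\<lambda>\<alpha> u \<gamma> w. V.swe V u (\<lambda>\<alpha> u \<beta> v. (ev v y \<otimes> ev w x) \<odot>\<^bsub>V\<^esub> u))"
    by (rule V.swe_coassoc[symmetric]) (auto intro!: lin graded_trilinearI)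
  also have "\<dots> = V.swe V f (\<lambda>\<alpha> u \<gamma> w. ev w x \<odot>\<^bsub>V\<^esub> ra u y)"
    unfolding ra_def
    by (rule V.swe_cong) (auto simp: V.swe_smult V.smult_assoc1[symmetric] m_comm intro!: V.swe_cong)
  also have "\<dots> = ra (ra f x) y"
    unfolding ra_def[of f]
    by (subst V.swe_linear_map[of V V "\<lambda>z. ra z y"])
      (auto intro!: lin V.swe_cong simp: linear_map_smult[OF lin_ra(1)[OF lin_id]])
  finally show ?thesis .
qed

text \<open>The mirror image of \<open>la_comult\<close>: the right action uses up a last leg of
  \<open>f\<close>, so it touches only the second leg of the coproduct.\<close>

lemma ra_comult:
  assumes P: "module K P" and b: "graded_bilinear K V V P b" and f: "f \<in> carrier V" and x: "x \<in> grade H \<xi>"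
  shows "V.swe P (ra f x) b = V.swe P f (\<lambda>\<alpha> u \<beta> v. b \<alpha> u (\<beta> + \<xi>) (ra v x))"
proof -
  interpret P: module K P by (rule P)
  have xc [simp]: "x \<in> carrier H" by (rule H.grade_closed[OF x])
  note [simp] = f P
  note bD = graded_bilinearD[OF b]
  have L: "linear_map K V P (\<lambda>z. V.swe P z b)" by (intro lin P b)
  have "V.swe P (ra f x) b = V.swe P f (\<lambda>\<alpha> u \<gamma> w. ev w x \<odot>\<^bsub>P\<^esub> V.swe P u b)"
    unfolding ra_def
    by (subst V.swe_linear_map[OF _ P L]) (auto intro!: V.swe_cong simp: linear_map_smult[OF L])
  also have "\<dots> = V.swe P f (\<lambda>\<alpha> u \<gamma> w. V.swe P u (\<lambda>\<alpha> u \<beta> v. ev w x \<odot>\<^bsub>P\<^esub> b \<alpha> u \<beta> v))"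
    by (rule V.swe_cong) (simp_all add: V.swe_smult bD)
  also have "\<dots> = V.swe P f (\<lambda>\<alpha> u \<beta> v. V.swe P v (\<lambda>\<beta> v \<gamma> w. ev w x \<odot>\<^bsub>P\<^esub> b \<alpha> u \<beta> v))"
    by (rule V.swe_coassoc) (auto intro!: lin graded_trilinearI bD)
  also have "\<dots> = V.swe P f (\<lambda>\<alpha> u \<beta> v. b \<alpha> u (\<beta> + \<xi>) (ra v x))"
  proof (rule V.swe_cong[OF f])
    fix \<alpha> u \<beta> v assume h: "v \<in> grade V \<beta>" "v \<in> carrier V" "u \<in> carrier V"
    have "V.swe P v (\<lambda>\<beta> v \<gamma> w. ev w x \<odot>\<^bsub>P\<^esub> b \<alpha> u \<beta> v) =
        V.swe P v (\<lambda>\<beta>' v \<gamma> w. b \<alpha> u (\<beta> + \<xi>) (ev w x \<odot>\<^bsub>V\<^esub> v))"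
    proof (rule V.swe_homogeneous_cong[OF h(1)])
      fix \<beta>' v \<gamma> w assume k: "w \<in> grade V \<gamma>" "v \<in> carrier V" "w \<in> carrier V" "\<beta>' + \<gamma> = \<beta>"
      show "ev w x \<odot>\<^bsub>P\<^esub> b \<alpha> u \<beta>' v = b \<alpha> u (\<beta> + \<xi>) (ev w x \<odot>\<^bsub>V\<^esub> v)"
        using ev_degree[OF k(1) x]
      proof
        assume "ev w x = \<zero>"
        then show ?thesis using k h linear_map_zero[OF V.module_axioms P bD(2)] by (simp add: bD)
      next
        assume "\<gamma> = - \<xi>"
        then have "\<beta> + \<xi> = \<beta>'" using k(4) by auto
        then show ?thesis using k h by (simp add: linear_map_smult[OF bD(2)])
      qed
    qed
    also have "\<dots> = b \<alpha> u (\<beta> + \<xi>) (ra v x)"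
      unfolding ra_def using h
      by (intro V.swe_linear_map[symmetric, OF _ P bD(2)]) auto
    finally show "V.swe P v (\<lambda>\<beta> v \<gamma> w. ev w x \<odot>\<^bsub>P\<^esub> b \<alpha> u \<beta> v) = b \<alpha> u (\<beta> + \<xi>) (ra v x)" .
  qed
  finally show ?thesis .
qed

text \<open>The mirror image of \<open>la_tensor\<close>. Since \<open>ev b x1\<close> forces
  \<open>\<beta> = - \<xi>1\<close>, the sign \<open>\<omega> \<beta> \<gamma>1\<close> is
  \<open>\<omega> \<gamma>1 \<xi>1\<close>; with the sign \<open>\<omega> \<gamma>2 \<xi>1\<close>
  of \<open>ev_mult\<close> it gives \<open>\<omega> \<gamma> \<xi>1\<close>.\<close>

lemma ra_mult:
  assumes f: "f \<in> carrier V" and g: "g \<in> grade V \<gamma>" and x: "x \<in> carrier H"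
  shows "ra (f \<otimes>\<^bsub>V\<^esub> g) x = H.swe V x (\<lambda>\<xi>1 x1 \<xi>2 x2. \<omega> \<gamma> \<xi>1 \<odot>\<^bsub>V\<^esub> (ra f x1 \<otimes>\<^bsub>V\<^esub> ra g x2))"
proof -
  have gc: "g \<in> carrier V" by (rule V.grade_closed[OF g])
  note [simp] = f gc x
  have "ra (f \<otimes>\<^bsub>V\<^esub> g) x = V.swe V f (\<lambda>\<alpha> a \<beta> b. V.swe V g (\<lambda>\<gamma>1 c \<gamma>2 e.
      \<omega> \<beta> \<gamma>1 \<odot>\<^bsub>V\<^esub> (ev (b \<otimes>\<^bsub>V\<^esub> e) x \<odot>\<^bsub>V\<^esub> (a \<otimes>\<^bsub>V\<^esub> c))))"
    unfolding ra_def by (rule V.swe_mult) (auto intro!: lin graded_bilinearI)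
  also have "\<dots> = V.swe V f (\<lambda>\<alpha> a \<beta> b. V.swe V g (\<lambda>\<gamma>1 c \<gamma>2 e. H.swe V x (\<lambda>\<xi>1 x1 \<xi>2 x2.
      \<omega> \<gamma> \<xi>1 \<odot>\<^bsub>V\<^esub> ((ev b x1 \<odot>\<^bsub>V\<^esub> a) \<otimes>\<^bsub>V\<^esub> (ev e x2 \<odot>\<^bsub>V\<^esub> c)))))"
  proof (rule V.swe_cong[OF f], rule V.swe_homogeneous_cong[OF g])
    fix \<alpha> a \<beta> b \<gamma>1 c \<gamma>2 e
    assume h: "b \<in> grade V \<beta>" "b \<in> carrier V" "a \<in> carrier V" "\<gamma>1 + \<gamma>2 = \<gamma>" "e \<in> grade V \<gamma>2" "e \<in> carrier V" "c \<in> carrier V"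
    have "\<omega> \<beta> \<gamma>1 \<odot>\<^bsub>V\<^esub> (ev (b \<otimes>\<^bsub>V\<^esub> e) x \<odot>\<^bsub>V\<^esub> (a \<otimes>\<^bsub>V\<^esub> c)) =
        H.swe V x (\<lambda>\<xi>1 x1 \<xi>2 x2. \<omega> \<beta> \<gamma>1 \<odot>\<^bsub>V\<^esub> ((\<omega> \<gamma>2 \<xi>1 \<otimes> (ev b x1 \<otimes> ev e x2)) \<odot>\<^bsub>V\<^esub> (a \<otimes>\<^bsub>V\<^esub> c)))"
      using h by (simp add: ev_mult[OF h(2,5)] H.swe_scalar H.swe_smult)
    also have "\<dots> = H.swe V x (\<lambda>\<xi>1 x1 \<xi>2 x2.
        \<omega> \<gamma> \<xi>1 \<odot>\<^bsub>V\<^esub> ((ev b x1 \<odot>\<^bsub>V\<^esub> a) \<otimes>\<^bsub>V\<^esub> (ev e x2 \<odot>\<^bsub>V\<^esub> c)))"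
    proof (rule H.swe_cong[OF x])
      fix \<xi>1 x1 \<xi>2 x2 assume k: "x1 \<in> grade H \<xi>1" "x1 \<in> carrier H" "x2 \<in> carrier H"
      show "\<omega> \<beta> \<gamma>1 \<odot>\<^bsub>V\<^esub> ((\<omega> \<gamma>2 \<xi>1 \<otimes> (ev b x1 \<otimes> ev e x2)) \<odot>\<^bsub>V\<^esub> (a \<otimes>\<^bsub>V\<^esub> c)) =
          \<omega> \<gamma> \<xi>1 \<odot>\<^bsub>V\<^esub> ((ev b x1 \<odot>\<^bsub>V\<^esub> a) \<otimes>\<^bsub>V\<^esub> (ev e x2 \<odot>\<^bsub>V\<^esub> c))"
        using ev_degree[OF h(1) k(1)] h(2-) k
        by (auto simp: V.smult_assoc1[symmetric] V.smult_mult_left V.smult_mult_right m_ac factor_add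
            simp flip: h(4))
    qed
    finally show "\<omega> \<beta> \<gamma>1 \<odot>\<^bsub>V\<^esub> (ev (b \<otimes>\<^bsub>V\<^esub> e) x \<odot>\<^bsub>V\<^esub> (a \<otimes>\<^bsub>V\<^esub> c)) = H.swe V x (\<lambda>\<xi>1 x1 \<xi>2 x2.
        \<omega> \<gamma> \<xi>1 \<odot>\<^bsub>V\<^esub> ((ev b x1 \<odot>\<^bsub>V\<^esub> a) \<otimes>\<^bsub>V\<^esub> (ev e x2 \<odot>\<^bsub>V\<^esub> c)))" .
  qed
  also have "\<dots> = V.swe V f (\<lambda>\<alpha> a \<beta> b. H.swe V x (\<lambda>\<xi>1 x1 \<xi>2 x2. V.swe V g (\<lambda>\<gamma>1 c \<gamma>2 e.
      \<omega> \<gamma> \<xi>1 \<odot>\<^bsub>V\<^esub> ((ev b x1 \<odot>\<^bsub>V\<^esub> a) \<otimes>\<^bsub>V\<^esub> (ev e x2 \<odot>\<^bsub>V\<^esub> c)))))"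
    by (rule V.swe_cong, simp, rule swap_VH) auto
  also have "\<dots> = H.swe V x (\<lambda>\<xi>1 x1 \<xi>2 x2. V.swe V f (\<lambda>\<alpha> a \<beta> b. V.swe V g (\<lambda>\<gamma>1 c \<gamma>2 e.
      \<omega> \<gamma> \<xi>1 \<odot>\<^bsub>V\<^esub> ((ev b x1 \<odot>\<^bsub>V\<^esub> a) \<otimes>\<^bsub>V\<^esub> (ev e x2 \<odot>\<^bsub>V\<^esub> c)))))"
    by (rule swap_VH) (auto intro!: V.swe_closed)
  also have "\<dots> = H.swe V x (\<lambda>\<xi>1 x1 \<xi>2 x2. \<omega> \<gamma> \<xi>1 \<odot>\<^bsub>V\<^esub> (ra f x1 \<otimes>\<^bsub>V\<^esub> ra g x2))"
  proof (rule H.swe_cong[OF x])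
    fix \<xi>1 x1 \<xi>2 x2 assume [simp]: "x1 \<in> carrier H" "x2 \<in> carrier H"
    have "\<omega> \<gamma> \<xi>1 \<odot>\<^bsub>V\<^esub> (ra f x1 \<otimes>\<^bsub>V\<^esub> ra g x2) =
        V.swe V f (\<lambda>\<alpha> a \<beta> b. \<omega> \<gamma> \<xi>1 \<odot>\<^bsub>V\<^esub> ((ev b x1 \<odot>\<^bsub>V\<^esub> a) \<otimes>\<^bsub>V\<^esub> ra g x2))"
      unfolding ra_def[of f]
      by (rule V.swe_linear_map[where f = "\<lambda>s. \<omega> \<gamma> \<xi>1 \<odot>\<^bsub>V\<^esub> (s \<otimes>\<^bsub>V\<^esub> ra g x2)"]) (auto intro!: lin)
    also have "\<dots> = V.swe V f (\<lambda>\<alpha> a \<beta> b. V.swe V g (\<lambda>\<gamma>1 c \<gamma>2 e.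
        \<omega> \<gamma> \<xi>1 \<odot>\<^bsub>V\<^esub> ((ev b x1 \<odot>\<^bsub>V\<^esub> a) \<otimes>\<^bsub>V\<^esub> (ev e x2 \<odot>\<^bsub>V\<^esub> c))))"
      unfolding ra_def[of g]
      by (rule V.swe_cong, simp, rule V.swe_linear_map[where P = V and Q = V]) (auto intro!: lin)
    finally show "V.swe V f (\<lambda>\<alpha> a \<beta> b. V.swe V g (\<lambda>\<gamma>1 c \<gamma>2 e.
        \<omega> \<gamma> \<xi>1 \<odot>\<^bsub>V\<^esub> ((ev b x1 \<odot>\<^bsub>V\<^esub> a) \<otimes>\<^bsub>V\<^esub> (ev e x2 \<odot>\<^bsub>V\<^esub> c)))) =
      \<omega> \<gamma> \<xi>1 \<odot>\<^bsub>V\<^esub> (ra f x1 \<otimes>\<^bsub>V\<^esub> ra g x2)" ..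
  qed
  finally show ?thesis .
qed

text \<open>The cancellation behind the compatibility of \<open>psi\<close> with co-multiplications.
  \<open>ra f1 x1\<close> hides a pairing by \<open>ev\<close> of two legs, \<open>la f2 x2\<close>
  a pairing by \<open>q\<close> of the legs following them. Coassociativity turns the four legs into
  a convolution product of \<open>ev\<close> and \<open>q\<close>, which
  \<open>ev_q_convolution\<close> replaces by co-units.\<close>

lemma ra_la_cancel:
  assumes P: "module K P" and b: "graded_bilinear K V H P b" and f: "f \<in> grade V \<phi>" and x: "x \<in> grade H \<xi>"
  shows "V.swe P f (\<lambda>\<phi>1 f1 \<phi>2 f2. H.swe P x (\<lambda>\<xi>1 x1 \<xi>2 x2.
    \<omega> \<phi>2 \<xi>1 \<odot>\<^bsub>P\<^esub> b (\<phi>1 + \<xi>1) (ra f1 x1) (\<phi>2 + \<xi>2) (la f2 x2))) = b \<phi> f \<xi> x"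
proof -
  interpret P: module K P by (rule P)
  have xc [simp]: "x \<in> carrier H" by (rule H.grade_closed[OF x])
  have fc [simp]: "f \<in> carrier V" by (rule V.grade_closed[OF f])
  note [simp] = P
  note bD = graded_bilinearD[OF b]
  \<comment> \<open>The summand with both actions expanded: \<open>a\<close> and \<open>z\<close>
    are the outer legs that survive, while \<open>c\<close>, \<open>f2\<close>, \<open>x1\<close>
    and \<open>y\<close> are the inner legs to be cancelled.\<close>
  let ?t = "\<lambda>\<phi>2 f2 \<xi>1 x1 \<alpha> a c y \<zeta> z. (\<omega> \<phi>2 \<xi>1 \<otimes> (ev c x1 \<otimes> q f2 y)) \<odot>\<^bsub>P\<^esub> b \<alpha> a \<zeta> z"
  have "V.swe P f (\<lambda>\<phi>1 f1 \<phi>2 f2. H.swe P x (\<lambda>\<xi>1 x1 \<xi>2 x2.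
      \<omega> \<phi>2 \<xi>1 \<odot>\<^bsub>P\<^esub> b (\<phi>1 + \<xi>1) (ra f1 x1) (\<phi>2 + \<xi>2) (la f2 x2))) =
    V.swe P f (\<lambda>\<phi>1 u \<phi>2 f2. H.swe P x (\<lambda>\<xi>1 x1 \<xi>2 w.
      V.swe P u (\<lambda>\<alpha> a \<gamma> c. H.swe P w (\<lambda>\<eta> y \<zeta> z. ?t \<phi>2 f2 \<xi>1 x1 \<alpha> a c y \<zeta> z))))"
  proof (rule V.swe_cong[OF fc], rule H.swe_cong[OF xc])
    fix \<phi>1 u \<phi>2 f2 \<xi>1 x1 \<xi>2 w
    assume h: "u \<in> grade V \<phi>1" "f2 \<in> grade V \<phi>2" "x1 \<in> grade H \<xi>1" "w \<in> grade H \<xi>2"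
      and [simp]: "u \<in> carrier V" "f2 \<in> carrier V" "x1 \<in> carrier H" "w \<in> carrier H"
    have "\<omega> \<phi>2 \<xi>1 \<odot>\<^bsub>P\<^esub> b (\<phi>1 + \<xi>1) (ra u x1) (\<phi>2 + \<xi>2) (la f2 w) =
        V.swe P u (\<lambda>\<alpha> a \<gamma> c. \<omega> \<phi>2 \<xi>1 \<odot>\<^bsub>P\<^esub> b (\<phi>1 + \<xi>1) (ev c x1 \<odot>\<^bsub>V\<^esub> a) (\<phi>2 + \<xi>2) (la f2 w))"
      unfolding ra_def
      by (rule V.swe_linear_map[where f = "\<lambda>s. \<omega> \<phi>2 \<xi>1 \<odot>\<^bsub>P\<^esub> b (\<phi>1 + \<xi>1) s (\<phi>2 + \<xi>2) (la f2 w)"])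
        (auto intro!: lin bD)
    also have "\<dots> = V.swe P u (\<lambda>\<alpha> a \<gamma> c. H.swe P w (\<lambda>\<eta> y \<zeta> z.
        \<omega> \<phi>2 \<xi>1 \<odot>\<^bsub>P\<^esub> b (\<phi>1 + \<xi>1) (ev c x1 \<odot>\<^bsub>V\<^esub> a) (\<phi>2 + \<xi>2) (q f2 y \<odot>\<^bsub>H\<^esub> z)))"
      unfolding la_def by (rule V.swe_cong, simp, rule H.swe_linear_map) (auto intro!: lin bD)
    also have "\<dots> = V.swe P u (\<lambda>\<alpha> a \<gamma> c. H.swe P w (\<lambda>\<eta> y \<zeta> z. ?t \<phi>2 f2 \<xi>1 x1 \<alpha> a c y \<zeta> z))"
    proof (rule V.swe_homogeneous_cong[OF h(1)], rule H.swe_homogeneous_cong[OF h(4)])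
      fix \<alpha> a \<gamma> c \<eta> y \<zeta> z
      assume k: "c \<in> grade V \<gamma>" "y \<in> grade H \<eta>" "\<alpha> + \<gamma> = \<phi>1" "\<eta> + \<zeta> = \<xi>2"
        and [simp]: "a \<in> carrier V" "c \<in> carrier V" "y \<in> carrier H" "z \<in> carrier H"
      show "\<omega> \<phi>2 \<xi>1 \<odot>\<^bsub>P\<^esub> b (\<phi>1 + \<xi>1) (ev c x1 \<odot>\<^bsub>V\<^esub> a) (\<phi>2 + \<xi>2) (q f2 y \<odot>\<^bsub>H\<^esub> z) =
          ?t \<phi>2 f2 \<xi>1 x1 \<alpha> a c y \<zeta> z"
      \<comment> \<open>If both pairings are non-zero, \<open>c\<close> and \<open>x1\<close> have
        opposite degrees, and so have \<open>f2\<close> and \<open>y\<close>. Then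
        \<open>\<phi>1 + \<xi>1\<close> and \<open>\<phi>2 + \<xi>2\<close> are the degrees of
        \<open>a\<close> and \<open>z\<close>.\<close>
      proof (cases "ev c x1 = \<zero> \<or> q f2 y = \<zero>")
        case True
        then show ?thesis
          using linear_map_zero[OF V.module_axioms P bD(1)] linear_map_zero[OF H.module_axioms P bD(2)]
          by (auto simp: bD linear_map_smult[OF bD(1)] linear_map_smult[OF bD(2)])
      next
        case False
        then have "\<phi>1 + \<xi>1 = \<alpha>" "\<phi>2 + \<xi>2 = \<zeta>"
          using ev_degree[OF k(1) h(3)] q_degree[OF h(2) k(2)] k by auto
        then show ?thesis
          by (simp add: linear_map_smult[OF bD(1)] linear_map_smult[OF bD(2)] P.smult_assoc1[symmetric]
              bD m_ac)
      qed
    qed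
    finally show "\<omega> \<phi>2 \<xi>1 \<odot>\<^bsub>P\<^esub> b (\<phi>1 + \<xi>1) (ra u x1) (\<phi>2 + \<xi>2) (la f2 w) =
      V.swe P u (\<lambda>\<alpha> a \<gamma> c. H.swe P w (\<lambda>\<eta> y \<zeta> z. ?t \<phi>2 f2 \<xi>1 x1 \<alpha> a c y \<zeta> z))" .
  qed
  also have "\<dots> = V.swe P f (\<lambda>\<phi>1 u \<phi>2 f2. V.swe P u (\<lambda>\<alpha> a \<gamma> c. H.swe P x (\<lambda>\<xi>1 x1 \<xi>2 w.
      H.swe P w (\<lambda>\<eta> y \<zeta> z. ?t \<phi>2 f2 \<xi>1 x1 \<alpha> a c y \<zeta> z))))"
    by (rule V.swe_cong, simp, rule swap_VH[symmetric]) (auto intro!: H.swe_closed bD)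
  \<comment> \<open>Coassociativity, first in \<open>x\<close> and next in \<open>f\<close>,
    collects the inner legs into the coproducts of one element of \<open>H\<close> and one of
    \<open>V\<close>.\<close>
  also have "\<dots> = V.swe P f (\<lambda>\<phi>1 u \<phi>2 f2. V.swe P u (\<lambda>\<alpha> a \<gamma> c. H.swe P x (\<lambda>\<eta> w \<zeta> z.
      H.swe P w (\<lambda>\<xi>1 x1 \<xi>2 y. ?t \<phi>2 f2 \<xi>1 x1 \<alpha> a c y \<zeta> z))))"
    by (rule V.swe_cong, simp, rule V.swe_cong, simp, rule H.swe_coassoc[symmetric])
      (auto intro!: lin graded_trilinearI bD)
  also have "\<dots> = V.swe P f (\<lambda>\<alpha> a \<phi> v. V.swe P v (\<lambda>\<gamma> c \<phi>2 f2. H.swe P x (\<lambda>\<eta> w \<zeta> z.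
      H.swe P w (\<lambda>\<xi>1 x1 \<xi>2 y. ?t \<phi>2 f2 \<xi>1 x1 \<alpha> a c y \<zeta> z))))"
    by (rule V.swe_coassoc) (auto intro!: lin graded_trilinearI graded_bilinearI bD)
  also have "\<dots> = V.swe P f (\<lambda>\<alpha> a \<phi> v. H.swe P x (\<lambda>\<eta> w \<zeta> z. V.swe P v (\<lambda>\<gamma> c \<phi>2 f2.
      H.swe P w (\<lambda>\<xi>1 x1 \<xi>2 y. ?t \<phi>2 f2 \<xi>1 x1 \<alpha> a c y \<zeta> z))))"
    by (rule V.swe_cong, simp, rule swap_VH) (auto intro!: H.swe_closed bD)
  also have "\<dots> = V.swe P f (\<lambda>\<alpha> a \<phi> v. H.swe P x (\<lambda>\<eta> w \<zeta> z. (counit V v \<otimes> counit H w) \<odot>\<^bsub>P\<^esub> b \<alpha> a \<zeta> z))"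
  proof (rule V.swe_cong[OF fc], rule H.swe_cong[OF xc])
    fix \<alpha> a \<phi> v \<eta> w \<zeta> z
    assume [simp]: "a \<in> carrier V" "v \<in> carrier V" "w \<in> carrier H" "z \<in> carrier H"
    show "V.swe P v (\<lambda>\<gamma> c \<phi>2 f2. H.swe P w (\<lambda>\<xi>1 x1 \<xi>2 y. ?t \<phi>2 f2 \<xi>1 x1 \<alpha> a c y \<zeta> z)) =
        (counit V v \<otimes> counit H w) \<odot>\<^bsub>P\<^esub> b \<alpha> a \<zeta> z"
      unfolding ev_q_convolution[OF \<open>v \<in> carrier V\<close> \<open>w \<in> carrier H\<close>, symmetric]
      by (subst V.swe_scalar) (auto intro!: V.swe_cong H.swe_scalars_closed simp: H.swe_scalar bD)
  qed
  also have "\<dots> = V.swe P f (\<lambda>\<alpha> a \<phi> v. counit V v \<odot>\<^bsub>P\<^esub> b \<alpha> a \<xi> x)"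
  proof (rule V.swe_cong[OF fc])
    fix \<alpha> a \<phi> v assume [simp]: "a \<in> carrier V" "v \<in> carrier V"
    have "H.swe P x (\<lambda>\<eta> w \<zeta> z. (counit V v \<otimes> counit H w) \<odot>\<^bsub>P\<^esub> b \<alpha> a \<zeta> z) =
        counit V v \<odot>\<^bsub>P\<^esub> H.swe P x (\<lambda>\<eta> w \<zeta> z. counit H w \<odot>\<^bsub>P\<^esub> b \<alpha> a \<zeta> z)"
      by (subst H.swe_smult) (auto intro!: H.swe_cong simp: bD P.smult_assoc1)
    also have "H.swe P x (\<lambda>\<eta> w \<zeta> z. counit H w \<odot>\<^bsub>P\<^esub> b \<alpha> a \<zeta> z) = b \<alpha> a \<xi> x"
      by (rule H.swe_counit_left[OF x P]) (rule bD(2), simp)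
    finally show "H.swe P x (\<lambda>\<eta> w \<zeta> z. (counit V v \<otimes> counit H w) \<odot>\<^bsub>P\<^esub> b \<alpha> a \<zeta> z) =
      counit V v \<odot>\<^bsub>P\<^esub> b \<alpha> a \<xi> x" .
  qed
  also have "\<dots> = b \<phi> f \<xi> x"
    by (rule V.swe_counit_right[OF f P]) (rule bD(1), simp)
  finally show ?thesis .
qed

end

lemma (in graded_module) linear_map_eqI_homogeneous:
  assumes "module K P" "linear_map K M P f" "linear_map K M P g"
    and "\<And>\<alpha> x. \<lbrakk>x \<in> grade M \<alpha>; x \<in> carrier M\<rbrakk> \<Longrightarrow> f x = g x" and x: "x \<in> carrier M"
  shows "f x = g x"
proof -
  obtain xs where xs: "\<forall>(\<alpha>, a)\<in>set xs. a \<in> grade M \<alpha>" "x = lsum M xs snd"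
    using homogeneous_list[OF x] by blast
  have cl: "\<And>i. i \<in> set xs \<Longrightarrow> snd i \<in> carrier M" using xs(1) grade_closed by force
  have "f x = lsum P xs (\<lambda>i. f (snd i))"
    unfolding xs(2) by (rule linear_map_lsum[OF module_axioms assms(1,2) cl])
  also have "\<dots> = lsum P xs (\<lambda>i. g (snd i))"
    by (rule lsum_cong) (use xs(1) cl in \<open>force intro!: assms(4)\<close>)
  also have "\<dots> = g x"
    unfolding xs(2) by (rule linear_map_lsum[OF module_axioms assms(1,3) cl, symmetric])
  finally show ?thesis .
qed

section \<open>The braiding of the dual with the Hopf algebra\<close>

context hopf_pairing
begin

sublocale HV: graded_pair K H V ..
sublocale VH: graded_pair K V H ..

abbreviation "T \<equiv> tensor_module K H V"
abbreviation "tens \<equiv> pure_tensor K H V"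

lemmas T_module [simp] = HV.module_tensor
lemmas [simp] = HV.pure_closed

definition "psi f x = V.swe T f (\<lambda>\<phi>1 f1 \<phi>2 f2. H.swe T x (\<lambda>\<xi>1 x1 \<xi>2 x2.
  \<omega> \<phi>2 \<xi>1 \<odot>\<^bsub>T\<^esub> tens (la f1 x1) (ra f2 x2)))"

lemma psi_closed [simp, intro]: "\<lbrakk>f \<in> carrier V; x \<in> carrier H\<rbrakk> \<Longrightarrow> psi f x \<in> carrier T"
  unfolding psi_def by (auto intro!: V.swe_closed H.swe_closed)

lemma lin_psi [lin]:
  "\<lbrakk>linear_map K Q H g; f \<in> carrier V; module K Q\<rbrakk> \<Longrightarrow> linear_map K Q T (\<lambda>z. psi f (g z))"
  "\<lbrakk>linear_map K Q V h; x \<in> carrier H; module K Q\<rbrakk> \<Longrightarrow> linear_map K Q T (\<lambda>z. psi (h z) x)"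
  unfolding psi_def by (auto intro!: lin graded_bilinearI)

lemmas lin_psi_eta [lin] = lin_psi(1)[OF lin_id]

lemma bilinear_psi: "bilinear_map K V H T psi"
  by (auto intro!: bilinear_mapI lin)

text \<open>The rule by which multiplications, \<open>cm\<close> and \<open>ce\<close> are pushed
  through a crossing.\<close>

lemma psi_linear_map:
  assumes P: "module K P" and L: "linear_map K T P L" and f: "f \<in> carrier V" and x: "x \<in> carrier H"
  shows "L (psi f x) = V.swe P f (\<lambda>\<phi>1 f1 \<phi>2 f2. H.swe P x (\<lambda>\<xi>1 x1 \<xi>2 x2.
    \<omega> \<phi>2 \<xi>1 \<odot>\<^bsub>P\<^esub> L (tens (la f1 x1) (ra f2 x2))))"
proof -
  note [simp] = f x P
  have "L (psi f x) = V.swe P f (\<lambda>\<phi>1 f1 \<phi>2 f2. L (H.swe T x (\<lambda>\<xi>1 x1 \<xi>2 x2.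
      \<omega> \<phi>2 \<xi>1 \<odot>\<^bsub>T\<^esub> tens (la f1 x1) (ra f2 x2))))"
    unfolding psi_def by (rule V.swe_linear_map[OF _ _ L]) (auto intro!: H.swe_closed)
  also have "\<dots> = V.swe P f (\<lambda>\<phi>1 f1 \<phi>2 f2. H.swe P x (\<lambda>\<xi>1 x1 \<xi>2 x2.
      L (\<omega> \<phi>2 \<xi>1 \<odot>\<^bsub>T\<^esub> tens (la f1 x1) (ra f2 x2))))"
    by (rule V.swe_cong, simp, rule H.swe_linear_map[OF _ _ L]) auto
  also have "\<dots> = V.swe P f (\<lambda>\<phi>1 f1 \<phi>2 f2. H.swe P x (\<lambda>\<xi>1 x1 \<xi>2 x2.
      \<omega> \<phi>2 \<xi>1 \<odot>\<^bsub>P\<^esub> L (tens (la f1 x1) (ra f2 x2))))"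
    by (rule V.swe_cong, simp, rule H.swe_cong) (auto simp: linear_map_smult[OF L])
  finally show ?thesis .
qed

lemma psi_grade: 
  assumes "f \<in> grade V \<phi>" "x \<in> grade H \<xi>"
  shows "psi f x \<in> tensor_grade K H V (\<phi> + \<xi>)"
  unfolding psi_def
proof (rule V.swe_submodule[OF T_module HV.submodule_tensor_grade assms(1)],
    rule H.swe_submodule[OF T_module HV.submodule_tensor_grade assms(2)])
  fix \<phi>1 f1 \<phi>2 f2 \<xi>1 x1 \<xi>2 x2
  assume h: "f1 \<in> grade V \<phi>1" "f2 \<in> grade V \<phi>2" "\<phi>1 + \<phi>2 = \<phi>" "x1 \<in> grade H \<xi>1" "x2 \<in> grade H \<xi>2" "\<xi>1 + \<xi>2 = \<xi>"
  have "tens (la f1 x1) (ra f2 x2) \<in> tensor_grade K H V (\<phi> + \<xi>)"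
    by (rule HV.pure_grade[OF la_grade[OF h(1,4)] ra_grade[OF h(2,5)]]) (use h in \<open>auto simp: ac_simps\<close>)
  then show "\<omega> \<phi>2 \<xi>1 \<odot>\<^bsub>T\<^esub> tens (la f1 x1) (ra f2 x2) \<in> tensor_grade K H V (\<phi> + \<xi>)"
    by (simp add: HV.T.submoduleE(4)[OF HV.submodule_tensor_grade])
qed

lemma la_one_left: "x \<in> carrier H \<Longrightarrow> la \<one>\<^bsub>V\<^esub> x = x"
  unfolding la_def
  by (rule trans[OF H.swe_cong H.swe_counit_id(1)]) (auto simp: V.antipode_one ev_one)

lemma la_one_right: "f \<in> carrier V \<Longrightarrow> la f \<one>\<^bsub>H\<^esub> = counit V f \<odot>\<^bsub>H\<^esub> \<one>\<^bsub>H\<^esub>"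
  unfolding la_def
  by (subst H.swe_one) (auto intro!: graded_bilinearI lin simp: counit_eq_ev
      antipode_eq_ev[of f "\<one>\<^bsub>H\<^esub>", simplified H.antipode_one])

lemma ra_one_left: "x \<in> carrier H \<Longrightarrow> ra \<one>\<^bsub>V\<^esub> x = counit H x \<odot>\<^bsub>V\<^esub> \<one>\<^bsub>V\<^esub>"
  unfolding ra_def
  by (subst V.swe_one[where P = V]) (auto intro!: graded_bilinearI lin simp: ev_one)

lemma ra_one_right: "f \<in> carrier V \<Longrightarrow> ra f \<one>\<^bsub>H\<^esub> = f"
  unfolding ra_def
  by (rule trans[OF V.swe_cong V.swe_counit_id(2)]) (auto simp: counit_eq_ev)

lemma psi_one_left: "x \<in> carrier H \<Longrightarrow> psi \<one>\<^bsub>V\<^esub> x = tens x \<one>\<^bsub>V\<^esub>"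
proof -
  assume [simp]: "x \<in> carrier H"
  have "psi \<one>\<^bsub>V\<^esub> x = H.swe T x (\<lambda>\<xi>1 x1 \<xi>2 x2. tens (la \<one>\<^bsub>V\<^esub> x1) (ra \<one>\<^bsub>V\<^esub> x2))"
    unfolding psi_def
    by (subst V.swe_one) (auto intro!: graded_bilinearI lin H.swe_cong)
  also have "\<dots> = H.swe T x (\<lambda>\<xi>1 x1 \<xi>2 x2. tens (counit H x2 \<odot>\<^bsub>H\<^esub> x1) \<one>\<^bsub>V\<^esub>)"
    by (rule H.swe_cong)
      (auto simp: la_one_left ra_one_left HV.pure_smult_left HV.pure_smult_right)
  also have "\<dots> = tens (H.swe H x (\<lambda>\<xi>1 x1 \<xi>2 x2. counit H x2 \<odot>\<^bsub>H\<^esub> x1)) \<one>\<^bsub>V\<^esub>"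
    by (rule H.swe_linear_map[symmetric]) (auto intro!: lin)
  finally show ?thesis by (simp add: H.swe_counit_id)
qed

lemma psi_one_right: "f \<in> carrier V \<Longrightarrow> psi f \<one>\<^bsub>H\<^esub> = tens \<one>\<^bsub>H\<^esub> f"
proof -
  assume [simp]: "f \<in> carrier V"
  have "psi f \<one>\<^bsub>H\<^esub> = V.swe T f (\<lambda>\<phi>1 f1 \<phi>2 f2. tens (la f1 \<one>\<^bsub>H\<^esub>) (ra f2 \<one>\<^bsub>H\<^esub>))"
    unfolding psi_def
    by (rule V.swe_cong, simp, subst H.swe_one) (auto intro!: graded_bilinearI lin)
  also have "\<dots> = V.swe T f (\<lambda>\<phi>1 f1 \<phi>2 f2. tens \<one>\<^bsub>H\<^esub> (counit V f1 \<odot>\<^bsub>V\<^esub> f2))"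
    by (rule V.swe_cong)
      (auto simp: la_one_right ra_one_right HV.pure_smult_left HV.pure_smult_right)
  also have "\<dots> = tens \<one>\<^bsub>H\<^esub> (V.swe V f (\<lambda>\<phi>1 f1 \<phi>2 f2. counit V f1 \<odot>\<^bsub>V\<^esub> f2))"
    by (rule V.swe_linear_map[where f = "\<lambda>s. tens \<one>\<^bsub>H\<^esub> s", symmetric]) (auto intro!: lin)
  finally show ?thesis by (simp add: V.swe_counit_id)
qed

text \<open>\<open>lmul\<close> and \<open>rmul\<close> multiply on the outer sides, by
  \<open>H\<close> from the left and by \<open>V\<close> from the right, where nothing has to be
  crossed. The product of \<open>x \<otimes> f\<close> and \<open>y \<otimes> g\<close> is
  \<open>lmul x (rmul g (psi f y))\<close>.\<close>

definition "lmul x t = tsum K T t (\<lambda>y g. tens (x \<otimes>\<^bsub>H\<^esub> y) g)"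
definition "rmul g t = tsum K T t (\<lambda>y f. tens y (f \<otimes>\<^bsub>V\<^esub> g))"

lemma bilinear_lmul: "x \<in> carrier H \<Longrightarrow> bilinear_map K H V T (\<lambda>y g. tens (x \<otimes>\<^bsub>H\<^esub> y) g)"
  and bilinear_rmul: "g \<in> carrier V \<Longrightarrow> bilinear_map K H V T (\<lambda>y f. tens y (f \<otimes>\<^bsub>V\<^esub> g))"
  by (auto intro!: bilinear_mapI lin)

lemma lin_lmul [lin]:
  "\<lbrakk>linear_map K Q T h; x \<in> carrier H\<rbrakk> \<Longrightarrow> linear_map K Q T (\<lambda>z. lmul x (h z))"
  "\<lbrakk>linear_map K Q H k; t \<in> carrier T; module K Q\<rbrakk> \<Longrightarrow> linear_map K Q T (\<lambda>z. lmul (k z) t)"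
proof -
  show "\<lbrakk>linear_map K Q T h; x \<in> carrier H\<rbrakk> \<Longrightarrow> linear_map K Q T (\<lambda>z. lmul x (h z))"
    unfolding lmul_def by (auto intro!: lin bilinear_lmul)
  assume "linear_map K Q H k" "t \<in> carrier T" "module K Q"
  then show "linear_map K Q T (\<lambda>z. lmul (k z) t)"
    unfolding lmul_def
    by (auto intro!: HV.tsum_pointwise_lin bilinear_lmul lin linear_map_closed[of K Q H k])
qed

lemma lin_rmul [lin]:
  "\<lbrakk>linear_map K Q T h; g \<in> carrier V\<rbrakk> \<Longrightarrow> linear_map K Q T (\<lambda>z. rmul g (h z))"
  "\<lbrakk>linear_map K Q V k; t \<in> carrier T; module K Q\<rbrakk> \<Longrightarrow> linear_map K Q T (\<lambda>z. rmul (k z) t)"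
proof -
  show "\<lbrakk>linear_map K Q T h; g \<in> carrier V\<rbrakk> \<Longrightarrow> linear_map K Q T (\<lambda>z. rmul g (h z))"
    unfolding rmul_def by (auto intro!: lin bilinear_rmul)
  assume "linear_map K Q V k" "t \<in> carrier T" "module K Q"
  then show "linear_map K Q T (\<lambda>z. rmul (k z) t)"
    unfolding rmul_def
    by (auto intro!: HV.tsum_pointwise_lin bilinear_rmul lin linear_map_closed[of K Q V k])
qed

lemmas lin_lmul_eta [lin] = lin_lmul(1)[OF lin_id]
lemmas lin_rmul_eta [lin] = lin_rmul(1)[OF lin_id]

lemma lmul_closed [simp, intro]: "\<lbrakk>x \<in> carrier H; t \<in> carrier T\<rbrakk> \<Longrightarrow> lmul x t \<in> carrier T"
  using linear_map_closed[OF lin_lmul(1)[OF lin_id]] by blast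

lemma rmul_closed [simp, intro]: "\<lbrakk>g \<in> carrier V; t \<in> carrier T\<rbrakk> \<Longrightarrow> rmul g t \<in> carrier T"
  using linear_map_closed[OF lin_rmul(1)[OF lin_id]] by blast

lemma lmul_tens [simp]:
  "\<lbrakk>x \<in> carrier H; y \<in> carrier H; f \<in> carrier V\<rbrakk> \<Longrightarrow> lmul x (tens y f) = tens (x \<otimes>\<^bsub>H\<^esub> y) f"
  unfolding lmul_def by (simp add: HV.tsum_pure bilinear_lmul)

lemma rmul_tens [simp]:
  "\<lbrakk>g \<in> carrier V; y \<in> carrier H; f \<in> carrier V\<rbrakk> \<Longrightarrow> rmul g (tens y f) = tens y (f \<otimes>\<^bsub>V\<^esub> g)"
  unfolding rmul_def by (simp add: HV.tsum_pure bilinear_rmul)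

lemma lmul_rmul:
  "\<lbrakk>x \<in> carrier H; g \<in> carrier V; t \<in> carrier T\<rbrakk> \<Longrightarrow> lmul x (rmul g t) = rmul g (lmul x t)"
  by (rule HV.tensor_eqI[OF T_module]) (auto intro!: lin)

lemma lmul_lmul:
  "\<lbrakk>x \<in> carrier H; y \<in> carrier H; t \<in> carrier T\<rbrakk> \<Longrightarrow> lmul x (lmul y t) = lmul (x \<otimes>\<^bsub>H\<^esub> y) t"
  by (rule HV.tensor_eqI[OF T_module]) (auto intro!: lin simp: H.A.m_assoc)

lemma rmul_rmul:
  "\<lbrakk>f \<in> carrier V; g \<in> carrier V; t \<in> carrier T\<rbrakk> \<Longrightarrow> rmul g (rmul f t) = rmul (f \<otimes>\<^bsub>V\<^esub> g) t"
  by (rule HV.tensor_eqI[OF T_module]) (auto intro!: lin simp: V.A.m_assoc)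

lemma lmul_one: "t \<in> carrier T \<Longrightarrow> lmul \<one>\<^bsub>H\<^esub> t = t"
  by (rule HV.tensor_eqI[OF T_module]) (auto intro!: lin)

lemma rmul_one: "t \<in> carrier T \<Longrightarrow> rmul \<one>\<^bsub>V\<^esub> t = t"
  by (rule HV.tensor_eqI[OF T_module]) (auto intro!: lin)

text \<open>\<open>g\<close> stands next to \<open>x\<close> and crosses first; \<open>f\<close>
  then crosses the element \<open>x'\<close> that emerges. On the left the two actions split by
  \<open>la_mult\<close> and \<open>ra_mult\<close>, on the right \<open>la_comult\<close> computes
  the coproduct of \<open>x'\<close>, and both become sums over three legs of
  \<open>x\<close>.\<close>

lemma psi_mult_homogeneous:
  assumes f: "f \<in> grade V \<phi>" and g: "g \<in> grade V \<gamma>" and x: "x \<in> grade H \<xi>"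
  shows "psi (f \<otimes>\<^bsub>V\<^esub> g) x = tsum K T (psi g x) (\<lambda>x' g'. rmul g' (psi f x'))"
proof -
  have fc [simp]: "f \<in> carrier V" and gc [simp]: "g \<in> carrier V" and xc [simp]: "x \<in> carrier H"
    using f g x V.grade_closed H.grade_closed by auto
  let ?t = "\<lambda>f1 g1 u f2 g2 v w. tens (la f1 (la g1 u)) (ra f2 v \<otimes>\<^bsub>V\<^esub> ra g2 w)"
  have bil: "bilinear_map K H V T (\<lambda>x' g'. rmul g' (psi f x'))"
    by (auto intro!: bilinear_mapI lin)
  have "psi (f \<otimes>\<^bsub>V\<^esub> g) x = V.swe T f (\<lambda>\<phi>1 f1 \<phi>2 f2. V.swe T g (\<lambda>\<gamma>1 g1 \<gamma>2 g2.
      \<omega> \<phi>2 \<gamma>1 \<odot>\<^bsub>T\<^esub> H.swe T x (\<lambda>\<xi>1 x1 \<xi>2 x2.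
        \<omega> (\<phi>2 + \<gamma>2) \<xi>1 \<odot>\<^bsub>T\<^esub> tens (la (f1 \<otimes>\<^bsub>V\<^esub> g1) x1) (ra (f2 \<otimes>\<^bsub>V\<^esub> g2) x2))))"
    unfolding psi_def by (rule V.swe_mult) (auto intro!: graded_bilinearI lin)
  also have "\<dots> = V.swe T f (\<lambda>\<phi>1 f1 \<phi>2 f2. V.swe T g (\<lambda>\<gamma>1 g1 \<gamma>2 g2. H.swe T x (\<lambda>\<alpha> u \<beta> v. H.swe T v (\<lambda>\<beta> v \<delta> w.
      (\<omega> \<phi>2 \<gamma>1 \<otimes> \<omega> (\<phi>2 + \<gamma>2) \<alpha> \<otimes> \<omega> \<gamma>2 \<beta>) \<odot>\<^bsub>T\<^esub> ?t f1 g1 u f2 g2 v w))))"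
  proof (rule V.swe_cong[OF fc], rule V.swe_cong[OF gc])
    fix \<phi>1 f1 \<phi>2 f2 \<gamma>1 g1 \<gamma>2 g2
    assume h: "f1 \<in> grade V \<phi>1" "f2 \<in> grade V \<phi>2" "g1 \<in> grade V \<gamma>1" "g2 \<in> grade V \<gamma>2"
      and [simp]: "f1 \<in> carrier V" "f2 \<in> carrier V" "g1 \<in> carrier V" "g2 \<in> carrier V"
    have "\<omega> \<phi>2 \<gamma>1 \<odot>\<^bsub>T\<^esub> H.swe T x (\<lambda>\<xi>1 x1 \<xi>2 x2.
        \<omega> (\<phi>2 + \<gamma>2) \<xi>1 \<odot>\<^bsub>T\<^esub> tens (la (f1 \<otimes>\<^bsub>V\<^esub> g1) x1) (ra (f2 \<otimes>\<^bsub>V\<^esub> g2) x2)) =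
      H.swe T x (\<lambda>\<xi>1 x1 \<xi>2 x2. (\<omega> \<phi>2 \<gamma>1 \<otimes> \<omega> (\<phi>2 + \<gamma>2) \<xi>1) \<odot>\<^bsub>T\<^esub>
        tens (la f1 (la g1 x1)) (ra (f2 \<otimes>\<^bsub>V\<^esub> g2) x2))"
      by (subst H.swe_smult) (auto intro!: H.swe_cong simp: la_mult[OF h(1,3)] HV.T.smult_assoc1)
    also have "\<dots> = H.swe T x (\<lambda>\<alpha> u \<beta> v. H.swe T v (\<lambda>\<beta> v \<delta> w.
      (\<omega> \<phi>2 \<gamma>1 \<otimes> \<omega> (\<phi>2 + \<gamma>2) \<alpha> \<otimes> \<omega> \<gamma>2 \<beta>) \<odot>\<^bsub>T\<^esub> ?t f1 g1 u f2 g2 v w))"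
    proof (rule H.swe_cong[OF xc])
      fix \<alpha> u \<beta> v assume [simp]: "u \<in> carrier H" "v \<in> carrier H"
      let ?c = "\<omega> \<phi>2 \<gamma>1 \<otimes> \<omega> (\<phi>2 + \<gamma>2) \<alpha>"
      have "?c \<odot>\<^bsub>T\<^esub> tens (la f1 (la g1 u)) (ra (f2 \<otimes>\<^bsub>V\<^esub> g2) v) =
          H.swe T v (\<lambda>\<beta> v \<delta> w. ?c \<odot>\<^bsub>T\<^esub> tens (la f1 (la g1 u)) (\<omega> \<gamma>2 \<beta> \<odot>\<^bsub>V\<^esub> (ra f2 v \<otimes>\<^bsub>V\<^esub> ra g2 w)))"
        unfolding ra_mult[OF \<open>f2 \<in> carrier V\<close> h(4) \<open>v \<in> carrier H\<close>]
        by (rule H.swe_linear_map[where f = "\<lambda>s. ?c \<odot>\<^bsub>T\<^esub> tens (la f1 (la g1 u)) s"]) (auto intro!: lin)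
      also have "\<dots> = H.swe T v (\<lambda>\<beta> v \<delta> w. (?c \<otimes> \<omega> \<gamma>2 \<beta>) \<odot>\<^bsub>T\<^esub> ?t f1 g1 u f2 g2 v w)"
        by (rule H.swe_cong) (auto simp: HV.pure_smult_right HV.T.smult_assoc1)
      finally show "?c \<odot>\<^bsub>T\<^esub> tens (la f1 (la g1 u)) (ra (f2 \<otimes>\<^bsub>V\<^esub> g2) v) =
        H.swe T v (\<lambda>\<beta> v \<delta> w. (?c \<otimes> \<omega> \<gamma>2 \<beta>) \<odot>\<^bsub>T\<^esub> ?t f1 g1 u f2 g2 v w)" .
    qed
    finally show "\<omega> \<phi>2 \<gamma>1 \<odot>\<^bsub>T\<^esub> H.swe T x (\<lambda>\<xi>1 x1 \<xi>2 x2.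
        \<omega> (\<phi>2 + \<gamma>2) \<xi>1 \<odot>\<^bsub>T\<^esub> tens (la (f1 \<otimes>\<^bsub>V\<^esub> g1) x1) (ra (f2 \<otimes>\<^bsub>V\<^esub> g2) x2)) =
      H.swe T x (\<lambda>\<alpha> u \<beta> v. H.swe T v (\<lambda>\<beta> v \<delta> w.
      (\<omega> \<phi>2 \<gamma>1 \<otimes> \<omega> (\<phi>2 + \<gamma>2) \<alpha> \<otimes> \<omega> \<gamma>2 \<beta>) \<odot>\<^bsub>T\<^esub> ?t f1 g1 u f2 g2 v w))" .
  qed
  \<comment> \<open>The legs \<open>u\<close> and \<open>v\<close> are regrouped as the coproduct of
    one element, which becomes \<open>x1\<close> below: by \<open>la_comult\<close> the element
    \<open>la g1 x1\<close> crossed by \<open>f\<close> has the legs \<open>la g1 u\<close> and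
    \<open>v\<close>.\<close>
  also have "\<dots> = V.swe T f (\<lambda>\<phi>1 f1 \<phi>2 f2. V.swe T g (\<lambda>\<gamma>1 g1 \<gamma>2 g2. H.swe T x (\<lambda>\<alpha> u \<delta> w. H.swe T u (\<lambda>\<alpha> u \<beta> v.
      (\<omega> \<phi>2 \<gamma>1 \<otimes> \<omega> (\<phi>2 + \<gamma>2) \<alpha> \<otimes> \<omega> \<gamma>2 \<beta>) \<odot>\<^bsub>T\<^esub> ?t f1 g1 u f2 g2 v w))))"
    by (rule V.swe_cong, simp, rule V.swe_cong, simp, rule H.swe_coassoc[symmetric])
      (auto intro!: graded_trilinearI lin)
  also have "\<dots> = V.swe T g (\<lambda>\<gamma>1 g1 \<gamma>2 g2. V.swe T f (\<lambda>\<phi>1 f1 \<phi>2 f2. H.swe T x (\<lambda>\<alpha> u \<delta> w. H.swe T u (\<lambda>\<alpha> u \<beta> v.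
      (\<omega> \<phi>2 \<gamma>1 \<otimes> \<omega> (\<phi>2 + \<gamma>2) \<alpha> \<otimes> \<omega> \<gamma>2 \<beta>) \<odot>\<^bsub>T\<^esub> ?t f1 g1 u f2 g2 v w))))"
    by (rule swap_VV) (auto intro!: H.swe_closed)
  also have "\<dots> = V.swe T g (\<lambda>\<gamma>1 g1 \<gamma>2 g2. H.swe T x (\<lambda>\<alpha> u \<delta> w. V.swe T f (\<lambda>\<phi>1 f1 \<phi>2 f2. H.swe T u (\<lambda>\<alpha> u \<beta> v.
      (\<omega> \<phi>2 \<gamma>1 \<otimes> \<omega> (\<phi>2 + \<gamma>2) \<alpha> \<otimes> \<omega> \<gamma>2 \<beta>) \<odot>\<^bsub>T\<^esub> ?t f1 g1 u f2 g2 v w))))"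
    by (rule V.swe_cong, simp, rule swap_VH) (auto intro!: H.swe_closed)
  also have "\<dots> = V.swe T g (\<lambda>\<gamma>1 g1 \<gamma>2 g2. H.swe T x (\<lambda>\<xi>1 x1 \<xi>2 w.
      \<omega> \<gamma>2 \<xi>1 \<odot>\<^bsub>T\<^esub> rmul (ra g2 w) (psi f (la g1 x1))))"
  proof (rule V.swe_cong[OF gc], rule H.swe_cong[OF xc])
    fix \<gamma>1 g1 \<gamma>2 g2 \<xi>1 x1 \<xi>2 w
    assume h: "g1 \<in> grade V \<gamma>1" "x1 \<in> grade H \<xi>1"
      and [simp]: "g1 \<in> carrier V" "g2 \<in> carrier V" "x1 \<in> carrier H" "w \<in> carrier H"
    let ?L = "\<lambda>s. \<omega> \<gamma>2 \<xi>1 \<odot>\<^bsub>T\<^esub> rmul (ra g2 w) s"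
    have L: "linear_map K T T ?L" by (auto intro!: lin)
    have "?L (psi f (la g1 x1)) = V.swe T f (\<lambda>\<phi>1 f1 \<phi>2 f2. H.swe T (la g1 x1) (\<lambda>\<alpha> u \<beta> v.
        \<omega> \<phi>2 \<alpha> \<odot>\<^bsub>T\<^esub> ?L (tens (la f1 u) (ra f2 v))))"
      by (rule psi_linear_map[OF _ L]) auto
    also have "\<dots> = V.swe T f (\<lambda>\<phi>1 f1 \<phi>2 f2. H.swe T x1 (\<lambda>\<alpha> u \<beta> v.
        \<omega> \<phi>2 (\<gamma>1 + \<alpha>) \<odot>\<^bsub>T\<^esub> ?L (tens (la f1 (la g1 u)) (ra f2 v))))"
      by (rule V.swe_cong, simp, rule la_comult[OF _ _ h(1)]) (auto intro!: graded_bilinearI lin)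
    also have "\<dots> = V.swe T f (\<lambda>\<phi>1 f1 \<phi>2 f2. H.swe T x1 (\<lambda>\<alpha> u \<beta> v.
      (\<omega> \<phi>2 \<gamma>1 \<otimes> \<omega> (\<phi>2 + \<gamma>2) \<alpha> \<otimes> \<omega> \<gamma>2 \<beta>) \<odot>\<^bsub>T\<^esub> ?t f1 g1 u f2 g2 v w))"
    proof (rule V.swe_cong[OF fc], rule H.swe_homogeneous_cong[OF h(2)])
      fix \<phi>1 f1 \<phi>2 f2 \<alpha> u \<beta> v
      assume k: "\<alpha> + \<beta> = \<xi>1" and [simp]: "f1 \<in> carrier V" "f2 \<in> carrier V" "u \<in> carrier H" "v \<in> carrier H"
      show "\<omega> \<phi>2 (\<gamma>1 + \<alpha>) \<odot>\<^bsub>T\<^esub> ?L (tens (la f1 (la g1 u)) (ra f2 v)) =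
          (\<omega> \<phi>2 \<gamma>1 \<otimes> \<omega> (\<phi>2 + \<gamma>2) \<alpha> \<otimes> \<omega> \<gamma>2 \<beta>) \<odot>\<^bsub>T\<^esub> ?t f1 g1 u f2 g2 v w"
        by (simp add: HV.T.smult_assoc1[symmetric] factor_add m_ac flip: k)
    qed
    finally show "V.swe T f (\<lambda>\<phi>1 f1 \<phi>2 f2. H.swe T x1 (\<lambda>\<alpha> u \<beta> v.
      (\<omega> \<phi>2 \<gamma>1 \<otimes> \<omega> (\<phi>2 + \<gamma>2) \<alpha> \<otimes> \<omega> \<gamma>2 \<beta>) \<odot>\<^bsub>T\<^esub> ?t f1 g1 u f2 g2 v w)) =
      \<omega> \<gamma>2 \<xi>1 \<odot>\<^bsub>T\<^esub> rmul (ra g2 w) (psi f (la g1 x1))" ..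
  qed
  also have "\<dots> = tsum K T (psi g x) (\<lambda>x' g'. rmul g' (psi f x'))"
    by (subst psi_linear_map[OF T_module HV.linear_map_tsum[OF T_module bil]])
      (auto intro!: V.swe_cong H.swe_cong simp: HV.tsum_pure[OF T_module bil])
  finally show ?thesis .
qed

end

section \<open>The double as an algebra\<close>

context hopf_pairing
begin

lemma bilinear_rmul_psi: "f \<in> carrier V \<Longrightarrow> bilinear_map K H V T (\<lambda>x' g'. rmul g' (psi f x'))"
  and bilinear_lmul_psi: "y \<in> carrier H \<Longrightarrow> bilinear_map K H V T (\<lambda>x' f'. lmul x' (psi f' y))"
  by (auto intro!: bilinear_mapI lin)

text \<open>The mirror image of \<open>psi_mult_homogeneous\<close>: \<open>f\<close> crosses
  \<open>x\<close>, and the form that emerges crosses \<open>y\<close>. The actions split over the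
  product by \<open>la_tensor\<close> and \<open>ra_tensor\<close>, and the coproduct of the
  emerging form is given by \<open>ra_comult\<close>.\<close>

lemma psi_tensor_homogeneous:
  assumes f: "f \<in> carrier V" and x: "x \<in> grade H \<xi>" and y: "y \<in> carrier H"
  shows "psi f (x \<otimes>\<^bsub>H\<^esub> y) = tsum K T (psi f x) (\<lambda>x' f'. lmul x' (psi f' y))"
proof -
  have xc [simp]: "x \<in> carrier H" by (rule H.grade_closed[OF x])
  note [simp] = f y
  let ?t = "\<lambda>a x1 b y1 c x2 y2. tens (la a x1 \<otimes>\<^bsub>H\<^esub> la b y1) (ra (ra c x2) y2)"
  let ?s = "\<lambda>\<beta> \<gamma> \<xi>1 \<xi>2 \<eta>1. \<omega> \<xi>2 \<eta>1 \<otimes> \<omega> \<gamma> (\<xi>1 + \<eta>1) \<otimes> \<omega> \<beta> \<xi>1"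
  have "psi f (x \<otimes>\<^bsub>H\<^esub> y) = V.swe T f (\<lambda>\<phi>1 f1 \<gamma> c. H.swe T x (\<lambda>\<xi>1 x1 \<xi>2 x2. H.swe T y (\<lambda>\<eta>1 y1 \<eta>2 y2.
      \<omega> \<xi>2 \<eta>1 \<odot>\<^bsub>T\<^esub> (\<omega> \<gamma> (\<xi>1 + \<eta>1) \<odot>\<^bsub>T\<^esub> tens (la f1 (x1 \<otimes>\<^bsub>H\<^esub> y1)) (ra c (x2 \<otimes>\<^bsub>H\<^esub> y2))))))"
    unfolding psi_def by (rule V.swe_cong, simp, rule H.swe_mult) (auto intro!: graded_bilinearI lin)
  also have "\<dots> = V.swe T f (\<lambda>\<phi>1 f1 \<gamma> c. H.swe T x (\<lambda>\<xi>1 x1 \<xi>2 x2. H.swe T y (\<lambda>\<eta>1 y1 \<eta>2 y2.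
      V.swe T f1 (\<lambda>\<alpha> a \<beta> b. ?s \<beta> \<gamma> \<xi>1 \<xi>2 \<eta>1 \<odot>\<^bsub>T\<^esub> ?t a x1 b y1 c x2 y2))))"
  proof (rule V.swe_cong[OF f], rule H.swe_cong[OF xc], rule H.swe_cong[OF y])
    fix \<phi>1 f1 \<gamma> c \<xi>1 x1 \<xi>2 x2 \<eta>1 y1 \<eta>2 y2
    assume h: "x1 \<in> grade H \<xi>1"
      and [simp]: "f1 \<in> carrier V" "c \<in> carrier V" "x1 \<in> carrier H" "x2 \<in> carrier H" "y1 \<in> carrier H" "y2 \<in> carrier H"
    let ?L = "\<lambda>s. \<omega> \<xi>2 \<eta>1 \<odot>\<^bsub>T\<^esub> (\<omega> \<gamma> (\<xi>1 + \<eta>1) \<odot>\<^bsub>T\<^esub> tens s (ra (ra c x2) y2))"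
    have "?L (la f1 (x1 \<otimes>\<^bsub>H\<^esub> y1)) = V.swe T f1 (\<lambda>\<alpha> a \<beta> b. ?L (\<omega> \<beta> \<xi>1 \<odot>\<^bsub>H\<^esub> (la a x1 \<otimes>\<^bsub>H\<^esub> la b y1)))"
      unfolding la_tensor[OF \<open>f1 \<in> carrier V\<close> h \<open>y1 \<in> carrier H\<close>]
      by (rule V.swe_linear_map[where f = ?L]) (auto intro!: lin)
    also have "\<dots> = V.swe T f1 (\<lambda>\<alpha> a \<beta> b. ?s \<beta> \<gamma> \<xi>1 \<xi>2 \<eta>1 \<odot>\<^bsub>T\<^esub> ?t a x1 b y1 c x2 y2)"
      by (rule V.swe_cong) (simp_all add: HV.pure_smult_left HV.T.smult_assoc1[symmetric] m_ac)
    finally show "\<omega> \<xi>2 \<eta>1 \<odot>\<^bsub>T\<^esub> (\<omega> \<gamma> (\<xi>1 + \<eta>1) \<odot>\<^bsub>T\<^esub> tens (la f1 (x1 \<otimes>\<^bsub>H\<^esub> y1)) (ra c (x2 \<otimes>\<^bsub>H\<^esub> y2))) =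
        V.swe T f1 (\<lambda>\<alpha> a \<beta> b. ?s \<beta> \<gamma> \<xi>1 \<xi>2 \<eta>1 \<odot>\<^bsub>T\<^esub> ?t a x1 b y1 c x2 y2)"
      by (simp add: ra_tensor)
  qed
  also have "\<dots> = V.swe T f (\<lambda>\<phi>1 f1 \<gamma> c. H.swe T x (\<lambda>\<xi>1 x1 \<xi>2 x2. V.swe T f1 (\<lambda>\<alpha> a \<beta> b.
      H.swe T y (\<lambda>\<eta>1 y1 \<eta>2 y2. ?s \<beta> \<gamma> \<xi>1 \<xi>2 \<eta>1 \<odot>\<^bsub>T\<^esub> ?t a x1 b y1 c x2 y2))))"
    by (rule V.swe_cong, simp, rule H.swe_cong, simp, rule swap_VH[symmetric]) auto
  also have "\<dots> = V.swe T f (\<lambda>\<phi>1 f1 \<gamma> c. V.swe T f1 (\<lambda>\<alpha> a \<beta> b. H.swe T x (\<lambda>\<xi>1 x1 \<xi>2 x2.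
      H.swe T y (\<lambda>\<eta>1 y1 \<eta>2 y2. ?s \<beta> \<gamma> \<xi>1 \<xi>2 \<eta>1 \<odot>\<^bsub>T\<^esub> ?t a x1 b y1 c x2 y2))))"
    by (rule V.swe_cong, simp, rule swap_VH[symmetric]) (auto intro!: H.swe_closed)
  also have "\<dots> = V.swe T f (\<lambda>\<alpha> a \<phi>2 f2. V.swe T f2 (\<lambda>\<beta> b \<gamma> c. H.swe T x (\<lambda>\<xi>1 x1 \<xi>2 x2.
      H.swe T y (\<lambda>\<eta>1 y1 \<eta>2 y2. ?s \<beta> \<gamma> \<xi>1 \<xi>2 \<eta>1 \<odot>\<^bsub>T\<^esub> ?t a x1 b y1 c x2 y2))))"
    by (rule V.swe_coassoc) (auto intro!: graded_trilinearI graded_bilinearI lin)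
  also have "\<dots> = V.swe T f (\<lambda>\<alpha> a \<phi>2 f2. H.swe T x (\<lambda>\<xi>1 x1 \<xi>2 x2. V.swe T f2 (\<lambda>\<beta> b \<gamma> c.
      H.swe T y (\<lambda>\<eta>1 y1 \<eta>2 y2. ?s \<beta> \<gamma> \<xi>1 \<xi>2 \<eta>1 \<odot>\<^bsub>T\<^esub> ?t a x1 b y1 c x2 y2))))"
    by (rule V.swe_cong, simp, rule swap_VH) (auto intro!: H.swe_closed)
  also have "\<dots> = V.swe T f (\<lambda>\<alpha> a \<phi>2 f2. H.swe T x (\<lambda>\<xi>1 x1 \<xi>2 x2.
      \<omega> \<phi>2 \<xi>1 \<odot>\<^bsub>T\<^esub> lmul (la a x1) (psi (ra f2 x2) y)))"
  proof (rule V.swe_cong[OF f], rule H.swe_cong[OF xc])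
    fix \<alpha> a \<phi>2 f2 \<xi>1 x1 \<xi>2 x2
    assume h: "f2 \<in> grade V \<phi>2" "x2 \<in> grade H \<xi>2"
      and [simp]: "a \<in> carrier V" "f2 \<in> carrier V" "x1 \<in> carrier H" "x2 \<in> carrier H"
    let ?L = "\<lambda>s. \<omega> \<phi>2 \<xi>1 \<odot>\<^bsub>T\<^esub> lmul (la a x1) s"
    have L: "linear_map K T T ?L" by (auto intro!: lin)
    have "?L (psi (ra f2 x2) y) = V.swe T (ra f2 x2) (\<lambda>\<beta> b \<gamma> c. H.swe T y (\<lambda>\<eta>1 y1 \<eta>2 y2.
        \<omega> \<gamma> \<eta>1 \<odot>\<^bsub>T\<^esub> ?L (tens (la b y1) (ra c y2))))"
      by (rule psi_linear_map[OF _ L]) auto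
    also have "\<dots> = V.swe T f2 (\<lambda>\<beta> b \<gamma> c. H.swe T y (\<lambda>\<eta>1 y1 \<eta>2 y2.
        \<omega> (\<gamma> + \<xi>2) \<eta>1 \<odot>\<^bsub>T\<^esub> ?L (tens (la b y1) (ra (ra c x2) y2))))"
      by (rule ra_comult[OF _ _ _ h(2)]) (auto intro!: graded_bilinearI lin)
    also have "\<dots> = V.swe T f2 (\<lambda>\<beta> b \<gamma> c. H.swe T y (\<lambda>\<eta>1 y1 \<eta>2 y2.
        ?s \<beta> \<gamma> \<xi>1 \<xi>2 \<eta>1 \<odot>\<^bsub>T\<^esub> ?t a x1 b y1 c x2 y2))"
    proof (rule V.swe_homogeneous_cong[OF h(1)], rule H.swe_cong[OF y])
      fix \<beta> b \<gamma> c \<eta>1 y1 \<eta>2 y2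
      assume k: "\<beta> + \<gamma> = \<phi>2" and [simp]: "b \<in> carrier V" "c \<in> carrier V" "y1 \<in> carrier H" "y2 \<in> carrier H"
      show "\<omega> (\<gamma> + \<xi>2) \<eta>1 \<odot>\<^bsub>T\<^esub> ?L (tens (la b y1) (ra (ra c x2) y2)) =
          ?s \<beta> \<gamma> \<xi>1 \<xi>2 \<eta>1 \<odot>\<^bsub>T\<^esub> ?t a x1 b y1 c x2 y2"
        by (simp add: HV.T.smult_assoc1[symmetric] factor_add m_ac flip: k)
    qed
    finally show "V.swe T f2 (\<lambda>\<beta> b \<gamma> c. H.swe T y (\<lambda>\<eta>1 y1 \<eta>2 y2.
        ?s \<beta> \<gamma> \<xi>1 \<xi>2 \<eta>1 \<odot>\<^bsub>T\<^esub> ?t a x1 b y1 c x2 y2)) = \<omega> \<phi>2 \<xi>1 \<odot>\<^bsub>T\<^esub> lmul (la a x1) (psi (ra f2 x2) y)" ..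
  qed
  also have "\<dots> = tsum K T (psi f x) (\<lambda>x' f'. lmul x' (psi f' y))"
    by (subst psi_linear_map[OF T_module HV.linear_map_tsum[OF T_module bilinear_lmul_psi]])
      (auto intro!: V.swe_cong H.swe_cong simp: HV.tsum_pure[OF T_module bilinear_lmul_psi])
  finally show ?thesis .
qed

lemma psi_tensor:
  assumes "f \<in> carrier V" "x \<in> carrier H" "y \<in> carrier H"
  shows "psi f (x \<otimes>\<^bsub>H\<^esub> y) = tsum K T (psi f x) (\<lambda>x' f'. lmul x' (psi f' y))"
  by (rule H.linear_map_eqI_homogeneous[where P = T and f = "\<lambda>x. psi f (x \<otimes>\<^bsub>H\<^esub> y)"])
    (use assms psi_tensor_homogeneous[OF assms(1) _ assms(3)] in \<open>auto intro!: lin bilinear_lmul_psi\<close>)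

lemma psi_mult:
  assumes f: "f \<in> carrier V" and g: "g \<in> carrier V" and x: "x \<in> carrier H"
  shows "psi (f \<otimes>\<^bsub>V\<^esub> g) x = tsum K T (psi g x) (\<lambda>x' g'. rmul g' (psi f x'))"
proof -
  have lf: "linear_map K V T (\<lambda>f. tsum K T (psi g x) (\<lambda>x' g'. rmul g' (psi f x')))"
    if "g \<in> carrier V" "x \<in> carrier H" for g x
    using that by (intro HV.tsum_pointwise_lin bilinear_rmul_psi lin) auto
  have 1: "psi (f \<otimes>\<^bsub>V\<^esub> g) x = tsum K T (psi g x) (\<lambda>x' g'. rmul g' (psi f x'))"
    if "f \<in> grade V \<phi>" "f \<in> carrier V" "g \<in> grade V \<gamma>" "g \<in> carrier V" for f g \<phi> \<gamma>
    by (rule H.linear_map_eqI_homogeneous[where P = T])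
      (use that x psi_mult_homogeneous[OF that(1,3)] in \<open>auto intro!: lin bilinear_rmul_psi\<close>)
  have 2: "psi (f \<otimes>\<^bsub>V\<^esub> g) x = tsum K T (psi g x) (\<lambda>x' g'. rmul g' (psi f x'))"
    if "f \<in> grade V \<phi>" "f \<in> carrier V" for f \<phi>
    by (rule V.linear_map_eqI_homogeneous[where P = T])
      (use that g x 1[OF that] in \<open>auto intro!: lin bilinear_rmul_psi\<close>)
  show ?thesis
    by (rule V.linear_map_eqI_homogeneous[where P = T]) (use f g x 2 in \<open>auto intro!: lin lf\<close>)
qed

definition "dm s t = tsum K T s (\<lambda>x f. tsum K T t (\<lambda>y g. lmul x (rmul g (psi f y))))"

lemma bilinear_dm:
  assumes "x \<in> carrier H" "f \<in> carrier V"
  shows "bilinear_map K H V T (\<lambda>y g. lmul x (rmul g (psi f y)))"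
  using assms by (auto intro!: bilinear_mapI lin)

lemma bilinear_dm_left:
  assumes "t \<in> carrier T"
  shows "bilinear_map K H V T (\<lambda>x f. tsum K T t (\<lambda>y g. lmul x (rmul g (psi f y))))"
  using assms by (intro bilinear_mapI HV.tsum_pointwise_lin bilinear_dm lin) auto

lemma lin_dm [lin]:
  "\<lbrakk>linear_map K Q T h; t \<in> carrier T\<rbrakk> \<Longrightarrow> linear_map K Q T (\<lambda>z. dm (h z) t)"
  "\<lbrakk>linear_map K Q T h; s \<in> carrier T; module K Q\<rbrakk> \<Longrightarrow> linear_map K Q T (\<lambda>z. dm s (h z))"
  unfolding dm_def
  by (auto intro!: HV.lin_tsum bilinear_dm_left)
    (intro HV.tsum_pointwise_lin bilinear_dm_left HV.lin_tsum bilinear_dm; auto intro: linear_map_closed)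

lemmas lin_dm_eta [lin] = lin_dm(2)[OF lin_id]

lemma dm_closed [simp, intro]: "\<lbrakk>s \<in> carrier T; t \<in> carrier T\<rbrakk> \<Longrightarrow> dm s t \<in> carrier T"
  using linear_map_closed[OF lin_dm(1)[OF lin_id]] by blast

lemma dm_tens:
  "\<lbrakk>x \<in> carrier H; f \<in> carrier V; t \<in> carrier T\<rbrakk> \<Longrightarrow>
    dm (tens x f) t = tsum K T t (\<lambda>y g. lmul x (rmul g (psi f y)))"
  unfolding dm_def by (rule HV.tsum_pure[OF T_module bilinear_dm_left])

lemma dm_tens_tens:
  "\<lbrakk>x \<in> carrier H; f \<in> carrier V; y \<in> carrier H; g \<in> carrier V\<rbrakk> \<Longrightarrow>
    dm (tens x f) (tens y g) = lmul x (rmul g (psi f y))"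
  by (simp add: dm_tens HV.tsum_pure[OF T_module bilinear_dm])

lemma dm_lmul: 
  assumes "x \<in> carrier H" "s \<in> carrier T" "t \<in> carrier T"
  shows "dm (lmul x s) t = lmul x (dm s t)"
proof (rule HV.tensor_eqI[OF T_module _ _ _ assms(2)])
  fix y g assume [simp]: "y \<in> carrier H" "g \<in> carrier V"
  note [simp] = assms
  show "dm (lmul x (tens y g)) t = lmul x (dm (tens y g) t)"
  proof (rule HV.tensor_eqI[OF T_module _ _ _ assms(3)])
    fix z h assume [simp]: "z \<in> carrier H" "h \<in> carrier V"
    show "dm (lmul x (tens y g)) (tens z h) = lmul x (dm (tens y g) (tens z h))"
      by (simp add: dm_tens_tens lmul_lmul)
  qed (auto intro!: lin)
qed (use assms in \<open>auto intro!: lin\<close>)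

lemma dm_rmul:
  assumes "g \<in> carrier V" "s \<in> carrier T" "t \<in> carrier T"
  shows "dm s (rmul g t) = rmul g (dm s t)"
proof (rule HV.tensor_eqI[OF T_module _ _ _ assms(2)])
  fix y f assume [simp]: "y \<in> carrier H" "f \<in> carrier V"
  note [simp] = assms
  show "dm (tens y f) (rmul g t) = rmul g (dm (tens y f) t)"
  proof (rule HV.tensor_eqI[OF T_module _ _ _ assms(3)])
    fix z h assume [simp]: "z \<in> carrier H" "h \<in> carrier V"
    show "dm (tens y f) (rmul g (tens z h)) = rmul g (dm (tens y f) (tens z h))"
      by (simp add: dm_tens_tens lmul_rmul rmul_rmul)
  qed (auto intro!: lin)
qed (use assms in \<open>auto intro!: lin\<close>)

text \<open>A case of associativity, with \<open>g\<close> to the left of \<open>z\<close>: after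
  reduction to a pure tensor it is \<open>psi_mult\<close> for a product of forms crossing
  \<open>z\<close>.\<close>

lemma dm_rmul_left:
  assumes "g \<in> carrier V" "s \<in> carrier T" "z \<in> carrier H" "h \<in> carrier V"
  shows "dm (rmul g s) (tens z h) = rmul h (dm s (psi g z))"
proof (rule HV.tensor_eqI[OF T_module _ _ _ assms(2)])
  fix y f assume [simp]: "y \<in> carrier H" "f \<in> carrier V"
  note [simp] = assms
  have "dm (rmul g (tens y f)) (tens z h) = rmul h (lmul y (psi (f \<otimes>\<^bsub>V\<^esub> g) z))"
    by (simp add: dm_tens_tens lmul_rmul)
  also have "lmul y (psi (f \<otimes>\<^bsub>V\<^esub> g) z) = dm (tens y f) (psi g z)"
    unfolding psi_mult[OF \<open>f \<in> carrier V\<close> assms(1,3)]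
    by (rule HV.tensor_eqI[OF T_module])
      (auto intro!: lin bilinear_rmul_psi simp: dm_tens_tens HV.tsum_pure[OF T_module bilinear_rmul_psi])
  finally show "dm (rmul g (tens y f)) (tens z h) = rmul h (dm (tens y f) (psi g z))" .
qed (use assms in \<open>auto intro!: lin\<close>)

text \<open>The counterpart of \<open>dm_rmul_left\<close>, with \<open>f\<close> to the left of
  \<open>y\<close>; it rests on \<open>psi_tensor\<close>.\<close>

lemma dm_lmul_right:
  assumes "x \<in> carrier H" "f \<in> carrier V" "y \<in> carrier H" "t \<in> carrier T"
  shows "dm (tens x f) (lmul y t) = lmul x (dm (psi f y) t)"
proof (rule HV.tensor_eqI[OF T_module _ _ _ assms(4)])
  fix z g assume [simp]: "z \<in> carrier H" "g \<in> carrier V"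
  note [simp] = assms
  have "dm (tens x f) (lmul y (tens z g)) = lmul x (rmul g (psi f (y \<otimes>\<^bsub>H\<^esub> z)))"
    by (simp add: dm_tens_tens)
  also have "rmul g (psi f (y \<otimes>\<^bsub>H\<^esub> z)) = dm (psi f y) (tens z g)"
    unfolding psi_tensor[OF assms(2,3) \<open>z \<in> carrier H\<close>]
    by (rule HV.tensor_eqI[OF T_module])
      (auto intro!: lin bilinear_lmul_psi simp: dm_tens_tens HV.tsum_pure[OF T_module bilinear_lmul_psi] lmul_rmul)
  finally show "dm (tens x f) (lmul y (tens z g)) = lmul x (dm (psi f y) (tens z g))" .
qed (use assms in \<open>auto intro!: lin\<close>)

lemma dm_assoc:
  assumes "r \<in> carrier T" "s \<in> carrier T" "t \<in> carrier T"
  shows "dm (dm r s) t = dm r (dm s t)"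
proof -
  note [simp] = assms
  \<comment> \<open>Both bracketings normalise to
    \<open>lmul x (rmul h (dm (psi f y) (psi g z)))\<close>.\<close>
  have 1: "dm (dm (tens x f) (tens y g)) (tens z h) = dm (tens x f) (dm (tens y g) (tens z h))"
    if [simp]: "x \<in> carrier H" "f \<in> carrier V" "y \<in> carrier H" "g \<in> carrier V" "z \<in> carrier H" "h \<in> carrier V"
    for x f y g z h
    by (simp add: dm_tens_tens dm_lmul dm_rmul dm_rmul_left dm_lmul_right lmul_rmul)
  have 2: "dm (dm (tens x f) (tens y g)) t = dm (tens x f) (dm (tens y g) t)"
    if [simp]: "x \<in> carrier H" "f \<in> carrier V" "y \<in> carrier H" "g \<in> carrier V" for x f y g
    by (rule HV.tensor_eqI[OF T_module _ _ _ assms(3)]) (auto intro!: lin simp: 1)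
  have 3: "dm (dm (tens x f) s) t = dm (tens x f) (dm s t)"
    if [simp]: "x \<in> carrier H" "f \<in> carrier V" for x f
    by (rule HV.tensor_eqI[OF T_module _ _ _ assms(2)]) (auto intro!: lin simp: 2)
  show ?thesis
    by (rule HV.tensor_eqI[OF T_module _ _ _ assms(1)]) (auto intro!: lin simp: 3)
qed

lemma dm_one:
  assumes "t \<in> carrier T"
  shows "dm (tens \<one>\<^bsub>H\<^esub> \<one>\<^bsub>V\<^esub>) t = t" "dm t (tens \<one>\<^bsub>H\<^esub> \<one>\<^bsub>V\<^esub>) = t"
  by (rule HV.tensor_eqI[OF T_module _ _ _ assms];
      auto intro!: lin simp: dm_tens_tens psi_one_left psi_one_right)+

lemma dm_grade:
  assumes "s \<in> tensor_grade K H V \<sigma>" "t \<in> tensor_grade K H V \<tau>"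
  shows "dm s t \<in> tensor_grade K H V (\<sigma> + \<tau>)"
proof -
  have c [simp]: "s \<in> carrier T" "t \<in> carrier T" using assms HV.tensor_grade_closed by auto
  have l: "lmul x r \<in> tensor_grade K H V (\<alpha> + \<rho>)" if "x \<in> grade H \<alpha>" "r \<in> tensor_grade K H V \<rho>" for x \<alpha> r \<rho>
    by (rule HV.linear_map_tensor_grade[OF T_module lin_lmul_eta HV.submodule_tensor_grade that(2)])
      (use that(1) H.grade_closed V.grade_closed in \<open>auto intro!: HV.pure_grade[OF H.grade_mult] simp: ac_simps\<close>)
  have r: "rmul g r \<in> tensor_grade K H V (\<rho> + \<gamma>)" if "g \<in> grade V \<gamma>" "r \<in> tensor_grade K H V \<rho>" for g \<gamma> r \<rho>
    by (rule HV.linear_map_tensor_grade[OF T_module lin_rmul_eta HV.submodule_tensor_grade that(2)])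
      (use that(1) H.grade_closed V.grade_closed in \<open>auto intro!: HV.pure_grade[OF _ V.grade_mult] simp: ac_simps\<close>)
  show ?thesis
  proof (rule HV.linear_map_tensor_grade[OF T_module _ HV.submodule_tensor_grade assms(1)])
    fix \<alpha> x \<beta> f assume h: "x \<in> grade H \<alpha>" "f \<in> grade V \<beta>" "\<alpha> + \<beta> = \<sigma>"
    have [simp]: "x \<in> carrier H" "f \<in> carrier V" using h H.grade_closed V.grade_closed by auto
    show "dm (tens x f) t \<in> tensor_grade K H V (\<sigma> + \<tau>)"
    proof (rule HV.linear_map_tensor_grade[OF T_module _ HV.submodule_tensor_grade assms(2)])
      fix \<gamma> y \<delta> g assume k: "y \<in> grade H \<gamma>" "g \<in> grade V \<delta>" "\<gamma> + \<delta> = \<tau>"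
      have [simp]: "y \<in> carrier H" "g \<in> carrier V" using k H.grade_closed V.grade_closed by auto
      have "lmul x (rmul g (psi f y)) \<in> tensor_grade K H V (\<alpha> + ((\<beta> + \<gamma>) + \<delta>))"
        by (intro l r psi_grade h k)
      then show "dm (tens x f) (tens y g) \<in> tensor_grade K H V (\<sigma> + \<tau>)"
        using h(3) k(3) by (auto simp: dm_tens_tens ac_simps)
    qed (auto intro!: lin)
  qed (auto intro!: lin)
qed

end

text \<open>The support of the chosen representative lies in the product of the carriers, so
  agreement on the carriers is enough and \<open>b'\<close> itself may be arbitrary
  elsewhere.\<close>

lemma (in module_pair) tsum_cong_carrier:
  assumes P: "module K P" and b: "bilinear_map K M N P b" and t: "t \<in> carrier T"
    and eq: "\<And>x y. \<lbrakk>x \<in> carrier M; y \<in> carrier N\<rbrakk> \<Longrightarrow> b' x y = b x y"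
  shows "tsum K P t b' = tsum K P t b"
proof -
  interpret P: module K P by fact
  let ?u = "SOME u. u \<in> t"
  obtain v where v: "v \<in> carrier F" "t = Rel +>\<^bsub>F\<^esub> v" using t by (auto simp: tensor_carrier)
  have "v \<in> t" unfolding v(2) using v(1) by (rule Rel.a_rcos_self)
  then have "?u \<in> t" by (rule someI[of "\<lambda>u. u \<in> t"])
  then have u: "?u \<in> carrier F"
    using v Rel.a_subset by (auto simp: a_r_coset_def')
  have p: "fst p \<in> carrier M" "snd p \<in> carrier N" if "?u p \<noteq> \<zero>\<^bsub>K\<^esub>" for p
    using u that by (cases p; auto simp: M.R.free_module_carrier)+
  show ?thesis unfolding tsum_def Let_def
    by (rule P.finsum_cong')
      (use p M.R.free_module_value[OF u] bilinear_map_closed[OF b] in \<open>auto simp: eq\<close>)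
qed

lemma (in graded_module) graded_ext_cong:
  assumes "x \<in> carrier M" "\<And>\<alpha> a. a \<in> carrier M \<Longrightarrow> F \<alpha> a = G \<alpha> a"
  shows "graded_ext M P F x = graded_ext M P G x"
proof -
  have "(\<lambda>\<alpha>. F \<alpha> (hcomp M x \<alpha>)) = (\<lambda>\<alpha>. G \<alpha> (hcomp M x \<alpha>))"
    using assms hcomp_closed by auto
  then show ?thesis by (simp add: graded_ext_def)
qed

lemma (in graded_pair) graded_ext2_cong:
  assumes "x \<in> carrier M" "y \<in> carrier N"
    and "\<And>\<alpha> a \<beta> c. \<lbrakk>a \<in> carrier M; c \<in> carrier N\<rbrakk> \<Longrightarrow> b \<alpha> a \<beta> c = b' \<alpha> a \<beta> c"
  shows "graded_ext2 M N P b x y = graded_ext2 M N P b' x y"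
  unfolding graded_ext2_def
  by (rule M.graded_ext_cong[OF assms(1)], rule N.graded_ext_cong[OF assms(2)], rule assms(3))

lemma (in graded_pair) lin_graded_ext2_param:
  assumes "module K P" "module K Q" "x \<in> carrier M" "y \<in> carrier N"
    and "\<And>\<alpha> a \<beta> c. \<lbrakk>a \<in> carrier M; c \<in> carrier N\<rbrakk> \<Longrightarrow> linear_map K Q P (\<lambda>z. b z \<alpha> a \<beta> c)"
  shows "linear_map K Q P (\<lambda>z. graded_ext2 M N P (b z) x y)"
  unfolding graded_ext2_def
  by (rule M.linear_map_graded_ext_param[OF assms(1,2,3)],
      rule N.linear_map_graded_ext_param[OF assms(1,2,4)], rule assms(5))

text \<open>The definitions nest \<open>colour_ext\<close> inside two sums over coproducts.
  Linearity in all four legs turns this into a double Sweedler sum with an explicit sign.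
  \<open>G'\<close> is the expression as defined, \<open>G\<close> its linear form, and they need to
  agree on the carriers only.\<close>

lemma tsum_colour_ext:
  assumes \<omega>: "commutative_factor K \<omega>" and A: "graded_module K A" and B: "graded_module K B" and P: "module K P"
    and s: "s \<in> carrier (tensor_module K A A)" and t: "t \<in> carrier (tensor_module K B B)"
    and eq: "\<And>a1 a2 b1 b2. \<lbrakk>a1 \<in> carrier A; a2 \<in> carrier A; b1 \<in> carrier B; b2 \<in> carrier B\<rbrakk> \<Longrightarrow>
      G' a1 a2 b1 b2 = G a1 a2 b1 b2"
    and lin1: "\<And>a2 b1 b2. \<lbrakk>a2 \<in> carrier A; b1 \<in> carrier B; b2 \<in> carrier B\<rbrakk> \<Longrightarrow>
      linear_map K A P (\<lambda>a1. G a1 a2 b1 b2)"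
    and lin2: "\<And>a1 b1 b2. \<lbrakk>a1 \<in> carrier A; b1 \<in> carrier B; b2 \<in> carrier B\<rbrakk> \<Longrightarrow>
      linear_map K A P (\<lambda>a2. G a1 a2 b1 b2)"
    and lin3: "\<And>a1 a2 b2. \<lbrakk>a1 \<in> carrier A; a2 \<in> carrier A; b2 \<in> carrier B\<rbrakk> \<Longrightarrow>
      linear_map K B P (\<lambda>b1. G a1 a2 b1 b2)"
    and lin4: "\<And>a1 a2 b1. \<lbrakk>a1 \<in> carrier A; a2 \<in> carrier A; b1 \<in> carrier B\<rbrakk> \<Longrightarrow>
      linear_map K B P (\<lambda>b2. G a1 a2 b1 b2)"
  shows "tsum K P s (\<lambda>a1 a2. tsum K P t (\<lambda>b1 b2.
      colour_ext K \<omega> A B P (\<lambda>a2' b1'. G' a1 a2' b1' b2) a2 b1)) =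
    gsum K A A P s (\<lambda>\<alpha>1 a1 \<alpha>2 a2. gsum K B B P t (\<lambda>\<beta>1 b1 \<beta>2 b2.
      \<omega> \<alpha>2 \<beta>1 \<odot>\<^bsub>P\<^esub> G a1 a2 b1 b2))"
proof -
  interpret commutative_factor K \<omega> by fact
  interpret A: graded_module K A by fact
  interpret B: graded_module K B by fact
  interpret P: module K P by fact
  interpret AA: graded_pair K A A ..
  interpret BB: graded_pair K B B ..
  interpret AB: graded_pair K A B ..
  let ?h = "\<lambda>a1 b2 \<alpha> a2 \<beta> b1. \<omega> \<alpha> \<beta> \<odot>\<^bsub>P\<^esub> G a1 a2 b1 b2"
  let ?g = "\<lambda>a1 b2. graded_ext2 A B P (?h a1 b2)"
  have h: "graded_bilinear K A B P (?h a1 b2)" if "a1 \<in> carrier A" "b2 \<in> carrier B" for a1 b2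
    using that by (intro graded_bilinearI P.lin_smult lin2 lin3) auto
  note g = AB.bilinear_graded_ext2[OF P h]
  have g1: "linear_map K A P (\<lambda>a1. ?g a1 b2 a2 b1)" if "a2 \<in> carrier A" "b1 \<in> carrier B" "b2 \<in> carrier B" for a2 b1 b2
    using that by (intro AB.lin_graded_ext2_param P A.module_axioms P.lin_smult lin1) auto
  have g4: "linear_map K B P (\<lambda>b2. ?g a1 b2 a2 b1)" if "a2 \<in> carrier A" "b1 \<in> carrier B" "a1 \<in> carrier A" for a2 b1 a1
    using that by (intro AB.lin_graded_ext2_param P B.module_axioms P.lin_smult lin4) auto
  have bb: "bilinear_map K B B P (\<lambda>b1 b2. ?g a1 b2 a2 b1)" if "a1 \<in> carrier A" "a2 \<in> carrier A" for a1 a2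
    using that by (intro bilinear_mapI g4 bilinear_map_right[OF g])
  have e1: "tsum K P t (\<lambda>b1 b2. colour_ext K \<omega> A B P (\<lambda>a2' b1'. G' a1 a2' b1' b2) a2 b1) =
      gsum K B B P t (\<lambda>\<beta>1 b1 \<beta>2 b2. ?g a1 b2 a2 b1)" if "a1 \<in> carrier A" "a2 \<in> carrier A" for a1 a2
  proof -
    have "tsum K P t (\<lambda>b1 b2. colour_ext K \<omega> A B P (\<lambda>a2' b1'. G' a1 a2' b1' b2) a2 b1) =
        tsum K P t (\<lambda>b1 b2. ?g a1 b2 a2 b1)"
      unfolding colour_ext_eq
      by (rule BB.tsum_cong_carrier[OF P bb[OF that] t], rule AB.graded_ext2_cong)
        (use that eq in auto)
    then show ?thesis by (simp add: BB.tsum_eq_gsum[OF P bb[OF that] t])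
  qed
  have ba: "bilinear_map K A A P (\<lambda>a1 a2. gsum K B B P t (\<lambda>\<beta>1 b1 \<beta>2 b2. ?g a1 b2 a2 b1))"
    by (intro bilinear_mapI BB.linear_map_gsum_pointwise P A.module_axioms t bilinear_map_left[OF g] g1)
  have "tsum K P s (\<lambda>a1 a2. tsum K P t (\<lambda>b1 b2.
      colour_ext K \<omega> A B P (\<lambda>a2' b1'. G' a1 a2' b1' b2) a2 b1)) =
    gsum K A A P s (\<lambda>\<alpha>1 a1 \<alpha>2 a2. gsum K B B P t (\<lambda>\<beta>1 b1 \<beta>2 b2. ?g a1 b2 a2 b1))"
    by (simp add: AA.tsum_cong_carrier[OF P ba s e1] AA.tsum_eq_gsum[OF P ba s])
  also have "\<dots> = gsum K A A P s (\<lambda>\<alpha>1 a1 \<alpha>2 a2. gsum K B B P t (\<lambda>\<beta>1 b1 \<beta>2 b2. \<omega> \<alpha>2 \<beta>1 \<odot>\<^bsub>P\<^esub> G a1 a2 b1 b2))"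
    by (rule AA.gsum_cong[OF s], rule BB.gsum_cong[OF t], rule AB.graded_ext2_homogeneous[OF P h])
  finally show ?thesis .
qed

lemma graded_module_record_cong:
  assumes "carrier M = carrier M'" "add M = add M'" "zero M = zero M'" "smult M = smult M'" "grade M = grade M'"
  shows "graded_module K M = graded_module K M'"
  by (simp add: graded_module_def graded_module_axioms_def module_record_cong[OF assms(1-4)]
      submodule_record_cong[OF assms(1-4)] homogeneous_decomposition_def
      finsum_record_cong[OF assms(1-3)] assms)

section \<open>The defined double in terms of Sweedler sums, and its graded algebra axioms\<close>

context hopf_pairing
begin

abbreviation "DR \<equiv> drinfeld_double K \<omega> H V"

lemma double_simps [simp]:
  "carrier DR = carrier T" "add DR = add T" "zero DR = zero T" "smult DR = smult T"
  "grade DR = tensor_grade K H V" "one DR = tens \<one>\<^bsub>H\<^esub> \<one>\<^bsub>V\<^esub>"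
  "mult DR = double_mult K \<omega> H V" "comult DR = double_comult K \<omega> H V"
  "counit DR = double_counit K H" "antipode DR = double_antipode K \<omega> H V"
  by (simp_all add: drinfeld_double_def Let_def)

lemma left_action_eq:
  assumes "f \<in> carrier V" "x \<in> carrier H"
  shows "left_action K H V f x = la f x"
proof -
  have "bilinear_map K H H H (\<lambda>u v. q f u \<odot>\<^bsub>H\<^esub> v)" using assms by (auto intro!: bilinear_mapI lin)
  then have "tsum K H (comult H x) (\<lambda>u v. q f u \<odot>\<^bsub>H\<^esub> v) = la f x"
    unfolding la_def using assms by (intro H.tsum_comult) auto
  then show ?thesis by (simp add: left_action_def ev_def)
qed

lemma right_action_eq:
  assumes "f \<in> carrier V" "x \<in> carrier H"
  shows "right_action K V f x = ra f x"
proof -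
  have "bilinear_map K V V V (\<lambda>f1 f2. ev f2 x \<odot>\<^bsub>V\<^esub> f1)" using assms by (auto intro!: bilinear_mapI lin)
  then have "tsum K V (comult V f) (\<lambda>f1 f2. ev f2 x \<odot>\<^bsub>V\<^esub> f1) = ra f x"
    unfolding ra_def using assms by (intro V.tsum_comult) auto
  then show ?thesis by (simp add: right_action_def ev_def)
qed

lemma double_psi_eq:
  assumes "t \<in> carrier (tensor_module K V H)"
  shows "double_psi K \<omega> H V t = tsum K T t psi"
  unfolding double_psi_def Let_def
proof (rule VH.tsum_cong_carrier[OF T_module bilinear_psi assms])
  fix f x assume "f \<in> carrier V" "x \<in> carrier H"
  then show "tsum K T (comult V f) (\<lambda>f1 f2. tsum K T (comult H x) (\<lambda>x1 x2.
      colour_ext K \<omega> V H T (\<lambda>f2' x1'. tens (left_action K H V f1 x1') (right_action K V f2' x2)) f2 x1)) = psi f x"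
    unfolding psi_def
    by (intro tsum_colour_ext commutative_factor_axioms V.graded_module_axioms H.graded_module_axioms)
      (auto intro!: lin simp: left_action_eq right_action_eq)
qed

lemma double_mult_eq:
  assumes s: "s \<in> carrier T" and t: "t \<in> carrier T"
  shows "double_mult K \<omega> H V s t = dm s t"
  unfolding double_mult_def Let_def dm_def
proof (rule HV.tsum_cong_carrier[OF T_module bilinear_dm_left[OF t] s],
    rule HV.tsum_cong_carrier[OF T_module bilinear_dm t])
  fix x f y g assume [simp]: "x \<in> carrier H" "f \<in> carrier V" "y \<in> carrier H" "g \<in> carrier V"
  have b: "bilinear_map K H V T (\<lambda>y' f'. tens (x \<otimes>\<^bsub>H\<^esub> y') (f' \<otimes>\<^bsub>V\<^esub> g))"
    by (auto intro!: bilinear_mapI lin)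
  have "tsum K T (psi f y) (\<lambda>y' f'. tens (x \<otimes>\<^bsub>H\<^esub> y') (f' \<otimes>\<^bsub>V\<^esub> g)) = lmul x (rmul g (psi f y))"
    by (rule HV.tensor_eqI[OF T_module]) (auto intro!: lin b simp: HV.tsum_pure[OF T_module b])
  then show "tsum K T (double_psi K \<omega> H V (pure_tensor K V H f y)) (\<lambda>y' f'. tens (x \<otimes>\<^bsub>H\<^esub> y') (f' \<otimes>\<^bsub>V\<^esub> g)) =
      lmul x (rmul g (psi f y))"
    by (simp add: double_psi_eq VH.pure_closed VH.tsum_pure[OF T_module bilinear_psi])
qed

lemma graded_module_double: "graded_module K DR"
  using HV.graded_module_tensor[of \<omega>]
  by (simp add: graded_module_record_cong[of DR "tensor K \<omega> H V"])

lemma graded_algebra_double: "graded_algebra K DR"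
proof (intro graded_algebra.intro graded_module_double graded_algebra_axioms.intro)
  interpret DR: graded_module K DR by (rule graded_module_double)
  show "ring DR"
    by (rule ringI)
      (use DR.abelian_group_axioms in \<open>auto intro!: monoidI simp: double_mult_eq dm_assoc
        dm_one linear_map_add[OF lin_dm(1)[OF lin_id]] linear_map_add[OF lin_dm_eta]\<close>)
qed (auto simp: double_mult_eq HV.tensor_grade_closed dm_grade HV.pure_grade[OF H.grade_one V.grade_one]
    linear_map_smult[OF lin_dm(1)[OF lin_id]] linear_map_smult[OF lin_dm_eta])

sublocale D: graded_algebra K DR
  by (rule graded_algebra_double)
sublocale DD: algebra_pair K \<omega> DR DR ..

end

text \<open>For mutually inverse signs that remain separated by another factor after a product has
  been sorted.\<close>

lemma (in commutative_factor) factor_cancel_gap: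
  assumes "c \<in> carrier K" "e \<in> carrier K"
  shows "\<omega> \<alpha> \<beta> \<otimes> (c \<otimes> \<omega> \<beta> \<alpha>) = c" "\<omega> \<alpha> \<beta> \<otimes> (c \<otimes> (\<omega> \<beta> \<alpha> \<otimes> e)) = c \<otimes> e"
  using assms by (simp_all add: m_lcomm[of "\<omega> \<alpha> \<beta>" c])

text \<open>Coassociativity of a tensor product of two co-algebras. Its signs are left to
  \<open>G\<close>, which may depend on all six degrees. The sums over the two algebras are
  interchanged, coassociativity is used in each of them, and the sums are interchanged back.
  \<open>linA\<close> and \<open>linB\<close> list the three positions of each algebra.\<close>

lemma swe2_coassoc:
  assumes A: "hopf_algebra K \<omega> A" and B: "hopf_algebra K \<omega> B" and P: "module K P"
    and a: "a \<in> carrier A" and b: "b \<in> carrier B"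
    and linA: "\<And>\<alpha>1 \<beta>1 b1 \<alpha>2 a2 \<beta>2 b2 \<alpha>3 a3 \<beta>3 b3.
      \<lbrakk>a2 \<in> carrier A; a3 \<in> carrier A; b1 \<in> carrier B; b2 \<in> carrier B; b3 \<in> carrier B\<rbrakk> \<Longrightarrow>
        linear_map K A P (\<lambda>a1. G \<alpha>1 a1 \<beta>1 b1 \<alpha>2 a2 \<beta>2 b2 \<alpha>3 a3 \<beta>3 b3) \<and>
        linear_map K A P (\<lambda>a1. G \<alpha>1 a2 \<beta>1 b1 \<alpha>2 a1 \<beta>2 b2 \<alpha>3 a3 \<beta>3 b3) \<and>
        linear_map K A P (\<lambda>a1. G \<alpha>1 a2 \<beta>1 b1 \<alpha>2 a3 \<beta>2 b2 \<alpha>3 a1 \<beta>3 b3)"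
    and linB: "\<And>\<alpha>1 a1 \<beta>1 \<alpha>2 a2 \<beta>2 b2 \<alpha>3 a3 \<beta>3 b3.
      \<lbrakk>a1 \<in> carrier A; a2 \<in> carrier A; a3 \<in> carrier A; b2 \<in> carrier B; b3 \<in> carrier B\<rbrakk> \<Longrightarrow>
        linear_map K B P (\<lambda>b1. G \<alpha>1 a1 \<beta>1 b1 \<alpha>2 a2 \<beta>2 b2 \<alpha>3 a3 \<beta>3 b3) \<and>
        linear_map K B P (\<lambda>b1. G \<alpha>1 a1 \<beta>1 b2 \<alpha>2 a2 \<beta>2 b1 \<alpha>3 a3 \<beta>3 b3) \<and>
        linear_map K B P (\<lambda>b1. G \<alpha>1 a1 \<beta>1 b2 \<alpha>2 a2 \<beta>2 b3 \<alpha>3 a3 \<beta>3 b1)"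
  shows "gsum K A A P (comult A a) (\<lambda>\<alpha> u \<alpha>3 a3. gsum K B B P (comult B b) (\<lambda>\<beta> v \<beta>3 b3.
      gsum K A A P (comult A u) (\<lambda>\<alpha>1 a1 \<alpha>2 a2. gsum K B B P (comult B v) (\<lambda>\<beta>1 b1 \<beta>2 b2.
        G \<alpha>1 a1 \<beta>1 b1 \<alpha>2 a2 \<beta>2 b2 \<alpha>3 a3 \<beta>3 b3)))) =
    gsum K A A P (comult A a) (\<lambda>\<alpha>1 a1 \<alpha> u. gsum K B B P (comult B b) (\<lambda>\<beta>1 b1 \<beta> v.
      gsum K A A P (comult A u) (\<lambda>\<alpha>2 a2 \<alpha>3 a3. gsum K B B P (comult B v) (\<lambda>\<beta>2 b2 \<beta>3 b3.
        G \<alpha>1 a1 \<beta>1 b1 \<alpha>2 a2 \<beta>2 b2 \<alpha>3 a3 \<beta>3 b3))))"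
proof -
  interpret A: hopf_algebra K \<omega> A by fact
  interpret B: hopf_algebra K \<omega> B by fact
  interpret P: module K P by fact
  note [simp] = P a b A.module_axioms B.module_axioms
  note swap = swe_swap[OF B A P] swe_swap[OF A B P]
  have cl: "G \<alpha>1 a1 \<beta>1 b1 \<alpha>2 a2 \<beta>2 b2 \<alpha>3 a3 \<beta>3 b3 \<in> carrier P"
    if "a1 \<in> carrier A" "a2 \<in> carrier A" "a3 \<in> carrier A" "b1 \<in> carrier B" "b2 \<in> carrier B" "b3 \<in> carrier B"
    for \<alpha>1 a1 \<beta>1 b1 \<alpha>2 a2 \<beta>2 b2 \<alpha>3 a3 \<beta>3 b3
    by (rule linear_map_closed[OF linA[OF that(2-6), THEN conjunct1] that(1)])
  note lA = linA[THEN conjunct1] linA[THEN conjunct2, THEN conjunct1] linA[THEN conjunct2, THEN conjunct2]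
  note lB = linB[THEN conjunct1] linB[THEN conjunct2, THEN conjunct1] linB[THEN conjunct2, THEN conjunct2]
  have "A.swe P a (\<lambda>\<alpha> u \<alpha>3 a3. B.swe P b (\<lambda>\<beta> v \<beta>3 b3. A.swe P u (\<lambda>\<alpha>1 a1 \<alpha>2 a2. B.swe P v (\<lambda>\<beta>1 b1 \<beta>2 b2.
        G \<alpha>1 a1 \<beta>1 b1 \<alpha>2 a2 \<beta>2 b2 \<alpha>3 a3 \<beta>3 b3)))) =
      A.swe P a (\<lambda>\<alpha> u \<alpha>3 a3. A.swe P u (\<lambda>\<alpha>1 a1 \<alpha>2 a2. B.swe P b (\<lambda>\<beta> v \<beta>3 b3. B.swe P v (\<lambda>\<beta>1 b1 \<beta>2 b2.
        G \<alpha>1 a1 \<beta>1 b1 \<alpha>2 a2 \<beta>2 b2 \<alpha>3 a3 \<beta>3 b3))))"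
    by (rule A.swe_cong[OF a], rule swap(1)) (auto intro!: B.swe_closed cl)
  also have "\<dots> = A.swe P a (\<lambda>\<alpha> u \<alpha>3 a3. A.swe P u (\<lambda>\<alpha>1 a1 \<alpha>2 a2. B.swe P b (\<lambda>\<beta>1 b1 \<beta> v. B.swe P v (\<lambda>\<beta>2 b2 \<beta>3 b3.
        G \<alpha>1 a1 \<beta>1 b1 \<alpha>2 a2 \<beta>2 b2 \<alpha>3 a3 \<beta>3 b3))))"
    by (rule A.swe_cong[OF a], rule A.swe_cong, assumption, rule B.swe_coassoc[OF b P])
      (rule graded_trilinearI; rule lB; assumption)
  also have "\<dots> = A.swe P a (\<lambda>\<alpha>1 a1 \<alpha> u. A.swe P u (\<lambda>\<alpha>2 a2 \<alpha>3 a3. B.swe P b (\<lambda>\<beta>1 b1 \<beta> v. B.swe P v (\<lambda>\<beta>2 b2 \<beta>3 b3.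
        G \<alpha>1 a1 \<beta>1 b1 \<alpha>2 a2 \<beta>2 b2 \<alpha>3 a3 \<beta>3 b3))))"
    by (rule A.swe_coassoc[OF a P])
      (rule graded_trilinearI; intro B.lin_swe_pointwise P A.module_axioms b; (rule lA)?; assumption)
  also have "\<dots> = A.swe P a (\<lambda>\<alpha>1 a1 \<alpha> u. B.swe P b (\<lambda>\<beta>1 b1 \<beta> v. A.swe P u (\<lambda>\<alpha>2 a2 \<alpha>3 a3. B.swe P v (\<lambda>\<beta>2 b2 \<beta>3 b3.
        G \<alpha>1 a1 \<beta>1 b1 \<alpha>2 a2 \<beta>2 b2 \<alpha>3 a3 \<beta>3 b3))))"
    by (rule A.swe_cong[OF a], rule swap(2)) (auto intro!: B.swe_closed cl)
  finally show ?thesis .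
qed

section \<open>The co-multiplication of the double\<close>

context hopf_pairing
begin

abbreviation "TD \<equiv> tensor_module K DR DR"
abbreviation "tD \<equiv> pure_tensor K DR DR"
abbreviation dd_mult (infixl "**" 70) where "s ** t \<equiv> s \<otimes>\<^bsub>tensor K \<omega> DR DR\<^esub> t"

lemmas TD_module [simp] = DD.AB.module_tensor

lemma linear_map_double [simp]:
  "linear_map K Q DR = linear_map K Q T" "linear_map K DR Q = linear_map K T Q"
  by (rule linear_map_record_cong; simp)+

lemma tD_closed [simp, intro]: "\<lbrakk>s \<in> carrier T; t \<in> carrier T\<rbrakk> \<Longrightarrow> tD s t \<in> carrier TD"
  using DD.AB.pure_closed by simp

lemma lin_tD [lin]:
  "\<lbrakk>linear_map K Q T f; t \<in> carrier T\<rbrakk> \<Longrightarrow> linear_map K Q TD (\<lambda>z. tD (f z) t)"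
  "\<lbrakk>linear_map K Q T f; t \<in> carrier T\<rbrakk> \<Longrightarrow> linear_map K Q TD (\<lambda>z. tD t (f z))"
  using DD.AB.lin_pure[where 'd = 'd] by simp_all

lemmas lin_tD_eta [lin] = lin_tD(2)[OF lin_id]

lemma lin_dd_mult [lin]:
  "\<lbrakk>linear_map K Q TD f; t \<in> carrier TD\<rbrakk> \<Longrightarrow> linear_map K Q TD (\<lambda>z. f z ** t)"
  "\<lbrakk>linear_map K Q TD f; t \<in> carrier TD\<rbrakk> \<Longrightarrow> linear_map K Q TD (\<lambda>z. t ** f z)"
  by (rule linear_map_compose[OF _ DD.lin_tensor_mult(1)], assumption+)
    (rule linear_map_compose[OF _ DD.lin_tensor_mult(2)], assumption+)

lemmas lin_dd_mult_eta [lin] = lin_dd_mult(2)[OF lin_id]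
lemmas dd_mult_closed [simp, intro] = DD.tensor_mult_closed

lemma tD_mult:
  "\<lbrakk>a \<in> carrier T; b \<in> tensor_grade K H V \<beta>; c \<in> tensor_grade K H V \<gamma>; e \<in> carrier T\<rbrakk> \<Longrightarrow>
    tD a b ** tD c e = \<omega> \<beta> \<gamma> \<odot>\<^bsub>TD\<^esub> tD (dm a c) (dm b e)"
  using DD.tensor_mult_pure[of a b \<beta> c \<gamma> e] by (simp add: double_mult_eq HV.tensor_grade_closed)

definition "dc x f = H.swe TD x (\<lambda>\<xi>1 x1 \<xi>2 x2. V.swe TD f (\<lambda>\<phi>1 f1 \<phi>2 f2.
  \<omega> \<xi>2 \<phi>1 \<odot>\<^bsub>TD\<^esub> tD (tens x1 f1) (tens x2 f2)))"

lemma dc_closed [simp, intro]: "\<lbrakk>x \<in> carrier H; f \<in> carrier V\<rbrakk> \<Longrightarrow> dc x f \<in> carrier TD"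
  unfolding dc_def by (auto intro!: H.swe_closed V.swe_closed)

lemma lin_dc [lin]:
  "\<lbrakk>linear_map K Q H g; f \<in> carrier V; module K Q\<rbrakk> \<Longrightarrow> linear_map K Q TD (\<lambda>z. dc (g z) f)"
  "\<lbrakk>linear_map K Q V h; x \<in> carrier H; module K Q\<rbrakk> \<Longrightarrow> linear_map K Q TD (\<lambda>z. dc x (h z))"
  unfolding dc_def by (auto intro!: lin graded_bilinearI)

lemmas lin_dc_eta [lin] = lin_dc(2)[OF lin_id]

lemma bilinear_dc: "bilinear_map K H V TD dc"
  by (auto intro!: bilinear_mapI lin)

definition "cm t = tsum K TD t dc"

lemma lin_cm [lin]: "linear_map K Q T h \<Longrightarrow> linear_map K Q TD (\<lambda>z. cm (h z))"
  unfolding cm_def by (auto intro!: lin bilinear_dc)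

lemmas lin_cm_eta [lin] = lin_cm[OF lin_id]

lemma cm_closed [simp, intro]: "t \<in> carrier T \<Longrightarrow> cm t \<in> carrier TD"
  using linear_map_closed[OF lin_cm_eta] by blast

lemma cm_tens [simp]: "\<lbrakk>x \<in> carrier H; f \<in> carrier V\<rbrakk> \<Longrightarrow> cm (tens x f) = dc x f"
  unfolding cm_def by (rule HV.tsum_pure[OF _ bilinear_dc]) auto

lemma double_comult_eq:
  assumes "t \<in> carrier T"
  shows "double_comult K \<omega> H V t = cm t"
proof -
  have eq: "tensor_module K T T = TD" "pure_tensor K T T = tD"
    by (rule tensor_module_cong pure_tensor_cong; simp)+
  show ?thesis
    unfolding double_comult_def Let_def eq cm_def
  proof (rule HV.tsum_cong_carrier[OF TD_module bilinear_dc assms])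
    fix x f assume "x \<in> carrier H" "f \<in> carrier V"
    then show "tsum K TD (comult H x) (\<lambda>x1 x2. tsum K TD (comult V f) (\<lambda>f1 f2.
        colour_ext K \<omega> H V TD (\<lambda>x2' f1'. tD (tens x1 f1') (tens x2' f2)) x2 f1)) = dc x f"
      unfolding dc_def
      by (intro tsum_colour_ext commutative_factor_axioms V.graded_module_axioms H.graded_module_axioms) (auto intro!: lin)
  qed
qed

lemma dc_linear_map:
  assumes P: "module K P" and L: "linear_map K TD P L" and x: "x \<in> carrier H" and f: "f \<in> carrier V"
  shows "L (dc x f) = H.swe P x (\<lambda>\<xi>1 x1 \<xi>2 x2. V.swe P f (\<lambda>\<phi>1 f1 \<phi>2 f2.
    \<omega> \<xi>2 \<phi>1 \<odot>\<^bsub>P\<^esub> L (tD (tens x1 f1) (tens x2 f2))))"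
proof -
  note [simp] = f x P
  have "L (dc x f) = H.swe P x (\<lambda>\<xi>1 x1 \<xi>2 x2. L (V.swe TD f (\<lambda>\<phi>1 f1 \<phi>2 f2.
      \<omega> \<xi>2 \<phi>1 \<odot>\<^bsub>TD\<^esub> tD (tens x1 f1) (tens x2 f2))))"
    unfolding dc_def by (rule H.swe_linear_map[OF _ _ L]) (auto intro!: V.swe_closed)
  also have "\<dots> = H.swe P x (\<lambda>\<xi>1 x1 \<xi>2 x2. V.swe P f (\<lambda>\<phi>1 f1 \<phi>2 f2.
      L (\<omega> \<xi>2 \<phi>1 \<odot>\<^bsub>TD\<^esub> tD (tens x1 f1) (tens x2 f2))))"
    by (rule H.swe_cong, simp, rule V.swe_linear_map[OF _ _ L]) auto
  also have "\<dots> = H.swe P x (\<lambda>\<xi>1 x1 \<xi>2 x2. V.swe P f (\<lambda>\<phi>1 f1 \<phi>2 f2.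
      \<omega> \<xi>2 \<phi>1 \<odot>\<^bsub>P\<^esub> L (tD (tens x1 f1) (tens x2 f2))))"
    by (rule H.swe_cong, simp, rule V.swe_cong) (auto simp: linear_map_smult[OF L])
  finally show ?thesis .
qed

lemma tens_one_grade:
  "x \<in> grade H \<xi> \<Longrightarrow> tens x \<one>\<^bsub>V\<^esub> \<in> tensor_grade K H V \<xi>"
  "f \<in> grade V \<phi> \<Longrightarrow> tens \<one>\<^bsub>H\<^esub> f \<in> tensor_grade K H V \<phi>"
  by (rule HV.pure_grade[OF _ V.grade_one]; simp)
    (rule HV.pure_grade[OF H.grade_one]; simp)

lemma dm_units:
  "\<lbrakk>x \<in> carrier H; y \<in> carrier H; g \<in> carrier V\<rbrakk> \<Longrightarrow> dm (tens x \<one>\<^bsub>V\<^esub>) (tens y g) = tens (x \<otimes>\<^bsub>H\<^esub> y) g"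
  "\<lbrakk>x \<in> carrier H; f \<in> carrier V; g \<in> carrier V\<rbrakk> \<Longrightarrow> dm (tens x f) (tens \<one>\<^bsub>H\<^esub> g) = tens x (f \<otimes>\<^bsub>V\<^esub> g)"
  "\<lbrakk>f \<in> carrier V; y \<in> carrier H\<rbrakk> \<Longrightarrow> dm (tens \<one>\<^bsub>H\<^esub> f) (tens y \<one>\<^bsub>V\<^esub>) = psi f y"
  by (simp_all add: dm_tens_tens psi_one_left psi_one_right lmul_one rmul_one)

lemma dc_one_right: "x \<in> carrier H \<Longrightarrow> dc x \<one>\<^bsub>V\<^esub> = H.swe TD x (\<lambda>\<xi>1 x1 \<xi>2 x2. tD (tens x1 \<one>\<^bsub>V\<^esub>) (tens x2 \<one>\<^bsub>V\<^esub>))"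
  unfolding dc_def by (rule H.swe_cong, simp, subst V.swe_one) (auto intro!: graded_bilinearI lin)

lemma dc_one_left: "f \<in> carrier V \<Longrightarrow> dc \<one>\<^bsub>H\<^esub> f = V.swe TD f (\<lambda>\<phi>1 f1 \<phi>2 f2. tD (tens \<one>\<^bsub>H\<^esub> f1) (tens \<one>\<^bsub>H\<^esub> f2))"
  unfolding dc_def by (subst H.swe_one) (auto intro!: graded_bilinearI lin V.swe_cong)

text \<open>\<open>x\<close> stands outermost, so no form crosses it: besides the signed interchange
  of tensor factors only the values of \<open>psi\<close> at units enter. The same holds for
  \<open>cm_rmul\<close>.\<close>

lemma cm_lmul:
  assumes x: "x \<in> carrier H" and t: "t \<in> carrier T"
  shows "cm (lmul x t) = cm (tens x \<one>\<^bsub>V\<^esub>) ** cm t"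
proof (rule HV.tensor_eqI[OF TD_module _ _ _ t])
  fix y g assume [simp]: "y \<in> carrier H" "g \<in> carrier V"
  note [simp] = x
  have "cm (lmul x (tens y g)) = H.swe TD x (\<lambda>\<xi>1 x1 \<xi>2 x2. H.swe TD y (\<lambda>\<eta>1 y1 \<eta>2 y2. \<omega> \<xi>2 \<eta>1 \<odot>\<^bsub>TD\<^esub>
      V.swe TD g (\<lambda>\<gamma>1 g1 \<gamma>2 g2. \<omega> (\<xi>2 + \<eta>2) \<gamma>1 \<odot>\<^bsub>TD\<^esub> tD (tens (x1 \<otimes>\<^bsub>H\<^esub> y1) g1) (tens (x2 \<otimes>\<^bsub>H\<^esub> y2) g2))))"
    by (simp, unfold dc_def, rule H.swe_mult) (auto intro!: graded_bilinearI lin)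
  also have "\<dots> = H.swe TD x (\<lambda>\<xi>1 x1 \<xi>2 x2. tD (tens x1 \<one>\<^bsub>V\<^esub>) (tens x2 \<one>\<^bsub>V\<^esub>) ** dc y g)"
  proof (rule H.swe_cong[OF x])
    fix \<xi>1 x1 \<xi>2 x2 assume h: "x2 \<in> grade H \<xi>2" and [simp]: "x1 \<in> carrier H" "x2 \<in> carrier H"
    have "tD (tens x1 \<one>\<^bsub>V\<^esub>) (tens x2 \<one>\<^bsub>V\<^esub>) ** dc y g = H.swe TD y (\<lambda>\<eta>1 y1 \<eta>2 y2. V.swe TD g (\<lambda>\<gamma>1 g1 \<gamma>2 g2.
        \<omega> \<eta>2 \<gamma>1 \<odot>\<^bsub>TD\<^esub> (tD (tens x1 \<one>\<^bsub>V\<^esub>) (tens x2 \<one>\<^bsub>V\<^esub>) ** tD (tens y1 g1) (tens y2 g2))))"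
      by (rule dc_linear_map) (auto intro!: lin)
    also have "\<dots> = H.swe TD y (\<lambda>\<eta>1 y1 \<eta>2 y2. \<omega> \<xi>2 \<eta>1 \<odot>\<^bsub>TD\<^esub> V.swe TD g (\<lambda>\<gamma>1 g1 \<gamma>2 g2.
        \<omega> (\<xi>2 + \<eta>2) \<gamma>1 \<odot>\<^bsub>TD\<^esub> tD (tens (x1 \<otimes>\<^bsub>H\<^esub> y1) g1) (tens (x2 \<otimes>\<^bsub>H\<^esub> y2) g2)))"
    proof (rule H.swe_cong, simp, subst V.swe_smult)
      fix \<eta>1 y1 \<eta>2 y2 assume k: "y1 \<in> grade H \<eta>1" "y2 \<in> grade H \<eta>2" and [simp]: "y1 \<in> carrier H" "y2 \<in> carrier H"
      show "V.swe TD g (\<lambda>\<gamma>1 g1 \<gamma>2 g2.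
          \<omega> \<eta>2 \<gamma>1 \<odot>\<^bsub>TD\<^esub> (tD (tens x1 \<one>\<^bsub>V\<^esub>) (tens x2 \<one>\<^bsub>V\<^esub>) ** tD (tens y1 g1) (tens y2 g2))) =
        V.swe TD g (\<lambda>\<gamma>1 g1 \<gamma>2 g2. \<omega> \<xi>2 \<eta>1 \<odot>\<^bsub>TD\<^esub>
          (\<omega> (\<xi>2 + \<eta>2) \<gamma>1 \<odot>\<^bsub>TD\<^esub> tD (tens (x1 \<otimes>\<^bsub>H\<^esub> y1) g1) (tens (x2 \<otimes>\<^bsub>H\<^esub> y2) g2)))"
      proof (rule V.swe_cong, simp)
        fix \<gamma>1 g1 \<gamma>2 g2 assume m: "g1 \<in> grade V \<gamma>1" and [simp]: "g1 \<in> carrier V" "g2 \<in> carrier V"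
        show "\<omega> \<eta>2 \<gamma>1 \<odot>\<^bsub>TD\<^esub> (tD (tens x1 \<one>\<^bsub>V\<^esub>) (tens x2 \<one>\<^bsub>V\<^esub>) ** tD (tens y1 g1) (tens y2 g2)) =
          \<omega> \<xi>2 \<eta>1 \<odot>\<^bsub>TD\<^esub> (\<omega> (\<xi>2 + \<eta>2) \<gamma>1 \<odot>\<^bsub>TD\<^esub> tD (tens (x1 \<otimes>\<^bsub>H\<^esub> y1) g1) (tens (x2 \<otimes>\<^bsub>H\<^esub> y2) g2))"
          by (simp add: tD_mult[OF _ tens_one_grade(1)[OF h] HV.pure_grade[OF k(1) m refl]] dm_units
              DD.AB.T.smult_assoc1[symmetric] factor_add m_ac)
      qed
    qed auto
    finally show "H.swe TD y (\<lambda>\<eta>1 y1 \<eta>2 y2. \<omega> \<xi>2 \<eta>1 \<odot>\<^bsub>TD\<^esub> V.swe TD g (\<lambda>\<gamma>1 g1 \<gamma>2 g2.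
        \<omega> (\<xi>2 + \<eta>2) \<gamma>1 \<odot>\<^bsub>TD\<^esub> tD (tens (x1 \<otimes>\<^bsub>H\<^esub> y1) g1) (tens (x2 \<otimes>\<^bsub>H\<^esub> y2) g2))) =
      tD (tens x1 \<one>\<^bsub>V\<^esub>) (tens x2 \<one>\<^bsub>V\<^esub>) ** dc y g" ..
  qed
  also have "\<dots> = dc x \<one>\<^bsub>V\<^esub> ** dc y g"
    unfolding dc_one_right[OF x] by (rule H.swe_linear_map[symmetric]) (auto intro!: lin)
  finally show "cm (lmul x (tens y g)) = cm (tens x \<one>\<^bsub>V\<^esub>) ** cm (tens y g)" by simp
qed (use x in \<open>auto intro!: lin\<close>)

lemma cm_rmul:
  assumes g: "g \<in> carrier V" and t: "t \<in> carrier T"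
  shows "cm (rmul g t) = cm t ** cm (tens \<one>\<^bsub>H\<^esub> g)"
proof (rule HV.tensor_eqI[OF TD_module _ _ _ t])
  fix y f assume y [simp]: "y \<in> carrier H" and f [simp]: "f \<in> carrier V"
  note [simp] = g
  have "cm (rmul g (tens y f)) = H.swe TD y (\<lambda>\<eta>1 y1 \<eta>2 y2. V.swe TD f (\<lambda>\<phi>1 f1 \<phi>2 f2. V.swe TD g (\<lambda>\<gamma>1 g1 \<gamma>2 g2.
      \<omega> \<phi>2 \<gamma>1 \<odot>\<^bsub>TD\<^esub> (\<omega> \<eta>2 (\<phi>1 + \<gamma>1) \<odot>\<^bsub>TD\<^esub> tD (tens y1 (f1 \<otimes>\<^bsub>V\<^esub> g1)) (tens y2 (f2 \<otimes>\<^bsub>V\<^esub> g2))))))"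
    by (simp, unfold dc_def, rule H.swe_cong, simp, rule V.swe_mult) (auto intro!: graded_bilinearI lin)
  also have "\<dots> = H.swe TD y (\<lambda>\<eta>1 y1 \<eta>2 y2. V.swe TD f (\<lambda>\<phi>1 f1 \<phi>2 f2.
      \<omega> \<eta>2 \<phi>1 \<odot>\<^bsub>TD\<^esub> (tD (tens y1 f1) (tens y2 f2) ** dc \<one>\<^bsub>H\<^esub> g)))"
  proof (rule H.swe_cong[OF y], rule V.swe_cong[OF f])
    fix \<eta>1 y1 \<eta>2 y2 \<phi>1 f1 \<phi>2 f2
    assume h: "y2 \<in> grade H \<eta>2" "f2 \<in> grade V \<phi>2"
      and [simp]: "y1 \<in> carrier H" "y2 \<in> carrier H" "f1 \<in> carrier V" "f2 \<in> carrier V"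
    have "\<omega> \<eta>2 \<phi>1 \<odot>\<^bsub>TD\<^esub> (tD (tens y1 f1) (tens y2 f2) ** dc \<one>\<^bsub>H\<^esub> g) = V.swe TD g (\<lambda>\<gamma>1 g1 \<gamma>2 g2.
        \<omega> \<eta>2 \<phi>1 \<odot>\<^bsub>TD\<^esub> (tD (tens y1 f1) (tens y2 f2) ** tD (tens \<one>\<^bsub>H\<^esub> g1) (tens \<one>\<^bsub>H\<^esub> g2)))"
      unfolding dc_one_left[OF g]
      by (rule V.swe_linear_map[where f = "\<lambda>s. \<omega> \<eta>2 \<phi>1 \<odot>\<^bsub>TD\<^esub> (tD (tens y1 f1) (tens y2 f2) ** s)"]) (auto intro!: lin)
    also have "\<dots> = V.swe TD g (\<lambda>\<gamma>1 g1 \<gamma>2 g2. \<omega> \<phi>2 \<gamma>1 \<odot>\<^bsub>TD\<^esub>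
        (\<omega> \<eta>2 (\<phi>1 + \<gamma>1) \<odot>\<^bsub>TD\<^esub> tD (tens y1 (f1 \<otimes>\<^bsub>V\<^esub> g1)) (tens y2 (f2 \<otimes>\<^bsub>V\<^esub> g2))))"
    proof (rule V.swe_cong[OF g])
      fix \<gamma>1 g1 \<gamma>2 g2 assume m: "g1 \<in> grade V \<gamma>1" and [simp]: "g1 \<in> carrier V" "g2 \<in> carrier V"
      show "\<omega> \<eta>2 \<phi>1 \<odot>\<^bsub>TD\<^esub> (tD (tens y1 f1) (tens y2 f2) ** tD (tens \<one>\<^bsub>H\<^esub> g1) (tens \<one>\<^bsub>H\<^esub> g2)) =
        \<omega> \<phi>2 \<gamma>1 \<odot>\<^bsub>TD\<^esub> (\<omega> \<eta>2 (\<phi>1 + \<gamma>1) \<odot>\<^bsub>TD\<^esub> tD (tens y1 (f1 \<otimes>\<^bsub>V\<^esub> g1)) (tens y2 (f2 \<otimes>\<^bsub>V\<^esub> g2)))"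
        by (simp add: tD_mult[OF _ HV.pure_grade[OF h refl] tens_one_grade(2)[OF m]] dm_units
            DD.AB.T.smult_assoc1[symmetric] factor_add m_ac)
    qed
    finally show "V.swe TD g (\<lambda>\<gamma>1 g1 \<gamma>2 g2. \<omega> \<phi>2 \<gamma>1 \<odot>\<^bsub>TD\<^esub>
        (\<omega> \<eta>2 (\<phi>1 + \<gamma>1) \<odot>\<^bsub>TD\<^esub> tD (tens y1 (f1 \<otimes>\<^bsub>V\<^esub> g1)) (tens y2 (f2 \<otimes>\<^bsub>V\<^esub> g2)))) =
      \<omega> \<eta>2 \<phi>1 \<odot>\<^bsub>TD\<^esub> (tD (tens y1 f1) (tens y2 f2) ** dc \<one>\<^bsub>H\<^esub> g)" ..
  qed
  also have "\<dots> = dc y f ** dc \<one>\<^bsub>H\<^esub> g"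
    by (rule dc_linear_map[where L = "\<lambda>s. s ** dc \<one>\<^bsub>H\<^esub> g", symmetric]) (auto intro!: lin)
  finally show "cm (rmul g (tens y f)) = cm (tens y f) ** cm (tens \<one>\<^bsub>H\<^esub> g)" by simp
qed (use g in \<open>auto intro!: lin\<close>)

text \<open>The right-hand side is the signed coproduct of the co-algebra
  \<open>V \<otimes> H\<close> followed by \<open>psi\<close> in both factors. Together with
  \<open>cm_psi\<close> it says that \<open>psi\<close> is a morphism of co-algebras.\<close>

lemma dc_one_mult:
  assumes f: "f \<in> carrier V" and y: "y \<in> carrier H"
  shows "dc \<one>\<^bsub>H\<^esub> f ** dc y \<one>\<^bsub>V\<^esub> = V.swe TD f (\<lambda>\<phi>1 f1 \<phi>2 f2. H.swe TD y (\<lambda>\<eta>1 y1 \<eta>2 y2.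
    \<omega> \<phi>2 \<eta>1 \<odot>\<^bsub>TD\<^esub> tD (psi f1 y1) (psi f2 y2)))"
proof -
  note [simp] = f y
  have "dc \<one>\<^bsub>H\<^esub> f ** dc y \<one>\<^bsub>V\<^esub> =
      V.swe TD f (\<lambda>\<phi>1 f1 \<phi>2 f2. tD (tens \<one>\<^bsub>H\<^esub> f1) (tens \<one>\<^bsub>H\<^esub> f2) ** dc y \<one>\<^bsub>V\<^esub>)"
    unfolding dc_one_left[OF f]
    by (rule V.swe_linear_map[where f = "\<lambda>s. s ** dc y \<one>\<^bsub>V\<^esub>"]) (auto intro!: lin)
  also have "\<dots> = V.swe TD f (\<lambda>\<phi>1 f1 \<phi>2 f2. H.swe TD y (\<lambda>\<eta>1 y1 \<eta>2 y2.
      tD (tens \<one>\<^bsub>H\<^esub> f1) (tens \<one>\<^bsub>H\<^esub> f2) ** tD (tens y1 \<one>\<^bsub>V\<^esub>) (tens y2 \<one>\<^bsub>V\<^esub>)))"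
    unfolding dc_one_right[OF y]
    by (rule V.swe_cong, simp, rule H.swe_linear_map) (auto intro!: lin)
  also have "\<dots> = V.swe TD f (\<lambda>\<phi>1 f1 \<phi>2 f2. H.swe TD y (\<lambda>\<eta>1 y1 \<eta>2 y2.
      \<omega> \<phi>2 \<eta>1 \<odot>\<^bsub>TD\<^esub> tD (psi f1 y1) (psi f2 y2)))"
  proof (rule V.swe_cong[OF f], rule H.swe_cong[OF y])
    fix \<phi>1 f1 \<phi>2 f2 \<eta>1 y1 \<eta>2 y2
    assume h: "f2 \<in> grade V \<phi>2" "y1 \<in> grade H \<eta>1"
      and [simp]: "f1 \<in> carrier V" "f2 \<in> carrier V" "y1 \<in> carrier H" "y2 \<in> carrier H"
    show "tD (tens \<one>\<^bsub>H\<^esub> f1) (tens \<one>\<^bsub>H\<^esub> f2) ** tD (tens y1 \<one>\<^bsub>V\<^esub>) (tens y2 \<one>\<^bsub>V\<^esub>) =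
        \<omega> \<phi>2 \<eta>1 \<odot>\<^bsub>TD\<^esub> tD (psi f1 y1) (psi f2 y2)"
      by (simp add: tD_mult[OF _ tens_one_grade(2)[OF h(1)] tens_one_grade(1)[OF h(2)]] dm_units)
  qed
  finally show ?thesis .
qed

text \<open>In the product on the right, \<open>f\<close> and \<open>y\<close> have four legs each,
  met by a left, a right, a left and a right action. The two middle actions cancel by
  \<open>ra_la_cancel\<close>. On the left, \<open>la_comult\<close> and \<open>ra_comult\<close>
  distribute the coproduct over the two actions directly. Both sides arrive at the same sum over
  three legs.\<close>

lemma cm_psi:
  assumes f: "f \<in> carrier V" and y: "y \<in> carrier H"
  shows "cm (psi f y) = cm (tens \<one>\<^bsub>H\<^esub> f) ** cm (tens y \<one>\<^bsub>V\<^esub>)"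
proof -
  note [simp] = f y
  note swe2 = swe2_coassoc[OF V.hopf_algebra_axioms H.hopf_algebra_axioms TD_module]
  \<comment> \<open>The common normal form: the outer legs are acted upon, while the middle legs
    \<open>M\<close> of \<open>f\<close> and \<open>N\<close> of \<open>y\<close> appear
    untouched.\<close>
  let ?X = "V.swe TD f (\<lambda>\<phi>1 f1 \<Gamma> G. H.swe TD y (\<lambda>\<alpha> u \<zeta> Z. V.swe TD G (\<lambda>\<mu> M \<phi>4 f4. H.swe TD Z (\<lambda>\<nu> N \<delta> y4.
      (\<omega> \<mu> \<alpha> \<otimes> \<omega> \<phi>4 (\<alpha> + \<nu>)) \<odot>\<^bsub>TD\<^esub> tD (tens (la f1 u) M) (tens N (ra f4 y4))))))"
  have "dc \<one>\<^bsub>H\<^esub> f ** dc y \<one>\<^bsub>V\<^esub> = V.swe TD f (\<lambda>\<Phi>1 F1 \<Phi>2 F2. H.swe TD y (\<lambda>\<eta>1 Y1 \<eta>2 Y2.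
      \<omega> \<Phi>2 \<eta>1 \<odot>\<^bsub>TD\<^esub> tD (psi F1 Y1) (psi F2 Y2)))"
    by (rule dc_one_mult[OF f y])
  also have "\<dots> = V.swe TD f (\<lambda>\<Phi>1 F1 \<Phi>2 F2. H.swe TD y (\<lambda>\<eta>1 Y1 \<eta>2 Y2.
      V.swe TD F1 (\<lambda>\<phi>1 f1 \<phi>2 f2. H.swe TD Y1 (\<lambda>\<alpha> u \<beta> y2.
        (\<omega> \<Phi>2 (\<alpha> + \<beta>) \<otimes> \<omega> \<phi>2 \<alpha>) \<odot>\<^bsub>TD\<^esub> tD (tens (la f1 u) (ra f2 y2)) (psi F2 Y2)))))"
  proof (rule V.swe_cong[OF f], rule H.swe_cong[OF y])
    fix \<Phi>1 F1 \<Phi>2 F2 \<eta>1 Y1 \<eta>2 Y2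
    assume h: "Y1 \<in> grade H \<eta>1"
      and [simp]: "F1 \<in> carrier V" "F2 \<in> carrier V" "Y1 \<in> carrier H" "Y2 \<in> carrier H"
    have "\<omega> \<Phi>2 \<eta>1 \<odot>\<^bsub>TD\<^esub> tD (psi F1 Y1) (psi F2 Y2) = V.swe TD F1 (\<lambda>\<phi>1 f1 \<phi>2 f2. H.swe TD Y1 (\<lambda>\<alpha> u \<beta> y2.
        \<omega> \<phi>2 \<alpha> \<odot>\<^bsub>TD\<^esub> (\<omega> \<Phi>2 \<eta>1 \<odot>\<^bsub>TD\<^esub> tD (tens (la f1 u) (ra f2 y2)) (psi F2 Y2))))"
      by (rule psi_linear_map[where L = "\<lambda>s. \<omega> \<Phi>2 \<eta>1 \<odot>\<^bsub>TD\<^esub> tD s (psi F2 Y2)"]) (auto intro!: lin)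
    also have "\<dots> = V.swe TD F1 (\<lambda>\<phi>1 f1 \<phi>2 f2. H.swe TD Y1 (\<lambda>\<alpha> u \<beta> y2.
        (\<omega> \<Phi>2 (\<alpha> + \<beta>) \<otimes> \<omega> \<phi>2 \<alpha>) \<odot>\<^bsub>TD\<^esub> tD (tens (la f1 u) (ra f2 y2)) (psi F2 Y2)))"
      by (rule V.swe_cong, simp, rule H.swe_homogeneous_cong[OF h])
        (auto simp: DD.AB.T.smult_assoc1[symmetric] m_ac)
    finally show "\<omega> \<Phi>2 \<eta>1 \<odot>\<^bsub>TD\<^esub> tD (psi F1 Y1) (psi F2 Y2) = V.swe TD F1 (\<lambda>\<phi>1 f1 \<phi>2 f2. H.swe TD Y1 (\<lambda>\<alpha> u \<beta> y2.
        (\<omega> \<Phi>2 (\<alpha> + \<beta>) \<otimes> \<omega> \<phi>2 \<alpha>) \<odot>\<^bsub>TD\<^esub> tD (tens (la f1 u) (ra f2 y2)) (psi F2 Y2)))" .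
  qed
  also have "\<dots> = V.swe TD f (\<lambda>\<phi>1 f1 \<Gamma> G. H.swe TD y (\<lambda>\<alpha> u \<zeta> Z.
      V.swe TD G (\<lambda>\<phi>2 f2 \<Phi>2 F2. H.swe TD Z (\<lambda>\<beta> y2 \<eta>2 Y2.
        (\<omega> \<Phi>2 (\<alpha> + \<beta>) \<otimes> \<omega> \<phi>2 \<alpha>) \<odot>\<^bsub>TD\<^esub> tD (tens (la f1 u) (ra f2 y2)) (psi F2 Y2)))))"
    by (rule swe2[OF f y]) (intro conjI; auto intro!: lin)+
  also have "\<dots> = ?X"
  proof (rule V.swe_cong[OF f], rule H.swe_cong[OF y])
    fix \<phi>1 f1 \<Gamma> G \<alpha> u \<zeta> Z
    assume G: "G \<in> carrier V" and Z: "Z \<in> carrier H" and [simp]: "f1 \<in> carrier V" "u \<in> carrier H"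
    note [simp] = G Z
    let ?t = "\<lambda>f2 y2 f3 y3 f4 y4. tD (tens (la f1 u) (ra f2 y2)) (tens (la f3 y3) (ra f4 y4))"
    have "V.swe TD G (\<lambda>\<phi>2 f2 \<Phi>2 F2. H.swe TD Z (\<lambda>\<beta> y2 \<eta>2 Y2.
        (\<omega> \<Phi>2 (\<alpha> + \<beta>) \<otimes> \<omega> \<phi>2 \<alpha>) \<odot>\<^bsub>TD\<^esub> tD (tens (la f1 u) (ra f2 y2)) (psi F2 Y2))) =
      V.swe TD G (\<lambda>\<phi>2 f2 \<Phi>2 F2. H.swe TD Z (\<lambda>\<beta> y2 \<eta>2 Y2.
        V.swe TD F2 (\<lambda>\<phi>3 f3 \<phi>4 f4. H.swe TD Y2 (\<lambda>\<gamma> y3 \<delta> y4.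
          (\<omega> (\<phi>3 + \<phi>4) (\<alpha> + \<beta>) \<otimes> \<omega> \<phi>2 \<alpha> \<otimes> \<omega> \<phi>4 \<gamma>) \<odot>\<^bsub>TD\<^esub> ?t f2 y2 f3 y3 f4 y4))))"
    proof (rule V.swe_cong[OF G], rule H.swe_cong[OF Z])
      fix \<phi>2 f2 \<Phi>2 F2 \<beta> y2 \<eta>2 Y2
      assume h: "F2 \<in> grade V \<Phi>2" and [simp]: "f2 \<in> carrier V" "F2 \<in> carrier V" "y2 \<in> carrier H" "Y2 \<in> carrier H"
      let ?c = "\<omega> \<Phi>2 (\<alpha> + \<beta>) \<otimes> \<omega> \<phi>2 \<alpha>"
      have "?c \<odot>\<^bsub>TD\<^esub> tD (tens (la f1 u) (ra f2 y2)) (psi F2 Y2) =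
          V.swe TD F2 (\<lambda>\<phi>3 f3 \<phi>4 f4. H.swe TD Y2 (\<lambda>\<gamma> y3 \<delta> y4.
            \<omega> \<phi>4 \<gamma> \<odot>\<^bsub>TD\<^esub> (?c \<odot>\<^bsub>TD\<^esub> ?t f2 y2 f3 y3 f4 y4)))"
        by (rule psi_linear_map[where L = "\<lambda>s. ?c \<odot>\<^bsub>TD\<^esub> tD (tens (la f1 u) (ra f2 y2)) s"]) (auto intro!: lin)
      also have "\<dots> = V.swe TD F2 (\<lambda>\<phi>3 f3 \<phi>4 f4. H.swe TD Y2 (\<lambda>\<gamma> y3 \<delta> y4.
          (\<omega> (\<phi>3 + \<phi>4) (\<alpha> + \<beta>) \<otimes> \<omega> \<phi>2 \<alpha> \<otimes> \<omega> \<phi>4 \<gamma>) \<odot>\<^bsub>TD\<^esub> ?t f2 y2 f3 y3 f4 y4))"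
        by (rule V.swe_homogeneous_cong[OF h], rule H.swe_cong)
          (auto simp: DD.AB.T.smult_assoc1[symmetric] m_ac)
      finally show "?c \<odot>\<^bsub>TD\<^esub> tD (tens (la f1 u) (ra f2 y2)) (psi F2 Y2) =
        V.swe TD F2 (\<lambda>\<phi>3 f3 \<phi>4 f4. H.swe TD Y2 (\<lambda>\<gamma> y3 \<delta> y4.
          (\<omega> (\<phi>3 + \<phi>4) (\<alpha> + \<beta>) \<otimes> \<omega> \<phi>2 \<alpha> \<otimes> \<omega> \<phi>4 \<gamma>) \<odot>\<^bsub>TD\<^esub> ?t f2 y2 f3 y3 f4 y4))" .
    qed
    \<comment> \<open>The second and third legs become the coproducts of the middle elements
      \<open>M\<close> and \<open>N\<close>, which puts the right action and the following left
      action in the position of \<open>ra_la_cancel\<close>.\<close>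
    also have "\<dots> = V.swe TD G (\<lambda>\<mu> M \<phi>4 f4. H.swe TD Z (\<lambda>\<nu> N \<delta> y4.
        V.swe TD M (\<lambda>\<phi>2 f2 \<phi>3 f3. H.swe TD N (\<lambda>\<beta> y2 \<gamma> y3.
          (\<omega> (\<phi>3 + \<phi>4) (\<alpha> + \<beta>) \<otimes> \<omega> \<phi>2 \<alpha> \<otimes> \<omega> \<phi>4 \<gamma>) \<odot>\<^bsub>TD\<^esub> ?t f2 y2 f3 y3 f4 y4))))"
      by (rule swe2[OF G Z, symmetric]) (intro conjI; auto intro!: lin)+
    also have "\<dots> = V.swe TD G (\<lambda>\<mu> M \<phi>4 f4. H.swe TD Z (\<lambda>\<nu> N \<delta> y4.
        (\<omega> \<mu> \<alpha> \<otimes> \<omega> \<phi>4 (\<alpha> + \<nu>)) \<odot>\<^bsub>TD\<^esub> tD (tens (la f1 u) M) (tens N (ra f4 y4))))"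
    proof (rule V.swe_cong[OF G], rule H.swe_cong[OF Z])
      fix \<mu> M \<phi>4 f4 \<nu> N \<delta> y4
      assume h: "M \<in> grade V \<mu>" "N \<in> grade H \<nu>"
        and [simp]: "M \<in> carrier V" "f4 \<in> carrier V" "N \<in> carrier H" "y4 \<in> carrier H"
      let ?c = "\<omega> \<mu> \<alpha> \<otimes> \<omega> \<phi>4 (\<alpha> + \<nu>)"
      \<comment> \<open>With \<open>\<phi>2 + \<phi>3 = \<mu>\<close> and
        \<open>\<beta> + \<gamma> = \<nu>\<close> the sign is the product of \<open>?c\<close>,
        which is constant in the inner sums, and the sign \<open>\<omega> \<phi>3 \<beta>\<close>
        that the cancellation requires.\<close>
      have "V.swe TD M (\<lambda>\<phi>2 f2 \<phi>3 f3. H.swe TD N (\<lambda>\<beta> y2 \<gamma> y3.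
          (\<omega> (\<phi>3 + \<phi>4) (\<alpha> + \<beta>) \<otimes> \<omega> \<phi>2 \<alpha> \<otimes> \<omega> \<phi>4 \<gamma>) \<odot>\<^bsub>TD\<^esub> ?t f2 y2 f3 y3 f4 y4)) =
        V.swe TD M (\<lambda>\<phi>2 f2 \<phi>3 f3. H.swe TD N (\<lambda>\<beta> y2 \<gamma> y3. \<omega> \<phi>3 \<beta> \<odot>\<^bsub>TD\<^esub>
          (?c \<odot>\<^bsub>TD\<^esub> tD (tens (la f1 u) (ra f2 y2)) (tens (la f3 y3) (ra f4 y4)))))"
        by (rule V.swe_homogeneous_cong[OF h(1)], rule H.swe_homogeneous_cong[OF h(2)])
          (auto simp: DD.AB.T.smult_assoc1[symmetric] factor_add m_ac)
      also have "\<dots> = ?c \<odot>\<^bsub>TD\<^esub> tD (tens (la f1 u) M) (tens N (ra f4 y4))"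
        by (rule ra_la_cancel[where b = "\<lambda>_ p _ z. ?c \<odot>\<^bsub>TD\<^esub> tD (tens (la f1 u) p) (tens z (ra f4 y4))", OF _ _ h])
          (auto intro!: graded_bilinearI lin)
      finally show "V.swe TD M (\<lambda>\<phi>2 f2 \<phi>3 f3. H.swe TD N (\<lambda>\<beta> y2 \<gamma> y3.
          (\<omega> (\<phi>3 + \<phi>4) (\<alpha> + \<beta>) \<otimes> \<omega> \<phi>2 \<alpha> \<otimes> \<omega> \<phi>4 \<gamma>) \<odot>\<^bsub>TD\<^esub> ?t f2 y2 f3 y3 f4 y4)) =
        ?c \<odot>\<^bsub>TD\<^esub> tD (tens (la f1 u) M) (tens N (ra f4 y4))" .
    qed
    finally show "V.swe TD G (\<lambda>\<phi>2 f2 \<Phi>2 F2. H.swe TD Z (\<lambda>\<beta> y2 \<eta>2 Y2.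
        (\<omega> \<Phi>2 (\<alpha> + \<beta>) \<otimes> \<omega> \<phi>2 \<alpha>) \<odot>\<^bsub>TD\<^esub> tD (tens (la f1 u) (ra f2 y2)) (psi F2 Y2))) =
      V.swe TD G (\<lambda>\<mu> M \<phi>4 f4. H.swe TD Z (\<lambda>\<nu> N \<delta> y4.
        (\<omega> \<mu> \<alpha> \<otimes> \<omega> \<phi>4 (\<alpha> + \<nu>)) \<odot>\<^bsub>TD\<^esub> tD (tens (la f1 u) M) (tens N (ra f4 y4))))" .
  qed
  finally have R: "dc \<one>\<^bsub>H\<^esub> f ** dc y \<one>\<^bsub>V\<^esub> = ?X" .
  let ?b = "\<lambda>\<mu> M \<phi>4 f4 \<alpha> u \<nu> N y4 f1.
    (\<omega> \<mu> \<alpha> \<otimes> \<omega> \<phi>4 (\<alpha> + \<nu>)) \<odot>\<^bsub>TD\<^esub> tD (tens (la f1 u) M) (tens N (ra f4 y4))"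
  have "cm (psi f y) = V.swe TD f (\<lambda>\<phi>1 f1 \<Gamma> G. H.swe TD y (\<lambda>\<eta>1 Y \<delta> y4.
      \<omega> \<Gamma> \<eta>1 \<odot>\<^bsub>TD\<^esub> dc (la f1 Y) (ra G y4)))"
    by (subst psi_linear_map[OF TD_module lin_cm_eta]) (auto intro!: V.swe_cong H.swe_cong)
  also have "\<dots> = V.swe TD f (\<lambda>\<phi>1 f1 \<Gamma> G. H.swe TD y (\<lambda>\<eta>1 Y \<delta> y4.
      H.swe TD Y (\<lambda>\<alpha> u \<nu> N. V.swe TD G (\<lambda>\<mu> M \<phi>4 f4. ?b \<mu> M \<phi>4 f4 \<alpha> u \<nu> N y4 f1))))"
  proof (rule V.swe_cong[OF f], rule H.swe_cong[OF y])
    fix \<phi>1 f1 \<Gamma> G \<eta>1 Y \<delta> y4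
    assume h: "f1 \<in> grade V \<phi>1" "G \<in> grade V \<Gamma>" "Y \<in> grade H \<eta>1" "y4 \<in> grade H \<delta>"
      and [simp]: "f1 \<in> carrier V" "G \<in> carrier V" "Y \<in> carrier H" "y4 \<in> carrier H"
    have "dc (la f1 Y) (ra G y4) = H.swe TD Y (\<lambda>\<alpha> u \<nu> N. V.swe TD (ra G y4) (\<lambda>\<mu> M \<phi>4 f4.
        \<omega> \<nu> \<mu> \<odot>\<^bsub>TD\<^esub> tD (tens (la f1 u) M) (tens N f4)))"
      unfolding dc_def by (rule la_comult[OF _ _ h(1)]) (auto intro!: graded_bilinearI lin)
    also have "\<dots> = H.swe TD Y (\<lambda>\<alpha> u \<nu> N. V.swe TD G (\<lambda>\<mu> M \<phi>4 f4.
        \<omega> \<nu> \<mu> \<odot>\<^bsub>TD\<^esub> tD (tens (la f1 u) M) (tens N (ra f4 y4))))"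
      by (rule H.swe_cong, simp, rule ra_comult[OF _ _ _ h(4)]) (auto intro!: graded_bilinearI lin)
    finally have "\<omega> \<Gamma> \<eta>1 \<odot>\<^bsub>TD\<^esub> dc (la f1 Y) (ra G y4) = H.swe TD Y (\<lambda>\<alpha> u \<nu> N. V.swe TD G (\<lambda>\<mu> M \<phi>4 f4.
        \<omega> \<Gamma> \<eta>1 \<odot>\<^bsub>TD\<^esub> (\<omega> \<nu> \<mu> \<odot>\<^bsub>TD\<^esub> tD (tens (la f1 u) M) (tens N (ra f4 y4)))))"
      by (simp add: H.swe_smult V.swe_closed) (auto intro!: H.swe_cong simp: V.swe_smult)
    \<comment> \<open>Here \<open>\<Gamma> = \<mu> + \<phi>4\<close> and
      \<open>\<eta>1 = \<alpha> + \<nu>\<close>. The factor \<open>\<omega> \<mu> \<nu>\<close> of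
      \<open>\<omega> \<Gamma> \<eta>1\<close> cancels against
      \<open>\<omega> \<nu> \<mu>\<close>.\<close>
    also have "\<dots> = H.swe TD Y (\<lambda>\<alpha> u \<nu> N. V.swe TD G (\<lambda>\<mu> M \<phi>4 f4. ?b \<mu> M \<phi>4 f4 \<alpha> u \<nu> N y4 f1))"
      by (rule H.swe_homogeneous_cong[OF h(3)], rule V.swe_homogeneous_cong[OF h(2)])
        (auto simp: DD.AB.T.smult_assoc1[symmetric] factor_add m_ac factor_cancel_gap)
    finally show "\<omega> \<Gamma> \<eta>1 \<odot>\<^bsub>TD\<^esub> dc (la f1 Y) (ra G y4) =
      H.swe TD Y (\<lambda>\<alpha> u \<nu> N. V.swe TD G (\<lambda>\<mu> M \<phi>4 f4. ?b \<mu> M \<phi>4 f4 \<alpha> u \<nu> N y4 f1))" .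
  qed
  also have "\<dots> = V.swe TD f (\<lambda>\<phi>1 f1 \<Gamma> G. H.swe TD y (\<lambda>\<eta>1 Y \<delta> y4.
      V.swe TD G (\<lambda>\<mu> M \<phi>4 f4. H.swe TD Y (\<lambda>\<alpha> u \<nu> N. ?b \<mu> M \<phi>4 f4 \<alpha> u \<nu> N y4 f1))))"
    by (rule V.swe_cong, simp, rule H.swe_cong, simp, rule swap_VH[symmetric]) auto
  also have "\<dots> = V.swe TD f (\<lambda>\<phi>1 f1 \<Gamma> G. V.swe TD G (\<lambda>\<mu> M \<phi>4 f4.
      H.swe TD y (\<lambda>\<eta>1 Y \<delta> y4. H.swe TD Y (\<lambda>\<alpha> u \<nu> N. ?b \<mu> M \<phi>4 f4 \<alpha> u \<nu> N y4 f1))))"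
    by (rule V.swe_cong, simp, rule swap_VH[symmetric]) (auto intro!: H.swe_closed)
  also have "\<dots> = V.swe TD f (\<lambda>\<phi>1 f1 \<Gamma> G. V.swe TD G (\<lambda>\<mu> M \<phi>4 f4.
      H.swe TD y (\<lambda>\<alpha> u \<zeta> Z. H.swe TD Z (\<lambda>\<nu> N \<delta> y4. ?b \<mu> M \<phi>4 f4 \<alpha> u \<nu> N y4 f1))))"
    by (rule V.swe_cong, simp, rule V.swe_cong, simp, rule H.swe_coassoc)
      (auto intro!: graded_trilinearI lin)
  also have "\<dots> = ?X"
    by (rule V.swe_cong, simp, rule swap_VH) (auto intro!: H.swe_closed)
  finally show ?thesis using R by simp
qed

text \<open>A product of pure tensors consists of an outer left factor, a crossing and an outer
  right factor, handled by \<open>cm_lmul\<close>, \<open>cm_psi\<close> and \<open>cm_rmul\<close>.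
  Associativity of the signed tensor square reassembles the four coproducts.\<close>

lemma cm_mult:
  assumes "s \<in> carrier T" "t \<in> carrier T"
  shows "cm (dm s t) = cm s ** cm t"
proof (rule HV.tensor_eqI[OF TD_module _ _ _ assms(1)])
  fix x f assume [simp]: "x \<in> carrier H" "f \<in> carrier V"
  note [simp] = assms
  show "cm (dm (tens x f) t) = cm (tens x f) ** cm t"
  proof (rule HV.tensor_eqI[OF TD_module _ _ _ assms(2)])
    fix y g assume [simp]: "y \<in> carrier H" "g \<in> carrier V"
    have 1: "cm (tens x f) = cm (tens x \<one>\<^bsub>V\<^esub>) ** cm (tens \<one>\<^bsub>H\<^esub> f)"
      if "x \<in> carrier H" "f \<in> carrier V" for x f
      using that cm_lmul[of x "tens \<one>\<^bsub>H\<^esub> f"] by simp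
    have "cm (dm (tens x f) (tens y g)) =
        cm (tens x \<one>\<^bsub>V\<^esub>) ** ((cm (tens \<one>\<^bsub>H\<^esub> f) ** cm (tens y \<one>\<^bsub>V\<^esub>)) ** cm (tens \<one>\<^bsub>H\<^esub> g))"
      by (simp add: dm_tens_tens cm_lmul cm_rmul cm_psi del: cm_tens)
    also have "\<dots> = cm (tens x f) ** cm (tens y g)"
      by (simp add: 1[of x f] 1[of y g] DD.tensor_mult_assoc del: cm_tens)
    finally show "cm (dm (tens x f) (tens y g)) = cm (tens x f) ** cm (tens y g)" .
  qed (auto intro!: lin)
qed (use assms in \<open>auto intro!: lin\<close>)

lemma cm_grade:
  assumes "t \<in> tensor_grade K H V \<gamma>"
  shows "cm t \<in> tensor_grade K DR DR \<gamma>"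
proof (rule HV.linear_map_tensor_grade[OF TD_module lin_cm_eta DD.AB.submodule_tensor_grade assms])
  fix \<xi> x \<phi> f assume h: "x \<in> grade H \<xi>" "f \<in> grade V \<phi>" "\<xi> + \<phi> = \<gamma>"
  then have [simp]: "x \<in> carrier H" "f \<in> carrier V" using H.grade_closed V.grade_closed by auto
  have "dc x f \<in> tensor_grade K DR DR \<gamma>" unfolding dc_def
  proof (rule H.swe_submodule[OF TD_module DD.AB.submodule_tensor_grade h(1)],
      rule V.swe_submodule[OF TD_module DD.AB.submodule_tensor_grade h(2)])
    fix \<phi>1 f1 \<phi>2 f2 \<xi>1 x1 \<xi>2 x2
    assume k: "f1 \<in> grade V \<phi>1" "f2 \<in> grade V \<phi>2" "\<phi>1 + \<phi>2 = \<phi>" "x1 \<in> grade H \<xi>1" "x2 \<in> grade H \<xi>2" "\<xi>1 + \<xi>2 = \<xi>"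
    have "tD (tens x1 f1) (tens x2 f2) \<in> tensor_grade K DR DR \<gamma>"
      using HV.pure_grade[OF k(4,1) refl] HV.pure_grade[OF k(5,2) refl] h(3) k
      by (intro DD.AB.pure_grade[where \<alpha> = "\<xi>1 + \<phi>1" and \<beta> = "\<xi>2 + \<phi>2"]) (auto simp: ac_simps)
    then show "\<omega> \<xi>2 \<phi>1 \<odot>\<^bsub>TD\<^esub> tD (tens x1 f1) (tens x2 f2) \<in> tensor_grade K DR DR \<gamma>"
      by (simp add: DD.AB.T.submoduleE(4)[OF DD.AB.submodule_tensor_grade])
  qed
  then show "cm (tens x f) \<in> tensor_grade K DR DR \<gamma>" by simp
qed

lemma double_comult_hom: "graded_algebra_hom K DR (tensor K \<omega> DR DR) (comult DR)"
proof -
  have "linear_map K T TD (double_comult K \<omega> H V)"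
    by (rule linear_map_cong[OF lin_cm_eta]) (simp_all add: double_comult_eq)
  moreover have "double_comult K \<omega> H V (tens \<one>\<^bsub>H\<^esub> \<one>\<^bsub>V\<^esub>) = tD (tens \<one>\<^bsub>H\<^esub> \<one>\<^bsub>V\<^esub>) (tens \<one>\<^bsub>H\<^esub> \<one>\<^bsub>V\<^esub>)"
    by (simp add: double_comult_eq dc_one_right, rule H.swe_one) (auto intro!: graded_bilinearI lin)
  ultimately show ?thesis
    by (auto simp: graded_algebra_hom_def linear_map_def double_comult_eq cm_grade HV.tensor_grade_closed
        double_mult_eq cm_mult)
qed

end

lemma (in graded_pair) tensor_grade_eqI:
  assumes "module K P" "linear_map K T P f" "linear_map K T P g" "t \<in> tensor_grade K M N \<gamma>"
    and "\<And>\<alpha> x \<beta> y. \<lbrakk>x \<in> grade M \<alpha>; y \<in> grade N \<beta>; x \<in> carrier M; y \<in> carrier N; \<alpha> + \<beta> = \<gamma>\<rbrakk> \<Longrightarrow>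
      f (pure x y) = g (pure x y)"
  shows "f t = g t"
proof -
  have "tensor_grade K M N \<gamma> \<subseteq> {t \<in> carrier T. f t = g t}" unfolding tensor_grade_def
    by (rule mspan_least[OF submodule_equalizer[OF T.module_axioms assms(1,2,3)]])
      (use assms(5) M.grade_closed N.grade_closed pure_closed in blast)
  then show ?thesis using assms(4) by blast
qed

section \<open>The other convolution identity, and the co-units of the two actions\<close>

context hopf_pairing
begin

lemma Sinv_convolution_right:
  assumes "x \<in> carrier H"
  shows "H.swe H x (\<lambda>\<alpha> u \<beta> v. \<omega> \<alpha> \<beta> \<odot>\<^bsub>H\<^esub> (v \<otimes>\<^bsub>H\<^esub> Sinv u)) = counit H x \<odot>\<^bsub>H\<^esub> \<one>\<^bsub>H\<^esub>"
proof (rule antipode_inj)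
  have "antipode H (H.swe H x (\<lambda>\<alpha> u \<beta> v. \<omega> \<alpha> \<beta> \<odot>\<^bsub>H\<^esub> (v \<otimes>\<^bsub>H\<^esub> Sinv u))) =
      H.swe H x (\<lambda>\<alpha> u \<beta> v. antipode H (\<omega> \<alpha> \<beta> \<odot>\<^bsub>H\<^esub> (v \<otimes>\<^bsub>H\<^esub> Sinv u)))"
    by (rule H.swe_linear_map[OF _ _ H.antipode_linear assms]) simp_all
  also have "\<dots> = H.swe H x (\<lambda>\<alpha> u \<beta> v. u \<otimes>\<^bsub>H\<^esub> antipode H v)"
    by (rule H.swe_cong[OF assms])
      (simp add: linear_map_smult[OF H.antipode_linear] H.antipode_mult[OF _ Sinv_grade]
        H.smult_assoc1[symmetric])
  also have "\<dots> = counit H x \<odot>\<^bsub>H\<^esub> \<one>\<^bsub>H\<^esub>"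
    by (rule H.swe_antipode(2)[where F = "\<lambda>x. x"]) (auto intro: lin assms)
  finally show "antipode H (H.swe H x (\<lambda>\<alpha> u \<beta> v. \<omega> \<alpha> \<beta> \<odot>\<^bsub>H\<^esub> (v \<otimes>\<^bsub>H\<^esub> Sinv u))) =
      antipode H (counit H x \<odot>\<^bsub>H\<^esub> \<one>\<^bsub>H\<^esub>)"
    using assms by (simp add: linear_map_smult[OF H.antipode_linear] H.antipode_one)
qed (use assms in \<open>auto intro!: H.swe_closed\<close>)

text \<open>\<open>q\<close> is also a left convolution inverse of evaluation. This order arises
  when co-units are applied to both factors of a crossing: the left action leaves \<open>q\<close>,
  the right action leaves \<open>ev\<close>.\<close>

lemma q_ev_convolution:
  assumes "f \<in> carrier V" "x \<in> carrier H"
  shows "V.swe Ks f (\<lambda>\<phi>1 f1 \<phi>2 f2. H.swe Ks x (\<lambda>\<xi>1 x1 \<xi>2 x2. \<omega> \<phi>2 \<xi>1 \<otimes> (q f1 x1 \<otimes> ev f2 x2))) =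
    counit V f \<otimes> counit H x"
proof -
  have "V.swe Ks f (\<lambda>\<phi>1 f1 \<phi>2 f2. H.swe Ks x (\<lambda>\<xi>1 x1 \<xi>2 x2. \<omega> \<phi>2 \<xi>1 \<otimes> (q f1 x1 \<otimes> ev f2 x2))) =
      V.swe Ks f (\<lambda>\<phi>1 f1 \<phi>2 f2. H.swe Ks x (\<lambda>\<xi>1 x1 \<xi>2 x2. \<omega> \<xi>1 \<xi>2 \<odot>\<^bsub>Ks\<^esub> (ev f1 (Sinv x1) \<otimes> ev f2 x2)))"
  proof (rule V.swe_cong[OF assms(1)], rule H.swe_cong[OF assms(2)])
    fix \<phi>1 f1 \<phi>2 f2 \<xi>1 x1 \<xi>2 x2
    assume h: "f1 \<in> carrier V" "f2 \<in> grade V \<phi>2" "f2 \<in> carrier V" "x1 \<in> carrier H" "x2 \<in> grade H \<xi>2" "x2 \<in> carrier H"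
    show "\<omega> \<phi>2 \<xi>1 \<otimes> (q f1 x1 \<otimes> ev f2 x2) = \<omega> \<xi>1 \<xi>2 \<odot>\<^bsub>Ks\<^esub> (ev f1 (Sinv x1) \<otimes> ev f2 x2)"
      using ev_degree[OF h(2,5)] h by (auto simp: q_eq_ev_Sinv)
  qed
  also have "\<dots> = H.swe Ks x (\<lambda>\<xi>1 x1 \<xi>2 x2. V.swe Ks f (\<lambda>\<phi>1 f1 \<phi>2 f2. \<omega> \<xi>1 \<xi>2 \<odot>\<^bsub>Ks\<^esub> (ev f1 (Sinv x1) \<otimes> ev f2 x2)))"
    by (rule swap_VH) (use assms in auto)
  also have "\<dots> = H.swe Ks x (\<lambda>\<xi>1 x1 \<xi>2 x2. ev f (\<omega> \<xi>1 \<xi>2 \<odot>\<^bsub>H\<^esub> (x2 \<otimes>\<^bsub>H\<^esub> Sinv x1)))"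
    by (rule H.swe_cong[OF assms(2)], subst V.swe_smult[symmetric])
      (use assms in \<open>auto simp: linear_map_smult[OF ev_right] ev_comult\<close>)
  also have "\<dots> = ev f (H.swe H x (\<lambda>\<xi>1 x1 \<xi>2 x2. \<omega> \<xi>1 \<xi>2 \<odot>\<^bsub>H\<^esub> (x2 \<otimes>\<^bsub>H\<^esub> Sinv x1)))"
    by (rule H.swe_linear_map[symmetric]) (use assms in \<open>auto intro: lin\<close>)
  also have "\<dots> = counit V f \<otimes> counit H x"
    using assms by (simp add: Sinv_convolution_right linear_map_smult[OF ev_right] counit_eq_ev m_comm)
  finally show ?thesis .
qed

lemma counit_smult:
  "\<lbrakk>a \<in> carrier K; x \<in> carrier H\<rbrakk> \<Longrightarrow> counit H (a \<odot>\<^bsub>H\<^esub> x) = a \<otimes> counit H x"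
  "\<lbrakk>a \<in> carrier K; f \<in> carrier V\<rbrakk> \<Longrightarrow> counit V (a \<odot>\<^bsub>V\<^esub> f) = a \<otimes> counit V f"
  using H.counit_hom V.counit_hom by (simp_all add: graded_algebra_hom_def linear_map_def)

text \<open>The co-unit absorbs the second leg and leaves all of \<open>x\<close> in the
  coefficient.\<close>

lemma counit_la: "\<lbrakk>f \<in> carrier V; x \<in> carrier H\<rbrakk> \<Longrightarrow> counit H (la f x) = q f x"
proof -
  assume [simp]: "f \<in> carrier V" "x \<in> carrier H"
  have "counit H (la f x) = H.swe Ks x (\<lambda>\<alpha> u \<beta> v. q f (counit H v \<odot>\<^bsub>H\<^esub> u))"
    unfolding la_def
    by (subst H.swe_linear_map[where Q = Ks and f = "counit H"])
      (auto intro!: H.swe_cong lin simp: counit_smult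
        linear_map_smult[OF ev_right] m_comm)
  also have "\<dots> = q f (H.swe H x (\<lambda>\<alpha> u \<beta> v. counit H v \<odot>\<^bsub>H\<^esub> u))"
    by (rule H.swe_linear_map[symmetric]) (auto intro!: lin)
  finally show ?thesis by (simp add: H.swe_counit_id)
qed

lemma counit_ra: "\<lbrakk>f \<in> carrier V; x \<in> carrier H\<rbrakk> \<Longrightarrow> counit V (ra f x) = ev f x"
proof -
  assume [simp]: "f \<in> carrier V" "x \<in> carrier H"
  have "counit V (ra f x) = V.swe Ks f (\<lambda>\<alpha> u \<beta> v. ev (counit V u \<odot>\<^bsub>V\<^esub> v) x)"
    unfolding ra_def
    by (subst V.swe_linear_map[where Q = Ks and f = "counit V"])
      (auto intro!: V.swe_cong lin simp: counit_smult
        linear_map_smult[OF ev_left] m_comm)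
  also have "\<dots> = ev (V.swe V f (\<lambda>\<alpha> u \<beta> v. counit V u \<odot>\<^bsub>V\<^esub> v)) x"
    by (rule V.swe_linear_map[where f = "\<lambda>s. ev s x", symmetric]) (auto intro!: lin)
  finally show ?thesis by (simp add: V.swe_counit_id)
qed

lemma counit_mult:
  "\<lbrakk>x \<in> carrier H; y \<in> carrier H\<rbrakk> \<Longrightarrow> counit H (x \<otimes>\<^bsub>H\<^esub> y) = counit H x \<otimes> counit H y"
  "\<lbrakk>f \<in> carrier V; g \<in> carrier V\<rbrakk> \<Longrightarrow> counit V (f \<otimes>\<^bsub>V\<^esub> g) = counit V f \<otimes> counit V g"
  using H.counit_hom V.counit_hom by (simp_all add: graded_algebra_hom_def)

section \<open>The co-unit of the double\<close>

definition "ce t = tsum K Ks t (\<lambda>x f. counit H x \<otimes> counit V f)"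

lemma bilinear_ce: "bilinear_map K H V Ks (\<lambda>x f. counit H x \<otimes> counit V f)"
  by (auto intro!: bilinear_mapI lin)

lemma lin_ce [lin]: "linear_map K Q T h \<Longrightarrow> linear_map K Q Ks (\<lambda>z. ce (h z))"
  unfolding ce_def by (auto intro!: lin bilinear_ce)

lemmas lin_ce_eta [lin] = lin_ce[OF lin_id]

lemma ce_closed [simp, intro]: "t \<in> carrier T \<Longrightarrow> ce t \<in> carrier K"
  using linear_map_closed[OF lin_ce_eta] by simp

lemma ce_tens [simp]: "\<lbrakk>x \<in> carrier H; f \<in> carrier V\<rbrakk> \<Longrightarrow> ce (tens x f) = counit H x \<otimes> counit V f"
  unfolding ce_def by (rule HV.tsum_pure[OF _ bilinear_ce]) auto

lemma double_counit_eq: "t \<in> carrier T \<Longrightarrow> double_counit K H t = ce t"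
  unfolding double_counit_def ce_def
  by (rule HV.tsum_cong_carrier[OF _ bilinear_ce]) (auto simp: counit_eq_ev ev_def)

text \<open>Co-units turn the actions into their coefficients, and the sum becomes the one in
  \<open>q_ev_convolution\<close>.\<close>

lemma ce_psi: "\<lbrakk>f \<in> carrier V; x \<in> carrier H\<rbrakk> \<Longrightarrow> ce (psi f x) = counit V f \<otimes> counit H x"
  by (subst psi_linear_map[OF _ lin_ce_eta])
    (auto intro!: V.swe_cong H.swe_cong simp: counit_la counit_ra simp flip: q_ev_convolution)

lemma ce_lmul: "\<lbrakk>x \<in> carrier H; t \<in> carrier T\<rbrakk> \<Longrightarrow> ce (lmul x t) = counit H x \<otimes> ce t"
  by (rule HV.tensor_eqI[where P = Ks]) (auto intro!: lin simp: counit_mult m_ac)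

lemma ce_rmul: "\<lbrakk>g \<in> carrier V; t \<in> carrier T\<rbrakk> \<Longrightarrow> ce (rmul g t) = ce t \<otimes> counit V g"
  by (rule HV.tensor_eqI[where P = Ks]) (auto intro!: lin simp: counit_mult m_ac)

lemma ce_mult:
  assumes "s \<in> carrier T" "t \<in> carrier T"
  shows "ce (dm s t) = ce s \<otimes> ce t"
proof (rule HV.tensor_eqI[where P = Ks, OF _ _ _ _ assms(1)])
  fix x f assume [simp]: "x \<in> carrier H" "f \<in> carrier V"
  note [simp] = assms
  show "ce (dm (tens x f) t) = ce (tens x f) \<otimes> ce t"
  proof (rule HV.tensor_eqI[where P = Ks, OF _ _ _ _ assms(2)])
    fix y g assume [simp]: "y \<in> carrier H" "g \<in> carrier V"
    show "ce (dm (tens x f) (tens y g)) = ce (tens x f) \<otimes> ce (tens y g)"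
      by (simp add: dm_tens_tens ce_lmul ce_rmul ce_psi m_ac)
  qed (auto intro!: lin)
qed (use assms in \<open>auto intro!: lin\<close>)

lemma ce_degree:
  assumes "t \<in> tensor_grade K H V \<gamma>" "\<gamma> \<noteq> 0"
  shows "ce t = \<zero>"
proof (rule HV.tensor_grade_eqI[where P = Ks and g = "\<lambda>t. \<zero>", OF _ lin_ce_eta _ assms(1)])
  fix \<xi> x \<phi> f assume h: "x \<in> grade H \<xi>" "f \<in> grade V \<phi>" "x \<in> carrier H" "f \<in> carrier V" "\<xi> + \<phi> = \<gamma>"
  then have "\<xi> \<noteq> 0 \<or> \<phi> \<noteq> 0" using assms(2) by auto
  then show "ce (tens x f) = \<zero>" using h H.counit_zero[OF h(1)] V.counit_zero[OF h(2)] by auto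
qed (auto intro!: linear_mapI)

lemma double_counit_hom: "graded_algebra_hom K DR Ks (counit DR)"
proof -
  have "linear_map K T Ks (double_counit K H)"
    by (rule linear_map_cong[OF lin_ce_eta]) (simp_all add: double_counit_eq)
  then show ?thesis
    using ce_degree
    by (auto simp: graded_algebra_hom_def double_counit_eq HV.tensor_grade_closed scalars_def
        double_mult_eq ce_mult H.counit_one V.counit_one)
qed

section \<open>The co-unit and coassociativity axioms of the double\<close>

lemma tsum_double: "tsum K DR = tsum K T"
  by (rule tsum_cong) simp_all

lemma tsum_cm_lin:
  assumes "module K P" "bilinear_map K T T P b"
  shows "linear_map K T P (\<lambda>t. tsum K P (cm t) b)" "linear_map K TD P (\<lambda>s. tsum K P s b)"
    and "\<lbrakk>r \<in> carrier T; s \<in> carrier T\<rbrakk> \<Longrightarrow> tsum K P (tD r s) b = b r s"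
proof -
  have b: "bilinear_map K DR DR P b" using assms(2) by (simp add: bilinear_map_def)
  show "linear_map K T P (\<lambda>t. tsum K P (cm t) b)" by (intro DD.AB.lin_tsum assms lin b)
  show "linear_map K TD P (\<lambda>s. tsum K P s b)" by (intro DD.AB.linear_map_tsum assms b)
  show "\<lbrakk>r \<in> carrier T; s \<in> carrier T\<rbrakk> \<Longrightarrow> tsum K P (tD r s) b = b r s"
    using DD.AB.tsum_pure[OF assms(1) b] by simp
qed

lemma tsum_double_comult:
  assumes "module K P" "bilinear_map K T T P b" "t \<in> carrier T"
    and "\<And>r s. \<lbrakk>r \<in> carrier T; s \<in> carrier T\<rbrakk> \<Longrightarrow> b' r s = b r s"
  shows "tsum K P (comult DR t) b' = tsum K P (cm t) b"
  using DD.AB.tsum_cong_carrier[of P b "cm t" b'] assms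
  by (simp add: double_comult_eq bilinear_map_def)

lemma tsum_dc:
  assumes "module K P" "bilinear_map K T T P b" "x \<in> carrier H" "f \<in> carrier V"
  shows "tsum K P (dc x f) b = H.swe P x (\<lambda>\<xi>1 x1 \<xi>2 x2. V.swe P f (\<lambda>\<phi>1 f1 \<phi>2 f2.
    \<omega> \<xi>2 \<phi>1 \<odot>\<^bsub>P\<^esub> b (tens x1 f1) (tens x2 f2)))"
  using assms
  by (subst dc_linear_map[OF assms(1) tsum_cm_lin(2)[OF assms(1,2)] assms(3,4)])
    (auto intro!: H.swe_cong V.swe_cong simp: tsum_cm_lin(3)[OF assms(1,2)])

lemma double_counit_left:
  assumes t: "t \<in> carrier T"
  shows "tsum K DR (comult DR t) (\<lambda>r s. counit DR r \<odot>\<^bsub>DR\<^esub> s) = t"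
proof -
  let ?b = "\<lambda>r s. ce r \<odot>\<^bsub>T\<^esub> s"
  have b: "bilinear_map K T T T ?b" by (auto intro!: bilinear_mapI lin)
  have "tsum K T (cm t) ?b = t"
  proof (rule HV.tensor_eqI_homogeneous[OF T_module tsum_cm_lin(1)[OF T_module b] lin_id _ t])
    fix \<xi> x \<phi> f assume x: "x \<in> grade H \<xi>" and f: "f \<in> grade V \<phi>" and [simp]: "x \<in> carrier H" "f \<in> carrier V"
    have "tsum K T (cm (tens x f)) ?b = H.swe T x (\<lambda>\<xi>1 x1 \<xi>2 x2. counit H x1 \<odot>\<^bsub>T\<^esub> tens x2 f)"
    proof (subst cm_tens, simp, simp, subst tsum_dc[OF T_module b], simp, simp, rule H.swe_cong, simp)
      fix \<xi>1 x1 \<xi>2 x2 assume [simp]: "x1 \<in> carrier H" "x2 \<in> carrier H"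
      have "V.swe T f (\<lambda>\<phi>1 f1 \<phi>2 f2. \<omega> \<xi>2 \<phi>1 \<odot>\<^bsub>T\<^esub> (ce (tens x1 f1) \<odot>\<^bsub>T\<^esub> tens x2 f2)) =
          V.swe T f (\<lambda>\<phi>1 f1 \<phi>2 f2. counit V f1 \<odot>\<^bsub>T\<^esub> ((counit H x1 \<otimes> \<omega> \<xi>2 \<phi>1) \<odot>\<^bsub>T\<^esub> tens x2 f2))"
        by (rule V.swe_cong) (simp_all add: HV.T.smult_assoc1[symmetric] m_ac)
      also have "\<dots> = (counit H x1 \<otimes> \<omega> \<xi>2 0) \<odot>\<^bsub>T\<^esub> tens x2 f"
        by (rule V.swe_counit_left[OF f]) (auto intro!: lin)
      finally show "V.swe T f (\<lambda>\<phi>1 f1 \<phi>2 f2. \<omega> \<xi>2 \<phi>1 \<odot>\<^bsub>T\<^esub> (ce (tens x1 f1) \<odot>\<^bsub>T\<^esub> tens x2 f2)) =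
          counit H x1 \<odot>\<^bsub>T\<^esub> tens x2 f" by simp
    qed
    also have "\<dots> = tens x f" by (rule H.swe_counit_left[OF x]) (auto intro!: lin)
    finally show "tsum K T (cm (tens x f)) ?b = tens x f" .
  qed
  then show ?thesis
    unfolding tsum_double by (subst tsum_double_comult[OF T_module b t]) (simp_all add: double_counit_eq)
qed

text \<open>In contrast to the left axiom, the co-unit on the form leaves the sign
  \<open>\<omega> \<xi>2 \<phi>\<close>. It disappears only with the co-unit on \<open>x2\<close>,
  which forces \<open>\<xi>2 = 0\<close>.\<close>

lemma double_counit_right:
  assumes t: "t \<in> carrier T"
  shows "tsum K DR (comult DR t) (\<lambda>r s. counit DR s \<odot>\<^bsub>DR\<^esub> r) = t"
proof -
  let ?b = "\<lambda>r s. ce s \<odot>\<^bsub>T\<^esub> r"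
  have b: "bilinear_map K T T T ?b" by (auto intro!: bilinear_mapI lin)
  have "tsum K T (cm t) ?b = t"
  proof (rule HV.tensor_eqI_homogeneous[OF T_module tsum_cm_lin(1)[OF T_module b] lin_id _ t])
    fix \<xi> x \<phi> f assume x: "x \<in> grade H \<xi>" and f: "f \<in> grade V \<phi>" and [simp]: "x \<in> carrier H" "f \<in> carrier V"
    have "tsum K T (cm (tens x f)) ?b = H.swe T x (\<lambda>\<xi>1 x1 \<xi>2 x2. counit H x2 \<odot>\<^bsub>T\<^esub> (\<omega> \<xi>2 \<phi> \<odot>\<^bsub>T\<^esub> tens x1 f))"
    proof (subst cm_tens, simp, simp, subst tsum_dc[OF T_module b], simp, simp, rule H.swe_cong, simp)
      fix \<xi>1 x1 \<xi>2 x2 assume [simp]: "x1 \<in> carrier H" "x2 \<in> carrier H"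
      have "V.swe T f (\<lambda>\<phi>1 f1 \<phi>2 f2. \<omega> \<xi>2 \<phi>1 \<odot>\<^bsub>T\<^esub> (ce (tens x2 f2) \<odot>\<^bsub>T\<^esub> tens x1 f1)) =
          V.swe T f (\<lambda>\<phi>1 f1 \<phi>2 f2. counit V f2 \<odot>\<^bsub>T\<^esub> ((counit H x2 \<otimes> \<omega> \<xi>2 \<phi>1) \<odot>\<^bsub>T\<^esub> tens x1 f1))"
        by (rule V.swe_cong) (simp_all add: HV.T.smult_assoc1[symmetric] m_ac)
      also have "\<dots> = (counit H x2 \<otimes> \<omega> \<xi>2 \<phi>) \<odot>\<^bsub>T\<^esub> tens x1 f"
        by (rule V.swe_counit_right[OF f]) (auto intro!: lin)
      finally show "V.swe T f (\<lambda>\<phi>1 f1 \<phi>2 f2. \<omega> \<xi>2 \<phi>1 \<odot>\<^bsub>T\<^esub> (ce (tens x2 f2) \<odot>\<^bsub>T\<^esub> tens x1 f1)) =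
          counit H x2 \<odot>\<^bsub>T\<^esub> (\<omega> \<xi>2 \<phi> \<odot>\<^bsub>T\<^esub> tens x1 f)" by (simp add: HV.T.smult_assoc1)
    qed
    also have "\<dots> = \<omega> 0 \<phi> \<odot>\<^bsub>T\<^esub> tens x f" by (rule H.swe_counit_right[OF x]) (auto intro!: lin)
    finally show "tsum K T (cm (tens x f)) ?b = tens x f" by simp
  qed
  then show ?thesis
    unfolding tsum_double by (subst tsum_double_comult[OF T_module b t]) (simp_all add: double_counit_eq)
qed

text \<open>On pure tensors the statement is \<open>swe2_coassoc\<close> for \<open>H\<close> and
  \<open>V\<close>. Both bracketings produce the same sign once the degree of a split leg is written
  as the sum of the degrees of its parts.\<close>

lemma double_coassociative:
  fixes t
  assumes t: "t \<in> carrier T"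
  defines "T3 \<equiv> tensor_module K DR TD"
  defines "tr \<equiv> \<lambda>r s u. pure_tensor K DR TD r (tD s u)"
  shows "tsum K T3 (comult DR t) (\<lambda>r u. tsum K T3 (comult DR r) (\<lambda>r s. tr r s u)) =
    tsum K T3 (comult DR t) (\<lambda>r v. tsum K T3 (comult DR v) (\<lambda>s u. tr r s u))"
proof -
  interpret T3: module_pair K DR TD ..
  have P [simp]: "module K T3" unfolding T3_def by (rule T3.module_tensor)
  have pl: "linear_map K Q T3 (\<lambda>z. pure_tensor K DR TD (h z) y)"
    if "linear_map K Q T h" "y \<in> carrier TD" for h y and Q :: "('k, 'q, 'm2) module_scheme"
    unfolding T3_def using that
    by (intro linear_map_compose[OF _ bilinear_map_left[OF T3.bilinear_map_pure], where f = h]) simp_all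
  have pr: "linear_map K Q T3 (\<lambda>z. pure_tensor K DR TD r (h z))"
    if "linear_map K Q TD h" "r \<in> carrier T" for h r and Q :: "('k, 'q, 'm2) module_scheme"
    unfolding T3_def using that
    by (intro linear_map_compose[OF _ bilinear_map_right[OF T3.bilinear_map_pure], where f = h]) simp_all
  have trl [lin]: "linear_map K Q T3 (\<lambda>z. tr (h z) s u)" "linear_map K Q T3 (\<lambda>z. tr s (h z) u)"
    "linear_map K Q T3 (\<lambda>z. tr s u (h z))"
    if "linear_map K Q T h" "s \<in> carrier T" "u \<in> carrier T" for h s u and Q :: "('k, 'q, 'm2) module_scheme"
    unfolding tr_def using that by (auto intro!: pl pr lin)
  have trc [simp]: "tr r s u \<in> carrier T3" if "r \<in> carrier T" "s \<in> carrier T" "u \<in> carrier T" for r s u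
    using linear_map_closed[OF trl(1)[OF lin_id that(2,3)] that(1)] .
  interpret T3m: module K T3 by (rule P)
  have b1: "bilinear_map K T T T3 (\<lambda>r s. tr r s u)" "bilinear_map K T T T3 (\<lambda>s v. tr u s v)"
    if "u \<in> carrier T" for u
    using that by (auto intro!: bilinear_mapI trl lin_id)
  let ?l = "\<lambda>r u. tsum K T3 (cm r) (\<lambda>r s. tr r s u)" and ?r = "\<lambda>r v. tsum K T3 (cm v) (\<lambda>s u. tr r s u)"
  have bD: "bilinear_map K DR DR T3 (\<lambda>r s. tr r s u)" "bilinear_map K DR DR T3 (\<lambda>s v. tr u s v)"
    if "u \<in> carrier T" for u
    using b1[OF that] by (simp_all add: bilinear_map_def)
  have bl: "bilinear_map K T T T3 ?l"
    by (rule bilinear_mapI, rule DD.AB.tsum_pointwise_lin; (rule tsum_cm_lin(1) bD trl lin_id)?;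
        simp add: b1 lin_id)
  have br: "bilinear_map K T T T3 ?r"
    by (rule bilinear_mapI, rule tsum_cm_lin(1), simp, rule b1, simp, rule DD.AB.tsum_pointwise_lin;
        (rule bD trl lin_id)?; simp add: lin_id)
  have "tsum K T3 (cm t) ?l = tsum K T3 (cm t) ?r"
  proof (rule HV.tensor_eqI_homogeneous[OF P tsum_cm_lin(1)[OF P bl] tsum_cm_lin(1)[OF P br] _ t])
    fix \<xi> x \<phi> f assume x: "x \<in> carrier H" and f: "f \<in> carrier V"
    note [simp] = x f
    \<comment> \<open>Each form leg passes the legs of \<open>x\<close> with a larger index:
      \<open>f1\<close> passes \<open>x2\<close> and \<open>x3\<close>, and \<open>f2\<close> passes
      \<open>x3\<close>.\<close>
    let ?G = "\<lambda>\<xi>1 x1 \<phi>1 f1 \<xi>2 x2 \<phi>2 f2 \<xi>3 x3 \<phi>3 f3.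
      (\<omega> (\<xi>2 + \<xi>3) \<phi>1 \<otimes> \<omega> \<xi>3 \<phi>2) \<odot>\<^bsub>T3\<^esub> tr (tens x1 f1) (tens x2 f2) (tens x3 f3)"
    have "tsum K T3 (cm (tens x f)) ?l = H.swe T3 x (\<lambda>\<Xi> X \<xi>3 x3. V.swe T3 f (\<lambda>\<Phi> F \<phi>3 f3.
        \<omega> \<xi>3 \<Phi> \<odot>\<^bsub>T3\<^esub> ?l (tens X F) (tens x3 f3)))"
      by (simp add: tsum_dc[OF P bl])
    also have "\<dots> = H.swe T3 x (\<lambda>\<Xi> X \<xi>3 x3. V.swe T3 f (\<lambda>\<Phi> F \<phi>3 f3.
        H.swe T3 X (\<lambda>\<xi>1 x1 \<xi>2 x2. V.swe T3 F (\<lambda>\<phi>1 f1 \<phi>2 f2. ?G \<xi>1 x1 \<phi>1 f1 \<xi>2 x2 \<phi>2 f2 \<xi>3 x3 \<phi>3 f3))))"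
    proof (rule H.swe_cong[OF x], rule V.swe_cong[OF f])
      fix \<Xi> X \<xi>3 x3 \<Phi> F \<phi>3 f3
      assume F: "F \<in> grade V \<Phi>" and [simp]: "X \<in> carrier H" "x3 \<in> carrier H" "F \<in> carrier V" "f3 \<in> carrier V"
      have "\<omega> \<xi>3 \<Phi> \<odot>\<^bsub>T3\<^esub> ?l (tens X F) (tens x3 f3) = H.swe T3 X (\<lambda>\<xi>1 x1 \<xi>2 x2. V.swe T3 F (\<lambda>\<phi>1 f1 \<phi>2 f2.
          \<omega> \<xi>3 \<Phi> \<odot>\<^bsub>T3\<^esub> (\<omega> \<xi>2 \<phi>1 \<odot>\<^bsub>T3\<^esub> tr (tens x1 f1) (tens x2 f2) (tens x3 f3))))"
        by (simp add: tsum_dc[OF P b1(1)] H.swe_smult V.swe_closed) (auto intro!: H.swe_cong simp: V.swe_smult)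
      also have "\<dots> = H.swe T3 X (\<lambda>\<xi>1 x1 \<xi>2 x2. V.swe T3 F (\<lambda>\<phi>1 f1 \<phi>2 f2. ?G \<xi>1 x1 \<phi>1 f1 \<xi>2 x2 \<phi>2 f2 \<xi>3 x3 \<phi>3 f3))"
        by (rule H.swe_cong, simp, rule V.swe_homogeneous_cong[OF F])
          (simp add: T3m.smult_assoc1[symmetric], auto simp: factor_add m_ac)
      finally show "\<omega> \<xi>3 \<Phi> \<odot>\<^bsub>T3\<^esub> ?l (tens X F) (tens x3 f3) = H.swe T3 X (\<lambda>\<xi>1 x1 \<xi>2 x2. V.swe T3 F (\<lambda>\<phi>1 f1 \<phi>2 f2.
          ?G \<xi>1 x1 \<phi>1 f1 \<xi>2 x2 \<phi>2 f2 \<xi>3 x3 \<phi>3 f3))" .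
    qed
    also have "\<dots> = H.swe T3 x (\<lambda>\<xi>1 x1 \<Xi> X. V.swe T3 f (\<lambda>\<phi>1 f1 \<Phi> F.
        H.swe T3 X (\<lambda>\<xi>2 x2 \<xi>3 x3. V.swe T3 F (\<lambda>\<phi>2 f2 \<phi>3 f3. ?G \<xi>1 x1 \<phi>1 f1 \<xi>2 x2 \<phi>2 f2 \<xi>3 x3 \<phi>3 f3))))"
      by (rule swe2_coassoc[OF H.hopf_algebra_axioms V.hopf_algebra_axioms P x f])
        (intro conjI; auto intro!: T3m.lin_smult trl lin)+
    also have "\<dots> = H.swe T3 x (\<lambda>\<xi>1 x1 \<Xi> X. V.swe T3 f (\<lambda>\<phi>1 f1 \<Phi> F.
        \<omega> \<Xi> \<phi>1 \<odot>\<^bsub>T3\<^esub> ?r (tens x1 f1) (tens X F)))"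
    proof (rule H.swe_cong[OF x], rule V.swe_cong[OF f])
      fix \<xi>1 x1 \<Xi> X \<phi>1 f1 \<Phi> F
      assume X: "X \<in> grade H \<Xi>" and [simp]: "X \<in> carrier H" "x1 \<in> carrier H" "F \<in> carrier V" "f1 \<in> carrier V"
      have "\<omega> \<Xi> \<phi>1 \<odot>\<^bsub>T3\<^esub> ?r (tens x1 f1) (tens X F) = H.swe T3 X (\<lambda>\<xi>2 x2 \<xi>3 x3. V.swe T3 F (\<lambda>\<phi>2 f2 \<phi>3 f3.
          \<omega> \<Xi> \<phi>1 \<odot>\<^bsub>T3\<^esub> (\<omega> \<xi>3 \<phi>2 \<odot>\<^bsub>T3\<^esub> tr (tens x1 f1) (tens x2 f2) (tens x3 f3))))"
        by (simp add: tsum_dc[OF P b1(2)] H.swe_smult V.swe_closed) (auto intro!: H.swe_cong simp: V.swe_smult)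
      also have "\<dots> = H.swe T3 X (\<lambda>\<xi>2 x2 \<xi>3 x3. V.swe T3 F (\<lambda>\<phi>2 f2 \<phi>3 f3. ?G \<xi>1 x1 \<phi>1 f1 \<xi>2 x2 \<phi>2 f2 \<xi>3 x3 \<phi>3 f3))"
        by (rule H.swe_homogeneous_cong[OF X], rule V.swe_cong)
          (simp_all add: T3m.smult_assoc1[symmetric])
      finally show "H.swe T3 X (\<lambda>\<xi>2 x2 \<xi>3 x3. V.swe T3 F (\<lambda>\<phi>2 f2 \<phi>3 f3. ?G \<xi>1 x1 \<phi>1 f1 \<xi>2 x2 \<phi>2 f2 \<xi>3 x3 \<phi>3 f3)) =
        \<omega> \<Xi> \<phi>1 \<odot>\<^bsub>T3\<^esub> ?r (tens x1 f1) (tens X F)" ..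
    qed
    also have "\<dots> = tsum K T3 (cm (tens x f)) ?r"
      by (simp add: tsum_dc[OF P br])
    finally show "tsum K T3 (cm (tens x f)) ?l = tsum K T3 (cm (tens x f)) ?r" .
  qed
  moreover have "tsum K T3 (comult DR t) (\<lambda>r u. tsum K T3 (comult DR r) (\<lambda>r s. tr r s u)) = tsum K T3 (cm t) ?l"
    by (rule tsum_double_comult[OF P bl t]) (rule tsum_double_comult[OF P b1(1)]; simp)
  moreover have "tsum K T3 (comult DR t) (\<lambda>r v. tsum K T3 (comult DR v) (\<lambda>s u. tr r s u)) = tsum K T3 (cm t) ?r"
    by (rule tsum_double_comult[OF P br t]) (rule tsum_double_comult[OF P b1(2)]; simp)
  ultimately show ?thesis by simp
qed

end

section \<open>The antipode of the double\<close>

context hopf_pairing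
begin

lemma antipode_in_grade:
  "x \<in> grade H \<xi> \<Longrightarrow> antipode H x \<in> grade H \<xi>" "f \<in> grade V \<phi> \<Longrightarrow> antipode V f \<in> grade V \<phi>"
  using H.antipode_grade V.antipode_grade by blast+

text \<open>The sign is that of the initial swap. It depends on the degrees of \<open>x\<close> and
  \<open>f\<close>, so the map is written with \<open>gsum\<close>, which supplies them.\<close>

definition "an t = gsum K H V T t (\<lambda>\<xi> x \<phi> f. \<omega> \<xi> \<phi> \<odot>\<^bsub>T\<^esub> psi (antipode V f) (antipode H x))"

lemma graded_bilinear_an:
  "graded_bilinear K H V T (\<lambda>\<xi> x \<phi> f. \<omega> \<xi> \<phi> \<odot>\<^bsub>T\<^esub> psi (antipode V f) (antipode H x))"
  by (auto intro!: graded_bilinearI lin)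

lemma lin_an [lin]: "linear_map K Q T h \<Longrightarrow> linear_map K Q T (\<lambda>z. an (h z))"
  unfolding an_def by (auto intro!: lin graded_bilinear_an)

lemmas lin_an_eta [lin] = lin_an[OF lin_id]

lemma an_closed [simp, intro]: "t \<in> carrier T \<Longrightarrow> an t \<in> carrier T"
  using linear_map_closed[OF lin_an_eta] by simp

lemma an_tens:
  "\<lbrakk>x \<in> grade H \<xi>; f \<in> grade V \<phi>\<rbrakk> \<Longrightarrow>
    an (tens x f) = \<omega> \<xi> \<phi> \<odot>\<^bsub>T\<^esub> psi (antipode V f) (antipode H x)"
  unfolding an_def by (rule HV.gsum_pure[OF T_module graded_bilinear_an])

lemma an_grade: "t \<in> tensor_grade K H V \<gamma> \<Longrightarrow> an t \<in> tensor_grade K H V \<gamma>"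
proof (rule HV.linear_map_tensor_grade[OF T_module lin_an_eta HV.submodule_tensor_grade])
  fix \<alpha> x \<beta> f assume h: "x \<in> grade H \<alpha>" "f \<in> grade V \<beta>" "\<alpha> + \<beta> = \<gamma>"
  have "psi (antipode V f) (antipode H x) \<in> tensor_grade K H V \<gamma>"
    using psi_grade[OF antipode_in_grade(2)[OF h(2)] antipode_in_grade(1)[OF h(1)]] h(3) by (simp add: add.commute)
  then show "an (tens x f) \<in> tensor_grade K H V \<gamma>"
    using HV.T.submoduleE(4)[OF HV.submodule_tensor_grade] h by (simp add: an_tens)
qed

text \<open>The three stages, signed swap, antipodes and braiding, are linear in \<open>t\<close>,
  so a comparison on homogeneous pure tensors suffices.\<close>

lemma double_antipode_eq:
  assumes t: "t \<in> carrier T"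
  shows "double_antipode K \<omega> H V t = an t"
proof -
  let ?b = "\<lambda>\<xi> x \<phi> f. \<omega> \<xi> \<phi> \<odot>\<^bsub>VH.T\<^esub> VH.pure f x"
  have b: "graded_bilinear K H V VH.T ?b"
    by (auto intro!: graded_bilinearI lin VH.T.lin_smult)
  let ?m = "\<lambda>f x. VH.pure (antipode V f) (antipode H x)"
  have m: "bilinear_map K V H VH.T ?m"
    by (auto intro!: bilinear_mapI lin)
  have e: "double_antipode K \<omega> H V = (\<lambda>t. double_psi K \<omega> H V (tsum K VH.T (tsum K VH.T t (graded_ext2 H V VH.T ?b)) ?m))"
    by (simp add: double_antipode_def tensor_map_def tensor_swap_def Let_def colour_ext_eq fun_eq_iff)
  have l: "linear_map K T VH.T (\<lambda>t. tsum K VH.T (tsum K VH.T t (graded_ext2 H V VH.T ?b)) ?m)"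
    by (intro VH.lin_tsum VH.module_tensor HV.linear_map_tsum m HV.bilinear_graded_ext2 b)
  have "tsum K T (tsum K VH.T (tsum K VH.T t (graded_ext2 H V VH.T ?b)) ?m) psi = an t"
  proof (rule HV.tensor_eqI_homogeneous[OF T_module VH.lin_tsum[OF T_module l bilinear_psi] lin_an_eta _ t])
    fix \<xi> x \<phi> f assume h: "x \<in> grade H \<xi>" "f \<in> grade V \<phi>" "x \<in> carrier H" "f \<in> carrier V"
    then show "tsum K T (tsum K VH.T (tsum K VH.T (tens x f) (graded_ext2 H V VH.T ?b)) ?m) psi = an (tens x f)"
      by (simp add: HV.tsum_pure[OF VH.module_tensor HV.bilinear_graded_ext2[OF VH.module_tensor b]]
          HV.graded_ext2_homogeneous[OF VH.module_tensor b] an_tens VH.pure_closed VH.T.smult_closed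
          linear_map_smult[OF VH.linear_map_tsum[OF VH.module_tensor m]] VH.tsum_pure[OF VH.module_tensor m]
          linear_map_smult[OF VH.linear_map_tsum[OF T_module bilinear_psi]] VH.tsum_pure[OF T_module bilinear_psi])
  qed
  then show ?thesis
    by (simp add: e double_psi_eq linear_map_closed[OF l t])
qed

text \<open>\<open>psi g y\<close> is the product of \<open>1 \<otimes> g\<close> and
  \<open>y \<otimes> 1\<close>, so a following \<open>x\<close> can be multiplied to
  \<open>y\<close> before \<open>g\<close> crosses.\<close>

lemma dm_psi_left:
  "\<lbrakk>g \<in> carrier V; y \<in> carrier H; x \<in> carrier H; f \<in> carrier V\<rbrakk> \<Longrightarrow>
    dm (psi g y) (tens x f) = rmul f (psi g (y \<otimes>\<^bsub>H\<^esub> x))"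
  using dm_lmul_right[of "\<one>\<^bsub>H\<^esub>" g y "tens x f"] by (simp add: lmul_one dm_tens_tens)

lemma dm_psi_right:
  "\<lbrakk>g \<in> carrier V; y \<in> carrier H; x \<in> carrier H; f \<in> carrier V\<rbrakk> \<Longrightarrow>
    dm (tens x f) (psi g y) = lmul x (psi (f \<otimes>\<^bsub>V\<^esub> g) y)"
  using dm_rmul_left[of g "tens x f" y "\<one>\<^bsub>V\<^esub>"] by (simp add: rmul_one dm_tens_tens)

text \<open>By \<open>dm_psi_left\<close> the two legs of \<open>x\<close> meet as the product of
  \<open>antipode H x1\<close> and \<open>x2\<close> inside one crossing, where the antipode axiom
  of \<open>H\<close> applies. The crossing becomes trivial and the antipode axiom of
  \<open>V\<close> remains.\<close>

lemma an_convolution_left: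
  assumes t: "t \<in> carrier T"
  shows "tsum K T (cm t) (\<lambda>r s. dm (an r) s) = ce t \<odot>\<^bsub>T\<^esub> tens \<one>\<^bsub>H\<^esub> \<one>\<^bsub>V\<^esub>"
proof -
  let ?b = "\<lambda>r s. dm (an r) s"
  have b: "bilinear_map K T T T ?b" by (auto intro!: bilinear_mapI lin)
  show ?thesis
  proof (rule HV.tensor_eqI_homogeneous[OF T_module tsum_cm_lin(1)[OF T_module b] _ _ t])
    show "linear_map K T T (\<lambda>t. ce t \<odot>\<^bsub>T\<^esub> tens \<one>\<^bsub>H\<^esub> \<one>\<^bsub>V\<^esub>)" by (auto intro!: lin)
    fix \<xi> x \<phi> f assume x: "x \<in> grade H \<xi>" and f: "f \<in> grade V \<phi>" and [simp]: "x \<in> carrier H" "f \<in> carrier V"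
    have "tsum K T (cm (tens x f)) ?b = H.swe T x (\<lambda>\<xi>1 x1 \<xi>2 x2. V.swe T f (\<lambda>\<phi>1 f1 \<phi>2 f2.
        \<omega> \<xi>2 \<phi>1 \<odot>\<^bsub>T\<^esub> dm (an (tens x1 f1)) (tens x2 f2)))"
      by (simp add: tsum_dc[OF T_module b])
    also have "\<dots> = H.swe T x (\<lambda>\<xi>1 x1 \<xi>2 x2. V.swe T f (\<lambda>\<phi>1 f1 \<phi>2 f2.
        \<omega> \<xi> \<phi>1 \<odot>\<^bsub>T\<^esub> rmul f2 (psi (antipode V f1) (antipode H x1 \<otimes>\<^bsub>H\<^esub> x2))))"
      by (rule H.swe_homogeneous_cong[OF x], rule V.swe_cong, simp)
        (simp add: an_tens linear_map_smult[OF lin_dm(1)[OF lin_id]] HV.T.smult_assoc1[symmetric] dm_psi_left,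
          auto simp: factor_add m_comm)
    also have "\<dots> = V.swe T f (\<lambda>\<phi>1 f1 \<phi>2 f2. H.swe T x (\<lambda>\<xi>1 x1 \<xi>2 x2.
        \<omega> \<xi> \<phi>1 \<odot>\<^bsub>T\<^esub> rmul f2 (psi (antipode V f1) (antipode H x1 \<otimes>\<^bsub>H\<^esub> x2))))"
      by (rule swe_swap[OF H.hopf_algebra_axioms V.hopf_algebra_axioms]) auto
    also have "\<dots> = V.swe T f (\<lambda>\<phi>1 f1 \<phi>2 f2. counit H x \<odot>\<^bsub>T\<^esub> tens \<one>\<^bsub>H\<^esub> (antipode V f1 \<otimes>\<^bsub>V\<^esub> f2))"
    proof (rule V.swe_cong, simp)
      fix \<phi>1 f1 \<phi>2 f2 assume [simp]: "f1 \<in> carrier V" "f2 \<in> carrier V"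
      have "H.swe T x (\<lambda>\<xi>1 x1 \<xi>2 x2.
          \<omega> \<xi> \<phi>1 \<odot>\<^bsub>T\<^esub> rmul f2 (psi (antipode V f1) (antipode H x1 \<otimes>\<^bsub>H\<^esub> x2))) =
        counit H x \<odot>\<^bsub>T\<^esub> (\<omega> \<xi> \<phi>1 \<odot>\<^bsub>T\<^esub> rmul f2 (psi (antipode V f1) \<one>\<^bsub>H\<^esub>))"
        by (rule H.swe_antipode(1)[where F = "\<lambda>z. \<omega> \<xi> \<phi>1 \<odot>\<^bsub>T\<^esub> rmul f2 (psi (antipode V f1) z)"]) (auto intro!: lin)
      \<comment> \<open>The signs have combined to \<open>\<omega> \<xi> \<phi>1\<close> with the
        full degree \<open>\<xi>\<close> of \<open>x\<close>. The co-unit of \<open>x\<close>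
        vanishes unless \<open>\<xi> = 0\<close>, where the sign is one.\<close>
      then show "H.swe T x (\<lambda>\<xi>1 x1 \<xi>2 x2.
          \<omega> \<xi> \<phi>1 \<odot>\<^bsub>T\<^esub> rmul f2 (psi (antipode V f1) (antipode H x1 \<otimes>\<^bsub>H\<^esub> x2))) =
        counit H x \<odot>\<^bsub>T\<^esub> tens \<one>\<^bsub>H\<^esub> (antipode V f1 \<otimes>\<^bsub>V\<^esub> f2)"
        using H.counit_zero[OF x] by (cases "\<xi> = 0") (simp_all add: psi_one_right)
    qed
    also have "\<dots> = counit V f \<odot>\<^bsub>T\<^esub> (counit H x \<odot>\<^bsub>T\<^esub> tens \<one>\<^bsub>H\<^esub> \<one>\<^bsub>V\<^esub>)"
      by (rule V.swe_antipode(1)[where F = "\<lambda>z. counit H x \<odot>\<^bsub>T\<^esub> tens \<one>\<^bsub>H\<^esub> z"]) (auto intro!: lin)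
    finally show "tsum K T (cm (tens x f)) ?b = ce (tens x f) \<odot>\<^bsub>T\<^esub> tens \<one>\<^bsub>H\<^esub> \<one>\<^bsub>V\<^esub>"
      by (simp add: HV.T.smult_assoc1[symmetric] m_comm)
  qed
qed

text \<open>The same with the roles exchanged: \<open>dm_psi_right\<close> brings the legs of
  \<open>f\<close> together inside the crossing, so the antipode axiom of \<open>V\<close> comes
  first, and the sign \<open>\<omega> \<xi>2 \<phi>\<close> disappears with the co-unit of
  \<open>f\<close>.\<close>

lemma an_convolution_right:
  assumes t: "t \<in> carrier T"
  shows "tsum K T (cm t) (\<lambda>r s. dm r (an s)) = ce t \<odot>\<^bsub>T\<^esub> tens \<one>\<^bsub>H\<^esub> \<one>\<^bsub>V\<^esub>"
proof -
  let ?b = "\<lambda>r s. dm r (an s)"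
  have b: "bilinear_map K T T T ?b" by (auto intro!: bilinear_mapI lin)
  show ?thesis
  proof (rule HV.tensor_eqI_homogeneous[OF T_module tsum_cm_lin(1)[OF T_module b] _ _ t])
    show "linear_map K T T (\<lambda>t. ce t \<odot>\<^bsub>T\<^esub> tens \<one>\<^bsub>H\<^esub> \<one>\<^bsub>V\<^esub>)" by (auto intro!: lin)
    fix \<xi> x \<phi> f assume x: "x \<in> grade H \<xi>" and f: "f \<in> grade V \<phi>" and [simp]: "x \<in> carrier H" "f \<in> carrier V"
    have "tsum K T (cm (tens x f)) ?b = H.swe T x (\<lambda>\<xi>1 x1 \<xi>2 x2. V.swe T f (\<lambda>\<phi>1 f1 \<phi>2 f2.
        \<omega> \<xi>2 \<phi>1 \<odot>\<^bsub>T\<^esub> dm (tens x1 f1) (an (tens x2 f2))))"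
      by (simp add: tsum_dc[OF T_module b])
    also have "\<dots> = H.swe T x (\<lambda>\<xi>1 x1 \<xi>2 x2. V.swe T f (\<lambda>\<phi>1 f1 \<phi>2 f2.
        \<omega> \<xi>2 \<phi> \<odot>\<^bsub>T\<^esub> lmul x1 (psi (f1 \<otimes>\<^bsub>V\<^esub> antipode V f2) (antipode H x2))))"
      by (rule H.swe_cong, simp, rule V.swe_homogeneous_cong[OF f])
        (simp add: an_tens linear_map_smult[OF lin_dm_eta] HV.T.smult_assoc1[symmetric] dm_psi_right,
          auto simp: factor_add m_comm)
    also have "\<dots> = H.swe T x (\<lambda>\<xi>1 x1 \<xi>2 x2. counit V f \<odot>\<^bsub>T\<^esub> tens (x1 \<otimes>\<^bsub>H\<^esub> antipode H x2) \<one>\<^bsub>V\<^esub>)"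
    proof (rule H.swe_cong, simp)
      fix \<xi>1 x1 \<xi>2 x2 assume [simp]: "x1 \<in> carrier H" "x2 \<in> carrier H"
      have "V.swe T f (\<lambda>\<phi>1 f1 \<phi>2 f2.
          \<omega> \<xi>2 \<phi> \<odot>\<^bsub>T\<^esub> lmul x1 (psi (f1 \<otimes>\<^bsub>V\<^esub> antipode V f2) (antipode H x2))) =
        counit V f \<odot>\<^bsub>T\<^esub> (\<omega> \<xi>2 \<phi> \<odot>\<^bsub>T\<^esub> lmul x1 (psi \<one>\<^bsub>V\<^esub> (antipode H x2)))"
        by (rule V.swe_antipode(2)[where F = "\<lambda>z. \<omega> \<xi>2 \<phi> \<odot>\<^bsub>T\<^esub> lmul x1 (psi z (antipode H x2))"]) (auto intro!: lin)
      then show "V.swe T f (\<lambda>\<phi>1 f1 \<phi>2 f2.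
          \<omega> \<xi>2 \<phi> \<odot>\<^bsub>T\<^esub> lmul x1 (psi (f1 \<otimes>\<^bsub>V\<^esub> antipode V f2) (antipode H x2))) =
        counit V f \<odot>\<^bsub>T\<^esub> tens (x1 \<otimes>\<^bsub>H\<^esub> antipode H x2) \<one>\<^bsub>V\<^esub>"
        using V.counit_zero[OF f] by (cases "\<phi> = 0") (simp_all add: psi_one_left)
    qed
    also have "\<dots> = counit H x \<odot>\<^bsub>T\<^esub> (counit V f \<odot>\<^bsub>T\<^esub> tens \<one>\<^bsub>H\<^esub> \<one>\<^bsub>V\<^esub>)"
      by (rule H.swe_antipode(2)[where F = "\<lambda>z. counit V f \<odot>\<^bsub>T\<^esub> tens z \<one>\<^bsub>V\<^esub>"]) (auto intro!: lin)
    finally show "tsum K T (cm (tens x f)) ?b = ce (tens x f) \<odot>\<^bsub>T\<^esub> tens \<one>\<^bsub>H\<^esub> \<one>\<^bsub>V\<^esub>"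
      by (simp add: HV.T.smult_assoc1[symmetric])
  qed
qed

text \<open>Anti-multiplicativity for an outer factor from \<open>H\<close>: the antipode of
  \<open>H\<close> puts \<open>x\<close> behind \<open>y\<close>, and \<open>dm_psi_left\<close>
  moves it out of the crossing. With \<open>an_rmul\<close> for outer factors from \<open>V\<close>,
  only a crossing itself remains to be treated.\<close>

lemma an_lmul:
  assumes x: "x \<in> grade H \<xi>" and c: "c \<in> tensor_grade K H V \<gamma>"
  shows "an (lmul x c) = \<omega> \<xi> \<gamma> \<odot>\<^bsub>T\<^esub> dm (an c) (tens (antipode H x) \<one>\<^bsub>V\<^esub>)"
proof -
  have [simp]: "x \<in> carrier H" using x H.grade_closed by blast
  show ?thesis
  proof (rule HV.tensor_grade_eqI[OF T_module _ _ c])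
    fix \<eta> y \<rho> g assume h: "y \<in> grade H \<eta>" "g \<in> grade V \<rho>" and [simp]: "y \<in> carrier H" "g \<in> carrier V" and s: "\<eta> + \<rho> = \<gamma>"
    show "an (lmul x (tens y g)) = \<omega> \<xi> \<gamma> \<odot>\<^bsub>T\<^esub> dm (an (tens y g)) (tens (antipode H x) \<one>\<^bsub>V\<^esub>)"
      using h x s[symmetric]
      by (simp add: an_tens[OF H.grade_mult] an_tens H.antipode_mult linear_map_smult[OF lin_psi_eta]
          linear_map_smult[OF lin_dm(1)[OF lin_id]] dm_psi_left rmul_one HV.T.smult_assoc1[symmetric] factor_add m_ac)
  qed (auto intro!: lin)
qed

lemma an_rmul:
  assumes g: "g \<in> grade V \<rho>" and c: "c \<in> tensor_grade K H V \<gamma>"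
  shows "an (rmul g c) = \<omega> \<gamma> \<rho> \<odot>\<^bsub>T\<^esub> dm (tens \<one>\<^bsub>H\<^esub> (antipode V g)) (an c)"
proof -
  have [simp]: "g \<in> carrier V" using g V.grade_closed by blast
  show ?thesis
  proof (rule HV.tensor_grade_eqI[OF T_module _ _ c])
    fix \<eta> y \<phi> f assume h: "y \<in> grade H \<eta>" "f \<in> grade V \<phi>" and [simp]: "y \<in> carrier H" "f \<in> carrier V" and s: "\<eta> + \<phi> = \<gamma>"
    show "an (rmul g (tens y f)) = \<omega> \<gamma> \<rho> \<odot>\<^bsub>T\<^esub> dm (tens \<one>\<^bsub>H\<^esub> (antipode V g)) (an (tens y f))"
      using h g s[symmetric]
      by (simp add: an_tens[OF _ V.grade_mult] an_tens V.antipode_mult linear_map_smult[OF lin_psi(2)[OF lin_id]]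
          linear_map_smult[OF lin_dm_eta] dm_psi_right lmul_one HV.T.smult_assoc1[symmetric] factor_add m_ac)
  qed (auto intro!: lin)
qed

text \<open>
  On the braided co-algebra \<open>V \<otimes> H\<close>, the left-hand side is a left and the right-hand side a right
  convolution inverse of \<open>psi\<close>, so both agree.
\<close>

lemma an_psi:
  assumes f: "f \<in> grade V \<phi>" and y: "y \<in> grade H \<eta>"
  shows "an (psi f y) = \<omega> \<phi> \<eta> \<odot>\<^bsub>T\<^esub> tens (antipode H y) (antipode V f)"
proof -
  have fc [simp]: "f \<in> carrier V" and yc [simp]: "y \<in> carrier H" using f y V.grade_closed H.grade_closed by auto
  let ?L = "\<lambda>\<phi> f \<eta> y. \<omega> \<phi> \<eta> \<odot>\<^bsub>T\<^esub> tens (antipode H y) (antipode V f)"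
  let ?one = "tens \<one>\<^bsub>H\<^esub> \<one>\<^bsub>V\<^esub>"
  \<comment> \<open>\<open>an\<close> is a left convolution inverse of the identity of the double.
    Composing with \<open>psi\<close>, which is a morphism of co-algebras by \<open>cm_psi\<close>
    and \<open>dc_one_mult\<close>, gives a left inverse of \<open>psi\<close>.\<close>
  have left: "V.swe T f (\<lambda>\<phi>1 f1 \<phi>2 f2. H.swe T y (\<lambda>\<eta>1 y1 \<eta>2 y2.
      \<omega> \<phi>2 \<eta>1 \<odot>\<^bsub>T\<^esub> dm (an (psi f1 y1)) (psi f2 y2))) = (counit V f \<otimes> counit H y) \<odot>\<^bsub>T\<^esub> ?one"
    if [simp]: "f \<in> carrier V" "y \<in> carrier H" for f y
  proof -
    let ?b = "\<lambda>r s. dm (an r) s" and ?t = "\<lambda>s. tsum K T s (\<lambda>r s. dm (an r) s)"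
    have b: "bilinear_map K T T T ?b" by (auto intro!: bilinear_mapI lin)
    note L = tsum_cm_lin(2)[OF T_module b]
    have "?t (cm (psi f y)) = ?t (V.swe TD f (\<lambda>\<phi>1 f1 \<phi>2 f2. H.swe TD y (\<lambda>\<eta>1 y1 \<eta>2 y2.
        \<omega> \<phi>2 \<eta>1 \<odot>\<^bsub>TD\<^esub> tD (psi f1 y1) (psi f2 y2))))"
      by (simp add: cm_psi dc_one_mult)
    also have "\<dots> = V.swe T f (\<lambda>\<phi>1 f1 \<phi>2 f2. ?t (H.swe TD y (\<lambda>\<eta>1 y1 \<eta>2 y2.
        \<omega> \<phi>2 \<eta>1 \<odot>\<^bsub>TD\<^esub> tD (psi f1 y1) (psi f2 y2))))"
      by (rule V.swe_linear_map[where f = ?t, OF TD_module T_module L]) (auto intro!: H.swe_closed)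
    also have "\<dots> = V.swe T f (\<lambda>\<phi>1 f1 \<phi>2 f2. H.swe T y (\<lambda>\<eta>1 y1 \<eta>2 y2.
        ?t (\<omega> \<phi>2 \<eta>1 \<odot>\<^bsub>TD\<^esub> tD (psi f1 y1) (psi f2 y2))))"
      by (rule V.swe_cong, simp, rule H.swe_linear_map[where f = ?t, OF TD_module T_module L]) auto
    also have "\<dots> = V.swe T f (\<lambda>\<phi>1 f1 \<phi>2 f2. H.swe T y (\<lambda>\<eta>1 y1 \<eta>2 y2.
        \<omega> \<phi>2 \<eta>1 \<odot>\<^bsub>T\<^esub> dm (an (psi f1 y1)) (psi f2 y2)))"
      by (rule V.swe_cong, simp, rule H.swe_cong) (auto simp: linear_map_smult[OF L] tsum_cm_lin(3)[OF T_module b])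
    finally show ?thesis by (simp add: an_convolution_left ce_psi)
  qed
  \<comment> \<open>By \<open>dm_psi_left\<close> the factor \<open>antipode H y2\<close> joins
    \<open>y1\<close> inside the crossing. The two antipode axioms then apply one after the
    other.\<close>
  have right: "V.swe T f (\<lambda>\<phi>1 f1 \<phi>2 f2. H.swe T y (\<lambda>\<eta>1 y1 \<eta>2 y2.
      \<omega> \<phi>2 \<eta>1 \<odot>\<^bsub>T\<^esub> dm (psi f1 y1) (?L \<phi>2 f2 \<eta>2 y2))) = (counit V f \<otimes> counit H y) \<odot>\<^bsub>T\<^esub> ?one"
    if [simp]: "f \<in> carrier V" "y \<in> carrier H" and y: "y \<in> grade H \<eta>" for f y \<eta>
  proof -
    have "V.swe T f (\<lambda>\<phi>1 f1 \<phi>2 f2. H.swe T y (\<lambda>\<eta>1 y1 \<eta>2 y2.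
        \<omega> \<phi>2 \<eta>1 \<odot>\<^bsub>T\<^esub> dm (psi f1 y1) (?L \<phi>2 f2 \<eta>2 y2))) =
      V.swe T f (\<lambda>\<phi>1 f1 \<phi>2 f2. H.swe T y (\<lambda>\<eta>1 y1 \<eta>2 y2.
        \<omega> \<phi>2 \<eta> \<odot>\<^bsub>T\<^esub> rmul (antipode V f2) (psi f1 (y1 \<otimes>\<^bsub>H\<^esub> antipode H y2))))"
      by (rule V.swe_cong, simp, rule H.swe_homogeneous_cong[OF y])
        (simp add: linear_map_smult[OF lin_dm_eta] HV.T.smult_assoc1[symmetric] dm_psi_left, auto simp: factor_add)
    also have "\<dots> = V.swe T f (\<lambda>\<phi>1 f1 \<phi>2 f2. counit H y \<odot>\<^bsub>T\<^esub> tens \<one>\<^bsub>H\<^esub> (f1 \<otimes>\<^bsub>V\<^esub> antipode V f2))"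
    proof (rule V.swe_cong, simp)
      fix \<phi>1 f1 \<phi>2 f2 assume [simp]: "f1 \<in> carrier V" "f2 \<in> carrier V"
      have "H.swe T y (\<lambda>\<eta>1 y1 \<eta>2 y2.
          \<omega> \<phi>2 \<eta> \<odot>\<^bsub>T\<^esub> rmul (antipode V f2) (psi f1 (y1 \<otimes>\<^bsub>H\<^esub> antipode H y2))) =
        counit H y \<odot>\<^bsub>T\<^esub> (\<omega> \<phi>2 \<eta> \<odot>\<^bsub>T\<^esub> rmul (antipode V f2) (psi f1 \<one>\<^bsub>H\<^esub>))"
        by (rule H.swe_antipode(2)[where F = "\<lambda>z. \<omega> \<phi>2 \<eta> \<odot>\<^bsub>T\<^esub> rmul (antipode V f2) (psi f1 z)"]) (auto intro!: lin)
      then show "H.swe T y (\<lambda>\<eta>1 y1 \<eta>2 y2.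
          \<omega> \<phi>2 \<eta> \<odot>\<^bsub>T\<^esub> rmul (antipode V f2) (psi f1 (y1 \<otimes>\<^bsub>H\<^esub> antipode H y2))) =
        counit H y \<odot>\<^bsub>T\<^esub> tens \<one>\<^bsub>H\<^esub> (f1 \<otimes>\<^bsub>V\<^esub> antipode V f2)"
        using H.counit_zero[OF y] by (cases "\<eta> = 0") (simp_all add: psi_one_right)
    qed
    also have "\<dots> = counit V f \<odot>\<^bsub>T\<^esub> (counit H y \<odot>\<^bsub>T\<^esub> ?one)"
      by (rule V.swe_antipode(2)[where F = "\<lambda>z. counit H y \<odot>\<^bsub>T\<^esub> tens \<one>\<^bsub>H\<^esub> z"]) (auto intro!: lin)
    finally show ?thesis by (simp add: HV.T.smult_assoc1)
  qed
  \<comment> \<open>The summand of the threefold convolution product of \<open>an\<close> after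
    \<open>psi\<close>, \<open>psi\<close> and \<open>?L\<close>. Collapsing the first two factors
    by \<open>left\<close> leaves \<open>?L\<close>, collapsing the last two by \<open>right\<close>
    leaves \<open>an (psi f y)\<close>.\<close>
  let ?G = "\<lambda>\<phi>1 f1 \<eta>1 y1 \<phi>2 f2 \<eta>2 y2 \<phi>3 f3 \<eta>3 y3.
    (\<omega> (\<phi>2 + \<phi>3) \<eta>1 \<otimes> \<omega> \<phi>3 \<eta>2) \<odot>\<^bsub>T\<^esub> dm (dm (an (psi f1 y1)) (psi f2 y2)) (?L \<phi>3 f3 \<eta>3 y3)"
  have "V.swe T f (\<lambda>\<Phi> F \<phi>3 f3. H.swe T y (\<lambda>\<Theta> Y \<eta>3 y3. V.swe T F (\<lambda>\<phi>1 f1 \<phi>2 f2. H.swe T Y (\<lambda>\<eta>1 y1 \<eta>2 y2.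
      ?G \<phi>1 f1 \<eta>1 y1 \<phi>2 f2 \<eta>2 y2 \<phi>3 f3 \<eta>3 y3)))) =
    V.swe T f (\<lambda>\<phi>1 f1 \<Phi> F. H.swe T y (\<lambda>\<eta>1 y1 \<Theta> Y. V.swe T F (\<lambda>\<phi>2 f2 \<phi>3 f3. H.swe T Y (\<lambda>\<eta>2 y2 \<eta>3 y3.
      ?G \<phi>1 f1 \<eta>1 y1 \<phi>2 f2 \<eta>2 y2 \<phi>3 f3 \<eta>3 y3))))"
    by (rule swe2_coassoc[OF V.hopf_algebra_axioms H.hopf_algebra_axioms T_module fc yc])
      (intro conjI; auto intro!: lin)+
  also have "V.swe T f (\<lambda>\<Phi> F \<phi>3 f3. H.swe T y (\<lambda>\<Theta> Y \<eta>3 y3. V.swe T F (\<lambda>\<phi>1 f1 \<phi>2 f2. H.swe T Y (\<lambda>\<eta>1 y1 \<eta>2 y2.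
      ?G \<phi>1 f1 \<eta>1 y1 \<phi>2 f2 \<eta>2 y2 \<phi>3 f3 \<eta>3 y3)))) =
    V.swe T f (\<lambda>\<Phi> F \<phi>3 f3. counit V F \<odot>\<^bsub>T\<^esub> H.swe T y (\<lambda>\<Theta> Y \<eta>3 y3. counit H Y \<odot>\<^bsub>T\<^esub> (\<omega> \<phi>3 \<Theta> \<odot>\<^bsub>T\<^esub> ?L \<phi>3 f3 \<eta>3 y3)))"
  proof (rule V.swe_cong[OF fc], subst H.swe_smult, simp, simp, simp, simp, rule H.swe_cong[OF yc])
    fix \<Phi> F \<phi>3 f3 \<Theta> Y \<eta>3 y3
    assume Y: "Y \<in> grade H \<Theta>" and [simp]: "F \<in> carrier V" "f3 \<in> carrier V" "Y \<in> carrier H" "y3 \<in> carrier H"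
    \<comment> \<open>\<open>?f\<close> multiplies by the third factor of the product. Its sign
      involves only the total degree \<open>\<Theta>\<close> of the two legs of \<open>Y\<close>, so
      it can be taken out of the inner sums.\<close>
    let ?l = "?L \<phi>3 f3 \<eta>3 y3" and ?f = "\<lambda>z. \<omega> \<phi>3 \<Theta> \<odot>\<^bsub>T\<^esub> dm z (?L \<phi>3 f3 \<eta>3 y3)"
    have F: "linear_map K T T ?f" by (auto intro!: lin)
    have "V.swe T F (\<lambda>\<phi>1 f1 \<phi>2 f2. H.swe T Y (\<lambda>\<eta>1 y1 \<eta>2 y2. ?G \<phi>1 f1 \<eta>1 y1 \<phi>2 f2 \<eta>2 y2 \<phi>3 f3 \<eta>3 y3)) =
      V.swe T F (\<lambda>\<phi>1 f1 \<phi>2 f2. H.swe T Y (\<lambda>\<eta>1 y1 \<eta>2 y2. ?f (\<omega> \<phi>2 \<eta>1 \<odot>\<^bsub>T\<^esub> dm (an (psi f1 y1)) (psi f2 y2))))"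
      by (rule V.swe_cong, simp, rule H.swe_homogeneous_cong[OF Y])
        (simp add: linear_map_smult[OF lin_dm(1)[OF lin_id]] HV.T.smult_assoc1[symmetric], auto simp: factor_add m_ac)
    also have "\<dots> = V.swe T F (\<lambda>\<phi>1 f1 \<phi>2 f2. ?f (H.swe T Y (\<lambda>\<eta>1 y1 \<eta>2 y2. \<omega> \<phi>2 \<eta>1 \<odot>\<^bsub>T\<^esub> dm (an (psi f1 y1)) (psi f2 y2))))"
      by (rule V.swe_cong, simp, rule H.swe_linear_map[where f = ?f, OF T_module T_module F, symmetric]) auto
    also have "\<dots> = ?f (V.swe T F (\<lambda>\<phi>1 f1 \<phi>2 f2. H.swe T Y (\<lambda>\<eta>1 y1 \<eta>2 y2. \<omega> \<phi>2 \<eta>1 \<odot>\<^bsub>T\<^esub> dm (an (psi f1 y1)) (psi f2 y2))))"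
      by (rule V.swe_linear_map[where f = ?f, OF T_module T_module F, symmetric]) (auto intro!: H.swe_closed)
    finally show "V.swe T F (\<lambda>\<phi>1 f1 \<phi>2 f2. H.swe T Y (\<lambda>\<eta>1 y1 \<eta>2 y2. ?G \<phi>1 f1 \<eta>1 y1 \<phi>2 f2 \<eta>2 y2 \<phi>3 f3 \<eta>3 y3)) =
      counit V F \<odot>\<^bsub>T\<^esub> (counit H Y \<odot>\<^bsub>T\<^esub> (\<omega> \<phi>3 \<Theta> \<odot>\<^bsub>T\<^esub> ?l))"
      by (simp add: left linear_map_smult[OF lin_dm(1)[OF lin_id]] dm_one HV.T.smult_assoc1[symmetric] m_ac)
  qed
  also have "\<dots> = V.swe T f (\<lambda>\<Phi> F \<phi>3 f3. counit V F \<odot>\<^bsub>T\<^esub> (\<omega> \<phi>3 0 \<odot>\<^bsub>T\<^esub> ?L \<phi>3 f3 \<eta> y))"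
    by (rule V.swe_cong[OF fc], subst H.swe_counit_left[OF y T_module]) (auto intro!: lin)
  also have "\<dots> = ?L \<phi> f \<eta> y"
    by (subst V.swe_counit_left[OF f T_module]) (auto intro!: lin)
  also have "V.swe T f (\<lambda>\<phi>1 f1 \<Phi> F. H.swe T y (\<lambda>\<eta>1 y1 \<Theta> Y. V.swe T F (\<lambda>\<phi>2 f2 \<phi>3 f3. H.swe T Y (\<lambda>\<eta>2 y2 \<eta>3 y3.
      ?G \<phi>1 f1 \<eta>1 y1 \<phi>2 f2 \<eta>2 y2 \<phi>3 f3 \<eta>3 y3)))) =
    V.swe T f (\<lambda>\<phi>1 f1 \<Phi> F. counit V F \<odot>\<^bsub>T\<^esub> H.swe T y (\<lambda>\<eta>1 y1 \<Theta> Y. counit H Y \<odot>\<^bsub>T\<^esub> (\<omega> \<Phi> \<eta>1 \<odot>\<^bsub>T\<^esub> an (psi f1 y1))))"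
  proof (rule V.swe_cong[OF fc], subst H.swe_smult, simp, simp, simp, simp, rule H.swe_cong[OF yc])
    fix \<phi>1 f1 \<Phi> F \<eta>1 y1 \<Theta> Y
    assume F: "F \<in> grade V \<Phi>" and Y: "Y \<in> grade H \<Theta>"
      and [simp]: "F \<in> carrier V" "f1 \<in> carrier V" "Y \<in> carrier H" "y1 \<in> carrier H"
    let ?f = "\<lambda>z. \<omega> \<Phi> \<eta>1 \<odot>\<^bsub>T\<^esub> dm (an (psi f1 y1)) z"
    have lf: "linear_map K T T ?f" by (auto intro!: lin)
    have "V.swe T F (\<lambda>\<phi>2 f2 \<phi>3 f3. H.swe T Y (\<lambda>\<eta>2 y2 \<eta>3 y3. ?G \<phi>1 f1 \<eta>1 y1 \<phi>2 f2 \<eta>2 y2 \<phi>3 f3 \<eta>3 y3)) =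
      V.swe T F (\<lambda>\<phi>2 f2 \<phi>3 f3. H.swe T Y (\<lambda>\<eta>2 y2 \<eta>3 y3. ?f (\<omega> \<phi>3 \<eta>2 \<odot>\<^bsub>T\<^esub> dm (psi f2 y2) (?L \<phi>3 f3 \<eta>3 y3))))"
      by (rule V.swe_homogeneous_cong[OF F], rule H.swe_cong)
        (auto simp: linear_map_smult[OF lin_dm_eta] HV.T.smult_assoc1[symmetric] dm_assoc m_assoc)
    also have "\<dots> = V.swe T F (\<lambda>\<phi>2 f2 \<phi>3 f3. ?f (H.swe T Y (\<lambda>\<eta>2 y2 \<eta>3 y3. \<omega> \<phi>3 \<eta>2 \<odot>\<^bsub>T\<^esub> dm (psi f2 y2) (?L \<phi>3 f3 \<eta>3 y3))))"
      by (rule V.swe_cong, simp, rule H.swe_linear_map[where f = ?f, OF T_module T_module lf, symmetric]) auto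
    also have "\<dots> = ?f (V.swe T F (\<lambda>\<phi>2 f2 \<phi>3 f3. H.swe T Y (\<lambda>\<eta>2 y2 \<eta>3 y3. \<omega> \<phi>3 \<eta>2 \<odot>\<^bsub>T\<^esub> dm (psi f2 y2) (?L \<phi>3 f3 \<eta>3 y3))))"
      by (rule V.swe_linear_map[where f = ?f, OF T_module T_module lf, symmetric]) (auto intro!: H.swe_closed)
    finally show "V.swe T F (\<lambda>\<phi>2 f2 \<phi>3 f3. H.swe T Y (\<lambda>\<eta>2 y2 \<eta>3 y3. ?G \<phi>1 f1 \<eta>1 y1 \<phi>2 f2 \<eta>2 y2 \<phi>3 f3 \<eta>3 y3)) =
      counit V F \<odot>\<^bsub>T\<^esub> (counit H Y \<odot>\<^bsub>T\<^esub> (\<omega> \<Phi> \<eta>1 \<odot>\<^bsub>T\<^esub> an (psi f1 y1)))"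
      by (simp only: right[OF \<open>F \<in> carrier V\<close> \<open>Y \<in> carrier H\<close> Y])
        (simp add: linear_map_smult[OF lin_dm_eta] dm_one HV.T.smult_assoc1[symmetric] m_ac)
  qed
  also have "\<dots> = V.swe T f (\<lambda>\<phi>1 f1 \<Phi> F. counit V F \<odot>\<^bsub>T\<^esub> (\<omega> \<Phi> \<eta> \<odot>\<^bsub>T\<^esub> an (psi f1 y)))"
    by (rule V.swe_cong[OF fc], subst H.swe_counit_right[OF y T_module]) (auto intro!: lin)
  also have "\<dots> = \<omega> 0 \<eta> \<odot>\<^bsub>T\<^esub> an (psi f y)"
    by (subst V.swe_counit_right[OF f T_module]) (auto intro!: lin)
  finally show ?thesis by simp
qed

text \<open>A product of pure tensors is an outer factor from \<open>H\<close>, a crossing and an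
  outer factor from \<open>V\<close>. \<open>an_lmul\<close>, \<open>an_rmul\<close> and
  \<open>an_psi\<close> reverse the three parts, with signs that multiply to
  \<open>\<omega> \<sigma> \<tau>\<close> and those of the two antipodes.\<close>

lemma an_mult:
  assumes s: "s \<in> tensor_grade K H V \<sigma>" and t: "t \<in> tensor_grade K H V \<tau>"
  shows "an (dm s t) = \<omega> \<sigma> \<tau> \<odot>\<^bsub>T\<^esub> dm (an t) (an s)"
proof -
  have c [simp]: "s \<in> carrier T" "t \<in> carrier T" using s t HV.tensor_grade_closed by auto
  show ?thesis
  proof (rule HV.tensor_grade_eqI[OF T_module _ _ s])
    fix \<xi> x \<phi> f assume x: "x \<in> grade H \<xi>" and f: "f \<in> grade V \<phi>" and [simp]: "x \<in> carrier H" "f \<in> carrier V"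
      and \<sigma>: "\<xi> + \<phi> = \<sigma>"
    show "an (dm (tens x f) t) = \<omega> \<sigma> \<tau> \<odot>\<^bsub>T\<^esub> dm (an t) (an (tens x f))"
    proof (rule HV.tensor_grade_eqI[OF T_module _ _ t])
      fix \<eta> y \<rho> g assume y: "y \<in> grade H \<eta>" and g: "g \<in> grade V \<rho>" and [simp]: "y \<in> carrier H" "g \<in> carrier V"
        and \<tau>: "\<eta> + \<rho> = \<tau>"
      have "rmul g (psi f y) = dm (psi f y) (tens \<one>\<^bsub>H\<^esub> g)" by (simp add: dm_psi_left)
      then have gr: "rmul g (psi f y) \<in> tensor_grade K H V (\<phi> + \<eta> + \<rho>)"
        using dm_grade[OF psi_grade[OF f y] tens_one_grade(2)[OF g]] by simp
      \<comment> \<open>The reversed parts are regrouped: the antipodes of \<open>g\<close> and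
        \<open>y\<close> form one crossing, those of \<open>f\<close> and \<open>x\<close> another.
        By \<open>an_tens\<close> these are, up to sign, the antipodes of the two factors.\<close>
      have "dm (dm (tens \<one>\<^bsub>H\<^esub> (antipode V g)) (tens (antipode H y) (antipode V f))) (tens (antipode H x) \<one>\<^bsub>V\<^esub>) =
          dm (psi (antipode V g) (antipode H y)) (psi (antipode V f) (antipode H x))"
        by (simp add: dm_tens_tens lmul_one dm_rmul_left rmul_one)
      then show "an (dm (tens x f) (tens y g)) = \<omega> \<sigma> \<tau> \<odot>\<^bsub>T\<^esub> dm (an (tens y g)) (an (tens x f))"
        unfolding \<sigma>[symmetric] \<tau>[symmetric]
        by (simp add: dm_tens_tens an_lmul[OF x gr] an_rmul[OF g psi_grade[OF f y]] an_psi[OF f y] an_tens[OF x f]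
            an_tens[OF y g] linear_map_smult[OF lin_dm_eta] linear_map_smult[OF lin_dm(1)[OF lin_id]]
            HV.T.smult_assoc1[symmetric] factor_add m_ac)
    qed (auto intro!: lin)
  qed (auto intro!: lin)
qed

lemma hopf_algebra_double: "hopf_algebra K \<omega> DR"
proof (intro hopf_algebra.intro hopf_algebra_axioms.intro commutative_factor_axioms graded_algebra_double
    double_comult_hom double_counit_hom)
  have b: "bilinear_map K T T T (\<lambda>r s. dm (an r) s)" "bilinear_map K T T T (\<lambda>r s. dm r (an s))"
    by (auto intro!: bilinear_mapI lin)
  show "linear_map K DR DR (antipode DR)"
    using linear_map_cong[OF lin_an_eta, of "double_antipode K \<omega> H V"] by (simp add: double_antipode_eq)
  show "antipode DR ` grade DR \<gamma> \<subseteq> grade DR \<gamma>" for \<gamma>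
    using an_grade HV.tensor_grade_closed by (auto simp: double_antipode_eq)
  show "antipode DR (s \<otimes>\<^bsub>DR\<^esub> t) = \<omega> \<sigma> \<tau> \<odot>\<^bsub>DR\<^esub> (antipode DR t \<otimes>\<^bsub>DR\<^esub> antipode DR s)"
    if "s \<in> grade DR \<sigma>" "t \<in> grade DR \<tau>" for s t \<sigma> \<tau>
    using that an_mult[of s \<sigma> t \<tau>] HV.tensor_grade_closed[of s] HV.tensor_grade_closed[of t]
    by (simp add: double_antipode_eq double_mult_eq)
  fix t assume t: "t \<in> carrier DR"
  then have [simp]: "t \<in> carrier T" by simp
  show "tsum K DR (comult DR t) (\<lambda>r s. counit DR r \<odot>\<^bsub>DR\<^esub> s) = t"
    by (rule double_counit_left) simp
  show "tsum K DR (comult DR t) (\<lambda>r s. counit DR s \<odot>\<^bsub>DR\<^esub> r) = t"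
    by (rule double_counit_right) simp
  show "tsum K DR (comult DR t) (\<lambda>r s. antipode DR r \<otimes>\<^bsub>DR\<^esub> s) = counit DR t \<odot>\<^bsub>DR\<^esub> \<one>\<^bsub>DR\<^esub>"
    unfolding tsum_double
    by (subst tsum_double_comult[OF T_module b(1)])
      (simp_all add: double_antipode_eq double_mult_eq an_convolution_left double_counit_eq)
  show "tsum K DR (comult DR t) (\<lambda>r s. r \<otimes>\<^bsub>DR\<^esub> antipode DR s) = counit DR t \<odot>\<^bsub>DR\<^esub> \<one>\<^bsub>DR\<^esub>"
    unfolding tsum_double
    by (subst tsum_double_comult[OF T_module b(2)])
      (simp_all add: double_antipode_eq double_mult_eq an_convolution_right double_counit_eq)
  show "let HH = tensor_module K DR DR; T = tensor_module K DR HH;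
           triple = (\<lambda>x y z. pure_tensor K DR HH x (pure_tensor K DR DR y z)) in
        tsum K T (comult DR t) (\<lambda>x1 x2. tsum K T (comult DR x1) (\<lambda>x11 x12. triple x11 x12 x2)) =
        tsum K T (comult DR t) (\<lambda>x1 x2. tsum K T (comult DR x2) (\<lambda>x21 x22. triple x1 x21 x22))"
    unfolding Let_def by (rule double_coassociative) simp
qed

end

section \<open>The opposite finite dual\<close>

lemma (in module) linear_form_zero_add:
  shows "linear_map R M (scalars R) (\<lambda>x\<in>carrier M. \<zero>)"
    and "\<lbrakk>linear_map R M (scalars R) f; linear_map R M (scalars R) g\<rbrakk> \<Longrightarrow>
      linear_map R M (scalars R) (\<lambda>x\<in>carrier M. f x \<oplus> g x)"
  by (rule linear_mapI; simp)
    (rule linear_mapI; simp add: linear_map_closed[of R M "scalars R"] linear_map_add[of R M "scalars R"]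
      linear_map_smult[of R M "scalars R"] R.a_ac R.r_distr linear_map_closed[of R M "scalars R", simplified])

lemma colour_ext_record_cong:
  assumes "carrier M = carrier M'" "add M = add M'" "zero M = zero M'" "grade M = grade M'"
  shows "colour_ext K \<omega> M = colour_ext K \<omega> M'"
  by (simp add: fun_eq_iff colour_ext_def hsupp_def hcomp_def homogeneous_decomposition_def assms
      finsum_record_cong[OF assms(1-3)])

locale opposite_dual = commutative_factor K \<omega> + H: hopf_algebra K \<omega> H + V: hopf_algebra K \<omega> "opposite_finite_dual K \<omega> H \<Delta>0"
  for K :: "('k, 's) ring_scheme" (structure) and \<omega> :: "'g::ab_group_add \<Rightarrow> 'g \<Rightarrow> 'k"
    and H :: "('k, 'a, 'g, 'm) hopf_scheme"
    and \<Delta>0 :: "('a \<Rightarrow> 'k) \<Rightarrow> (('a \<Rightarrow> 'k) \<times> ('a \<Rightarrow> 'k) \<Rightarrow> 'k) set" +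
  assumes bij: "bij_betw (antipode H) (carrier H) (carrier H)"
    and formula: "opposite_comult_formula K \<omega> H \<Delta>0"
begin

abbreviation "F \<equiv> finite_dual K H"
abbreviation "V \<equiv> opposite_finite_dual K \<omega> H \<Delta>0"
abbreviation Ks :: "('k, 'k, 'g) graded_module" where "Ks \<equiv> scalars K"

lemma V_simps:
  "carrier V = carrier F" "add V = add F" "zero V = zero F" "smult V = smult F" "grade V = grade F"
  "one V = (\<lambda>x\<in>carrier H. counit H x)" "comult V = \<Delta>0" "counit V = (\<lambda>f. f \<one>\<^bsub>H\<^esub>)"
  "antipode V = (\<lambda>f. \<lambda>x\<in>carrier H. f (inv_into (carrier H) (antipode H) x))"
  "mult V = (\<lambda>f g. \<lambda>x\<in>carrier H. pairing2 K \<omega> H (pure_tensor K F F f g) (comult H x))"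
  by (simp_all add: opposite_finite_dual_def Let_def)

lemma F_simps:
  "add F = (\<lambda>f g. \<lambda>x\<in>carrier H. f x \<oplus> g x)" "zero F = (\<lambda>x\<in>carrier H. \<zero>)"
  "smult F = (\<lambda>a f. \<lambda>x\<in>carrier H. a \<otimes> f x)"
  "grade F \<gamma> = dual_grade K H \<gamma> \<inter> carrier F"
  by (simp_all add: finite_dual_def graded_dual_def linear_forms_def Let_def)

lemma modules [simp]: "module K H" "module K V" "module K Ks" "cring K"
  by (rule H.module_axioms V.module_axioms module_scalars is_cring)+

text \<open>The carrier of the graded dual is defined through a span. Linearity is read off from a
  decomposition into homogeneous forms, which are linear by the definition of
  \<open>dual_grade\<close>.\<close>

lemma linear_form: 
  assumes "f \<in> carrier V"
  shows "linear_map K H Ks f"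
proof -
  obtain xs where xs: "\<forall>(\<alpha>, a)\<in>set xs. a \<in> grade V \<alpha>" "f = lsum V xs snd"
    using V.homogeneous_list[OF assms] by blast
  have "linear_map K H Ks (lsum V ys snd)" if "set ys \<subseteq> set xs" for ys
    using that
  proof (induction ys)
    case Nil
    show ?case unfolding lsum_Nil V_simps F_simps by (rule H.linear_form_zero_add(1))
  next
    case (Cons y ys)
    have "snd y \<in> grade V (fst y)" using Cons.prems xs(1) by (cases y) auto
    then have "linear_map K H Ks (snd y)"
      by (simp add: V_simps F_simps dual_grade_def linear_forms_def)
    moreover have "linear_map K H Ks (lsum V ys snd)" using Cons by simp
    moreover have "lsum V (y # ys) snd = (\<lambda>x\<in>carrier H. snd y x \<oplus> lsum V ys snd x)"
      by (simp add: V_simps F_simps)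
    ultimately show ?case by (simp only: H.linear_form_zero_add(2))
  qed
  then show ?thesis unfolding xs(2) by simp
qed

lemma eval_linear: "x \<in> carrier H \<Longrightarrow> linear_map K V Ks (\<lambda>f. f x)"
  using linear_map_closed[OF linear_form, of _ x]
  by (intro linear_mapI) (simp_all, simp_all add: V_simps F_simps)

lemma eval_closed [simp]: "\<lbrakk>f \<in> carrier V; x \<in> carrier H\<rbrakk> \<Longrightarrow> f x \<in> carrier K"
  using linear_map_closed[OF eval_linear] by fastforce

lemma eval_degree: "\<lbrakk>f \<in> grade V \<phi>; x \<in> grade H \<xi>\<rbrakk> \<Longrightarrow> f x = \<zero> \<or> \<phi> = - \<xi>"
  by (cases "\<xi> = - \<phi>") (auto simp: V_simps F_simps dual_grade_def)

sublocale HH: graded_pair K H H ..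
sublocale VV: graded_pair K V V ..

lemma linear_evals:
  assumes "f \<in> carrier V" "g \<in> carrier V" "u \<in> carrier H" "v \<in> carrier H"
  shows "linear_map K V Ks (\<lambda>f. f u \<otimes> g v)" "linear_map K V Ks (\<lambda>g. f u \<otimes> g v)"
    "linear_map K H Ks (\<lambda>u. f u \<otimes> g v)" "linear_map K H Ks (\<lambda>v. f u \<otimes> g v)"
  using assms
  by (simp_all add: lin_scalars_mult(1)[OF eval_linear] lin_scalars_mult(2)[OF eval_linear]
      lin_scalars_mult(1)[OF linear_form] lin_scalars_mult(2)[OF linear_form])

lemma linear_evals_smult:
  assumes "f \<in> carrier V" "g \<in> carrier V" "u \<in> carrier H" "v \<in> carrier H" "c \<in> carrier K"
  shows "linear_map K V Ks (\<lambda>f. c \<otimes> (f u \<otimes> g v))" "linear_map K V Ks (\<lambda>g. c \<otimes> (f u \<otimes> g v))"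
    "linear_map K H Ks (\<lambda>u. c \<otimes> (f u \<otimes> g v))" "linear_map K H Ks (\<lambda>v. c \<otimes> (f u \<otimes> g v))"
  by (rule lin_scalars_mult(2)[OF linear_evals(1)[OF assms(1-4)] assms(5)]
      lin_scalars_mult(2)[OF linear_evals(2)[OF assms(1-4)] assms(5)]
      lin_scalars_mult(2)[OF linear_evals(3)[OF assms(1-4)] assms(5)]
      lin_scalars_mult(2)[OF linear_evals(4)[OF assms(1-4)] assms(5)])+

text \<open>The definition decomposes forms by the grading of the finite dual, which its opposite
  shares. Evaluation is linear in both arguments, so \<open>tsum_colour_ext\<close> makes the sign
  explicit.\<close>

lemma pairing2_eq:
  assumes "s \<in> carrier (tensor_module K V V)" "t \<in> carrier (tensor_module K H H)"
  shows "pairing2 K \<omega> H s t = gsum K V V Ks s (\<lambda>\<phi> f \<gamma> g. gsum K H H Ks t (\<lambda>\<alpha> u \<beta> v.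
    \<omega> \<gamma> \<alpha> \<odot>\<^bsub>Ks\<^esub> (f u \<otimes> g v)))"
proof -
  have c: "colour_ext K \<omega> F H Ks = colour_ext K \<omega> V H Ks"
    by (simp add: colour_ext_record_cong[of F V] V_simps)
  show ?thesis unfolding pairing2_def Let_def c
    by (rule tsum_colour_ext[where G = "\<lambda>f g u v. f u \<otimes> g v",
          OF commutative_factor_axioms V.graded_module_axioms H.graded_module_axioms modules(3) assms])
      (simp_all add: lin_scalars_mult(1)[OF eval_linear] lin_scalars_mult(2)[OF eval_linear]
        lin_scalars_mult(1)[OF linear_form] lin_scalars_mult(2)[OF linear_form])
qed

text \<open>The pairing formula is evaluated on a pure tensor of homogeneous forms, and linearity
  then removes the homogeneity of \<open>f\<close>. That of \<open>g\<close> stays, because the sign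
  refers to its degree.\<close>

lemma eval_mult:
  assumes f: "f \<in> carrier V" and g: "g \<in> grade V \<gamma>" and x: "x \<in> carrier H"
  shows "(f \<otimes>\<^bsub>V\<^esub> g) x = H.swe Ks x (\<lambda>\<alpha> u \<beta> v. \<omega> \<gamma> \<alpha> \<otimes> (f u \<otimes> g v))"
proof (rule V.linear_map_eqI_homogeneous[OF modules(3) _ _ _ f, where f = "\<lambda>f. (f \<otimes>\<^bsub>V\<^esub> g) x"])
  have gc [simp]: "g \<in> carrier V" using g by (rule V.grade_closed)
  show "linear_map K V Ks (\<lambda>f. (f \<otimes>\<^bsub>V\<^esub> g) x)"
    by (rule linear_map_compose[OF V.lin_mult(1)[OF lin_id gc] eval_linear[OF x]])
  show "linear_map K V Ks (\<lambda>f. H.swe Ks x (\<lambda>\<alpha> u \<beta> v. \<omega> \<gamma> \<alpha> \<otimes> (f u \<otimes> g v)))"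
    by (rule H.lin_swe_pointwise[OF modules(3,2) x], rule linear_evals_smult(1)[OF gc gc]) auto
  fix \<phi> f assume h: "f \<in> grade V \<phi>" "f \<in> carrier V"
  have "pure_tensor K F F = pure_tensor K V V" by (rule pure_tensor_cong) (simp_all add: V_simps)
  then have "(f \<otimes>\<^bsub>V\<^esub> g) x = pairing2 K \<omega> H (VV.pure f g) (comult H x)"
    using x by (simp add: V_simps)
  also have "\<dots> = gsum K V V Ks (VV.pure f g) (\<lambda>\<phi> f \<gamma> g. H.swe Ks x (\<lambda>\<alpha> u \<beta> v. \<omega> \<gamma> \<alpha> \<odot>\<^bsub>Ks\<^esub> (f u \<otimes> g v)))"
    using h x by (intro pairing2_eq VV.pure_closed) auto
  also have "\<dots> = H.swe Ks x (\<lambda>\<alpha> u \<beta> v. \<omega> \<gamma> \<alpha> \<odot>\<^bsub>Ks\<^esub> (f u \<otimes> g v))"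
    by (rule VV.gsum_pure[OF modules(3) _ h(1) g], rule graded_bilinearI;
        use x in \<open>auto intro!: H.lin_swe_pointwise linear_evals_smult\<close>)
  finally show "(f \<otimes>\<^bsub>V\<^esub> g) x = H.swe Ks x (\<lambda>\<alpha> u \<beta> v. \<omega> \<gamma> \<alpha> \<otimes> (f u \<otimes> g v))" by simp
qed

lemma eval_comult:
  assumes f: "f \<in> carrier V" and x: "x \<in> carrier H" and y: "y \<in> carrier H"
  shows "f (y \<otimes>\<^bsub>H\<^esub> x) = V.swe Ks f (\<lambda>\<phi>1 f1 \<phi>2 f2. f1 x \<otimes> f2 y)"
proof -
  have l: "linear_map K H Ks (\<lambda>u. f (y \<otimes>\<^bsub>H\<^esub> u))" "linear_map K H Ks (\<lambda>u. f (u \<otimes>\<^bsub>H\<^esub> y))"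
    "linear_map K H Ks (\<lambda>u. V.swe Ks f (\<lambda>\<phi>1 f1 \<phi>2 f2. f1 u \<otimes> f2 y))"
    "linear_map K H Ks (\<lambda>u. V.swe Ks f (\<lambda>\<phi>1 f1 \<phi>2 f2. f1 y \<otimes> f2 u))"
    if y: "y \<in> carrier H" for y
  proof -
    show "linear_map K H Ks (\<lambda>u. f (y \<otimes>\<^bsub>H\<^esub> u))" "linear_map K H Ks (\<lambda>u. f (u \<otimes>\<^bsub>H\<^esub> y))"
      by (rule linear_map_compose[OF H.lin_mult(2)[OF lin_id y] linear_form[OF f]]
          linear_map_compose[OF H.lin_mult(1)[OF lin_id y] linear_form[OF f]])+
    show "linear_map K H Ks (\<lambda>u. V.swe Ks f (\<lambda>\<phi>1 f1 \<phi>2 f2. f1 u \<otimes> f2 y))"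
      by (rule V.lin_swe_pointwise[OF modules(3,1) f], rule linear_evals(3)[OF _ _ y y])
    show "linear_map K H Ks (\<lambda>u. V.swe Ks f (\<lambda>\<phi>1 f1 \<phi>2 f2. f1 y \<otimes> f2 u))"
      by (rule V.lin_swe_pointwise[OF modules(3,1) f], rule linear_evals(4)[OF _ _ y y])
  qed
  have 1: "f (y \<otimes>\<^bsub>H\<^esub> x) = V.swe Ks f (\<lambda>\<phi>1 f1 \<phi>2 f2. f1 x \<otimes> f2 y)"
    if x: "x \<in> grade H \<xi>" "x \<in> carrier H" and y: "y \<in> grade H \<eta>" "y \<in> carrier H" for x y \<xi> \<eta>
  proof -
    note [simp] = x(2) y(2) f
    have "\<omega> \<xi> \<eta> \<otimes> f (y \<otimes>\<^bsub>H\<^esub> x) = pairing2 K \<omega> H (comult V f) (HH.pure x y)"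
      using formula f x y by (simp add: opposite_comult_formula_def V_simps)
    also have "\<dots> = V.swe Ks f (\<lambda>\<phi> f \<gamma> g. gsum K H H Ks (HH.pure x y) (\<lambda>\<alpha> u \<beta> v. \<omega> \<gamma> \<alpha> \<odot>\<^bsub>Ks\<^esub> (f u \<otimes> g v)))"
      by (rule pairing2_eq) (auto intro!: HH.pure_closed)
    also have "\<dots> = V.swe Ks f (\<lambda>\<phi>1 f1 \<phi>2 f2. \<omega> \<xi> \<eta> \<odot>\<^bsub>Ks\<^esub> (f1 x \<otimes> f2 y))"
    proof (rule V.swe_cong[OF f])
      fix \<phi>1 f1 \<phi>2 f2 assume h: "f2 \<in> grade V \<phi>2" "f1 \<in> carrier V" "f2 \<in> carrier V"
      have "gsum K H H Ks (HH.pure x y) (\<lambda>\<alpha> u \<beta> v. \<omega> \<phi>2 \<alpha> \<odot>\<^bsub>Ks\<^esub> (f1 u \<otimes> f2 v)) = \<omega> \<phi>2 \<xi> \<odot>\<^bsub>Ks\<^esub> (f1 x \<otimes> f2 y)"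
        by (rule HH.gsum_pure[OF modules(3) _ x(1) y(1)], rule graded_bilinearI)
          (use h in \<open>auto intro!: linear_evals_smult\<close>)
      \<comment> \<open>Unless \<open>f2 y\<close> vanishes, \<open>\<phi>2 = - \<eta>\<close>, and
        then \<open>\<omega> \<phi>2 \<xi> = \<omega> \<xi> \<eta>\<close>. The sign no longer
        depends on the legs of \<open>f\<close> and leaves the sum.\<close>
      then show "gsum K H H Ks (HH.pure x y) (\<lambda>\<alpha> u \<beta> v. \<omega> \<phi>2 \<alpha> \<odot>\<^bsub>Ks\<^esub> (f1 u \<otimes> f2 v)) = \<omega> \<xi> \<eta> \<odot>\<^bsub>Ks\<^esub> (f1 x \<otimes> f2 y)"
        using eval_degree[OF h(1) y(1)] h by auto
    qed
    also have "\<dots> = \<omega> \<xi> \<eta> \<otimes> V.swe Ks f (\<lambda>\<phi>1 f1 \<phi>2 f2. f1 x \<otimes> f2 y)"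
      by (subst V.swe_smult[symmetric]) auto
    \<comment> \<open>The common sign \<open>\<omega> \<xi> \<eta>\<close> is removed by multiplying
      with its inverse \<open>\<omega> \<eta> \<xi>\<close>.\<close>
    finally have "\<omega> \<eta> \<xi> \<otimes> (\<omega> \<xi> \<eta> \<otimes> f (y \<otimes>\<^bsub>H\<^esub> x)) =
        \<omega> \<eta> \<xi> \<otimes> (\<omega> \<xi> \<eta> \<otimes> V.swe Ks f (\<lambda>\<phi>1 f1 \<phi>2 f2. f1 x \<otimes> f2 y))" by simp
    moreover have "V.swe Ks f (\<lambda>\<phi>1 f1 \<phi>2 f2. f1 x \<otimes> f2 y) \<in> carrier Ks"
      by (rule V.swe_closed) auto
    ultimately show ?thesis by simp
  qed
  have 2: "f (y \<otimes>\<^bsub>H\<^esub> x) = V.swe Ks f (\<lambda>\<phi>1 f1 \<phi>2 f2. f1 x \<otimes> f2 y)"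
    if "y \<in> grade H \<eta>" "y \<in> carrier H" for y \<eta>
    by (rule H.linear_map_eqI_homogeneous[OF modules(3) l(1) l(3) 1 x]) (rule that | assumption)+
  show ?thesis
    by (rule H.linear_map_eqI_homogeneous[OF modules(3) l(2)[OF x] l(4)[OF x] 2 y])
qed

lemma hopf_pairing: "hopf_pairing K \<omega> H V"
proof
  show "linear_map K H Ks (ev f)" if "f \<in> carrier V" for f
    using linear_form[OF that] by (simp add: ev_def[abs_def])
  show "linear_map K V Ks (\<lambda>f. ev f x)" if "x \<in> carrier H" for x
    using eval_linear[OF that] by (simp add: ev_def)
  show "ev f x = \<zero> \<or> \<phi> = - \<xi>" if "f \<in> grade V \<phi>" "x \<in> grade H \<xi>" for f \<phi> x \<xi>
    using eval_degree[OF that] by (simp add: ev_def)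
  show "ev (f \<otimes>\<^bsub>V\<^esub> g) x = H.swe Ks x (\<lambda>\<alpha> u \<beta> v. \<omega> \<gamma> \<alpha> \<otimes> (ev f u \<otimes> ev g v))"
    if "f \<in> carrier V" "g \<in> grade V \<gamma>" "x \<in> carrier H" for f g \<gamma> x
    using eval_mult[OF that] by (simp add: ev_def)
  show "ev f (y \<otimes>\<^bsub>H\<^esub> x) = V.swe Ks f (\<lambda>\<alpha> f1 \<beta> f2. ev f1 x \<otimes> ev f2 y)"
    if "f \<in> carrier V" "x \<in> carrier H" "y \<in> carrier H" for f x y
    using eval_comult[OF that] by (simp add: ev_def)
  show "ev (antipode V f) (antipode H x) = ev f x" if "f \<in> carrier V" "x \<in> carrier H" for f x
    using that bij bij_betwE[OF bij] by (simp add: ev_def V_simps bij_betw_def)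
qed (simp_all add: ev_def V_simps bij)

end

theorem theoremA13:
  fixes K :: "('k, 's) ring_scheme"
    and \<omega> :: "'g::ab_group_add \<Rightarrow> 'g \<Rightarrow> 'k"
    and H :: "('k, 'a, 'g, 'm) hopf_scheme"
    and \<Delta>0 :: "('a \<Rightarrow> 'k) \<Rightarrow> (('a \<Rightarrow> 'k) \<times> ('a \<Rightarrow> 'k) \<Rightarrow> 'k) set"
  defines "H0 \<equiv> opposite_finite_dual K \<omega> H \<Delta>0"
  assumes "commutative_factor K \<omega>"
    and "hopf_algebra K \<omega> H"
    and "proper K H"
    and "bij_betw (antipode H) (carrier H) (carrier H)"
    and "hopf_algebra K \<omega> H0"
    and "opposite_comult_formula K \<omega> H \<Delta>0"
  shows "hopf_algebra K \<omega> (drinfeld_double K \<omega> H H0)"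
proof -
  have "opposite_dual K \<omega> H \<Delta>0"
    using assms by (simp add: opposite_dual_def opposite_dual_axioms_def)
  then show ?thesis
    unfolding H0_def by (intro hopf_pairing.hopf_algebra_double opposite_dual.hopf_pairing)
qed

end
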